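(* Fix an integer $k\ge 3$. There exist a constant $a_k^{\mathrm{TV}}>0$ and a threshold $r_0$, both depending only on $k$, and an absolute constant $B>0$ such that for every integer $r\ge r_0$, every prime power $q$ and every integer $m\ge1$ such that $c:=\frac mr\binom rk$ is an integer (resonance), with $N=r+c$, one has $$d_{\mathrm{TV}}\bigl(\mathcal L(\mathcal Z_{N,r}),\mathcal L(\mathcal B_r)\bigr)\le e^{-a_k^{\mathrm{TV}}\Psi_r},$$ $$d_{\mathrm{TV}}\bigl(\mathcal L(\Xi_r),\mathcal L(\Pi_r)\bigr)\le e^{-a_k^{\mathrm{TV}}\Psi_r},$$ $$d_{\mathrm{TV}}\bigl(\mathcal L(X_{N,r}),\mathrm{Poisson}(\mu_{N,r})\bigr)\le e^{-a_k^{\mathrm{TV}}\Psi_r},$$ $$d_{\mathrm{TV}}\bigl(\mathcal L(X_{N,r}),\mathrm{Poisson}(C_q)\bigr)\le Bq^{-r}+e^{-a_k^{\mathrm{TV}}\Psi_r}.$$ Consequently, along every resonant sequence $r\to\infty$ with $q=q_r$ a prime power and $m=m_r\ge1$ (both allowed to vary with $r$), $$d_{\mathrm{TV}}\bigl(\mathcal L(X_{N,r}),\mathrm{Poisson}(C_{q_r})\bigr)\to0 .$$ If moreover $q_r\to\infty$, then $C_{q_r}\to1$ and hence $X_{N,r}$ converges in distribution to $\mathrm{Poisson}(1)$.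
   Context: Let $q$ be a prime power, $V_N=\mathbb F_q^N$, and let $\Theta_N$ be uniformly random in $\mathrm{Hom}(\Lambda^kV_N,\mathbb F_q^m)$. An $r$-dimensional linear subspace $H\le V_N$ is null if $\Theta_N(\Lambda^kH)=0$. $\mathcal G_r=\mathrm{Gr}(r,V_N)$ is the set of all $r$-dimensional subspaces of $V_N$; $\mathcal Z_{N,r}\subseteq\mathcal G_r$ is the random set of null $r$-spaces; $X_{N,r}=|\mathcal Z_{N,r}|$; $\mu_{N,r}=\mathbb E X_{N,r}$; $\Xi_r=\sum_{H\in\mathcal Z_{N,r}}\delta_H$ is the associated counting measure. Resonance means $m\binom rk=r(N-r)$; writing $N=r+c$ this is $c=\frac mr\binom rk\in\mathbb Z$. At resonance put $p_r=q^{-m\binom rk}=q^{-rc}$, $\rho_{m,k}(r)=\sqrt m\,r^{(k-2)/2}$ and $\Psi_r=\rho_{m,k}(r)\log(2+\rho_{m,k}(r))$. $\mathcal B_r\subseteq\mathcal G_r$ is the random subset retaining each element of $\mathcal G_r$ independently with probability $p_r$. $\Pi_r$ is the Poisson point process on $\mathcal G_r$ with intensity $p_r\sum_{H\in\mathcal G_r}\delta_H$. $C_q=\prod_{j\ge1}(1-q^{-j})^{-1}$. $\mathcal L(\cdot)$ denotes the law and $d_{\mathrm{TV}}$ total-variation distance (the supremum over events of the difference of probabilities). *)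

theory Defs
  imports
    "HOL-Probability.Probability"
    "HOL-Number_Theory.Prime_Powers"
    "HOL-Algebra.AbelCoset"
    "Jordan_Normal_Form.Missing_VectorSpace"
begin

text \<open>
  The prime power \<open>q\<close> is quantified over inside the main statement, so fields are handled as
  records with a carrier rather than through type classes.  The carrier lives in \<^typ>\<open>nat\<close>;
  up to isomorphism this covers every finite field.
\<close>

definition is_GF :: "nat \<Rightarrow> nat ring \<Rightarrow> bool" where
  "is_GF q F \<longleftrightarrow> Ring.field F \<and> finite (carrier F) \<and> card (carrier F) = q"

abbreviation coord_space :: "('a, 'c) ring_scheme \<Rightarrow> nat \<Rightarrow> ('a, nat \<Rightarrow> 'a) module" where
  "coord_space F n \<equiv> ring.func_space F {..<n}"

definition Gr :: "('a, 'c) ring_scheme \<Rightarrow> nat \<Rightarrow> ('a, 'v, 'd) module_scheme \<Rightarrow> 'v set set" where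
  "Gr F r V = {H. VectorSpace.subspace F H V \<and> vectorspace.dim F (V\<lparr>carrier := H\<rparr>) = r}"

definition quot_module :: "('a, 'v, 'd) module_scheme \<Rightarrow> 'v set \<Rightarrow> ('a, 'v set) module" where
  "quot_module M U =
     \<lparr>carrier = a_rcosets\<^bsub>M\<^esub> U,
      mult = (\<lambda>_ _. U), one = U, \<comment> \<open>dummies: the record type \<open>module\<close> extends \<open>ring\<close>\<close>
      zero = U,
      add = (\<lambda>X Y. X <+>\<^bsub>M\<^esub> Y),
      smult = (\<lambda>a X. \<Union>x\<in>X. U +>\<^bsub>M\<^esub> (a \<odot>\<^bsub>M\<^esub> x))\<rparr>"

text \<open>
  The exterior power \<open>\<Lambda>\<^sup>k V\<close> is the free module on \<open>V\<^sup>k\<close> modulo the submodule spanned by the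
  multilinearity relations and by the tuples with a repeated entry.  All functions \<open>V\<^sup>k \<rightarrow> F\<close>
  are admitted as formal linear combinations, which is correct because \<open>V\<close> is finite in
  every use below.
\<close>

definition tuples :: "nat \<Rightarrow> 'v set \<Rightarrow> (nat \<Rightarrow> 'v) set" where
  "tuples k A = {..<k} \<rightarrow>\<^sub>E A"

definition free_on_tuples ::
  "('a, 'c) ring_scheme \<Rightarrow> nat \<Rightarrow> ('a, 'v, 'd) module_scheme \<Rightarrow> ('a, (nat \<Rightarrow> 'v) \<Rightarrow> 'a) module" where
  "free_on_tuples F k V = ring.func_space F (tuples k (carrier V))"

definition gen ::
  "('a, 'c) ring_scheme \<Rightarrow> nat \<Rightarrow> ('a, 'v, 'd) module_scheme \<Rightarrow> (nat \<Rightarrow> 'v) \<Rightarrow> ((nat \<Rightarrow> 'v) \<Rightarrow> 'a)" where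
  "gen F k V v = (\<lambda>w\<in>tuples k (carrier V). if w = v then \<one>\<^bsub>F\<^esub> else \<zero>\<^bsub>F\<^esub>)"

definition alternating_relations ::
  "('a, 'c) ring_scheme \<Rightarrow> nat \<Rightarrow> ('a, 'v, 'd) module_scheme \<Rightarrow> ((nat \<Rightarrow> 'v) \<Rightarrow> 'a) set" where
  "alternating_relations F k V =
     (let T = tuples k (carrier V); L = free_on_tuples F k V; g = gen F k V in
       {g (v(i := x \<oplus>\<^bsub>V\<^esub> y)) \<ominus>\<^bsub>L\<^esub> (g (v(i := x)) \<oplus>\<^bsub>L\<^esub> g (v(i := y))) | v i x y.
          v \<in> T \<and> i < k \<and> x \<in> carrier V \<and> y \<in> carrier V} \<union>
       {g (v(i := a \<odot>\<^bsub>V\<^esub> x)) \<ominus>\<^bsub>L\<^esub> (a \<odot>\<^bsub>L\<^esub> g (v(i := x))) | v i a x.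
          v \<in> T \<and> i < k \<and> a \<in> carrier F \<and> x \<in> carrier V} \<union>
       {g v | v i j. v \<in> T \<and> i < k \<and> j < k \<and> i \<noteq> j \<and> v i = v j})"

definition relation_space ::
  "('a, 'c) ring_scheme \<Rightarrow> nat \<Rightarrow> ('a, 'v, 'd) module_scheme \<Rightarrow> ((nat \<Rightarrow> 'v) \<Rightarrow> 'a) set" where
  "relation_space F k V =
     LinearCombinations.module.span F (free_on_tuples F k V) (alternating_relations F k V)"

definition exterior_power ::
  "('a, 'c) ring_scheme \<Rightarrow> nat \<Rightarrow> ('a, 'v, 'd) module_scheme \<Rightarrow>
     ('a, ((nat \<Rightarrow> 'v) \<Rightarrow> 'a) set) module" where
  "exterior_power F k V = quot_module (free_on_tuples F k V) (relation_space F k V)"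

definition wedge ::
  "('a, 'c) ring_scheme \<Rightarrow> nat \<Rightarrow> ('a, 'v, 'd) module_scheme \<Rightarrow>
     (nat \<Rightarrow> 'v) \<Rightarrow> ((nat \<Rightarrow> 'v) \<Rightarrow> 'a) set" where
  "wedge F k V v = relation_space F k V +>\<^bsub>free_on_tuples F k V\<^esub> gen F k V v"

text \<open>
  The image of \<open>\<Lambda>\<^sup>k H \<rightarrow> \<Lambda>\<^sup>k V\<close> for a subspace \<open>H\<close> of \<open>V\<close>; this map is injective over a field,
  so the image is \<open>\<Lambda>\<^sup>k H\<close> regarded as a subspace of \<open>\<Lambda>\<^sup>k V\<close>.
\<close>

definition exterior_subspace ::
  "('a, 'c) ring_scheme \<Rightarrow> nat \<Rightarrow> ('a, 'v, 'd) module_scheme \<Rightarrow> 'v set \<Rightarrow>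
     ((nat \<Rightarrow> 'v) \<Rightarrow> 'a) set set" where
  "exterior_subspace F k V H =
     LinearCombinations.module.span F (exterior_power F k V) (wedge F k V ` tuples k H)"

text \<open>
  Linear maps are restricted to functions that are \<^const>\<open>undefined\<close> off the carrier, so that
  the Hom space is a finite set.
\<close>

definition Hom_space ::
  "('a, 'c) ring_scheme \<Rightarrow> ('a, 'v, 'd) module_scheme \<Rightarrow> ('a, 'w, 'e) module_scheme \<Rightarrow>
     ('v \<Rightarrow> 'w) set" where
  "Hom_space F V W = module_hom F V W \<inter> extensional (carrier V)"

definition Theta_law ::
  "('a, 'c) ring_scheme \<Rightarrow> nat \<Rightarrow> nat \<Rightarrow> nat \<Rightarrow>
     ((((nat \<Rightarrow> nat \<Rightarrow> 'a) \<Rightarrow> 'a) set) \<Rightarrow> (nat \<Rightarrow> 'a)) pmf" where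
  "Theta_law F k m N =
     pmf_of_set (Hom_space F (exterior_power F k (coord_space F N)) (coord_space F m))"

definition null_spaces ::
  "('a, 'c) ring_scheme \<Rightarrow> nat \<Rightarrow> nat \<Rightarrow> nat \<Rightarrow> nat \<Rightarrow>
     ((((nat \<Rightarrow> nat \<Rightarrow> 'a) \<Rightarrow> 'a) set) \<Rightarrow> (nat \<Rightarrow> 'a)) \<Rightarrow> (nat \<Rightarrow> 'a) set set" where
  "null_spaces F k m N r \<theta> =
     {H \<in> Gr F r (coord_space F N).
        \<theta> ` exterior_subspace F k (coord_space F N) H = {\<zero>\<^bsub>coord_space F m\<^esub>}}"

definition Z_law ::
  "('a, 'c) ring_scheme \<Rightarrow> nat \<Rightarrow> nat \<Rightarrow> nat \<Rightarrow> nat \<Rightarrow> (nat \<Rightarrow> 'a) set set pmf" where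
  "Z_law F k m N r = map_pmf (null_spaces F k m N r) (Theta_law F k m N)"

definition X_law :: "('a, 'c) ring_scheme \<Rightarrow> nat \<Rightarrow> nat \<Rightarrow> nat \<Rightarrow> nat \<Rightarrow> nat pmf" where
  "X_law F k m N r = map_pmf card (Z_law F k m N r)"

definition mean_X :: "('a, 'c) ring_scheme \<Rightarrow> nat \<Rightarrow> nat \<Rightarrow> nat \<Rightarrow> nat \<Rightarrow> real" where
  "mean_X F k m N r = measure_pmf.expectation (X_law F k m N r) real"

text \<open>The measure \<open>\<Sum>\<^bsub>H\<in>S\<^esub> n(H) \<delta>\<^sub>H\<close> on the power set of \<open>S\<close>.\<close>

definition atomic_measure :: "'h set \<Rightarrow> ('h \<Rightarrow> nat) \<Rightarrow> 'h measure" where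
  "atomic_measure S n = point_measure S (\<lambda>H. of_nat (n H))"

definition Xi_law ::
  "('a, 'c) ring_scheme \<Rightarrow> nat \<Rightarrow> nat \<Rightarrow> nat \<Rightarrow> nat \<Rightarrow> (nat \<Rightarrow> 'a) set measure pmf" where
  "Xi_law F k m N r =
     map_pmf (\<lambda>Z. atomic_measure (Gr F r (coord_space F N)) (\<lambda>H. of_bool (H \<in> Z)))
       (Z_law F k m N r)"

text \<open>
  At resonance the exponent equals \<open>r c\<close>.  The library's \<^const>\<open>poisson_pmf\<close> below requires a positive
  rate, which holds for all rates used: \<open>p_res\<close>, \<open>mean_X\<close>, \<open>C_const\<close> and \<open>1\<close>.
\<close>

definition p_res :: "nat \<Rightarrow> nat \<Rightarrow> nat \<Rightarrow> nat \<Rightarrow> real" where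
  "p_res k q m r = (1 / real q) ^ (m * (r choose k))"

definition bernoulli_subset :: "'h set \<Rightarrow> real \<Rightarrow> 'h set pmf" where
  "bernoulli_subset S p =
     map_pmf (\<lambda>b. {H \<in> S. b H}) (Pi_pmf S False (\<lambda>_. bernoulli_pmf p))"

text \<open>
  The Poisson point process on a finite set \<open>S\<close> with intensity \<open>p \<Sum>\<^bsub>H\<in>S\<^esub> \<delta>\<^sub>H\<close>: the
  multiplicities of the points are independent Poisson variables of mean \<open>p\<close>.
\<close>

definition poisson_process :: "'h set \<Rightarrow> real \<Rightarrow> 'h measure pmf" where
  "poisson_process S p = map_pmf (atomic_measure S) (Pi_pmf S 0 (\<lambda>_. poisson_pmf p))"

definition C_const :: "nat \<Rightarrow> real" where
  "C_const q = (\<Prod>j. inverse (1 - 1 / real q ^ Suc j))"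

definition rho :: "nat \<Rightarrow> nat \<Rightarrow> nat \<Rightarrow> real" where
  "rho m k r = sqrt (real m) * real r powr ((real k - 2) / 2)"

definition Psi :: "nat \<Rightarrow> nat \<Rightarrow> nat \<Rightarrow> real" where
  "Psi m k r = rho m k r * ln (2 + rho m k r)"

text \<open>All laws compared are discrete, so every set is an event.\<close>

definition d_TV :: "'b pmf \<Rightarrow> 'b pmf \<Rightarrow> real" where
  "d_TV P Q = (SUP A. \<bar>measure_pmf.prob P A - measure_pmf.prob Q A\<bar>)"

text \<open>The existence of a natural number \<open>c\<close> encodes the integrality condition.\<close>

definition resonant :: "nat \<Rightarrow> nat \<Rightarrow> nat \<Rightarrow> nat \<Rightarrow> bool" where
  "resonant k r m c \<longleftrightarrow> r \<ge> 1 \<and> real c = real m / real r * real (r choose k)"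

end

theory Submission
  imports Defs
begin

text \<open>
  Linear maps on \<open>\<Lambda>\<^sup>k V\<close> are alternating forms, so the probability that all members of \<open>S\<close> are
  null is the proportion of alternating \<open>W\<close>-valued forms that vanish on every \<open>H \<in> S\<close>.  It equals
  \<open>p\<^bsup>card S\<^esup>\<close> when the sum of the members is direct.  In general, a form on \<open>U\<close> extends
  to \<open>U + \<langle>x\<rangle>\<close> by choosing its contraction by \<open>x\<close>, and this contraction must vanish on every
  member of \<open>S\<close> that grows; iterating this bounds from below the number of linear conditions that
  \<open>S\<close> imposes on forms on its span \<open>U\<close>.  At resonance this number, in powers of \<open>q\<close>, exceeds the
  exponent \<open>c dim U\<close> of a direct sum by an amount of order \<open>c t\<close>, where \<open>t\<close> is least such that
  each member meets the span of its predecessors in dimension at most \<open>t\<close> or one of them in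
  codimension at most \<open>t\<close>.  There are so few families with a given \<open>t > 0\<close> that their contribution
  to the joint moments is negligible, up to an order \<open>L\<close> comparable with \<open>\<rho>\<close>.

  By Bonferroni's inequalities, agreement of these moments with those of the Bernoulli
  subset controls the total variation distance up to \<open>(2\<mu>)\<^sup>L / L!\<close>, which is \<open>exp (- a \<Psi>)\<close> as
  \<open>L log L\<close> is of the order of \<open>\<Psi>\<close>.  The Poisson statements follow from replacing each
  Bernoulli variable by a Poisson variable and from the product formula for the number
  of subspaces.
\<close>

section \<open>Total variation distance and Poisson variables\<close>

text \<open>Weighted by q to the power -c times the dimension of their span, the lists of n spaces
  at level t have total mass about q^(t n^2 r), while their gain is of order c t. So moments are
  under control for n up to the order of sqrt (c / r), and by resonance c / r = m binom(r, k) / r^2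
  is m r^(k-2) up to a factor depending on k: this square root is \<open>rho\<close>. The obstacle
  is a space H that lies almost inside the span of its predecessors but far from each of them. Its
  own contribution c j (r - j) / r, with j the dimension of the intersection, degenerates as j
  approaches r, and such families are too many to be dismissed. The missing conditions are collected
  earlier, while the predecessors sweep out H: a vector that enlarges the traces of both X and H
  requires contractions by it to vanish on both, and inclusion-exclusion bounds from below what H
  adds to X. Only upper bounds for probabilities need this. The lower bound p^s holds for every
  family of s spaces, as a further null space costs at most the number of forms on it.\<close>

lemma le_d_TV: "\<bar>measure_pmf.prob P A - measure_pmf.prob Q A\<bar> \<le> d_TV P Q"
  unfolding d_TV_def
proof (rule cSUP_upper)
  have "\<bar>measure_pmf.prob P A - measure_pmf.prob Q A\<bar> \<le> 1" for A
    using measure_pmf.prob_le_1[of P A] measure_pmf.prob_le_1[of Q A] measure_nonneg[of P A] measure_nonneg[of Q A]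
    by linarith
  then show "bdd_above (range (\<lambda>A. \<bar>measure_pmf.prob P A - measure_pmf.prob Q A\<bar>))"
    by (intro bdd_aboveI[of _ 1]) auto
qed simp

lemma d_TV_le: "(\<And>A. \<bar>measure_pmf.prob P A - measure_pmf.prob Q A\<bar> \<le> b) \<Longrightarrow> d_TV P Q \<le> b"
  unfolding d_TV_def by (rule cSUP_least) auto

lemma d_TV_le_one_sided:
  assumes "\<And>A. measure_pmf.prob P A - measure_pmf.prob Q A \<le> b"
  shows "d_TV P Q \<le> b"
proof (rule d_TV_le)
  fix A
  have "measure_pmf.prob P (- A) = 1 - measure_pmf.prob P A" "measure_pmf.prob Q (- A) = 1 - measure_pmf.prob Q A"
    using measure_pmf.prob_compl[of A P] measure_pmf.prob_compl[of A Q] by (auto simp: Compl_eq_Diff_UNIV)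
  then show "\<bar>measure_pmf.prob P A - measure_pmf.prob Q A\<bar> \<le> b" using assms[of A] assms[of "- A"] by linarith
qed

lemma d_TV_nonneg: "0 \<le> d_TV P Q"
  using le_d_TV[of P "{}" Q] by simp

lemma d_TV_commute: "d_TV P Q = d_TV Q P"
  unfolding d_TV_def by (simp add: abs_minus_commute)

lemma d_TV_triangle: "d_TV P R \<le> d_TV P Q + d_TV Q R"
proof (rule d_TV_le)
  fix A show "\<bar>measure_pmf.prob P A - measure_pmf.prob R A\<bar> \<le> d_TV P Q + d_TV Q R"
    using le_d_TV[of P A Q] le_d_TV[of Q A R] by linarith
qed

lemma d_TV_map: "d_TV (map_pmf f P) (map_pmf f Q) \<le> d_TV P Q"
  by (rule d_TV_le) (simp add: le_d_TV)

text \<open>Condition on the shared second coordinate: the probabilities of each section of the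
  event differ by at most the distance of the first coordinates.\<close>

lemma d_TV_pair_left:
  fixes P Q :: "'a pmf" and R :: "'b pmf"
  shows "d_TV (pair_pmf P R) (pair_pmf Q R) \<le> d_TV P Q"
proof (rule d_TV_le_one_sided)
  fix A
  have em: "emeasure (pair_pmf M R) A = (\<integral>\<^sup>+y. ennreal (measure_pmf.prob M {x. (x, y) \<in> A}) \<partial>R)"
    for M :: "'a pmf"
  proof -
    have "pair_pmf M R = bind_pmf R (\<lambda>y. map_pmf (\<lambda>x. (x, y)) M)"
      unfolding pair_pmf_def map_pmf_def by (rule bind_commute_pmf)
    then have "emeasure (pair_pmf M R) A = (\<integral>\<^sup>+y. emeasure (map_pmf (\<lambda>x. (x, y)) M) A \<partial>R)"
      by (simp only: emeasure_bind_pmf)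
    also have "\<dots> = (\<integral>\<^sup>+y. ennreal (measure_pmf.prob M {x. (x, y) \<in> A}) \<partial>R)"
      by (intro nn_integral_cong) (simp add: measure_pmf.emeasure_eq_measure vimage_def)
    finally show ?thesis .
  qed
  have "emeasure (pair_pmf P R) A \<le> (\<integral>\<^sup>+y. ennreal (measure_pmf.prob Q {x. (x, y) \<in> A}) + ennreal (d_TV P Q) \<partial>R)"
    unfolding em
  proof (intro nn_integral_mono)
    fix y
    have "measure_pmf.prob P {x. (x, y) \<in> A} \<le> measure_pmf.prob Q {x. (x, y) \<in> A} + d_TV P Q"
      using le_d_TV[of P "{x. (x, y) \<in> A}" Q] by linarith
    then have "ennreal (measure_pmf.prob P {x. (x, y) \<in> A}) \<le> ennreal (measure_pmf.prob Q {x. (x, y) \<in> A} + d_TV P Q)"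
      by (rule ennreal_leI)
    also have "\<dots> = ennreal (measure_pmf.prob Q {x. (x, y) \<in> A}) + ennreal (d_TV P Q)"
      by (rule ennreal_plus) (auto simp: d_TV_nonneg)
    finally show "ennreal (measure_pmf.prob P {x. (x, y) \<in> A}) \<le> ennreal (measure_pmf.prob Q {x. (x, y) \<in> A}) + ennreal (d_TV P Q)" .
  qed
  also have "\<dots> = emeasure (pair_pmf Q R) A + ennreal (d_TV P Q)"
    unfolding em by (subst nn_integral_add) (auto simp: measure_pmf.emeasure_eq_measure)
  finally have "ennreal (measure_pmf.prob (pair_pmf P R) A) \<le> ennreal (measure_pmf.prob (pair_pmf Q R) A + d_TV P Q)"
    by (simp add: measure_pmf.emeasure_eq_measure ennreal_plus d_TV_nonneg)
  then have "measure_pmf.prob (pair_pmf P R) A \<le> measure_pmf.prob (pair_pmf Q R) A + d_TV P Q"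
    by (subst (asm) ennreal_le_iff) (auto simp: d_TV_nonneg)
  then show "measure_pmf.prob (pair_pmf P R) A - measure_pmf.prob (pair_pmf Q R) A \<le> d_TV P Q" by linarith
qed

lemma d_TV_pair: "d_TV (pair_pmf P R) (pair_pmf Q S) \<le> d_TV P Q + d_TV R S"
proof -
  have "d_TV (pair_pmf Q R) (pair_pmf Q S) \<le> d_TV (pair_pmf R Q) (pair_pmf S Q)"
    by (subst (1 2) pair_commute_pmf) (rule d_TV_map)
  then show ?thesis
    using d_TV_triangle[of "pair_pmf P R" "pair_pmf Q S" "pair_pmf Q R"] d_TV_pair_left[of P R Q]
      d_TV_pair_left[of R Q S] by linarith
qed

lemma d_TV_Pi_pmf:
  "finite S \<Longrightarrow> d_TV (Pi_pmf S d (\<lambda>_. P)) (Pi_pmf S d (\<lambda>_. Q)) \<le> real (card S) * d_TV P Q"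
proof (induction S rule: finite_induct)
  case empty
  then show ?case by (auto intro: d_TV_le)
next
  case (insert x S)
  have "d_TV (Pi_pmf (insert x S) d (\<lambda>_. P)) (Pi_pmf (insert x S) d (\<lambda>_. Q)) \<le>
      d_TV (pair_pmf P (Pi_pmf S d (\<lambda>_. P))) (pair_pmf Q (Pi_pmf S d (\<lambda>_. Q)))"
    using insert.hyps by (simp add: Pi_pmf_insert d_TV_map)
  also have "\<dots> \<le> d_TV P Q + real (card S) * d_TV P Q"
    using d_TV_pair insert.IH by (rule order_trans[OF _ add_left_mono])
  finally show ?case using insert.hyps by (simp add: algebra_simps)
qed

section \<open>Poisson variables and their Bernoulli approximation\<close>

lemma poisson_convolution:
  assumes "0 < a" "0 < b"
  shows "map_pmf (\<lambda>(x, y). x + y) (pair_pmf (poisson_pmf a) (poisson_pmf b)) = poisson_pmf (a + b)"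
proof (rule pmf_eqI)
  fix n :: nat
  have "(\<lambda>(x, y). x + y) -` {n} = (\<lambda>i. (i, n - i)) ` {..n}" by (auto simp: image_iff)
  then have "pmf (map_pmf (\<lambda>(x, y). x + y) (pair_pmf (poisson_pmf a) (poisson_pmf b))) n =
      measure_pmf.prob (pair_pmf (poisson_pmf a) (poisson_pmf b)) ((\<lambda>i. (i, n - i)) ` {..n})"
    by (simp add: pmf_map)
  also have "\<dots> = (\<Sum>i\<le>n. pmf (pair_pmf (poisson_pmf a) (poisson_pmf b)) (i, n - i))"
    by (subst measure_measure_pmf_finite) (auto simp: sum.reindex inj_on_def)
  also have "\<dots> = (\<Sum>i\<le>n. (real (n choose i) * a ^ i * b ^ (n - i)) * (exp (- (a + b)) / fact n))"
  proof (intro sum.cong refl)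
    fix i assume "i \<in> {..n}"
    then have ch: "real (n choose i) = fact n / (fact i * fact (n - i))" by (intro binomial_fact) auto
    have c: "real (n choose i) * fact i * fact (n - i) = fact n" unfolding ch by simp
    have e: "exp (- (a + b)) = exp (- a) * exp (- b)" by (simp add: exp_add[symmetric])
    have "pmf (pair_pmf (poisson_pmf a) (poisson_pmf b)) (i, n - i) =
        a ^ i * b ^ (n - i) * exp (- (a + b)) * (1 / (fact i * fact (n - i)))"
      unfolding e using assms by (simp add: pmf_pair)
    also have "1 / (fact i * fact (n - i)) = real (n choose i) / (fact n :: real)"
      unfolding ch by simp
    finally show "pmf (pair_pmf (poisson_pmf a) (poisson_pmf b)) (i, n - i) =
        (real (n choose i) * a ^ i * b ^ (n - i)) * (exp (- (a + b)) / fact n)" by simp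
  qed
  also have "\<dots> = (a + b) ^ n * (exp (- (a + b)) / fact n)"
    unfolding sum_distrib_right[symmetric] binomial_ring[of a b n] by simp
  also have "\<dots> = pmf (poisson_pmf (a + b)) n" using assms by simp
  finally show "pmf (map_pmf (\<lambda>(x, y). x + y) (pair_pmf (poisson_pmf a) (poisson_pmf b))) n = pmf (poisson_pmf (a + b)) n" .
qed

lemma map_sum_Pi_pmf_poisson:
  assumes "finite S" "S \<noteq> {}" "0 < a"
  shows "map_pmf (\<lambda>f. \<Sum>x\<in>S. f x) (Pi_pmf S 0 (\<lambda>_. poisson_pmf a)) = poisson_pmf (real (card S) * a)"
  using assms(1,2)
proof (induction S rule: finite_ne_induct)
  case (singleton x)
  then show ?case by (simp add: Pi_pmf_component)
next
  case (insert x S)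
  have "map_pmf (\<lambda>f. \<Sum>y\<in>insert x S. f y) (Pi_pmf (insert x S) 0 (\<lambda>_. poisson_pmf a)) =
      map_pmf (\<lambda>(y, f). y + (\<Sum>z\<in>S. f z)) (pair_pmf (poisson_pmf a) (Pi_pmf S 0 (\<lambda>_. poisson_pmf a)))"
  proof -
    have "(\<Sum>z\<in>S. (f(x := y)) z) = (\<Sum>z\<in>S. f z)" for f and y :: nat
      using insert.hyps by (intro sum.cong) auto
    then show ?thesis
      using insert.hyps by (simp add: Pi_pmf_insert map_pmf_comp case_prod_unfold)
  qed
  also have "\<dots> = map_pmf (\<lambda>(x, y). x + y) (pair_pmf (poisson_pmf a) (map_pmf (\<lambda>f. \<Sum>x\<in>S. f x) (Pi_pmf S 0 (\<lambda>_. poisson_pmf a))))"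
    by (simp add: pair_map_pmf2 map_pmf_comp case_prod_unfold)
  also have "\<dots> = poisson_pmf (a + real (card S) * a)"
    unfolding insert.IH using assms(3) insert.hyps card_gt_0_iff[of S] by (intro poisson_convolution) auto
  also have "a + real (card S) * a = real (card (insert x S)) * a" using insert.hyps by (simp add: algebra_simps)
  finally show ?case .
qed

text \<open>The laws compared with a Poisson law below live on 0 and 1, so these two masses are all
  that is needed from it.\<close>

lemma prob_split_finite:
  fixes P :: "nat pmf"
  shows "pmf P 0 * of_bool (0 \<in> A) + pmf P 1 * of_bool (1 \<in> A) \<le> measure_pmf.prob P A"
proof -
  have "pmf P 0 * of_bool (0 \<in> A) + pmf P 1 * of_bool (1 \<in> A) = measure_pmf.prob P (A \<inter> {0, 1})"
    by (subst measure_measure_pmf_finite) (auto simp: Int_insert_right)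
  also have "\<dots> \<le> measure_pmf.prob P A" by (intro measure_pmf.finite_measure_mono) auto
  finally show ?thesis .
qed

text \<open>At 0 the Poisson mass \<open>exp (- p)\<close> is at least 1 - p, so the Bernoulli law
  exceeds it only at 1, by p - p exp(-p) \<le> p^2.\<close>

lemma d_TV_bernoulli_poisson:
  assumes "0 < p" "p \<le> 1"
  shows "d_TV (map_pmf of_bool (bernoulli_pmf p)) (poisson_pmf p) \<le> p\<^sup>2"
proof (rule d_TV_le_one_sided)
  fix A :: "nat set"
  let ?B = "map_pmf of_bool (bernoulli_pmf p) :: nat pmf"
  have "measure_pmf.prob ?B A = measure_pmf.prob (bernoulli_pmf p) (of_bool -` A)" by simp
  also have "\<dots> = (1 - p) * of_bool (0 \<in> A) + p * of_bool (1 \<in> A)"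
  proof -
    have v: "of_bool -` A = (if (0 :: nat) \<in> A then {False} else {}) \<union> (if (1 :: nat) \<in> A then {True} else {})"
      by (auto simp: vimage_def of_bool_def split: if_splits)
    show ?thesis unfolding v using assms by (subst measure_measure_pmf_finite) auto
  qed
  finally have 1: "measure_pmf.prob ?B A = (1 - p) * of_bool (0 \<in> A) + p * of_bool (1 \<in> A)" .
  have 2: "exp (- p) * of_bool (0 \<in> A) + p * exp (- p) * of_bool (1 \<in> A) \<le> measure_pmf.prob (poisson_pmf p) A"
    using prob_split_finite[of "poisson_pmf p" A] assms by simp
  have e: "1 - p \<le> exp (- p)" using exp_ge_add_one_self[of "- p"] by simp
  have "p * (1 - exp (- p)) \<le> p * p" using e assms by (intro mult_left_mono) auto
  moreover define t where "t = p\<^sup>2"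
  ultimately have t: "p - p * exp (- p) \<le> t" "0 \<le> t" by (auto simp: power2_eq_square algebra_simps)
  define w where "w = measure_pmf.prob (poisson_pmf p) A"
  have "0 \<le> w" by (simp add: w_def)
  then have "measure_pmf.prob ?B A - w \<le> t"
    using 1 2[folded w_def] e t by (cases "0 \<in> A"; cases "1 \<in> A") auto
  then show "measure_pmf.prob ?B A - measure_pmf.prob (poisson_pmf p) A \<le> p\<^sup>2" by (simp add: t_def w_def)
qed

text \<open>A Poisson variable of rate b is one of rate a plus an independent one of rate b - a, and
  the latter differs from 0 with probability at most b - a.\<close>

lemma d_TV_poisson_less:
  assumes "0 < a" "a < b" shows "d_TV (poisson_pmf a) (poisson_pmf b) \<le> b - a"
proof -
  let ?\<delta> = "b - a"
  have "poisson_pmf b = map_pmf (\<lambda>(x, y). x + y) (pair_pmf (poisson_pmf a) (poisson_pmf ?\<delta>))"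
    using poisson_convolution[of a ?\<delta>] assms by simp
  moreover have "poisson_pmf a = map_pmf (\<lambda>(x, y). x + y) (pair_pmf (poisson_pmf a) (return_pmf 0))"
    by (simp add: pair_return_pmf2 map_pmf_comp)
  ultimately have "d_TV (poisson_pmf a) (poisson_pmf b) \<le> d_TV (pair_pmf (poisson_pmf a) (return_pmf 0)) (pair_pmf (poisson_pmf a) (poisson_pmf ?\<delta>))"
    using d_TV_map[of "\<lambda>(x, y). x + y" "pair_pmf (poisson_pmf a) (return_pmf 0)" "pair_pmf (poisson_pmf a) (poisson_pmf ?\<delta>)"] by simp
  also have "\<dots> \<le> d_TV (poisson_pmf a) (poisson_pmf a) + d_TV (return_pmf 0) (poisson_pmf ?\<delta>)" by (rule d_TV_pair)
  also have "d_TV (poisson_pmf a) (poisson_pmf a) \<le> 0" by (rule d_TV_le) simp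
  also have "d_TV (return_pmf 0) (poisson_pmf ?\<delta>) \<le> ?\<delta>"
  proof (rule d_TV_le_one_sided)
    fix A :: "nat set"
    have "exp (- ?\<delta>) * of_bool (0 \<in> A) + pmf (poisson_pmf ?\<delta>) 1 * of_bool (1 \<in> A) \<le> measure_pmf.prob (poisson_pmf ?\<delta>) A"
      using prob_split_finite[of "poisson_pmf ?\<delta>" A] assms by simp
    then have "exp (- ?\<delta>) * of_bool (0 \<in> A) \<le> measure_pmf.prob (poisson_pmf ?\<delta>) A"
      using pmf_nonneg[of "poisson_pmf ?\<delta>" 1] by (smt (verit) mult_nonneg_nonneg of_bool_eq(1,2) of_bool_def)
    moreover have "1 - ?\<delta> \<le> exp (- ?\<delta>)" using exp_ge_add_one_self[of "- ?\<delta>"] by linarith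
    moreover define w where "w = measure_pmf.prob (poisson_pmf ?\<delta>) A"
    ultimately have w: "exp (- ?\<delta>) * of_bool (0 \<in> A) \<le> w" "1 - ?\<delta> \<le> exp (- ?\<delta>)" "0 \<le> w" by simp_all
    then have "measure_pmf.prob (return_pmf 0) A - w \<le> ?\<delta>"
      using assms by (cases "0 \<in> A") (auto simp: indicator_def)
    then show "measure_pmf.prob (return_pmf 0) A - measure_pmf.prob (poisson_pmf ?\<delta>) A \<le> ?\<delta>" by (simp add: w_def)
  qed
  finally show ?thesis by simp
qed

lemma d_TV_poisson:
  assumes "0 < a" "0 < b" shows "d_TV (poisson_pmf a) (poisson_pmf b) \<le> \<bar>a - b\<bar>"
proof -
  consider "a < b" | "b < a" | "a = b" by linarith
  then show ?thesis
  proof cases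
    case 3
    then show ?thesis by (auto intro: d_TV_le)
  qed (use assms d_TV_poisson_less[of a b] d_TV_poisson_less[of b a] d_TV_commute[of "poisson_pmf a" "poisson_pmf b"] in auto)
qed

lemma map_bernoulli_subset:
  "finite S \<Longrightarrow> map_pmf (\<lambda>Z x. of_bool (x \<in> Z) :: nat) (bernoulli_subset S p) =
    Pi_pmf S 0 (\<lambda>_. map_pmf of_bool (bernoulli_pmf p))"
proof -
  assume S: "finite S"
  have "map_pmf (\<lambda>Z x. of_bool (x \<in> Z) :: nat) (bernoulli_subset S p) =
      map_pmf (\<lambda>b x. of_bool (x \<in> S \<and> b x)) (Pi_pmf S False (\<lambda>_. bernoulli_pmf p))"
    unfolding bernoulli_subset_def by (simp add: map_pmf_comp)
  also have "\<dots> = map_pmf (\<lambda>b. of_bool \<circ> b) (Pi_pmf S False (\<lambda>_. bernoulli_pmf p))"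
  \<comment> \<open>Off S the product law takes its default \<open>False\<close>, so intersecting
    with S changes nothing.\<close>
  proof (intro map_pmf_cong refl)
    fix b assume "b \<in> set_pmf (Pi_pmf S False (\<lambda>_. bernoulli_pmf p))"
    then have "\<forall>x. x \<notin> S \<longrightarrow> b x = False" using set_Pi_pmf_subset[OF S] by fastforce
    then show "(\<lambda>x. of_bool (x \<in> S \<and> b x)) = (of_bool \<circ> b :: _ \<Rightarrow> nat)" by (auto simp: fun_eq_iff)
  qed
  also have "\<dots> = Pi_pmf S 0 (\<lambda>_. map_pmf of_bool (bernoulli_pmf p))"
    by (rule Pi_pmf_map[symmetric]) (auto simp: S)
  finally show ?thesis .
qed

lemma d_TV_bernoulli_subset_poisson:
  assumes S: "finite S" and p: "0 < p" "p \<le> 1"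
  shows "d_TV (map_pmf (\<lambda>Z x. of_bool (x \<in> Z) :: nat) (bernoulli_subset S p))
    (Pi_pmf S 0 (\<lambda>_. poisson_pmf p)) \<le> real (card S) * p\<^sup>2"
proof -
  have "d_TV (Pi_pmf S 0 (\<lambda>_. map_pmf of_bool (bernoulli_pmf p))) (Pi_pmf S 0 (\<lambda>_. poisson_pmf p))
      \<le> real (card S) * d_TV (map_pmf of_bool (bernoulli_pmf p)) (poisson_pmf p)" by (rule d_TV_Pi_pmf[OF S])
  also have "\<dots> \<le> real (card S) * p\<^sup>2" by (intro mult_left_mono d_TV_bernoulli_poisson p) auto
  finally show ?thesis unfolding map_bernoulli_subset[OF S] .
qed

lemma prob_bernoulli_superset:
  assumes S: "finite S" "T \<subseteq> S" and p: "0 \<le> p" "p \<le> 1"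
  shows "measure_pmf.prob (bernoulli_subset S p) {Z. T \<subseteq> Z} = p ^ card T"
proof -
  have "measure_pmf.prob (bernoulli_subset S p) {Z. T \<subseteq> Z} =
      measure_pmf.prob (Pi_pmf S False (\<lambda>_. bernoulli_pmf p)) (Pi S (\<lambda>x. if x \<in> T then {True} else UNIV))"
    unfolding bernoulli_subset_def using S(2)
    by (auto intro!: arg_cong[where f = "measure_pmf.prob _"] simp: Pi_iff split: if_splits)
  also have "\<dots> = (\<Prod>x\<in>S. if x \<in> T then p else 1)"
    using p by (subst measure_Pi_pmf_Pi[OF S(1)]) (auto intro!: prod.cong simp: measure_pmf_single)
  also have "\<dots> = (\<Prod>x\<in>T. p)" using S by (simp add: prod.If_cases Int_absorb1)
  finally show ?thesis by simp
qed

text \<open>Pascal's rule telescopes the partial sum to a single binomial coefficient of M - 1,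
  which is dominated by \<open>M choose Suc n\<close>; for M = 0 only the term 1 survives.\<close>

lemma alternating_choose_sum:
  "\<bar>of_bool (M = 0) - (\<Sum>i<Suc n. (-1) ^ i * real (M choose i))\<bar> \<le> real (M choose Suc n)"
proof (cases M)
  case (Suc N)
  have "(\<Sum>i<Suc n. (-1) ^ i * real (Suc N choose i)) = (-1) ^ n * real (N choose n)"
    by (induction n) (auto simp: algebra_simps)
  then show ?thesis using Suc by (simp add: abs_mult power_abs)
qed (simp add: sum.lessThan_Suc_shift del: sum.lessThan_Suc)

text \<open>The sets between S and Z are S together with a subset of Z - S; grouped by size they
  turn the sum into the alternating binomial sum for \<open>card (Z - S)\<close>, cut off at L -
  card S.\<close>

lemma bonferroni_pointwise:
  assumes Z: "finite Z" and SL: "card S < L" and S: "finite S"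
  shows "\<bar>of_bool (Z = S) - (\<Sum>T | S \<subseteq> T \<and> T \<subseteq> Z \<and> card T < L. (-1) ^ (card T - card S))\<bar> \<le>
    real (card {T. S \<subseteq> T \<and> T \<subseteq> Z \<and> card T = L})"
proof (cases "S \<subseteq> Z")
  case False
  then have e: "{T. S \<subseteq> T \<and> T \<subseteq> Z \<and> card T < L} = {}" and "Z \<noteq> S" by auto
  then show ?thesis unfolding e by simp
next
  case True
  define R where "R = Z - S"
  have R: "finite R" "R \<inter> S = {}" using Z by (auto simp: R_def)
  obtain n where n: "L - card S = Suc n" using SL by (metis Suc_diff_Suc)
  have cardU: "card (A \<union> S) = card A + card S" if "A \<subseteq> R" for A
    using that R S by (intro card_Un_disjoint) (auto intro: finite_subset)
  have bij: "bij_betw (\<lambda>A. A \<union> S) {A. A \<subseteq> R \<and> Q (card A)} {T. S \<subseteq> T \<and> T \<subseteq> Z \<and> Q (card T - card S) \<and> card S \<le> card T}" for Q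
    by (rule bij_betwI[of _ _ _ "\<lambda>T. T - S"])
       (use True cardU R in \<open>auto simp: R_def card_Diff_subset S\<close>)
  have fin: "finite {A. A \<subseteq> R \<and> Q (card A)}" for Q
    by (rule finite_subset[of _ "Pow R"]) (auto simp: R)
  have le: "card S \<le> card T" if "S \<subseteq> T" "T \<subseteq> Z" for T using that Z by (auto intro!: card_mono intro: finite_subset)
  have s1: "{T. S \<subseteq> T \<and> T \<subseteq> Z \<and> card T < L} = {T. S \<subseteq> T \<and> T \<subseteq> Z \<and> card T - card S < Suc n \<and> card S \<le> card T}"
    using n le by auto
  have s2: "{T. S \<subseteq> T \<and> T \<subseteq> Z \<and> card T = L} = {T. S \<subseteq> T \<and> T \<subseteq> Z \<and> card T - card S = Suc n \<and> card S \<le> card T}"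
    using n le by auto
  have "(\<Sum>T | S \<subseteq> T \<and> T \<subseteq> Z \<and> card T < L. (-1) ^ (card T - card S)) = (\<Sum>A | A \<subseteq> R \<and> card A < Suc n. (-1) ^ card A :: real)"
    unfolding s1 using sum.reindex_bij_betw[OF bij[of "\<lambda>x. x < Suc n"], of "\<lambda>T. (-1) ^ (card T - card S) :: real"] cardU
    by (auto intro!: sum.cong)
  also have "\<dots> = (\<Sum>i<Suc n. \<Sum>A\<in>{A \<in> {A. A \<subseteq> R \<and> card A < Suc n}. card A = i}. (-1) ^ card A)"
    by (rule sum.group[symmetric]) (auto intro: fin)
  also have "\<dots> = (\<Sum>i<Suc n. (-1) ^ i * real (card R choose i))"
  proof (intro sum.cong refl)
    fix i assume "i \<in> {..<Suc n}"
    then have "{A \<in> {A. A \<subseteq> R \<and> card A < Suc n}. card A = i} = {A. A \<subseteq> R \<and> card A = i}" by auto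
    then show "(\<Sum>A\<in>{A \<in> {A. A \<subseteq> R \<and> card A < Suc n}. card A = i}. (-1) ^ card A) = (-1) ^ i * real (card R choose i)"
      using n_subsets[OF R(1), of i] by simp
  qed
  finally have e1: "(\<Sum>T | S \<subseteq> T \<and> T \<subseteq> Z \<and> card T < L. (-1) ^ (card T - card S)) = (\<Sum>i<Suc n. (-1) ^ i * real (card R choose i))" .
  have e2: "card {T. S \<subseteq> T \<and> T \<subseteq> Z \<and> card T = L} = card R choose Suc n"
    unfolding s2 using bij_betw_same_card[OF bij[of "\<lambda>x. x = Suc n"]] n_subsets[OF R(1), of "Suc n"] by simp
  have e3: "Z = S \<longleftrightarrow> card R = 0" using True R by (auto simp: R_def)
  show ?thesis unfolding e1 e2 e3 by (rule alternating_choose_sum)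
qed

section \<open>Random subsets and joint moments\<close>

text \<open>Exchanging the order of summation makes a weighted sum of superset probabilities an
  average over outcomes Z, so that pointwise inequalities transfer to the law.\<close>

lemma prob_superset_sum:
  assumes "finite G" "set_pmf P \<subseteq> Pow G" "finite \<S>" "\<And>T. T \<in> \<S> \<Longrightarrow> T \<subseteq> G"
  shows "(\<Sum>T\<in>\<S>. h T * measure_pmf.prob P {Z. T \<subseteq> Z}) =
    (\<Sum>Z\<in>Pow G. pmf P Z * (\<Sum>T | T \<in> \<S> \<and> T \<subseteq> Z. h T))"
proof -
  have pr: "measure_pmf.prob P {Z. T \<subseteq> Z} = (\<Sum>Z\<in>Pow G. pmf P Z * of_bool (T \<subseteq> Z))" for T
  proof -
    have "measure_pmf.prob P {Z. T \<subseteq> Z} = measure_pmf.prob P {Z \<in> Pow G. T \<subseteq> Z}"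
      using assms(2) by (intro measure_prob_cong_0) (auto simp: set_pmf_eq)
    also have "\<dots> = (\<Sum>Z\<in>{Z \<in> Pow G. T \<subseteq> Z}. pmf P Z)" using assms(1) by (intro measure_measure_pmf_finite) auto
    also have "\<dots> = (\<Sum>Z\<in>Pow G. if T \<subseteq> Z then pmf P Z else 0)" using assms(1) by (intro sum.inter_filter) auto
    also have "\<dots> = (\<Sum>Z\<in>Pow G. pmf P Z * of_bool (T \<subseteq> Z))" by (intro sum.cong) auto
    finally show ?thesis .
  qed
  have "(\<Sum>T\<in>\<S>. h T * measure_pmf.prob P {Z. T \<subseteq> Z}) = (\<Sum>T\<in>\<S>. \<Sum>Z\<in>Pow G. pmf P Z * (h T * of_bool (T \<subseteq> Z)))"
    unfolding pr by (simp add: sum_distrib_left mult.left_commute)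
  also have "\<dots> = (\<Sum>Z\<in>Pow G. \<Sum>T\<in>\<S>. pmf P Z * (h T * of_bool (T \<subseteq> Z)))" by (rule sum.swap)
  also have "\<dots> = (\<Sum>Z\<in>Pow G. pmf P Z * (\<Sum>T | T \<in> \<S> \<and> T \<subseteq> Z. h T))"
  proof (intro sum.cong refl)
    fix Z
    have "(\<Sum>T | T \<in> \<S> \<and> T \<subseteq> Z. h T) = (\<Sum>T\<in>\<S>. if T \<subseteq> Z then h T else 0)"
      using assms(3) by (intro sum.inter_filter)
    also have "\<dots> = (\<Sum>T\<in>\<S>. h T * of_bool (T \<subseteq> Z))" by (intro sum.cong) auto
    finally show "(\<Sum>T\<in>\<S>. pmf P Z * (h T * of_bool (T \<subseteq> Z))) = pmf P Z * (\<Sum>T | T \<in> \<S> \<and> T \<subseteq> Z. h T)"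
      by (simp only: sum_distrib_left)
  qed
  finally show ?thesis .
qed

lemma bonferroni_pmf:
  assumes G: "finite G" and P: "set_pmf P \<subseteq> Pow G" and S: "S \<subseteq> G" "card S < L"
  shows "\<bar>pmf P S - (\<Sum>T | S \<subseteq> T \<and> T \<subseteq> G \<and> card T < L. (-1) ^ (card T - card S) * measure_pmf.prob P {Z. T \<subseteq> Z})\<bar> \<le>
    (\<Sum>T | S \<subseteq> T \<and> T \<subseteq> G \<and> card T = L. measure_pmf.prob P {Z. T \<subseteq> Z})"
proof -
  let ?A = "{T. S \<subseteq> T \<and> T \<subseteq> G \<and> card T < L}" and ?B = "{T. S \<subseteq> T \<and> T \<subseteq> G \<and> card T = L}"
  have fin: "finite ?A" "finite ?B" using G by (auto intro: finite_subset[of _ "Pow G"])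
  let ?h = "\<lambda>T. (-1) ^ (card T - card S) :: real"
  have one: "pmf P S = (\<Sum>Z\<in>Pow G. pmf P Z * of_bool (Z = S))"
  proof -
    have "(\<Sum>Z\<in>Pow G. pmf P Z * of_bool (Z = S)) = (\<Sum>Z\<in>Pow G. if Z = S then pmf P Z else 0)"
      by (intro sum.cong) auto
    then show ?thesis using G S by simp
  qed
  have A: "(\<Sum>T\<in>?A. ?h T * measure_pmf.prob P {Z. T \<subseteq> Z}) =
      (\<Sum>Z\<in>Pow G. pmf P Z * (\<Sum>T | S \<subseteq> T \<and> T \<subseteq> Z \<and> card T < L. ?h T))"
    unfolding prob_superset_sum[OF G P fin(1), of ?h, simplified]
    by (intro sum.cong arg_cong2[where f = "(*)"] refl) auto
  have B: "(\<Sum>T\<in>?B. measure_pmf.prob P {Z. T \<subseteq> Z}) =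
      (\<Sum>Z\<in>Pow G. pmf P Z * real (card {T. S \<subseteq> T \<and> T \<subseteq> Z \<and> card T = L}))"
  proof -
    have "(\<Sum>T\<in>?B. 1 * measure_pmf.prob P {Z. T \<subseteq> Z}) = (\<Sum>Z\<in>Pow G. pmf P Z * (\<Sum>T | T \<in> ?B \<and> T \<subseteq> Z. 1))"
      by (rule prob_superset_sum[OF G P fin(2)]) auto
    also have "\<dots> = (\<Sum>Z\<in>Pow G. pmf P Z * real (card {T. S \<subseteq> T \<and> T \<subseteq> Z \<and> card T = L}))"
      by (intro sum.cong refl) (auto intro!: arg_cong[where f = card])
    finally show ?thesis by simp
  qed
  have "\<bar>pmf P S - (\<Sum>T\<in>?A. ?h T * measure_pmf.prob P {Z. T \<subseteq> Z})\<bar> =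
      \<bar>\<Sum>Z\<in>Pow G. pmf P Z * (of_bool (Z = S) - (\<Sum>T | S \<subseteq> T \<and> T \<subseteq> Z \<and> card T < L. ?h T))\<bar>"
    unfolding one A by (simp only: sum_subtractf right_diff_distrib)
  also have "\<dots> \<le> (\<Sum>Z\<in>Pow G. \<bar>pmf P Z * (of_bool (Z = S) - (\<Sum>T | S \<subseteq> T \<and> T \<subseteq> Z \<and> card T < L. ?h T))\<bar>)"
    by (rule sum_abs)
  also have "\<dots> \<le> (\<Sum>Z\<in>Pow G. pmf P Z * real (card {T. S \<subseteq> T \<and> T \<subseteq> Z \<and> card T = L}))"
  proof (rule sum_mono)
    fix Z assume "Z \<in> Pow G"
    then have "finite Z" "finite S" using G S finite_subset by auto
    then show "\<bar>pmf P Z * (of_bool (Z = S) - (\<Sum>T | S \<subseteq> T \<and> T \<subseteq> Z \<and> card T < L. ?h T))\<bar> \<le>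
        pmf P Z * real (card {T. S \<subseteq> T \<and> T \<subseteq> Z \<and> card T = L})"
      using bonferroni_pointwise[of Z S L] S(2) by (simp add: abs_mult mult_left_mono)
  qed
  finally show ?thesis unfolding B .
qed

lemma prob_card_ge:
  assumes G: "finite G" and P: "set_pmf P \<subseteq> Pow G"
  shows "measure_pmf.prob P {Z. L \<le> card Z} \<le> (\<Sum>T | T \<subseteq> G \<and> card T = L. measure_pmf.prob P {Z. T \<subseteq> Z})"
proof -
  have "measure_pmf.prob P {Z. L \<le> card Z} \<le> measure_pmf.prob P (\<Union>T\<in>{T. T \<subseteq> G \<and> card T = L}. {Z. T \<subseteq> Z})"
  proof (rule measure_pmf.finite_measure_mono_AE)
    show "AE Z in measure_pmf P. Z \<in> {Z. L \<le> card Z} \<longrightarrow> Z \<in> (\<Union>T\<in>{T. T \<subseteq> G \<and> card T = L}. {Z. T \<subseteq> Z})"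
    proof (rule AE_pmfI, rule impI)
      fix Z assume "Z \<in> set_pmf P" "Z \<in> {Z. L \<le> card Z}"
      then have "Z \<subseteq> G" "L \<le> card Z" using P by auto
      then obtain T where "T \<subseteq> Z" "card T = L" by (meson obtain_subset_with_card_n)
      then show "Z \<in> (\<Union>T\<in>{T. T \<subseteq> G \<and> card T = L}. {Z. T \<subseteq> Z})" using \<open>Z \<subseteq> G\<close> by auto
    qed
  qed simp
  also have "\<dots> \<le> (\<Sum>T | T \<subseteq> G \<and> card T = L. measure_pmf.prob P {Z. T \<subseteq> Z})"
    using G by (intro measure_pmf.finite_measure_subadditive_finite) (auto intro: finite_subset[of _ "Pow G"])
  finally show ?thesis .
qed

lemma sum_supersets_le:
  assumes G: "finite G" and h: "\<And>T. 0 \<le> h T" and \<S>: "\<And>S. S \<in> \<S> \<Longrightarrow> S \<subseteq> G" and \<T>: "\<And>T. T \<in> \<T> \<Longrightarrow> T \<subseteq> G"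
    and n: "\<And>T. T \<in> \<T> \<Longrightarrow> card {S \<in> \<S>. S \<subseteq> T} \<le> n T"
  shows "(\<Sum>S\<in>\<S>. \<Sum>T\<in>{T \<in> \<T>. S \<subseteq> T}. h T :: real) \<le> (\<Sum>T\<in>\<T>. real (n T) * h T)"
proof -
  have fin: "finite \<S>" "finite \<T>" using \<S> \<T> G by (auto intro: finite_subset[of _ "Pow G"])
  have "(\<Sum>S\<in>\<S>. \<Sum>T\<in>{T \<in> \<T>. S \<subseteq> T}. h T) = (\<Sum>T\<in>\<T>. \<Sum>S\<in>{S \<in> \<S>. S \<subseteq> T}. h T)"
    using fin by (rule sum.swap_restrict)
  also have "\<dots> = (\<Sum>T\<in>\<T>. real (card {S \<in> \<S>. S \<subseteq> T}) * h T)" by simp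
  also have "\<dots> \<le> (\<Sum>T\<in>\<T>. real (n T) * h T)" using n h by (intro sum_mono mult_right_mono) auto
  finally show ?thesis .
qed

text \<open>Outcomes with fewer than L elements are compared one at a time by Bonferroni's
  inequality; summing over them counts each T once for every subset S of it, hence the factor
  \<open>2 ^ card T\<close>. Larger outcomes are bounded by the moments of order L.\<close>

lemma d_TV_subsets:
  assumes G: "finite G" and P: "set_pmf P \<subseteq> Pow G" and Q: "set_pmf Q \<subseteq> Pow G"
  shows "d_TV P Q \<le>
    (\<Sum>T | T \<subseteq> G \<and> card T < L. 2 ^ card T * \<bar>measure_pmf.prob P {Z. T \<subseteq> Z} - measure_pmf.prob Q {Z. T \<subseteq> Z}\<bar>) +
    2 ^ L * (\<Sum>T | T \<subseteq> G \<and> card T = L. measure_pmf.prob P {Z. T \<subseteq> Z} + measure_pmf.prob Q {Z. T \<subseteq> Z})"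
proof (rule d_TV_le)
  fix A
  let ?p = "\<lambda>T. measure_pmf.prob P {Z. T \<subseteq> Z}" and ?q = "\<lambda>T. measure_pmf.prob Q {Z. T \<subseteq> Z}"
  let ?S = "{S. S \<subseteq> G \<and> card S < L}" and ?T = "{T. T \<subseteq> G \<and> card T < L}" and ?U = "{T. T \<subseteq> G \<and> card T = L}"
  have fin: "finite ?S" "finite ?U" using G by (auto intro: finite_subset[of _ "Pow G"])
  have split: "\<bar>measure_pmf.prob M A - measure_pmf.prob M (A \<inter> ?S)\<bar> \<le> measure_pmf.prob M {Z. L \<le> card Z}"
    if "set_pmf M \<subseteq> Pow G" for M
  proof -
    have "measure_pmf.prob M A \<le> measure_pmf.prob M (A \<inter> ?S \<union> {Z. L \<le> card Z})"
      using that by (intro measure_pmf.finite_measure_mono_AE AE_pmfI) auto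
    also have "\<dots> \<le> measure_pmf.prob M (A \<inter> ?S) + measure_pmf.prob M {Z. L \<le> card Z}"
      by (rule measure_Un_le) auto
    finally have "measure_pmf.prob M A - measure_pmf.prob M (A \<inter> ?S) \<le> measure_pmf.prob M {Z. L \<le> card Z}" by simp
    moreover have "measure_pmf.prob M (A \<inter> ?S) \<le> measure_pmf.prob M A"
      by (intro measure_pmf.finite_measure_mono) auto
    ultimately show ?thesis by simp
  qed
  have point: "\<bar>pmf P S - pmf Q S\<bar> \<le> (\<Sum>T\<in>{T \<in> ?T. S \<subseteq> T}. \<bar>?p T - ?q T\<bar>) + (\<Sum>T\<in>{T \<in> ?U. S \<subseteq> T}. ?p T + ?q T)"
    if S: "S \<in> ?S" for S
  proof -
    have eqT: "{T. S \<subseteq> T \<and> T \<subseteq> G \<and> card T < L} = {T \<in> ?T. S \<subseteq> T}" and eqU: "{T. S \<subseteq> T \<and> T \<subseteq> G \<and> card T = L} = {T \<in> ?U. S \<subseteq> T}"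
      by auto
    let ?h = "\<lambda>T. (-1) ^ (card T - card S) :: real"
    have b: "\<bar>pmf P S - (\<Sum>T\<in>{T \<in> ?T. S \<subseteq> T}. ?h T * ?p T)\<bar> \<le> (\<Sum>T\<in>{T \<in> ?U. S \<subseteq> T}. ?p T)"
      "\<bar>pmf Q S - (\<Sum>T\<in>{T \<in> ?T. S \<subseteq> T}. ?h T * ?q T)\<bar> \<le> (\<Sum>T\<in>{T \<in> ?U. S \<subseteq> T}. ?q T)"
      using bonferroni_pmf[OF G P, of S L] bonferroni_pmf[OF G Q, of S L] S unfolding eqT eqU by auto
    have "\<bar>(\<Sum>T\<in>{T \<in> ?T. S \<subseteq> T}. ?h T * ?p T) - (\<Sum>T\<in>{T \<in> ?T. S \<subseteq> T}. ?h T * ?q T)\<bar> =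
        \<bar>\<Sum>T\<in>{T \<in> ?T. S \<subseteq> T}. ?h T * (?p T - ?q T)\<bar>"
      by (simp only: sum_subtractf right_diff_distrib)
    also have "\<dots> \<le> (\<Sum>T\<in>{T \<in> ?T. S \<subseteq> T}. \<bar>?h T * (?p T - ?q T)\<bar>)" by (rule sum_abs)
    also have "\<dots> = (\<Sum>T\<in>{T \<in> ?T. S \<subseteq> T}. \<bar>?p T - ?q T\<bar>)" by (simp add: abs_mult power_abs)
    finally show ?thesis using b unfolding sum.distrib by linarith
  qed
  have "\<bar>measure_pmf.prob P (A \<inter> ?S) - measure_pmf.prob Q (A \<inter> ?S)\<bar> = \<bar>\<Sum>S\<in>A \<inter> ?S. pmf P S - pmf Q S\<bar>"
    using fin by (simp add: measure_measure_pmf_finite sum_subtractf)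
  also have "\<dots> \<le> (\<Sum>S\<in>A \<inter> ?S. \<bar>pmf P S - pmf Q S\<bar>)" by (rule sum_abs)
  also have "\<dots> \<le> (\<Sum>S\<in>?S. \<bar>pmf P S - pmf Q S\<bar>)" using fin by (intro sum_mono2) auto
  also have "\<dots> \<le> (\<Sum>S\<in>?S. (\<Sum>T\<in>{T \<in> ?T. S \<subseteq> T}. \<bar>?p T - ?q T\<bar>) + (\<Sum>T\<in>{T \<in> ?U. S \<subseteq> T}. ?p T + ?q T))"
    by (intro sum_mono point)
  also have "\<dots> = (\<Sum>S\<in>?S. \<Sum>T\<in>{T \<in> ?T. S \<subseteq> T}. \<bar>?p T - ?q T\<bar>) + (\<Sum>S\<in>?S. \<Sum>T\<in>{T \<in> ?U. S \<subseteq> T}. ?p T + ?q T)"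
    by (rule sum.distrib)
  also have "\<dots> \<le> (\<Sum>T\<in>?T. real (2 ^ card T) * \<bar>?p T - ?q T\<bar>) + (\<Sum>T\<in>?U. real (2 ^ L - 1) * (?p T + ?q T))"
  proof (intro add_mono sum_supersets_le[OF G])
    fix T assume T: "T \<in> ?T"
    then have "finite T" using G finite_subset by auto
    have "card {S \<in> ?S. S \<subseteq> T} \<le> card (Pow T)" using \<open>finite T\<close> by (intro card_mono) auto
    then show "card {S \<in> ?S. S \<subseteq> T} \<le> 2 ^ card T" using \<open>finite T\<close> by (simp add: card_Pow)
  next
    \<comment> \<open>T itself has L elements and is not among the S; the copy of its moment saved
      here pays for the outcomes with at least L elements.\<close>
    fix T assume T: "T \<in> ?U"
    then have "finite T" using G finite_subset by auto
    have "card {S \<in> ?S. S \<subseteq> T} \<le> card (Pow T - {T})" using \<open>finite T\<close> T by (intro card_mono) auto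
    then show "card {S \<in> ?S. S \<subseteq> T} \<le> 2 ^ L - 1" using \<open>finite T\<close> T by (simp add: card_Pow card_Diff_singleton)
  qed auto
  finally have main: "\<bar>measure_pmf.prob P (A \<inter> ?S) - measure_pmf.prob Q (A \<inter> ?S)\<bar> \<le>
      (\<Sum>T\<in>?T. 2 ^ card T * \<bar>?p T - ?q T\<bar>) + (2 ^ L - 1) * (\<Sum>T\<in>?U. ?p T + ?q T)"
    by (simp add: of_nat_diff sum_distrib_left)
  have "measure_pmf.prob P {Z. L \<le> card Z} + measure_pmf.prob Q {Z. L \<le> card Z} \<le> (\<Sum>T\<in>?U. ?p T + ?q T)"
    using prob_card_ge[OF G P, of L] prob_card_ge[OF G Q, of L] by (simp add: sum.distrib)
  then have "\<bar>measure_pmf.prob P A - measure_pmf.prob Q A\<bar> \<le>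
      (\<Sum>T\<in>?T. 2 ^ card T * \<bar>?p T - ?q T\<bar>) + (2 ^ L - 1) * (\<Sum>T\<in>?U. ?p T + ?q T) + (\<Sum>T\<in>?U. ?p T + ?q T)"
    using main split[OF P] split[OF Q] by linarith
  then show "\<bar>measure_pmf.prob P A - measure_pmf.prob Q A\<bar> \<le>
      (\<Sum>T\<in>?T. 2 ^ card T * \<bar>?p T - ?q T\<bar>) + 2 ^ L * (\<Sum>T\<in>?U. ?p T + ?q T)"
    by (simp add: algebra_simps)
qed

text \<open>The Bernoulli moments are \<open>p ^ card T\<close>. The orders below L contribute L e
  and the order L another e; there are at most |G|^L / L! sets of order L, whence the last
  term.\<close>

lemma d_TV_bernoulli_subset:
  assumes G: "finite G" and P: "set_pmf P \<subseteq> Pow G" and p: "0 \<le> p" "p \<le> 1"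
    and e: "\<And>s. s \<le> L \<Longrightarrow> (\<Sum>T | T \<subseteq> G \<and> card T = s. \<bar>measure_pmf.prob P {Z. T \<subseteq> Z} - p ^ s\<bar>) \<le> e"
  shows "d_TV P (bernoulli_subset G p) \<le> 2 ^ L * (real (L + 1) * e + 2 * (real (card G) * p) ^ L / fact L)"
proof -
  let ?p = "\<lambda>T. measure_pmf.prob P {Z. T \<subseteq> Z}" and ?q = "\<lambda>T. measure_pmf.prob (bernoulli_subset G p) {Z. T \<subseteq> Z}"
  have q: "?q T = p ^ card T" if "T \<subseteq> G" for T using prob_bernoulli_superset[OF G that p] .
  have Q: "set_pmf (bernoulli_subset G p) \<subseteq> Pow G" by (auto simp: bernoulli_subset_def)
  let ?T = "{T. T \<subseteq> G \<and> card T < L}" and ?U = "{T. T \<subseteq> G \<and> card T = L}"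
  have fin: "finite ?T" "finite ?U" using G by (auto intro: finite_subset[of _ "Pow G"])
  have "(\<Sum>T\<in>?T. 2 ^ card T * \<bar>?p T - ?q T\<bar>) \<le> (\<Sum>T\<in>?T. 2 ^ L * \<bar>?p T - p ^ card T\<bar>)"
    by (intro sum_mono mult_mono) (auto simp: q)
  also have "\<dots> = 2 ^ L * (\<Sum>T\<in>?T. \<bar>?p T - p ^ card T\<bar>)" by (simp only: sum_distrib_left)
  also have "(\<Sum>T\<in>?T. \<bar>?p T - p ^ card T\<bar>) = (\<Sum>s\<in>{..<L}. \<Sum>T\<in>{T \<in> ?T. card T = s}. \<bar>?p T - p ^ card T\<bar>)"
    using fin by (intro sum.group[symmetric]) auto
  also have "\<dots> = (\<Sum>s\<in>{..<L}. \<Sum>T | T \<subseteq> G \<and> card T = s. \<bar>?p T - p ^ s\<bar>)"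
    by (intro sum.cong refl) auto
  also have "\<dots> \<le> (\<Sum>s\<in>{..<L}. e)" by (intro sum_mono e) auto
  also have "\<dots> = real L * e" by simp
  finally have 1: "(\<Sum>T\<in>?T. 2 ^ card T * \<bar>?p T - ?q T\<bar>) \<le> 2 ^ L * (real L * e)" by simp
  have "(\<Sum>T\<in>?U. ?p T + ?q T) \<le> (\<Sum>T\<in>?U. \<bar>?p T - p ^ L\<bar> + 2 * p ^ L)"
    by (intro sum_mono) (auto simp: q)
  also have "\<dots> = (\<Sum>T\<in>?U. \<bar>?p T - p ^ L\<bar>) + 2 * (real (card G choose L) * p ^ L)"
    using n_subsets[OF G, of L] by (simp add: sum.distrib)
  also have "\<dots> \<le> e + 2 * ((real (card G) * p) ^ L / fact L)"
  proof (intro add_mono e mult_left_mono)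
    have "real (card G choose L) \<le> real (card G) ^ L / fact L"
      using binomial_fact_pow[of "card G" L] by (simp add: field_simps) (metis of_nat_fact of_nat_le_iff of_nat_mult of_nat_power)
    then show "real (card G choose L) * p ^ L \<le> (real (card G) * p) ^ L / fact L"
      using p by (simp add: power_mult_distrib mult_right_mono[of _ _ "p ^ L"] flip: times_divide_eq_left)
  qed auto
  finally have 2: "2 ^ L * (\<Sum>T\<in>?U. ?p T + ?q T) \<le> 2 ^ L * (e + 2 * ((real (card G) * p) ^ L / fact L))"
    by (intro mult_left_mono) auto
  show ?thesis
    using d_TV_subsets[OF G P Q, of L] 1 2 by (simp add: algebra_simps)
qed

section \<open>Asymptotic estimates\<close>

lemma prod_one_minus_powers_ge:
  fixes x :: real assumes "0 \<le> x" "x \<le> 1 / 2"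
  shows "(\<Prod>j<n. 1 - x ^ Suc j) \<ge> 1 / 4"
proof -
  \<comment> \<open>The bound 1/4 alone is not inductive, as each factor would lower it. With the
    surplus e the step reads (1/4 + e)(1 - e) \<ge> 1/4 + e/2, which holds for e \<le> 1/4.\<close>
  have ge: "(\<Prod>j<Suc n. 1 - (1/2 :: real) ^ Suc j) \<ge> 1 / 4 + (1/2) ^ (n + 2)" for n
  proof (induction n)
    case (Suc n)
    define e :: real where "e = (1/2) ^ (n + 2)"
    have e: "0 \<le> e" "e \<le> 1 / 4"
      using power_decreasing[of 2 "n + 2" "1/2 :: real"] by (auto simp: e_def power2_eq_square)
    have "1 / 4 + e / 2 \<le> (1 / 4 + e) * (1 - e)"
    proof -
      have "(1 / 4 + e) * (1 - e) = 1 / 4 + 3 / 4 * e - e * e" by (simp add: field_simps)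
      then show ?thesis using mult_left_mono[OF e(2) e(1)] by simp
    qed
    also have "\<dots> \<le> (\<Prod>j<Suc n. 1 - (1/2 :: real) ^ Suc j) * (1 - e)"
      using Suc e by (intro mult_right_mono) (auto simp: e_def)
    also have "\<dots> = (\<Prod>j<Suc (Suc n). 1 - (1/2 :: real) ^ Suc j)" by (simp add: e_def)
    finally show ?case by (simp add: e_def)
  qed simp
  have "(\<Prod>j<n. 1 - (1/2 :: real) ^ Suc j) \<ge> 1 / 4"
  proof (cases n)
    case (Suc k)
    have "1 / 4 \<le> 1 / 4 + (1/2 :: real) ^ (k + 2)" by simp
    also have "\<dots> \<le> (\<Prod>j<n. 1 - (1/2 :: real) ^ Suc j)" using ge[of k] Suc by simp
    finally show ?thesis .
  qed simp
  also have "(\<Prod>j<n. 1 - (1/2 :: real) ^ Suc j) \<le> (\<Prod>j<n. 1 - x ^ Suc j)"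
    using assms by (intro prod_mono) (auto intro!: power_mono power_le_one mult_le_one simp del: power_Suc)
  finally show ?thesis .
qed

text \<open>The factors from r on multiply to at least one minus a geometric sum of ratio at most
  1/2. The shift s serves the numerator of the mean (s = c) as well as the partial products of C_q
  (s = 0).\<close>

lemma prod_one_minus_powers_diff:
  fixes x :: real assumes x: "0 \<le> x" "x \<le> 1 / 2" and n: "r \<le> n"
  shows "(\<Prod>j<r. 1 - x ^ Suc (s + j)) - (\<Prod>j<n. 1 - x ^ Suc (s + j)) \<le> 2 * x ^ Suc (s + r)"
    "(\<Prod>j<n. 1 - x ^ Suc (s + j)) \<le> (\<Prod>j<r. 1 - x ^ Suc (s + j))"
    "0 \<le> (\<Prod>j<n. 1 - x ^ Suc (s + j))" "(\<Prod>j<n. 1 - x ^ Suc (s + j)) \<le> 1"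
proof -
  have x01: "x ^ i \<in> {0..1}" for i using x by (auto intro: power_le_one)
  \<comment> \<open>Subtracting the last power keeps the induction going; a bare bound by twice the
    first term would not.\<close>
  have geo: "(\<Sum>j\<in>{r..<n}. x ^ Suc (s + j)) \<le> 2 * (x ^ Suc (s + r) - x ^ Suc (s + n))"
    using n
  proof (induction n rule: dec_induct)
    case (step n)
    have "x ^ Suc (s + n) * (2 * x) \<le> x ^ Suc (s + n) * 1"
      using x by (intro mult_left_mono) auto
    then show ?case using step by (simp add: algebra_simps)
  qed simp
  let ?B = "\<Prod>j\<in>{r..<n}. 1 - x ^ Suc (s + j)" and ?A = "\<Prod>j<r. 1 - x ^ Suc (s + j)"
  have split: "(\<Prod>j<n. 1 - x ^ Suc (s + j)) = ?A * ?B"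
    using prod.atLeastLessThan_concat[of 0 r n "\<lambda>j. 1 - x ^ Suc (s + j)"] n by (simp add: atLeast0LessThan)
  have B: "1 - 2 * x ^ Suc (s + r) \<le> ?B"
  proof -
    have "1 - (\<Sum>j\<in>{r..<n}. x ^ Suc (s + j)) \<le> ?B" by (rule Weierstrass_prod_ineq) (rule x01)
    then show ?thesis using geo x01[of "Suc (s + n)"] by (auto simp del: power_Suc)
  qed
  have B1: "0 \<le> ?B" "?B \<le> 1" using x01 by (auto intro!: prod_nonneg prod_le_1 simp del: power_Suc)
  have A1: "0 \<le> ?A" "?A \<le> 1" using x01 by (auto intro!: prod_nonneg prod_le_1 simp del: power_Suc)
  have "?A * (1 - ?B) \<le> 1 * (2 * x ^ Suc (s + r))" using A1 B B1 by (intro mult_mono) auto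
  then show "?A - (\<Prod>j<n. 1 - x ^ Suc (s + j)) \<le> 2 * x ^ Suc (s + r)"
    unfolding split by (simp add: algebra_simps del: power_Suc)
  show "(\<Prod>j<n. 1 - x ^ Suc (s + j)) \<le> ?A" unfolding split using A1 B1 by (simp add: mult_left_le)
  show "0 \<le> (\<Prod>j<n. 1 - x ^ Suc (s + j))" unfolding split using A1 B1 by simp
  show "(\<Prod>j<n. 1 - x ^ Suc (s + j)) \<le> 1" unfolding split using A1 B1 by (simp add: mult_le_one)
qed

text \<open>The partial products of C_q are \<open>1 / A (Suc n)\<close> and increase with n; both
  bounds hold along the sequence and pass to the limit. The factor 32 is 2 divided twice by
  1/4.\<close>

lemma C_const_approx:
  assumes q: "q \<ge> 2"
  defines "A \<equiv> (\<lambda>n. \<Prod>j<n. 1 - (1 / real q) ^ Suc j)"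
  shows "1 / A r \<le> C_const q" "C_const q \<le> 1 / A r + 32 * (1 / real q) ^ Suc r"
proof -
  define x where "x = 1 / real q"
  have x: "0 < x" "x \<le> 1 / 2" using q by (auto simp: x_def field_simps)
  have A: "A n = (\<Prod>j<n. 1 - x ^ Suc j)" for n by (simp add: A_def x_def)
  have A4: "1 / 4 \<le> A n" for n using prod_one_minus_powers_ge[of x n] x by (simp add: A)
  let ?f = "\<lambda>j. inverse (1 - 1 / real q ^ Suc j)"
  have f: "?f j = inverse (1 - x ^ Suc j)" for j by (simp add: x_def power_one_over)
  have small: "x ^ Suc j \<le> 1 / 2" for j
  proof -
    have "x ^ Suc j \<le> x ^ 1" using x by (intro power_decreasing) auto
    then show ?thesis using x(2) by (simp del: power_Suc)
  qed
  have "norm (?f j - 1) \<le> 2 * x ^ Suc j" for j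
  proof -
    have "?f j - 1 = x ^ Suc j / (1 - x ^ Suc j)" unfolding f using small[of j] by (simp add: field_simps del: power_Suc)
    moreover have "0 \<le> x ^ Suc j / (1 - x ^ Suc j)" using small[of j] x by (auto simp del: power_Suc)
    ultimately have "norm (?f j - 1) = x ^ Suc j / (1 - x ^ Suc j)" by (simp only: real_norm_def abs_of_nonneg)
    also have "\<dots> \<le> x ^ Suc j / (1 / 2)"
      using small[of j] x by (intro divide_left_mono) (auto simp del: power_Suc)
    also have "\<dots> = 2 * x ^ Suc j" by simp
    finally show ?thesis .
  qed
  moreover have "summable (\<lambda>j. 2 * x ^ Suc j)"
    using x by (intro summable_mult) (simp add: summable_mult summable_geometric)
  ultimately have "summable (\<lambda>j. norm (?f j - 1))" 
    by (intro summable_comparison_test'[of "\<lambda>j. 2 * x ^ Suc j" 0 "\<lambda>j. norm (?f j - 1)"]) (simp_all only: real_norm_def abs_abs)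
  then have "convergent_prod ?f"
    by (rule abs_convergent_prod_imp_convergent_prod[OF summable_imp_abs_convergent_prod])
  then have "(\<lambda>n. \<Prod>j\<le>n. ?f j) \<longlonglongrightarrow> C_const q" unfolding C_const_def by (rule convergent_prod_LIMSEQ)
  moreover have "(\<Prod>j\<le>n. ?f j) = 1 / A (Suc n)" for n
    unfolding f A by (simp add: lessThan_Suc_atMost prod_dividef inverse_eq_divide del: power_Suc)
  ultimately have lim: "(\<lambda>n. 1 / A (Suc n)) \<longlonglongrightarrow> C_const q" by simp
  have bnds: "1 / A r \<le> 1 / A (Suc n)" "1 / A (Suc n) \<le> 1 / A r + 32 * x ^ Suc r" if n: "n \<ge> r" for n
  proof -
    have d: "A r - A (Suc n) \<le> 2 * x ^ Suc r" "A (Suc n) \<le> A r"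
      using prod_one_minus_powers_diff[of x r "Suc n" 0] x n by (auto simp: A)
    show "1 / A r \<le> 1 / A (Suc n)" using d A4[of "Suc n"] by (intro divide_left_mono) (auto intro: mult_pos_pos order.strict_trans2[OF _ A4])
    have p: "A r > 0" "A (Suc n) > 0" using A4[of r] A4[of "Suc n"] by auto
    have "1 / A (Suc n) - 1 / A r = (A r - A (Suc n)) / (A (Suc n) * A r)" using p by (simp add: field_simps)
    also have "\<dots> \<le> (2 * x ^ Suc r) / ((1 / 4) * (1 / 4))"
      using d A4 p x by (intro frac_le mult_mono) auto
    finally show "1 / A (Suc n) \<le> 1 / A r + 32 * x ^ Suc r" by simp
  qed
  show "1 / A r \<le> C_const q"
    by (rule LIMSEQ_le_const[OF lim]) (use bnds(1) in auto)
  show "C_const q \<le> 1 / A r + 32 * (1 / real q) ^ Suc r"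
    unfolding x_def[symmetric] by (rule LIMSEQ_le_const2[OF lim]) (use bnds(2) in auto)
qed

lemma C_const_bounds:
  assumes "q \<ge> 2" shows "1 \<le> C_const q" "C_const q \<le> 1 + 32 / real q"
  using C_const_approx[OF assms, of 0] by auto

text \<open>By \<open>mean_eq\<close> this \<mu> is the expected number of null spaces. It falls
  below 1 / A r only through its numerator, which is within 2 x^(c+1) of 1, while C_q lies just
  above 1 / A r.\<close>

lemma mean_approx:
  assumes q: "q \<ge> 2" and rc: "r \<le> c"
  defines "\<mu> \<equiv> (\<Prod>j<r. 1 - (1 / real q) ^ Suc (c + j)) / (\<Prod>j<r. 1 - (1 / real q) ^ Suc j)"
  shows "0 < \<mu>" "\<mu> \<le> 4" "\<bar>\<mu> - C_const q\<bar> \<le> 20 * (1 / real q) ^ r"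
proof -
  define x where "x = 1 / real q"
  have x: "0 < x" "x \<le> 1 / 2" using q by (auto simp: x_def field_simps)
  let ?A = "\<Prod>j<r. 1 - x ^ Suc j" and ?N = "\<Prod>j<r. 1 - x ^ Suc (c + j)"
  have A4: "1 / 4 \<le> ?A" using prod_one_minus_powers_ge[of x r] x by simp
  have N: "1 - ?N \<le> 2 * x ^ Suc c" "?N \<le> 1"
    using prod_one_minus_powers_diff[of x 0 r c] x by auto
  have \<mu>: "\<mu> = ?N / ?A" by (simp add: \<mu>_def x_def)
  have "0 < 1 - x ^ Suc (c + j)" for j
  proof -
    have "x ^ Suc (c + j) \<le> x ^ 1" using x by (intro power_decreasing) auto
    then show ?thesis using x(2) by (simp del: power_Suc)
  qed
  then have "0 < ?N" by (intro prod_pos) auto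
  then show "0 < \<mu>" unfolding \<mu> using A4 by simp
  have "?N / ?A \<le> 1 / (1 / 4)" using N A4 by (intro frac_le) auto
  then show "\<mu> \<le> 4" unfolding \<mu> by simp
  have 1: "?N / ?A \<le> 1 / ?A" using N A4 by (intro divide_right_mono) auto
  have "(1 - ?N) / ?A \<le> (2 * x ^ Suc c) / (1 / 4)" using N A4 x by (intro frac_le) auto
  then have 2: "1 / ?A - ?N / ?A \<le> 8 * x ^ Suc c" by (simp add: diff_divide_distrib)
  have "x ^ Suc c \<le> x ^ Suc r" using x rc by (intro power_decreasing) auto
  moreover have "x ^ Suc r \<le> x ^ r / 2" using mult_right_mono[OF x(2), of "x ^ r"] x by simp
  \<comment> \<open>As x \<le> 1/2 and r \<le> c, the 32 contributes 16 and the 8 contributes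
    4.\<close>
  ultimately have "32 * x ^ Suc r + 8 * x ^ Suc c \<le> 20 * x ^ r" by linarith
  then show "\<bar>\<mu> - C_const q\<bar> \<le> 20 * (1 / real q) ^ r"
    using C_const_approx[OF q, of r] 1 2 unfolding \<mu> x_def[symmetric] by linarith
qed

text \<open>Each value of a distribution function is the probability of an event, so convergence
  holds at every point.\<close>

lemma weak_conv_if_d_TV:
  assumes "(\<lambda>n. d_TV (P n) Q) \<longlonglongrightarrow> 0"
  shows "weak_conv_m (\<lambda>n. distr (measure_pmf (P n)) borel real) (distr (measure_pmf Q) borel (real :: nat \<Rightarrow> real))"
  unfolding weak_conv_m_def weak_conv_def
proof (intro allI impI)
  fix x
  have cdf: "cdf (distr (measure_pmf M) borel (real :: nat \<Rightarrow> real)) x = measure_pmf.prob M {n. real n \<le> x}" for M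
    by (simp add: cdf_def measure_distr vimage_def)
  have "(\<lambda>n. measure_pmf.prob (P n) {n. real n \<le> x}) \<longlonglongrightarrow> measure_pmf.prob Q {n. real n \<le> x}"
  proof (rule LIM_zero_cancel, rule Lim_null_comparison[OF _ assms])
    show "\<forall>\<^sub>F n in sequentially. norm (measure_pmf.prob (P n) {n. real n \<le> x} - measure_pmf.prob Q {n. real n \<le> x}) \<le> d_TV (P n) Q"
      by (simp add: le_d_TV)
  qed
  then show "(\<lambda>n. cdf (distr (measure_pmf (P n)) borel real) x) \<longlonglongrightarrow> cdf (distr (measure_pmf Q) borel real) x"
    unfolding cdf .
qed

section \<open>Size of rho and the choice of constants\<close>

lemma rho_square:
  assumes "r \<ge> 1" "k \<ge> 3" shows "(rho m k r)\<^sup>2 = real m * real r ^ (k - 2)"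
proof -
  have "(real r powr ((real k - 2) / 2))\<^sup>2 = real r powr (real (k - 2))"
    using assms by (simp add: power2_eq_square powr_add[symmetric] of_nat_diff)
  also have "\<dots> = real r ^ (k - 2)" using assms by (intro powr_realpow) auto
  finally show ?thesis by (simp add: rho_def power_mult_distrib)
qed

text \<open>For k \<ge> 3 the exponent k - 2 is positive, so \<open>rho\<close> tends to infinity
  with r, uniformly in m \<ge> 1; for k = 2 it would not grow with r.\<close>

lemma rho_ge:
  assumes "r \<ge> 1" "k \<ge> 3" "m \<ge> 1" shows "sqrt (real r) \<le> rho m k r"
proof -
  have "real r ^ 1 \<le> real r ^ (k - 2)" using assms by (intro power_increasing) auto
  then have "1 * real r \<le> real m * real r ^ (k - 2)" using assms by (intro mult_mono) auto
  then have "(sqrt (real r))\<^sup>2 \<le> (rho m k r)\<^sup>2" using rho_square[OF assms(1,2)] by simp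
  then show ?thesis by (rule power2_le_imp_le) (simp add: rho_def)
qed

text \<open>No Poisson mass exceeds 1: at L with rate L this reads L^L / L! \<le> e^L, and e \<le>
  3.\<close>

lemma fact_inverse_le: "1 / fact L \<le> (3 / real L) ^ L" if "L \<ge> 1"
proof -
  have "pmf (poisson_pmf (real L)) L \<le> 1" by (rule pmf_le_1)
  then have "real L ^ L / fact L * exp (- real L) \<le> 1" using that by simp
  then have "real L ^ L / fact L \<le> exp (real L)" by (simp add: exp_minus field_simps)
  also have "\<dots> = exp 1 ^ L" by (simp add: exp_of_nat_mult[symmetric])
  also have "\<dots> \<le> 3 ^ L" by (intro power_mono exp_le) auto
  finally show ?thesis using that by (simp add: field_simps power_divide)
qed

text \<open>All numerical choices in one place: \<open>kp\<close> equals \<open>kap'\<close> below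
  and L is the order of the moments. The four conclusions serve, in this order,
  \<open>mean_approx\<close>, \<open>moment_error\<close>, the distance to the Bernoulli subset and
  the passage from Bernoulli to Poisson. The constants depend on k alone, which makes the final
  bounds uniform in m and q.\<close>

lemma asymptotic_constants:
  assumes k: "k \<ge> 3"
  defines "kp \<equiv> 1 / 2 ^ (k + 2) / 16 :: real"
  obtains \<alpha> a :: real and r0 :: nat where "0 < a" "0 < \<alpha>" "4 * k + 14 \<le> r0"
    "\<And>r m c q L. r \<ge> r0 \<Longrightarrow> m \<ge> 1 \<Longrightarrow> real m * real (r choose k) = real r * real c \<Longrightarrow> q \<ge> (2::real) \<Longrightarrow>
      L = nat \<lceil>\<alpha> * rho m k r\<rceil> \<Longrightarrow>
      r \<le> c \<and> 2 * real (L * (L + 1) * r) \<le> kp * real c \<and>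
      (\<forall>\<mu>. 0 \<le> \<mu> \<longrightarrow> \<mu> \<le> 4 \<longrightarrow>
        2 ^ L * (real (L + 1) * (real r * (64 * (real L + 1) * (real r + 1)\<^sup>2) ^ L * q powr (- (kp * real c / 2)))
          + 2 * \<mu> ^ L / fact L) \<le> exp (- a * Psi m k r) / 2) \<and>
      4 / q ^ (r * c) \<le> exp (- a * Psi m k r) / 4"
proof -
  \<comment> \<open>With L \<le> 2 \<alpha> rho, the quantity 2 L (L + 1) r is at most 16 \<alpha>^2
    rho^2 r, and c is at least rho^2 r / k^k; this \<alpha> makes the former at most kp c.\<close>
  define \<alpha> where "\<alpha> = sqrt (kp / (16 * real k ^ k))"
  \<comment> \<open>Half of L log L is at least \<alpha> Psi / 4; using only half of this leaves a
    second factor \<open>exp (- a * Psi m k r)\<close> that absorbs constants.\<close>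
  define a where "a = \<alpha> / 8"
  \<comment> \<open>576 is 24^2, which gives 24 / L \<le> 1 / sqrt L below; dividing by \<alpha>^2
    makes (\<alpha> rho)^2 dominate 2 + rho.\<close>
  define X where "X = 576 / \<alpha>\<^sup>2"
  define r0 where "r0 = max (4 * k + 14) (nat \<lceil>X\<^sup>2\<rceil>)"
  have kp: "0 < kp" "kp \<le> 1"
  proof -
    have "(1::real) \<le> 2 ^ (k + 2) * 16" using one_le_power[of "2::real" "k + 2"] by linarith
    then show "kp \<le> 1" unfolding kp_def by (simp add: field_simps)
  qed (simp add: kp_def)
  have kk: "1 \<le> real k ^ k" using k by (intro one_le_power) auto
  have \<alpha>2: "\<alpha>\<^sup>2 = kp / (16 * real k ^ k)" using kp kk by (simp add: \<alpha>_def)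
  have "0 < kp / (16 * real k ^ k)" using kp(1) kk by (intro divide_pos_pos) linarith+
  then have \<alpha>0: "0 < \<alpha>" by (simp add: \<alpha>_def)
  have "kp \<le> 16 * real k ^ k" using kp kk by linarith
  then have \<alpha>21: "\<alpha>\<^sup>2 \<le> 1" unfolding \<alpha>2 by (subst divide_le_eq_1_pos) (use kk in linarith)+
  then have \<alpha>1: "\<alpha> \<le> 1" using power2_le_imp_le[of \<alpha> 1] by simp
  have a0: "0 < a" "a \<le> 1 / 8" using \<alpha>0 \<alpha>1 by (auto simp: a_def)
  have X: "576 \<le> X" unfolding X_def using \<alpha>21 \<alpha>0 by (simp add: field_simps)
  show thesis
  proof (rule that[of a \<alpha> r0])
    show "0 < a" "0 < \<alpha>" "4 * k + 14 \<le> r0" using a0 \<alpha>0 by (auto simp: r0_def)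
    fix r m c L :: nat and q :: real
    assume r: "r0 \<le> r" and m: "1 \<le> m" and res: "real m * real (r choose k) = real r * real c"
      and q: "2 \<le> q" and L: "L = nat \<lceil>\<alpha> * rho m k r\<rceil>"
    have rk: "4 * k + 14 \<le> r" using r by (simp add: r0_def)
    then have r1: "r \<ge> 1" "real r > 0" "real r \<ge> 1" by auto
    have rX: "X\<^sup>2 \<le> real r"
    proof -
      have "X\<^sup>2 \<le> real (nat \<lceil>X\<^sup>2\<rceil>)" by (rule real_nat_ceiling_ge)
      also have "\<dots> \<le> real r"
      proof (rule of_nat_mono)
        show "nat \<lceil>X\<^sup>2\<rceil> \<le> r" using r unfolding r0_def by (rule max.boundedE)
      qed
      finally show ?thesis .
    qed
    define x where "x = rho m k r"
    have x2: "x\<^sup>2 = real m * real r ^ (k - 2)" unfolding x_def by (rule rho_square[OF r1(1) k])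
    have "X \<le> sqrt (real r)" by (rule real_le_rsqrt[OF rX])
    also have "\<dots> \<le> x" unfolding x_def by (rule rho_ge[OF r1(1) k m])
    finally have xX: "X \<le> x" .
    have x576: "576 \<le> x" using xX X by linarith
    have xr: "real r \<le> x\<^sup>2"
    proof -
      have "(sqrt (real r))\<^sup>2 \<le> x\<^sup>2" using rho_ge[OF r1(1) k m] by (intro power_mono) (auto simp: x_def)
      then show ?thesis by simp
    qed
    have xx: "x \<le> x\<^sup>2" using x576 by (simp add: power2_eq_square mult_le_cancel_left1)
    have \<alpha>x: "576 \<le> \<alpha>\<^sup>2 * x"
      using mult_left_mono[OF xX, of "\<alpha>\<^sup>2"] \<alpha>0 by (simp add: X_def)
    have \<alpha>x1: "576 \<le> \<alpha> * x"
    proof -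
      have "\<alpha>\<^sup>2 * x \<le> \<alpha> * x" using \<alpha>0 \<alpha>1 x576 by (intro mult_right_mono) (auto simp: power2_eq_square mult_left_le)
      then show ?thesis using \<alpha>x by linarith
    qed
    have cl: "x\<^sup>2 * real r / real k ^ k \<le> real c"
    proof -
      have "(real r / real k) ^ k \<le> real (r choose k)" using rk k by (intro binomial_ge_n_over_k_pow_k) auto
      then have "real m * (real r / real k) ^ k \<le> real r * real c"
        unfolding res[symmetric] by (intro mult_left_mono) auto
      moreover have "real r ^ k = real r ^ (k - 2) * real r * real r"
      proof -
        have "k = Suc (Suc (k - 2))" using k by simp
        then have "real r ^ k = real r ^ Suc (Suc (k - 2))" by (rule arg_cong)
        then show ?thesis by (simp only: power_Suc ac_simps)
      qed
      ultimately have "real r * (x\<^sup>2 * real r / real k ^ k) \<le> real r * real c"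
        unfolding x2 power_divide by (simp add: algebra_simps)
      then show ?thesis by (rule mult_left_le_imp_le) (rule r1(2))
    qed
    have kpc: "16 * \<alpha>\<^sup>2 * x\<^sup>2 * real r \<le> kp * real c"
    proof -
      have "16 * \<alpha>\<^sup>2 * x\<^sup>2 * real r = kp * (x\<^sup>2 * real r / real k ^ k)" unfolding \<alpha>2 using kk by (simp add: field_simps)
      also have "\<dots> \<le> kp * real c" using cl kp by (intro mult_left_mono) auto
      finally show ?thesis .
    qed
    have \<alpha>r: "10 \<le> \<alpha>\<^sup>2 * real r"
    proof -
      have "X \<le> X\<^sup>2" using X by (simp add: power2_eq_square mult_le_cancel_left1)
      then have "X \<le> real r" using rX by linarith
      then have "\<alpha>\<^sup>2 * X \<le> \<alpha>\<^sup>2 * real r" by (intro mult_left_mono) auto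
      then show ?thesis using \<alpha>0 by (simp add: X_def)
    qed
    \<comment> \<open>A quarter of 160 survives when q^(-kp c / 2) is turned into an exponential;
      exp (-40 x^2) then beats the factor exp (29 x^2) that the remaining terms of the error
      cost.\<close>
    have kpc2: "160 * x\<^sup>2 \<le> kp * real c"
      using mult_right_mono[OF \<alpha>r, of "16 * x\<^sup>2"] kpc by (simp add: algebra_simps)
    have rc: "r \<le> c"
    proof -
      have "real k ^ k \<le> X"
      proof -
        have "real k ^ k * kp \<le> real k ^ k * (576 * 16)" using kp kk by (intro mult_left_mono) auto
        then show ?thesis unfolding X_def \<alpha>2 using kp kk by (simp add: field_simps)
      qed
      then have "real k ^ k \<le> x\<^sup>2" using xX xx by linarith
      then have "1 \<le> x\<^sup>2 / real k ^ k" by (subst le_divide_eq_1_pos) (use kk in linarith)+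
      then have "real r * 1 \<le> real r * (x\<^sup>2 / real k ^ k)" using r1 by (intro mult_left_mono) auto
      then have "real r \<le> real c" using cl by (simp add: mult.commute)
      then show ?thesis by simp
    qed
    have Lb: "\<alpha> * x \<le> real L" "real L \<le> 2 * (\<alpha> * x)" "real L \<le> 2 * x" "1 \<le> L"
    proof -
      show 1: "\<alpha> * x \<le> real L" unfolding L x_def[symmetric] by (rule real_nat_ceiling_ge)
      have "real L \<le> \<alpha> * x + 1" unfolding L x_def[symmetric] using \<alpha>x1 by linarith
      then show 2: "real L \<le> 2 * (\<alpha> * x)" using \<alpha>x1 by linarith
      have "\<alpha> * x \<le> 1 * x" using \<alpha>1 x576 by (intro mult_right_mono) auto
      then show "real L \<le> 2 * x" using 2 by linarith
      have "1 \<le> real L" using 1 \<alpha>x1 by linarith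
      then show "1 \<le> L" by simp
    qed
    have small: "2 * real (L * (L + 1) * r) \<le> kp * real c"
    proof -
      have "2 * real (L * (L + 1) * r) \<le> 4 * (real L)\<^sup>2 * real r"
      proof -
        have "real L + 1 \<le> 2 * real L" using Lb(4) by simp
        then have "2 * (real L * (real L + 1) * real r) \<le> 2 * (real L * (2 * real L) * real r)"
          by (intro mult_left_mono mult_right_mono) auto
        then show ?thesis by (simp add: power2_eq_square algebra_simps)
      qed
      also have "\<dots> \<le> 4 * (2 * (\<alpha> * x))\<^sup>2 * real r"
        using Lb(2) by (intro mult_right_mono mult_left_mono power_mono) auto
      also have "\<dots> = 16 * \<alpha>\<^sup>2 * x\<^sup>2 * real r" by (simp add: power_mult_distrib)
      finally show ?thesis using kpc by linarith
    qed
    define \<Psi> where "\<Psi> = Psi m k r"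
    have \<Psi>: "\<Psi> = x * ln (2 + x)" by (simp add: \<Psi>_def Psi_def x_def)
    have ln1: "1 \<le> ln (2 + x)"
    proof -
      have "exp 1 \<le> 2 + x" using exp_le x576 by linarith
      then show ?thesis using x576 by (simp add: ln_ge_iff)
    qed
    have \<Psi>u: "a * \<Psi> \<le> x\<^sup>2 / 4" "3 \<le> a * \<Psi>"
    proof -
      have "ln (2 + x) \<le> 1 + x" using ln_add_one_self_le_self[of "1 + x"] x576 by (simp add: add.assoc[symmetric])
      then have "x * ln (2 + x) \<le> x * (2 * x)" using x576 by (intro mult_left_mono) auto
      then have "a * \<Psi> \<le> (1 / 8) * (x * (2 * x))" unfolding \<Psi> using a0 x576 ln1 by (intro mult_mono) auto
      then show "a * \<Psi> \<le> x\<^sup>2 / 4" by (simp add: power2_eq_square)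
      have "(\<alpha> * x / 8) * 1 \<le> (\<alpha> * x / 8) * ln (2 + x)" using ln1 \<alpha>x1 by (intro mult_left_mono) auto
      then show "3 \<le> a * \<Psi>" unfolding \<Psi> a_def using \<alpha>x1 by (simp add: algebra_simps)
    qed
    have E8: "exp (- (a * \<Psi>)) \<le> 1 / 8"
    proof -
      have "(2::real) ^ 3 \<le> exp 1 ^ 3" using exp_ge_add_one_self[of 1] by (intro power_mono) auto
      also have "exp 1 ^ 3 = exp (3::real)" by (simp add: exp_of_nat_mult[symmetric])
      also have "\<dots> \<le> exp (a * \<Psi>)" using \<Psi>u by simp
      finally show ?thesis by (simp add: exp_minus field_simps)
    qed
    have E2: "exp (- (2 * (a * \<Psi>))) \<le> exp (- (a * \<Psi>)) / 8"
    proof -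
      have "exp (- (2 * (a * \<Psi>))) = exp (- (a * \<Psi>)) * exp (- (a * \<Psi>))" by (simp add: exp_add[symmetric])
      also have "\<dots> \<le> exp (- (a * \<Psi>)) * (1 / 8)" using E8 by (intro mult_left_mono) auto
      finally show ?thesis by simp
    qed
    \<comment> \<open>As ln q \<ge> ln 2 \<ge> 1/2, powers of q are replaced by exponentials
      independent of q.\<close>
    have qpow: "q powr (- y) \<le> exp (- (y / 2))" if "0 \<le> y" for y
    proof -
      have "1 / 2 \<le> ln (2::real)" using ln2_ge_two_thirds by linarith
      also have "\<dots> \<le> ln q" using q by simp
      finally have "y * (1 / 2) \<le> y * ln q" using that by (intro mult_left_mono) auto
      then show ?thesis using q by (simp add: powr_def)
    qed
    have e1: "2 ^ L * (real (L + 1) * (real r * (64 * (real L + 1) * (real r + 1)\<^sup>2) ^ L * q powr (- (kp * real c / 2)))) \<le> exp (- (a * \<Psi>)) / 8"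
    proof -
      have f1: "(2::real) ^ L \<le> exp (2 * x\<^sup>2)"
      proof -
        have "(2::real) ^ L \<le> exp 1 ^ L" using exp_ge_add_one_self[of 1] by (intro power_mono) auto
        also have "\<dots> = exp (real L)" by (simp add: exp_of_nat_mult[symmetric])
        also have "\<dots> \<le> exp (2 * x\<^sup>2)" using Lb(3) xx by simp
        finally show ?thesis .
      qed
      have f2: "real (L + 1) \<le> exp (2 * x\<^sup>2)"
      proof -
        have "real (L + 1) \<le> exp (real L)" using exp_ge_add_one_self[of "real L"] by (simp add: add.commute)
        also have "\<dots> \<le> exp (2 * x\<^sup>2)" using Lb(3) xx by simp
        finally show ?thesis .
      qed
      have f3: "real r \<le> exp (x\<^sup>2)" using xr exp_ge_add_one_self[of "x\<^sup>2"] by linarith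
      have f4: "(64 * (real L + 1) * (real r + 1)\<^sup>2) ^ L \<le> exp (24 * x\<^sup>2)"
      proof -
        have "real r + 1 \<le> 2 * x\<^sup>2" using xr r1 by linarith
        then have "64 * (real L + 1) * (real r + 1)\<^sup>2 \<le> 64 * (3 * x) * (2 * x\<^sup>2)\<^sup>2"
          using Lb(3) x576 by (intro mult_mono power_mono) auto
        also have "\<dots> = 768 * x ^ 5" by (simp add: power_mult_distrib eval_nat_numeral)
        also have "\<dots> \<le> exp (5 * x) * exp (5 * x)"
        proof (intro mult_mono)
          show "768 \<le> exp (5 * x)" using exp_ge_add_one_self[of "5 * x"] x576 by linarith
          have "x ^ 5 \<le> exp x ^ 5" using exp_ge_add_one_self[of x] x576 by (intro power_mono) linarith+
          then show "x ^ 5 \<le> exp (5 * x)" using exp_of_nat_mult[of 5 x] by simp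
        qed (use x576 in auto)
        also have "\<dots> \<le> exp (12 * x)" using x576 by (simp add: exp_add[symmetric])
        finally have "(64 * (real L + 1) * (real r + 1)\<^sup>2) ^ L \<le> exp (12 * x) ^ L" by (intro power_mono) auto
        also have "\<dots> = exp (real L * (12 * x))" by (simp add: exp_of_nat_mult)
        also have "\<dots> \<le> exp (24 * x\<^sup>2)"
        proof -
          have "real L * (12 * x) \<le> (2 * x) * (12 * x)" using Lb(3) x576 by (intro mult_right_mono) auto
          then show ?thesis by (simp add: power2_eq_square)
        qed
        finally show ?thesis .
      qed
      have f5: "q powr (- (kp * real c / 2)) \<le> exp (- (40 * x\<^sup>2))"
      proof -
        have "q powr (- (kp * real c / 2)) \<le> exp (- (kp * real c / 2 / 2))" using kp by (intro qpow) auto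
        also have "\<dots> \<le> exp (- (40 * x\<^sup>2))" using kpc2 by simp
        finally show ?thesis .
      qed
      have "2 ^ L * (real (L + 1) * (real r * (64 * (real L + 1) * (real r + 1)\<^sup>2) ^ L * q powr (- (kp * real c / 2)))) \<le>
          exp (2 * x\<^sup>2) * (exp (2 * x\<^sup>2) * (exp (x\<^sup>2) * exp (24 * x\<^sup>2) * exp (- (40 * x\<^sup>2))))"
        by (intro mult_mono f1 f2 f3 f4 f5) auto
      also have "\<dots> = exp (- (11 * x\<^sup>2))" by (simp add: exp_add[symmetric])
      also have "\<dots> \<le> exp (- (2 * (a * \<Psi>)))"
      proof -
        have "2 * (a * \<Psi>) \<le> 11 * x\<^sup>2" using \<Psi>u(1) zero_le_power2[of x] by linarith
        then show ?thesis by simp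
      qed
      finally show ?thesis using E2 by linarith
    qed
    \<comment> \<open>(2 \<mu>)^L / L! is at most (24 / L)^L, hence at most L^(-L/2); since L^2
      \<ge> 2 + rho, the exponent reaches 2 a Psi.\<close>
    have e2: "2 ^ L * (2 * \<mu> ^ L / fact L) \<le> exp (- (a * \<Psi>)) / 4" if \<mu>: "0 \<le> \<mu>" "\<mu> \<le> 4" for \<mu> :: real
    proof -
      have L576: "576 \<le> real L" using Lb(1) \<alpha>x1 by linarith
      have "2 ^ L * (2 * \<mu> ^ L / fact L) = 2 * ((2 * \<mu>) ^ L * (1 / fact L))" by (simp add: power_mult_distrib)
      also have "\<dots> \<le> 2 * (8 ^ L * (3 / real L) ^ L)"
        using \<mu> fact_inverse_le[OF Lb(4)] by (intro mult_left_mono mult_mono power_mono) auto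
      also have "\<dots> = 2 * (24 / real L) ^ L" by (simp add: power_mult_distrib[symmetric])
      also have "\<dots> \<le> 2 * exp (- (ln (real L) / 2)) ^ L"
      proof (intro mult_left_mono power_mono)
        have "24 \<le> sqrt (real L)" using L576 real_le_rsqrt[of 24 "real L"] by simp
        then have "24 / real L \<le> sqrt (real L) / real L" using L576 by (intro divide_right_mono) auto
        also have "\<dots> = 1 / sqrt (real L)" using L576 by (simp add: real_div_sqrt field_simps)
        also have "\<dots> = exp (- (ln (real L) / 2))"
        proof -
          have "sqrt (real L) = exp (ln (real L) / 2)" using L576 by (simp add: ln_sqrt[symmetric])
          then show ?thesis by (simp add: exp_minus inverse_eq_divide)
        qed
        finally show "24 / real L \<le> exp (- (ln (real L) / 2))" .
      qed auto
      also have "exp (- (ln (real L) / 2)) ^ L = exp (- (real L * ln (real L) / 2))"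
        by (simp add: exp_of_nat_mult[symmetric])
      also have "2 * exp (- (real L * ln (real L) / 2)) \<le> 2 * exp (- (2 * (a * \<Psi>)))"
      proof -
        have "2 + x \<le> 2 * x" using x576 by linarith
        also have "\<dots> \<le> (\<alpha>\<^sup>2 * x) * x" using \<alpha>x x576 by (intro mult_right_mono) auto
        also have "\<dots> = (\<alpha> * x)\<^sup>2" by (simp add: power2_eq_square)
        also have "\<dots> \<le> (real L)\<^sup>2" using Lb(1) \<alpha>x1 by (intro power_mono) auto
        finally have "ln (2 + x) \<le> ln ((real L)\<^sup>2)" by (subst ln_le_cancel_iff) (use x576 in linarith)+
        then have l: "ln (2 + x) / 2 \<le> ln (real L)" using L576 by (simp add: ln_realpow)
        have "(\<alpha> * x) * (ln (2 + x) / 2) \<le> real L * ln (real L)"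
          using Lb(1) l ln1 \<alpha>x1 by (intro mult_mono) auto
        then show ?thesis unfolding \<Psi> a_def by (simp add: algebra_simps)
      qed
      finally show ?thesis using E2 by linarith
    qed
    have e3: "4 / q ^ (r * c) \<le> exp (- (a * \<Psi>)) / 4"
    proof -
      have "1 / q ^ (r * c) = q powr (- real (r * c))" using q powr_realpow[of q "r * c"] by (simp add: powr_minus inverse_eq_divide)
      also have "\<dots> \<le> exp (- (real (r * c) / 2))" by (intro qpow) auto
      also have "\<dots> \<le> exp (- (3 * (a * \<Psi>)))"
      proof -
        have "kp * real c \<le> real r * real c" using kp r1 by (intro mult_right_mono) auto
        then have "160 * x\<^sup>2 \<le> real (r * c)" using kpc2 by simp
        then have "3 * (a * \<Psi>) \<le> real (r * c) / 2" using \<Psi>u(1) zero_le_power2[of x] by linarith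
        then show ?thesis by simp
      qed
      also have "\<dots> = exp (- (2 * (a * \<Psi>))) * exp (- (a * \<Psi>))" by (simp add: exp_add[symmetric])
      also have "\<dots> \<le> (exp (- (a * \<Psi>)) / 8) * (1 / 8)" using E2 E8 by (intro mult_mono) auto
      finally have "1 / q ^ (r * c) \<le> exp (- (a * \<Psi>)) / 8 * (1 / 8)" .
      moreover have "4 / q ^ (r * c) = 4 * (1 / q ^ (r * c))" by simp
      ultimately show ?thesis using exp_gt_zero[of "- (a * \<Psi>)"] by linarith
    qed
    have ep: "exp (- a * Psi m k r) = exp (- (a * \<Psi>))" by (simp add: \<Psi>_def)
    have "2 ^ L * (real (L + 1) * (real r * (64 * (real L + 1) * (real r + 1)\<^sup>2) ^ L * q powr (- (kp * real c / 2)))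
          + 2 * \<mu> ^ L / fact L) \<le> exp (- (a * \<Psi>)) / 2" if "0 \<le> \<mu>" "\<mu> \<le> 4" for \<mu> :: real
    proof -
      have pos: "0 \<le> exp (- (a * \<Psi>))" by simp
      show ?thesis using e1 e2[OF that] pos unfolding distrib_left[of "2 ^ L"] by linarith
    qed
    then show "r \<le> c \<and> 2 * real (L * (L + 1) * r) \<le> kp * real c \<and>
      (\<forall>\<mu>. 0 \<le> \<mu> \<longrightarrow> \<mu> \<le> 4 \<longrightarrow>
        2 ^ L * (real (L + 1) * (real r * (64 * (real L + 1) * (real r + 1)\<^sup>2) ^ L * q powr (- (kp * real c / 2)))
          + 2 * \<mu> ^ L / fact L) \<le> exp (- a * Psi m k r) / 2) \<and>
      4 / q ^ (r * c) \<le> exp (- a * Psi m k r) / 4"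
      unfolding ep using rc small e3 by blast
  qed
qed

section \<open>Subspaces of a finite vector space\<close>

locale finite_vectorspace = vectorspace K V
  for K :: "('a, 'b) ring_scheme" and V :: "('a, 'c, 'd) module_scheme" +
  assumes finite_K: "finite (carrier K)" and finite_V: "finite (carrier V)"
begin

text \<open>Elementwise form of \<open>subspace\<close>, better suited to intersections and sums;
  the two agree by \<open>subspace_iff_sub\<close>.\<close>

definition sub :: "'c set \<Rightarrow> bool" where
  "sub H \<longleftrightarrow> H \<subseteq> carrier V \<and> \<zero>\<^bsub>V\<^esub> \<in> H \<and> (\<forall>x\<in>H. \<forall>y\<in>H. x \<oplus>\<^bsub>V\<^esub> y \<in> H) \<and>
     (\<forall>a\<in>carrier K. \<forall>x\<in>H. a \<odot>\<^bsub>V\<^esub> x \<in> H)"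

definition ssum :: "'c set \<Rightarrow> 'c set \<Rightarrow> 'c set" where
  "ssum A B = (\<lambda>(x, y). x \<oplus>\<^bsub>V\<^esub> y) ` (A \<times> B)"

definition line :: "'c \<Rightarrow> 'c set" where
  "line x = (\<lambda>a. a \<odot>\<^bsub>V\<^esub> x) ` carrier K"

text \<open>Dimension read off the cardinality, so that dimension formulas reduce to counting.
  \<open>card_sub_power\<close> shows that the exponent exists, \<open>dim_eq_sdim\<close> that it
  is the usual dimension.\<close>

definition sdim :: "'c set \<Rightarrow> nat" where
  "sdim H = (THE d. card H = card (carrier K) ^ d)"

lemma sub_carrier: "sub H \<Longrightarrow> x \<in> H \<Longrightarrow> x \<in> carrier V"
  and sub_subset: "sub H \<Longrightarrow> H \<subseteq> carrier V"
  and sub_zero: "sub H \<Longrightarrow> \<zero>\<^bsub>V\<^esub> \<in> H"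
  and sub_add: "sub H \<Longrightarrow> x \<in> H \<Longrightarrow> y \<in> H \<Longrightarrow> x \<oplus>\<^bsub>V\<^esub> y \<in> H"
  and sub_smult: "sub H \<Longrightarrow> a \<in> carrier K \<Longrightarrow> x \<in> H \<Longrightarrow> a \<odot>\<^bsub>V\<^esub> x \<in> H"
  by (auto simp: sub_def)

lemma sub_neg: "sub H \<Longrightarrow> x \<in> H \<Longrightarrow> \<ominus>\<^bsub>V\<^esub> x \<in> H"
  using sub_smult[of H "\<ominus>\<^bsub>K\<^esub> \<one>\<^bsub>K\<^esub>" x] sub_carrier[of H x] by (simp add: smult_l_minus)

lemma sub_minus: "sub H \<Longrightarrow> x \<in> H \<Longrightarrow> y \<in> H \<Longrightarrow> x \<ominus>\<^bsub>V\<^esub> y \<in> H"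
  using sub_add sub_neg by (simp add: a_minus_def)

lemma finite_sub: "sub H \<Longrightarrow> finite H"
  using finite_V finite_subset sub_subset by blast

lemma sub_Int: "sub A \<Longrightarrow> sub B \<Longrightarrow> sub (A \<inter> B)"
  by (auto simp: sub_def)

lemma sub_carrier_V: "sub (carrier V)"
  by (auto simp: sub_def)

lemma sub_triv: "sub {\<zero>\<^bsub>V\<^esub>}"
  by (auto simp: sub_def)

lemma ssumI: "x \<in> A \<Longrightarrow> y \<in> B \<Longrightarrow> x \<oplus>\<^bsub>V\<^esub> y \<in> ssum A B"
  by (force simp: ssum_def)

lemma ssumE:
  assumes "z \<in> ssum A B" obtains x y where "x \<in> A" "y \<in> B" "z = x \<oplus>\<^bsub>V\<^esub> y"
  using assms by (auto simp: ssum_def)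

lemma sub_ssum:
  assumes A: "sub A" and B: "sub B" shows "sub (ssum A B)"
  unfolding sub_def
proof (intro conjI ballI subsetI)
  fix z assume "z \<in> ssum A B"
  then show "z \<in> carrier V" using A B by (auto elim!: ssumE dest: sub_carrier)
next
  show "\<zero>\<^bsub>V\<^esub> \<in> ssum A B" using ssumI[OF sub_zero[OF A] sub_zero[OF B]] by simp
next
  fix x y assume "x \<in> ssum A B" "y \<in> ssum A B"
  then obtain a b a' b' where *: "a \<in> A" "b \<in> B" "x = a \<oplus>\<^bsub>V\<^esub> b" "a' \<in> A" "b' \<in> B" "y = a' \<oplus>\<^bsub>V\<^esub> b'"
    by (auto elim!: ssumE)
  then have "a \<in> carrier V" "b \<in> carrier V" "a' \<in> carrier V" "b' \<in> carrier V"
    using A B sub_carrier by auto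
  then have "x \<oplus>\<^bsub>V\<^esub> y = (a \<oplus>\<^bsub>V\<^esub> a') \<oplus>\<^bsub>V\<^esub> (b \<oplus>\<^bsub>V\<^esub> b')"
    using * by (simp add: a_ac)
  then show "x \<oplus>\<^bsub>V\<^esub> y \<in> ssum A B" using * A B by (auto intro!: ssumI sub_add)
next
  fix c x assume c: "c \<in> carrier K" and "x \<in> ssum A B"
  then obtain a b where *: "a \<in> A" "b \<in> B" "x = a \<oplus>\<^bsub>V\<^esub> b" by (auto elim!: ssumE)
  then have "c \<odot>\<^bsub>V\<^esub> x = c \<odot>\<^bsub>V\<^esub> a \<oplus>\<^bsub>V\<^esub> c \<odot>\<^bsub>V\<^esub> b"
    using A B c sub_carrier by (simp add: smult_r_distr)
  then show "c \<odot>\<^bsub>V\<^esub> x \<in> ssum A B" using * A B c by (auto intro!: ssumI sub_smult)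
qed

lemma ssum_upper1: "sub A \<Longrightarrow> sub B \<Longrightarrow> A \<subseteq> ssum A B"
  using ssumI[OF _ sub_zero] sub_carrier by (metis M.r_zero subsetI)

lemma ssum_upper2: "sub A \<Longrightarrow> sub B \<Longrightarrow> B \<subseteq> ssum A B"
  using ssumI[OF sub_zero] sub_carrier by (metis M.l_zero subsetI)

lemma ssum_least: "sub C \<Longrightarrow> A \<subseteq> C \<Longrightarrow> B \<subseteq> C \<Longrightarrow> ssum A B \<subseteq> C"
  by (auto elim!: ssumE intro: sub_add)

lemma ssum_mono: "A \<subseteq> A' \<Longrightarrow> B \<subseteq> B' \<Longrightarrow> ssum A B \<subseteq> ssum A' B'"
  by (auto simp: ssum_def)

lemma ssum_commute: "sub A \<Longrightarrow> sub B \<Longrightarrow> ssum A B = ssum B A"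
  by (intro equalityI ssum_least sub_ssum ssum_upper1 ssum_upper2)

lemma ssum_assoc:
  assumes "sub A" "sub B" "sub C" shows "ssum (ssum A B) C = ssum A (ssum B C)"
proof (rule equalityI)
  note [intro] = sub_ssum
  show "ssum (ssum A B) C \<subseteq> ssum A (ssum B C)"
    using assms ssum_upper1[of B C] ssum_upper2[of B C] ssum_upper2[of A "ssum B C"]
    by (intro ssum_least ssum_upper1) auto
  show "ssum A (ssum B C) \<subseteq> ssum (ssum A B) C"
    using assms ssum_upper1[of A B] ssum_upper2[of A B] ssum_upper1[of "ssum A B" C]
    by (intro ssum_least ssum_upper2) auto
qed

lemma ssum_absorb: "sub A \<Longrightarrow> sub B \<Longrightarrow> B \<subseteq> A \<Longrightarrow> ssum A B = A"
  by (intro equalityI ssum_least ssum_upper1) auto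

lemma ssum_triv_left: "sub A \<Longrightarrow> ssum {\<zero>\<^bsub>V\<^esub>} A = A"
  using ssum_absorb[of A "{\<zero>\<^bsub>V\<^esub>}"] ssum_commute[of A "{\<zero>\<^bsub>V\<^esub>}"] sub_triv sub_zero by auto

lemma sub_line: "x \<in> carrier V \<Longrightarrow> sub (line x)"
  unfolding sub_def line_def
proof (intro conjI ballI)
  assume x: "x \<in> carrier V"
  show "(\<lambda>a. a \<odot>\<^bsub>V\<^esub> x) ` carrier K \<subseteq> carrier V" using x by auto
  have "\<zero>\<^bsub>V\<^esub> = \<zero>\<^bsub>K\<^esub> \<odot>\<^bsub>V\<^esub> x" using x by simp
  then show "\<zero>\<^bsub>V\<^esub> \<in> (\<lambda>a. a \<odot>\<^bsub>V\<^esub> x) ` carrier K" by blast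
  show "y \<oplus>\<^bsub>V\<^esub> z \<in> (\<lambda>a. a \<odot>\<^bsub>V\<^esub> x) ` carrier K"
    if "y \<in> (\<lambda>a. a \<odot>\<^bsub>V\<^esub> x) ` carrier K" "z \<in> (\<lambda>a. a \<odot>\<^bsub>V\<^esub> x) ` carrier K" for y z
    using that x by (auto simp: smult_l_distr[symmetric])
  show "a \<odot>\<^bsub>V\<^esub> y \<in> (\<lambda>a. a \<odot>\<^bsub>V\<^esub> x) ` carrier K"
    if "a \<in> carrier K" "y \<in> (\<lambda>a. a \<odot>\<^bsub>V\<^esub> x) ` carrier K" for a y
    using that x by (auto simp: smult_assoc1[symmetric])
qed

lemma line_self: "x \<in> carrier V \<Longrightarrow> x \<in> line x"
  unfolding line_def by (rule image_eqI[of _ _ "\<one>\<^bsub>K\<^esub>"]) auto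

lemma line_least: "sub U \<Longrightarrow> x \<in> U \<Longrightarrow> line x \<subseteq> U"
  by (auto simp: line_def intro: sub_smult)

lemma smult_mem_iff:
  assumes U: "sub U" and x: "x \<in> carrier V" and a: "a \<in> carrier K" "a \<noteq> \<zero>\<^bsub>K\<^esub>"
  shows "a \<odot>\<^bsub>V\<^esub> x \<in> U \<longleftrightarrow> x \<in> U"
proof
  assume "a \<odot>\<^bsub>V\<^esub> x \<in> U"
  then have "inv\<^bsub>K\<^esub> a \<odot>\<^bsub>V\<^esub> (a \<odot>\<^bsub>V\<^esub> x) \<in> U" using a U by (auto intro!: sub_smult[of U "inv\<^bsub>K\<^esub> a"] simp: field_Units)
  moreover have "inv\<^bsub>K\<^esub> a \<odot>\<^bsub>V\<^esub> (a \<odot>\<^bsub>V\<^esub> x) = x"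
    using a x by (subst smult_assoc1[symmetric]) (auto simp: field_Units)
  ultimately show "x \<in> U" by simp
qed (use U a in \<open>auto intro: sub_smult\<close>)

lemma card_line: "x \<in> carrier V \<Longrightarrow> x \<noteq> \<zero>\<^bsub>V\<^esub> \<Longrightarrow> card (line x) = card (carrier K)"
  unfolding line_def
proof (rule card_image, rule inj_onI)
  fix a b assume x: "x \<in> carrier V" "x \<noteq> \<zero>\<^bsub>V\<^esub>" and ab: "a \<in> carrier K" "b \<in> carrier K"
    and eq: "a \<odot>\<^bsub>V\<^esub> x = b \<odot>\<^bsub>V\<^esub> x"
  have "(a \<ominus>\<^bsub>K\<^esub> b) \<odot>\<^bsub>V\<^esub> x = \<zero>\<^bsub>V\<^esub>"
    using x ab eq by (simp add: R.minus_eq smult_l_distr smult_l_minus M.r_neg)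
  then have "a \<ominus>\<^bsub>K\<^esub> b = \<zero>\<^bsub>K\<^esub>"
    using smult_mem_iff[OF sub_triv x(1), of "a \<ominus>\<^bsub>K\<^esub> b"] x ab by auto
  then show "a = b" using ab by (simp add: R.minus_eq R.r_neg R.add.inv_solve_right')
qed

text \<open>Each fibre of addition on the product of A and B is a translate of A \<inter> B: the
  pairs with sum a + b are (a + t, b - t).\<close>

lemma card_ssum:
  assumes A: "sub A" and B: "sub B"
  shows "card (ssum A B) * card (A \<inter> B) = card A * card B"
proof -
  have fib: "card {p \<in> A \<times> B. (case p of (x, y) \<Rightarrow> x \<oplus>\<^bsub>V\<^esub> y) = z} = card (A \<inter> B)"
    if z: "z \<in> ssum A B" for z
  proof -
    obtain a b where ab: "a \<in> A" "b \<in> B" "z = a \<oplus>\<^bsub>V\<^esub> b" using z by (auto elim: ssumE)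
    have c: "a \<in> carrier V" "b \<in> carrier V" using ab A B sub_carrier by auto
    have "bij_betw (\<lambda>t. (a \<oplus>\<^bsub>V\<^esub> t, b \<ominus>\<^bsub>V\<^esub> t)) (A \<inter> B) {p \<in> A \<times> B. (case p of (x, y) \<Rightarrow> x \<oplus>\<^bsub>V\<^esub> y) = z}"
    proof (rule bij_betwI')
      fix t t' assume t: "t \<in> A \<inter> B" "t' \<in> A \<inter> B"
      then show "((a \<oplus>\<^bsub>V\<^esub> t, b \<ominus>\<^bsub>V\<^esub> t) = (a \<oplus>\<^bsub>V\<^esub> t', b \<ominus>\<^bsub>V\<^esub> t')) = (t = t')"
        using c A sub_carrier by auto
    next
      fix t assume t: "t \<in> A \<inter> B"
      then have tc: "t \<in> carrier V" using A sub_carrier by auto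
      have "(a \<oplus>\<^bsub>V\<^esub> t) \<oplus>\<^bsub>V\<^esub> (b \<oplus>\<^bsub>V\<^esub> \<ominus>\<^bsub>V\<^esub> t) = a \<oplus>\<^bsub>V\<^esub> (b \<oplus>\<^bsub>V\<^esub> (t \<oplus>\<^bsub>V\<^esub> \<ominus>\<^bsub>V\<^esub> t))"
        using c tc by (simp add: a_ac del: M.r_neg)
      then have "(a \<oplus>\<^bsub>V\<^esub> t) \<oplus>\<^bsub>V\<^esub> (b \<ominus>\<^bsub>V\<^esub> t) = z" using c tc ab by (simp add: M.r_neg a_minus_def)
      then show "(a \<oplus>\<^bsub>V\<^esub> t, b \<ominus>\<^bsub>V\<^esub> t) \<in> {p \<in> A \<times> B. (case p of (x, y) \<Rightarrow> x \<oplus>\<^bsub>V\<^esub> y) = z}"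
        using t ab A B sub_add sub_minus by auto
    next
      fix p assume "p \<in> {p \<in> A \<times> B. (case p of (x, y) \<Rightarrow> x \<oplus>\<^bsub>V\<^esub> y) = z}"
      then obtain x y where p: "p = (x, y)" "x \<in> A" "y \<in> B" "x \<oplus>\<^bsub>V\<^esub> y = z" by auto
      have pc: "x \<in> carrier V" "y \<in> carrier V" using p A B sub_carrier by auto
      have "x \<ominus>\<^bsub>V\<^esub> a = (x \<oplus>\<^bsub>V\<^esub> y) \<ominus>\<^bsub>V\<^esub> a \<ominus>\<^bsub>V\<^esub> y"
      proof -
        have "(x \<oplus>\<^bsub>V\<^esub> y) \<oplus>\<^bsub>V\<^esub> \<ominus>\<^bsub>V\<^esub> a \<oplus>\<^bsub>V\<^esub> \<ominus>\<^bsub>V\<^esub> y = x \<oplus>\<^bsub>V\<^esub> \<ominus>\<^bsub>V\<^esub> a \<oplus>\<^bsub>V\<^esub> (y \<oplus>\<^bsub>V\<^esub> \<ominus>\<^bsub>V\<^esub> y)"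
          using c pc by (simp add: a_ac del: M.r_neg)
        then show ?thesis using c pc by (simp add: M.r_neg a_minus_def)
      qed
      also have "\<dots> = (a \<oplus>\<^bsub>V\<^esub> b) \<ominus>\<^bsub>V\<^esub> a \<ominus>\<^bsub>V\<^esub> y" using p ab by simp
      also have "\<dots> = b \<ominus>\<^bsub>V\<^esub> y"
      proof -
        have "(a \<oplus>\<^bsub>V\<^esub> b) \<oplus>\<^bsub>V\<^esub> \<ominus>\<^bsub>V\<^esub> a \<oplus>\<^bsub>V\<^esub> \<ominus>\<^bsub>V\<^esub> y = b \<oplus>\<^bsub>V\<^esub> \<ominus>\<^bsub>V\<^esub> y \<oplus>\<^bsub>V\<^esub> (a \<oplus>\<^bsub>V\<^esub> \<ominus>\<^bsub>V\<^esub> a)"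
          using c pc by (simp add: a_ac del: M.r_neg)
        then show ?thesis using c pc by (simp add: M.r_neg a_minus_def)
      qed
      finally have eq: "x \<ominus>\<^bsub>V\<^esub> a = b \<ominus>\<^bsub>V\<^esub> y" .
      have "x \<ominus>\<^bsub>V\<^esub> a \<in> A \<inter> B" using eq p ab A B sub_minus by (metis IntI)
      moreover have "a \<oplus>\<^bsub>V\<^esub> (x \<ominus>\<^bsub>V\<^esub> a) = x"
      proof -
        have "a \<oplus>\<^bsub>V\<^esub> (x \<oplus>\<^bsub>V\<^esub> \<ominus>\<^bsub>V\<^esub> a) = x \<oplus>\<^bsub>V\<^esub> (a \<oplus>\<^bsub>V\<^esub> \<ominus>\<^bsub>V\<^esub> a)"
          using c pc by (simp add: a_ac del: M.r_neg)
        then show ?thesis using c pc by (simp add: M.r_neg a_minus_def)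
      qed
      moreover have "b \<ominus>\<^bsub>V\<^esub> (x \<ominus>\<^bsub>V\<^esub> a) = y"
      proof -
        have "b \<oplus>\<^bsub>V\<^esub> \<ominus>\<^bsub>V\<^esub> (b \<oplus>\<^bsub>V\<^esub> \<ominus>\<^bsub>V\<^esub> y) = (b \<oplus>\<^bsub>V\<^esub> \<ominus>\<^bsub>V\<^esub> b) \<oplus>\<^bsub>V\<^esub> y"
          using c pc by (simp add: a_ac M.minus_add del: M.r_neg)
        then show ?thesis unfolding eq using c pc by (simp add: M.r_neg a_minus_def)
      qed
      ultimately show "\<exists>t\<in>A \<inter> B. p = (a \<oplus>\<^bsub>V\<^esub> t, b \<ominus>\<^bsub>V\<^esub> t)" using p by metis
    qed
    then show ?thesis using bij_betw_same_card by force
  qed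
  have "card (A \<times> B) = (\<Sum>z\<in>ssum A B. card {p \<in> A \<times> B. (case p of (x, y) \<Rightarrow> x \<oplus>\<^bsub>V\<^esub> y) = z})"
    unfolding ssum_def card_eq_sum using A B finite_sub
    by (subst sum.image_gen[where g = "\<lambda>(x, y). x \<oplus>\<^bsub>V\<^esub> y"]) auto
  then show ?thesis using fib by (simp add: card_cartesian_product)
qed

lemma q_ge2: "card (carrier K) \<ge> 2"
proof -
  have "card {\<zero>\<^bsub>K\<^esub>, \<one>\<^bsub>K\<^esub>} \<le> card (carrier K)" by (rule card_mono[OF finite_K]) auto
  then show ?thesis using zero_not_one by auto
qed

lemma line_Int:
  assumes U: "sub U" and x: "x \<in> carrier V" "x \<notin> U"
  shows "U \<inter> line x = {\<zero>\<^bsub>V\<^esub>}"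
proof -
  have "y = \<zero>\<^bsub>V\<^esub>" if y: "y \<in> U" "y \<in> line x" for y
  proof -
    obtain a where a: "a \<in> carrier K" "y = a \<odot>\<^bsub>V\<^esub> x" using y by (auto simp: line_def)
    then have "a = \<zero>\<^bsub>K\<^esub>" using smult_mem_iff[OF U x(1) a(1)] x y by blast
    then show ?thesis using a x by simp
  qed
  then show ?thesis using sub_zero[OF U] sub_zero[OF sub_line[OF x(1)]] by blast
qed

lemma card_extend:
  assumes U: "sub U" and x: "x \<in> carrier V" "x \<notin> U"
  shows "card (ssum U (line x)) = card (carrier K) * card U"
proof -
  have "x \<noteq> \<zero>\<^bsub>V\<^esub>" using x sub_zero[OF U] by auto
  then show ?thesis
    using card_ssum[OF U sub_line[OF x(1)]] line_Int[OF U x] card_line[OF x(1)] by simp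
qed

text \<open>Among the subspaces of H whose cardinality is a power of q take a maximal one; adjoining
  a vector outside it would multiply the cardinality by q.\<close>

lemma card_sub_power:
  assumes H: "sub H" shows "\<exists>d. card H = card (carrier K) ^ d"
proof -
  define P where "P = {U. sub U \<and> U \<subseteq> H \<and> (\<exists>d. card U = card (carrier K) ^ d)}"
  have "finite P" unfolding P_def by (rule finite_subset[of _ "Pow H"]) (auto simp: finite_sub H)
  moreover have "{\<zero>\<^bsub>V\<^esub>} \<in> P" unfolding P_def using sub_triv sub_zero[OF H] by (auto intro!: exI[of _ 0])
  ultimately obtain U where U: "U \<in> P" "\<And>U'. U' \<in> P \<Longrightarrow> U \<subseteq> U' \<Longrightarrow> U' = U"
    by (metis empty_iff finite_has_maximal)
  have "U = H"
  proof (rule ccontr)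
    assume "U \<noteq> H"
    then obtain x where x: "x \<in> H" "x \<notin> U" using U(1) P_def by auto
    have sU: "sub U" "U \<subseteq> H" using U(1) P_def by auto
    have xc: "x \<in> carrier V" using x H sub_carrier by auto
    have "ssum U (line x) \<in> P" unfolding P_def
      using U(1) sub_ssum[OF sU(1) sub_line[OF xc]] ssum_least[OF H sU(2) line_least[OF H x(1)]]
        card_extend[OF sU(1) xc x(2)] by (auto simp: P_def power_Suc[symmetric] simp del: power_Suc)
    then have "ssum U (line x) = U" using U(2) ssum_upper1[OF sU(1) sub_line[OF xc]] by blast
    then show False using x ssum_upper2[OF sU(1) sub_line[OF xc]] line_self[OF xc] by blast
  qed
  then show ?thesis using U(1) P_def by auto
qed

lemma sdim_eqI: "card H = card (carrier K) ^ d \<Longrightarrow> sdim H = d"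
  unfolding sdim_def using q_ge2 by (auto intro!: the_equality)

lemma card_sub: "sub H \<Longrightarrow> card H = card (carrier K) ^ sdim H"
  using card_sub_power[of H] sdim_eqI[of H] by auto

lemma sdim_triv: "sdim {\<zero>\<^bsub>V\<^esub>} = 0"
  by (rule sdim_eqI) simp

lemma sdim_ssum:
  assumes "sub A" "sub B" shows "sdim (ssum A B) + sdim (A \<inter> B) = sdim A + sdim B"
proof -
  have "card (carrier K) ^ (sdim (ssum A B) + sdim (A \<inter> B)) = card (carrier K) ^ (sdim A + sdim B)"
    using card_ssum[OF assms] card_sub assms by (simp add: power_add sub_ssum sub_Int)
  then show ?thesis using q_ge2 by (subst (asm) power_inject_exp) auto
qed

lemma sdim_mono:
  assumes "sub A" "sub B" "A \<subseteq> B" shows "sdim A \<le> sdim B"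
proof -
  have "card (carrier K) ^ sdim A \<le> card (carrier K) ^ sdim B"
    using card_mono[OF finite_sub[OF assms(2)] assms(3)] by (simp add: card_sub assms)
  then show ?thesis using q_ge2 by (simp add: power_increasing_iff)
qed

lemma sdim_eq_imp_eq:
  assumes "sub A" "sub B" "A \<subseteq> B" "sdim B \<le> sdim A" shows "A = B"
proof -
  have "sdim A = sdim B" using sdim_mono[OF assms(1-3)] assms(4) by simp
  then have "card A = card B" by (simp add: card_sub assms)
  then show ?thesis using card_subset_eq[OF finite_sub[OF assms(2)] assms(3)] by simp
qed

lemma sdim_extend:
  "sub U \<Longrightarrow> x \<in> carrier V \<Longrightarrow> x \<notin> U \<Longrightarrow> sdim (ssum U (line x)) = Suc (sdim U)"
  by (rule sdim_eqI) (simp add: card_extend card_sub)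

text \<open>The quotient of \<open>B \<inter> ssum U (line x)\<close> by \<open>B \<inter> U\<close>
  embeds into that of \<open>ssum U (line x)\<close> by U, which is a line.\<close>

lemma sdim_Int_extend_le:
  assumes "sub U" "sub B" "x \<in> carrier V" "x \<notin> U"
  shows "sdim (B \<inter> ssum U (line x)) \<le> Suc (sdim (B \<inter> U))"
proof -
  let ?U = "ssum U (line x)"
  have s: "sub ?U" by (rule sub_ssum[OF assms(1) sub_line[OF assms(3)]])
  have "sdim (ssum (B \<inter> ?U) U) + sdim (B \<inter> ?U \<inter> U) = sdim (B \<inter> ?U) + sdim U"
    by (rule sdim_ssum[OF sub_Int[OF assms(2) s] assms(1)])
  moreover have "B \<inter> ?U \<inter> U = B \<inter> U" using ssum_upper1[OF assms(1) sub_line[OF assms(3)]] by auto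
  moreover have "sdim (ssum (B \<inter> ?U) U) \<le> sdim ?U"
    using ssum_upper1[OF assms(1) sub_line[OF assms(3)]]
    by (intro sdim_mono sub_ssum[OF sub_Int[OF assms(2) s] assms(1)] s ssum_least) auto
  ultimately show ?thesis using sdim_extend[OF assms(1,3,4)] by simp
qed

lemma sdim_Int_extend_active:
  assumes "sub U" "sub B" "x \<in> carrier V" "x \<notin> U" "\<not> B \<inter> ssum U (line x) \<subseteq> U"
  shows "sdim (B \<inter> ssum U (line x)) = Suc (sdim (B \<inter> U))"
proof -
  let ?U = "ssum U (line x)"
  have s: "sub ?U" by (rule sub_ssum[OF assms(1) sub_line[OF assms(3)]])
  have sub: "U \<subseteq> ?U" using ssum_upper1[OF assms(1) sub_line[OF assms(3)]] .
  have "sdim (B \<inter> U) \<le> sdim (B \<inter> ?U)" 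
    using sub by (intro sdim_mono sub_Int assms s) auto
  moreover have "sdim (B \<inter> U) \<noteq> sdim (B \<inter> ?U)"
  proof
    assume "sdim (B \<inter> U) = sdim (B \<inter> ?U)"
    moreover have "B \<inter> U \<subseteq> B \<inter> ?U" using sub by auto
    ultimately have "B \<inter> U = B \<inter> ?U"
      by (intro sdim_eq_imp_eq sub_Int assms s) auto
    then show False using assms(5) by auto
  qed
  ultimately show ?thesis using sdim_Int_extend_le[OF assms(1-4)] by linarith
qed

lemma extend_mem_iff:
  assumes "sub U" "x \<in> carrier V"
  shows "z \<in> ssum U (line x) \<longleftrightarrow> (\<exists>u\<in>U. \<exists>a\<in>carrier K. z = u \<oplus>\<^bsub>V\<^esub> a \<odot>\<^bsub>V\<^esub> x)"
  by (auto simp: ssum_def line_def)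

lemma submodule_iff_sub: "submodule K H V \<longleftrightarrow> sub H"
  unfolding submodule_def sub_def using module_axioms by (auto simp: is_module)

lemma subspace_iff_sub: "subspace K H V \<longleftrightarrow> sub H"
  unfolding subspace_def submodule_iff_sub using vectorspace_axioms by auto

end

context finite_vectorspace
begin

text \<open>Counting the linear combinations of a basis gives q to the number of basis
  vectors.\<close>

lemma dim_eq_sdim:
  assumes H: "sub H" shows "vectorspace.dim K (V\<lparr>carrier := H\<rparr>) = sdim H"
proof -
  interpret H: vectorspace K "vs H"
    using subspace_is_vs H by (simp add: subspace_iff_sub)
  have "H.gen_set H"
    using H.in_own_span[of H] H.span_is_subset2[of H] by auto
  then have "H.fin_dim" unfolding H.fin_dim_def using finite_sub[OF H] by auto
  then obtain \<beta> where \<beta>: "finite \<beta>" "H.basis \<beta>" using H.finite_basis_exists by blast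
  then have \<beta>H: "\<beta> \<subseteq> H" by (simp add: H.basis_def)
  have uni: "\<forall>v. v \<in> H \<longrightarrow> (\<exists>!a. a \<in> \<beta> \<rightarrow>\<^sub>E carrier K \<and> H.lincomb a \<beta> = v)"
    using H.basis_criterion[OF \<beta>(1)] \<beta>(2) \<beta>H by auto
  have "bij_betw (\<lambda>a. H.lincomb a \<beta>) (\<beta> \<rightarrow>\<^sub>E carrier K) H"
    unfolding bij_betw_def
  proof
    have cl: "H.lincomb a \<beta> \<in> H" if "a \<in> \<beta> \<rightarrow>\<^sub>E carrier K" for a
      using H.lincomb_closed[of \<beta> a] that \<beta>H by auto
    show "inj_on (\<lambda>a. H.lincomb a \<beta>) (\<beta> \<rightarrow>\<^sub>E carrier K)"
      using uni cl by (intro inj_onI) metis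
    show "(\<lambda>a. H.lincomb a \<beta>) ` (\<beta> \<rightarrow>\<^sub>E carrier K) = H"
      using uni cl by blast
  qed
  then have "card H = card (\<beta> \<rightarrow>\<^sub>E carrier K)" using bij_betw_same_card by metis
  also have "\<dots> = card (carrier K) ^ card \<beta>" using \<beta>(1) by (simp add: card_PiE)
  finally have "sdim H = card \<beta>" by (rule sdim_eqI)
  then show ?thesis using H.dim_basis[OF \<beta>] by simp
qed

lemma Gr_iff: "H \<in> Gr K r V \<longleftrightarrow> sub H \<and> sdim H = r"
  unfolding Gr_def using dim_eq_sdim by (auto simp: subspace_iff_sub)

section \<open>Counting the subspaces between two given ones\<close>

primrec adjoin :: "'c set \<Rightarrow> 'c list \<Rightarrow> 'c set" where
  "adjoin A [] = A"
| "adjoin A (x # xs) = adjoin (ssum A (line x)) xs"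

primrec indep_over :: "'c set \<Rightarrow> 'c list \<Rightarrow> bool" where
  "indep_over A [] \<longleftrightarrow> True"
| "indep_over A (x # xs) \<longleftrightarrow> x \<notin> A \<and> indep_over (ssum A (line x)) xs"

definition between :: "'c set \<Rightarrow> 'c set \<Rightarrow> nat \<Rightarrow> 'c set set" where
  "between A U b = {H. sub H \<and> A \<subseteq> H \<and> H \<subseteq> U \<and> sdim H = sdim A + b}"

definition frames :: "'c set \<Rightarrow> 'c set \<Rightarrow> nat \<Rightarrow> 'c list set" where
  "frames A U b = {xs. set xs \<subseteq> U \<and> length xs = b \<and> indep_over A xs}"

lemma sub_adjoin: "sub A \<Longrightarrow> set xs \<subseteq> carrier V \<Longrightarrow> sub (adjoin A xs)"
  by (induction xs arbitrary: A) (auto simp: sub_ssum sub_line)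

lemma adjoin_upper: "sub A \<Longrightarrow> set xs \<subseteq> carrier V \<Longrightarrow> A \<subseteq> adjoin A xs \<and> set xs \<subseteq> adjoin A xs"
proof (induction xs arbitrary: A)
  case (Cons x xs)
  have x: "x \<in> carrier V" using Cons by auto
  have s: "sub (ssum A (line x))" by (rule sub_ssum[OF Cons(2) sub_line[OF x]])
  show ?case
    using Cons.IH[OF s] Cons.prems ssum_upper1[OF Cons(2) sub_line[OF x]]
      ssum_upper2[OF Cons(2) sub_line[OF x]] line_self[OF x] by auto
qed simp

lemma adjoin_least: "sub C \<Longrightarrow> A \<subseteq> C \<Longrightarrow> set xs \<subseteq> C \<Longrightarrow> adjoin A xs \<subseteq> C"
  by (induction xs arbitrary: A) (auto simp: ssum_least line_least)

lemma sdim_adjoin: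
  "sub A \<Longrightarrow> set xs \<subseteq> carrier V \<Longrightarrow> indep_over A xs \<Longrightarrow> sdim (adjoin A xs) = sdim A + length xs"
  by (induction xs arbitrary: A) (auto simp: sdim_extend sub_ssum sub_line)

lemma finite_frames: "sub U \<Longrightarrow> finite (frames A U b)"
  unfolding frames_def
  by (rule finite_subset[OF _ finite_lists_length_eq[of U b]]) (auto simp: finite_sub)

lemma card_frames:
  assumes "sub A" "sub U" "A \<subseteq> U"
  shows "card (frames A U b) =
    (\<Prod>i<b. card (carrier K) ^ sdim U - card (carrier K) ^ (sdim A + i))"
  using assms
proof (induction b arbitrary: A)
  case 0
  have "frames A U 0 = {[]}" by (auto simp: frames_def)
  then show ?case by simp
next
  case (Suc b)
  let ?q = "card (carrier K)"
  have eq: "frames A U (Suc b) = (\<Union>x\<in>U - A. (#) x ` frames (ssum A (line x)) U b)" (is "?L = ?R")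
  proof
    show "?L \<subseteq> ?R"
    proof
      fix xs assume "xs \<in> ?L"
      then show "xs \<in> ?R" by (cases xs) (auto simp: frames_def)
    qed
  qed (auto simp: frames_def)
  have c: "card (frames (ssum A (line x)) U b) = (\<Prod>i<b. ?q ^ sdim U - ?q ^ (Suc (sdim A) + i))"
    if x: "x \<in> U - A" for x
  proof -
    have xc: "x \<in> carrier V" using x Suc.prems sub_carrier by auto
    have "ssum A (line x) \<subseteq> U"
      using x Suc.prems by (intro ssum_least line_least) auto
    then show ?thesis
      using Suc.IH[OF sub_ssum[OF Suc.prems(1) sub_line[OF xc]] Suc.prems(2)]
        sdim_extend[OF Suc.prems(1) xc] x by simp
  qed
  have "card (frames A U (Suc b)) = (\<Sum>x\<in>U - A. card ((#) x ` frames (ssum A (line x)) U b))"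
    unfolding eq by (rule card_UN_disjoint) (auto simp: finite_frames Suc.prems finite_sub)
  also have "\<dots> = (\<Sum>x\<in>U - A. (\<Prod>i<b. ?q ^ sdim U - ?q ^ (Suc (sdim A) + i)))"
    by (intro sum.cong refl) (simp add: card_image c)
  also have "\<dots> = (?q ^ sdim U - ?q ^ sdim A) * (\<Prod>i<b. ?q ^ sdim U - ?q ^ (Suc (sdim A) + i))"
    using Suc.prems by (simp add: card_Diff_subset finite_sub card_sub)
  also have "\<dots> = (\<Prod>i<Suc b. ?q ^ sdim U - ?q ^ (sdim A + i))"
    by (simp add: prod.lessThan_Suc_shift del: prod.lessThan_Suc)
  finally show ?case .
qed

lemma finite_between: "finite (between A U b)"
  by (rule finite_subset[of _ "Pow (carrier V)"]) (auto simp: between_def finite_V dest: sub_carrier)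

text \<open>Every frame of U over A belongs to exactly one intermediate space, the one it generates
  together with A. Kept free of division, this is the formula for Gaussian binomial
  coefficients.\<close>

lemma card_between:
  assumes A: "sub A" and U: "sub U" and AU: "A \<subseteq> U"
  shows "card (between A U b) * (\<Prod>i<b. card (carrier K) ^ (sdim A + b) - card (carrier K) ^ (sdim A + i)) =
    (\<Prod>i<b. card (carrier K) ^ sdim U - card (carrier K) ^ (sdim A + i))"
proof -
  have fin: "finite (between A U b)" by (rule finite_between)
  have "frames A U b = (\<Union>H\<in>between A U b. frames A H b)"
  proof (intro equalityI subsetI)
    fix xs assume xs: "xs \<in> frames A U b"
    then have c: "set xs \<subseteq> carrier V" using U sub_subset by (auto simp: frames_def)
    have "adjoin A xs \<in> between A U b"
      using xs sub_adjoin[OF A c] adjoin_upper[OF A c] adjoin_least[OF U AU] sdim_adjoin[OF A c]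
      by (auto simp: frames_def between_def)
    moreover have "xs \<in> frames A (adjoin A xs) b"
      using xs adjoin_upper[OF A c] by (auto simp: frames_def)
    ultimately show "xs \<in> (\<Union>H\<in>between A U b. frames A H b)" by blast
  qed (auto simp: frames_def between_def)
  moreover have "H = adjoin A xs" if "H \<in> between A U b" "xs \<in> frames A H b" for H xs
  proof -
    have H: "sub H" "A \<subseteq> H" "sdim H = sdim A + b" using that by (auto simp: between_def)
    have xs: "set xs \<subseteq> H" "length xs = b" "indep_over A xs" using that by (auto simp: frames_def)
    then have c: "set xs \<subseteq> carrier V" using H sub_subset by blast
    show ?thesis
      using sdim_eq_imp_eq[OF sub_adjoin[OF A c] H(1) adjoin_least[OF H(1,2) xs(1)]]
        sdim_adjoin[OF A c xs(3)] H xs by simp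
  qed
  then have "frames A H b \<inter> frames A H' b = {}"
    if "H \<in> between A U b" "H' \<in> between A U b" "H \<noteq> H'" for H H' using that by blast
  ultimately have "card (frames A U b) = (\<Sum>H\<in>between A U b. card (frames A H b))"
    using fin by (simp add: card_UN_disjoint finite_frames between_def)
  also have "\<dots> = (\<Sum>H\<in>between A U b. \<Prod>i<b. card (carrier K) ^ (sdim A + b) - card (carrier K) ^ (sdim A + i))"
    by (intro sum.cong refl) (simp add: card_frames A between_def)
  finally show ?thesis using card_frames[OF A U AU] by simp
qed

text \<open>Each numerator factor is at most \<open>q ^ sdim U\<close>, and by
  \<open>prod_one_minus_powers_ge\<close> the denominator loses at most a factor 4 against its
  leading power. The empty case is set apart because the exponent uses truncated
  subtraction.\<close>

lemma card_between_le:
  assumes A: "sub A" and U: "sub U" and AU: "A \<subseteq> U"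
  shows "real (card (between A U b)) \<le>
    4 * real (card (carrier K)) ^ (b * (sdim U - sdim A - b))"
proof (cases "between A U b = {}")
  case False
  then obtain H where H: "sub H" "H \<subseteq> U" "sdim H = sdim A + b" by (auto simp: between_def)
  then have le: "sdim A + b \<le> sdim U" using sdim_mono[OF H(1) U H(2)] by simp
  let ?q = "real (card (carrier K))"
  have q: "?q \<ge> 2" using q_ge2 by simp
  have fac: "real (card (carrier K) ^ (sdim A + b) - card (carrier K) ^ (sdim A + i)) =
      ?q ^ (sdim A + b) * (1 - (1 / ?q) ^ (b - i))" if "i < b" for i
  proof -
    have "?q ^ (sdim A + b) * (1 / ?q) ^ (b - i) = ?q ^ (sdim A + i)"
      using that q by (simp add: power_one_over power_diff field_simps power_add)
    then show ?thesis
      using that q_ge2 by (subst of_nat_diff) (auto intro!: power_increasing simp: algebra_simps)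
  qed
  have "?q ^ (b * (sdim A + b)) * (1 / 4) \<le> (\<Prod>i<b. ?q ^ (sdim A + b)) * (\<Prod>i<b. 1 - (1 / ?q) ^ (b - i))"
  proof (intro mult_mono)
    have "(\<Prod>i<b. 1 - (1 / ?q) ^ (b - i)) = (\<Prod>j<b. 1 - (1 / ?q) ^ Suc j)"
      by (rule prod.reindex_bij_witness[of _ "\<lambda>j. b - Suc j" "\<lambda>j. b - Suc j"]) (auto simp: Suc_diff_Suc)
    then show "1 / 4 \<le> (\<Prod>i<b. 1 - (1 / ?q) ^ (b - i))"
      using prod_one_minus_powers_ge[of "1 / ?q" b] q by simp
  qed (use q in \<open>auto simp: power_mult[symmetric] mult.commute intro!: prod_nonneg\<close>)
  also have "\<dots> = real (\<Prod>i<b. card (carrier K) ^ (sdim A + b) - card (carrier K) ^ (sdim A + i))"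
    by (simp only: of_nat_prod prod.distrib[symmetric]) (intro prod.cong refl, simp only: fac lessThan_iff)
  finally have low: "?q ^ (b * (sdim A + b)) * (1 / 4) \<le>
    real (\<Prod>i<b. card (carrier K) ^ (sdim A + b) - card (carrier K) ^ (sdim A + i))" .
  have "(\<Prod>i<b. card (carrier K) ^ sdim U - card (carrier K) ^ (sdim A + i)) \<le> (\<Prod>i<b. card (carrier K) ^ sdim U)"
    by (intro prod_mono) auto
  also have "\<dots> = card (carrier K) ^ (b * sdim U)" by (simp add: power_mult[symmetric] mult.commute)
  finally have up: "(\<Prod>i<b. card (carrier K) ^ sdim U - card (carrier K) ^ (sdim A + i)) \<le> card (carrier K) ^ (b * sdim U)" .
  have "real (card (between A U b)) * (?q ^ (b * (sdim A + b)) * (1 / 4)) \<le>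
      real (card (between A U b)) * real (\<Prod>i<b. card (carrier K) ^ (sdim A + b) - card (carrier K) ^ (sdim A + i))"
    by (rule mult_left_mono[OF low]) simp
  also have "\<dots> = real (\<Prod>i<b. card (carrier K) ^ sdim U - card (carrier K) ^ (sdim A + i))"
    unfolding card_between[OF A U AU, of b, symmetric] by (rule of_nat_mult[symmetric])
  also have "\<dots> \<le> real (card (carrier K) ^ (b * sdim U))" using up by (simp only: of_nat_le_iff)
  finally have "real (card (between A U b)) * (?q ^ (b * (sdim A + b)) * (1 / 4)) \<le> ?q ^ (b * sdim U)" by simp
  moreover have "?q ^ (b * sdim U) = ?q ^ (b * (sdim A + b)) * ?q ^ (b * (sdim U - sdim A - b))"
  proof -
    have "sdim U = (sdim A + b) + (sdim U - sdim A - b)" using le by simp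
    then have "b * sdim U = b * (sdim A + b) + b * (sdim U - sdim A - b)"
      by (metis add_mult_distrib2)
    then show ?thesis by (simp only: power_add)
  qed
  ultimately show ?thesis using q by (simp add: field_simps)
qed simp

end

section \<open>Alternating forms\<close>

text \<open>A (k+1)-tuple is a first entry followed by a k-tuple, \<open>case_nat x w\<close>;
  contraction and extension of forms act on that first entry.\<close>

lemma tuples_SucI: "x \<in> A \<Longrightarrow> w \<in> tuples k A \<Longrightarrow> case_nat x w \<in> tuples (Suc k) A"
  by (auto simp: tuples_def PiE_def extensional_def split: nat.splits)

lemma tuples_SucD:
  assumes "v \<in> tuples (Suc k) A"
  shows "v 0 \<in> A" "(\<lambda>i. v (Suc i)) \<in> tuples k A"
  using assms by (auto simp: tuples_def PiE_def extensional_def)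

lemma case_nat_eta: "case_nat (v 0) (\<lambda>i. v (Suc i)) = v"
  by (auto split: nat.splits)

lemma tuples_SucE:
  assumes "v \<in> tuples (Suc k) A"
  obtains x w where "x \<in> A" "w \<in> tuples k A" "v = case_nat x w"
  using tuples_SucD[OF assms] case_nat_eta[of v] by metis

lemma tuples_0: "tuples 0 A = {\<lambda>_. undefined}"
  by (simp add: tuples_def)

lemma case_nat_upd_0: "(case_nat x w)(0 := y) = case_nat y w"
  and case_nat_upd_Suc: "(case_nat x w)(Suc i := y) = case_nat x (w(i := y))"
  by (auto split: nat.splits)

lemma tuples_upd: "v \<in> tuples k A \<Longrightarrow> i < k \<Longrightarrow> x \<in> A \<Longrightarrow> v(i := x) \<in> tuples k A"
  by (auto simp: tuples_def PiE_def extensional_def)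

lemma tuples_nth: "v \<in> tuples k A \<Longrightarrow> i < k \<Longrightarrow> v i \<in> A"
  by (auto simp: tuples_def)

lemma tuples_mono: "A \<subseteq> B \<Longrightarrow> tuples k A \<subseteq> tuples k B"
  unfolding tuples_def by (intro PiE_mono) auto

lemma finite_tuples: "finite A \<Longrightarrow> finite (tuples k A)"
  unfolding tuples_def by (intro finite_PiE) auto

lemma card_le_card_times:
  assumes "finite S" "f ` S \<subseteq> T" "finite T" "\<And>y. y \<in> T \<Longrightarrow> card {x \<in> S. f x = y} \<le> n"
  shows "card S \<le> card T * n"
proof -
  have "card S = (\<Sum>y\<in>T. card {x \<in> S. f x = y})"
    using sum.group[OF assms(1,3,2), of "\<lambda>_. 1 :: nat"] by simp
  also have "\<dots> \<le> (\<Sum>y\<in>T. n)" by (intro sum_mono assms)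
  finally show ?thesis by simp
qed

locale alternating_forms = finite_vectorspace K V + W: module K W
  for K :: "('a, 'b) ring_scheme" and V :: "('a, 'c, 'd) module_scheme"
    and W :: "('a, 'e, 'f) module_scheme" +
  assumes finite_W: "finite (carrier W)" and card_W: "card (carrier W) \<ge> 2"
begin

definition alternating :: "nat \<Rightarrow> 'c set \<Rightarrow> ((nat \<Rightarrow> 'c) \<Rightarrow> 'e) \<Rightarrow> bool" where
  "alternating k U f \<longleftrightarrow>
     (\<forall>v\<in>tuples k U. f v \<in> carrier W) \<and>
     (\<forall>v\<in>tuples k U. \<forall>i<k. \<forall>x\<in>U. \<forall>y\<in>U.
        f (v(i := x \<oplus>\<^bsub>V\<^esub> y)) = f (v(i := x)) \<oplus>\<^bsub>W\<^esub> f (v(i := y))) \<and>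
     (\<forall>v\<in>tuples k U. \<forall>i<k. \<forall>a\<in>carrier K. \<forall>x\<in>U.
        f (v(i := a \<odot>\<^bsub>V\<^esub> x)) = a \<odot>\<^bsub>W\<^esub> f (v(i := x))) \<and>
     (\<forall>v\<in>tuples k U. \<forall>i<k. \<forall>j<k. i \<noteq> j \<longrightarrow> v i = v j \<longrightarrow> f v = \<zero>\<^bsub>W\<^esub>)"

lemma alternatingD:
  assumes "alternating k U f" "v \<in> tuples k U"
  shows "f v \<in> carrier W"
    "i < k \<Longrightarrow> x \<in> U \<Longrightarrow> y \<in> U \<Longrightarrow> f (v(i := x \<oplus>\<^bsub>V\<^esub> y)) = f (v(i := x)) \<oplus>\<^bsub>W\<^esub> f (v(i := y))"
    "i < k \<Longrightarrow> a \<in> carrier K \<Longrightarrow> x \<in> U \<Longrightarrow> f (v(i := a \<odot>\<^bsub>V\<^esub> x)) = a \<odot>\<^bsub>W\<^esub> f (v(i := x))"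
    "i < k \<Longrightarrow> j < k \<Longrightarrow> i \<noteq> j \<Longrightarrow> v i = v j \<Longrightarrow> f v = \<zero>\<^bsub>W\<^esub>"
  using assms unfolding alternating_def by blast+

lemma alternating_mono: "alternating k U f \<Longrightarrow> U' \<subseteq> U \<Longrightarrow> alternating k U' f"
  using tuples_mono[of U' U k] unfolding alternating_def by (meson subsetD)

lemma alternating_cong:
  assumes "sub U" "\<And>v. v \<in> tuples k U \<Longrightarrow> f v = g v"
  shows "alternating k U f = alternating k U g"
proof -
  have "alternating k U g" if f: "alternating k U f" and eq: "\<And>v. v \<in> tuples k U \<Longrightarrow> f v = g v" for f g
    unfolding alternating_def
  proof (intro conjI ballI allI impI)
    fix v assume v: "v \<in> tuples k U"
    show "g v \<in> carrier W" using alternatingD(1)[OF f v] eq[OF v] by simp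
    show "g (v(i := x \<oplus>\<^bsub>V\<^esub> y)) = g (v(i := x)) \<oplus>\<^bsub>W\<^esub> g (v(i := y))" if "i < k" "x \<in> U" "y \<in> U" for i x y
      using alternatingD(2)[OF f v that] eq tuples_upd[OF v that(1)] that sub_add[OF assms(1)] by simp
    show "g (v(i := a \<odot>\<^bsub>V\<^esub> x)) = a \<odot>\<^bsub>W\<^esub> g (v(i := x))" if "i < k" "a \<in> carrier K" "x \<in> U" for i a x
      using alternatingD(3)[OF f v that] eq tuples_upd[OF v that(1)] that sub_smult[OF assms(1)] by simp
    show "g v = \<zero>\<^bsub>W\<^esub>" if "i < k" "j < k" "i \<noteq> j" "v i = v j" for i j
      using alternatingD(4)[OF f v that] eq[OF v] by simp
  qed
  from this[of f g] this[of g f] assms(2) show ?thesis by (metis (no_types, lifting))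
qed

lemma alternating_swap:
  assumes U: "sub U" and f: "alternating k U f" and v: "v \<in> tuples k U"
    and ij: "i < k" "j < k" "i \<noteq> j"
  shows "f v \<oplus>\<^bsub>W\<^esub> f (v(i := v j, j := v i)) = \<zero>\<^bsub>W\<^esub>"
proof -
  let ?s = "v i \<oplus>\<^bsub>V\<^esub> v j"
  have vi: "v i \<in> U" and vj: "v j \<in> U" using v ij tuples_nth by auto
  have s: "?s \<in> U" using vi vj sub_add[OF U] by simp
  have t: "v(i := a, j := b) \<in> tuples k U" if "a \<in> U" "b \<in> U" for a b
    using that v ij by (simp add: tuples_upd)
  have "\<zero>\<^bsub>W\<^esub> = f (v(i := ?s, j := ?s))"
    using alternatingD(4)[OF f t[OF s s] ij] ij by simp
  also have "\<dots> = f (v(i := ?s, j := v i)) \<oplus>\<^bsub>W\<^esub> f (v(i := ?s, j := v j))"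
    using alternatingD(2)[OF f tuples_upd[OF v ij(1) s] ij(2) vi vj] .
  also have "f (v(i := ?s, j := v i)) = f (v(i := v i, j := v i)) \<oplus>\<^bsub>W\<^esub> f (v(i := v j, j := v i))"
    using alternatingD(2)[OF f tuples_upd[OF v ij(2) vi] ij(1) vi vj] by (simp only: fun_upd_twist[OF ij(3)[symmetric]])
  also have "f (v(i := ?s, j := v j)) = f (v(i := v i, j := v j)) \<oplus>\<^bsub>W\<^esub> f (v(i := v j, j := v j))"
    using alternatingD(2)[OF f tuples_upd[OF v ij(2) vj] ij(1) vi vj] by (simp only: fun_upd_twist[OF ij(3)[symmetric]])
  also have "f (v(i := v i, j := v i)) = \<zero>\<^bsub>W\<^esub>"
    using alternatingD(4)[OF f t[OF vi vi] ij] ij by simp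
  also have "f (v(i := v j, j := v j)) = \<zero>\<^bsub>W\<^esub>"
    using alternatingD(4)[OF f t[OF vj vj] ij] ij by simp
  also have "v(i := v i, j := v j) = v" by simp
  finally have "\<zero>\<^bsub>W\<^esub> = (\<zero>\<^bsub>W\<^esub> \<oplus>\<^bsub>W\<^esub> f (v(i := v j, j := v i))) \<oplus>\<^bsub>W\<^esub> (f v \<oplus>\<^bsub>W\<^esub> \<zero>\<^bsub>W\<^esub>)" .
  then show ?thesis
    using alternatingD(1)[OF f v] alternatingD(1)[OF f t[OF vj vi]] by (simp add: W.M.a_comm)
qed

lemma alternating_contract:
  assumes f: "alternating (Suc k) U f" and x: "x \<in> U"
  shows "alternating k U (\<lambda>w. f (case_nat x w))"
  unfolding alternating_def
proof (intro conjI ballI allI impI)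
  fix w assume w: "w \<in> tuples k U"
  note t = tuples_SucI[OF x w]
  show "f (case_nat x w) \<in> carrier W" by (rule alternatingD(1)[OF f t])
  show "f (case_nat x (w(i := y \<oplus>\<^bsub>V\<^esub> z))) = f (case_nat x (w(i := y))) \<oplus>\<^bsub>W\<^esub> f (case_nat x (w(i := z)))"
    if "i < k" "y \<in> U" "z \<in> U" for i y z
    using alternatingD(2)[OF f t, of "Suc i" y z] that by (simp add: case_nat_upd_Suc)
  show "f (case_nat x (w(i := a \<odot>\<^bsub>V\<^esub> y))) = a \<odot>\<^bsub>W\<^esub> f (case_nat x (w(i := y)))"
    if "i < k" "a \<in> carrier K" "y \<in> U" for i a y
    using alternatingD(3)[OF f t, of "Suc i" a y] that by (simp add: case_nat_upd_Suc)
  show "f (case_nat x w) = \<zero>\<^bsub>W\<^esub>" if "i < k" "j < k" "i \<noteq> j" "w i = w j" for i j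
    using alternatingD(4)[OF f t, of "Suc i" "Suc j"] that by simp
qed

text \<open>Alternation need only be checked for equal first two arguments: the form is already
  alternating in the remaining ones, so \<open>alternating_swap\<close> moves any repetition of the
  first entry into second place.\<close>

lemma alternating_SucI:
  assumes U: "sub U"
    and a: "\<And>x. x \<in> U \<Longrightarrow> alternating k U (\<lambda>w. f (case_nat x w))"
    and add: "\<And>x y w. x \<in> U \<Longrightarrow> y \<in> U \<Longrightarrow> w \<in> tuples k U \<Longrightarrow>
      f (case_nat (x \<oplus>\<^bsub>V\<^esub> y) w) = f (case_nat x w) \<oplus>\<^bsub>W\<^esub> f (case_nat y w)"
    and smult: "\<And>b x w. b \<in> carrier K \<Longrightarrow> x \<in> U \<Longrightarrow> w \<in> tuples k U \<Longrightarrow>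
      f (case_nat (b \<odot>\<^bsub>V\<^esub> x) w) = b \<odot>\<^bsub>W\<^esub> f (case_nat x w)"
    and alt: "\<And>l x w. k = Suc l \<Longrightarrow> x \<in> U \<Longrightarrow> w \<in> tuples l U \<Longrightarrow> f (case_nat x (case_nat x w)) = \<zero>\<^bsub>W\<^esub>"
  shows "alternating (Suc k) U f"
  unfolding alternating_def
proof (intro conjI ballI allI impI)
  fix v assume v: "v \<in> tuples (Suc k) U"
  then obtain x w where xw: "x \<in> U" "w \<in> tuples k U" "v = case_nat x w" by (rule tuples_SucE)
  note g = a[OF xw(1)]
  show "f v \<in> carrier W" using alternatingD(1)[OF g xw(2)] xw(3) by simp
  show "f (v(i := y \<oplus>\<^bsub>V\<^esub> z)) = f (v(i := y)) \<oplus>\<^bsub>W\<^esub> f (v(i := z))"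
    if "i < Suc k" "y \<in> U" "z \<in> U" for i y z
  proof (cases i)
    case 0 then show ?thesis using add that xw by (simp add: case_nat_upd_0)
  next
    case (Suc j) then show ?thesis
      using alternatingD(2)[OF g xw(2), of j y z] that xw by (simp add: case_nat_upd_Suc)
  qed
  show "f (v(i := b \<odot>\<^bsub>V\<^esub> y)) = b \<odot>\<^bsub>W\<^esub> f (v(i := y))"
    if "i < Suc k" "b \<in> carrier K" "y \<in> U" for i b y
  proof (cases i)
    case 0 then show ?thesis using smult that xw by (simp add: case_nat_upd_0)
  next
    case (Suc j) then show ?thesis
      using alternatingD(3)[OF g xw(2), of j b y] that xw by (simp add: case_nat_upd_Suc)
  qed
  have zero: "f v = \<zero>\<^bsub>W\<^esub>" if l: "l < k" "w l = x" for l
  proof -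
    obtain k' where k': "k = Suc k'" using l by (cases k) auto
    have first: "f (case_nat x u) = \<zero>\<^bsub>W\<^esub>" if "u \<in> tuples k U" "u 0 = x" for u
      using alt[OF k' xw(1), of "\<lambda>i. u (Suc i)"] tuples_SucD(2)[of u k' U] that k' case_nat_eta[of u] by simp
    show ?thesis
    proof (cases "l = 0")
      case True then show ?thesis using first[OF xw(2)] l xw(3) by simp
    next
      case False
      have w0: "w 0 \<in> U" using tuples_nth[OF xw(2)] k' by simp
      let ?w = "w(0 := w l, l := w 0)"
      have "?w \<in> tuples k U" using xw l w0 k' by (simp add: tuples_upd)
      then have "f (case_nat x ?w) = \<zero>\<^bsub>W\<^esub>" using first[of ?w] l False by simp
      then show ?thesis
        using alternating_swap[OF U g xw(2), of 0 l] False l k' alternatingD(1)[OF g xw(2)] xw(3) by simp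
    qed
  qed
  show "f v = \<zero>\<^bsub>W\<^esub>" if ij: "i < Suc k" "j < Suc k" "i \<noteq> j" "v i = v j" for i j
  proof (cases i)
    case 0
    then obtain l where "j = Suc l" using ij by (cases j) auto
    then show ?thesis using zero[of l] ij 0 xw(3) by simp
  next
    case (Suc i')
    show ?thesis
    proof (cases j)
      case 0 then show ?thesis using zero[of i'] ij Suc xw(3) by simp
    next
      case (Suc j')
      then show ?thesis
        using alternatingD(4)[OF g xw(2), of i' j'] ij \<open>i = Suc i'\<close> xw(3) by simp
    qed
  qed
qed

section \<open>Linear structure and forms with prescribed zeros\<close>

lemma alternating_add:
  assumes "sub U" "alternating k U f" "alternating k U g"
  shows "alternating k U (\<lambda>v. f v \<oplus>\<^bsub>W\<^esub> g v)"
  unfolding alternating_def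
proof (intro conjI ballI allI impI)
  note [simp] = alternatingD(1)[OF assms(2)] alternatingD(1)[OF assms(3)]
  fix v assume v: "v \<in> tuples k U"
  show "f v \<oplus>\<^bsub>W\<^esub> g v \<in> carrier W" using v by simp
  show "f (v(i := x \<oplus>\<^bsub>V\<^esub> y)) \<oplus>\<^bsub>W\<^esub> g (v(i := x \<oplus>\<^bsub>V\<^esub> y)) =
      f (v(i := x)) \<oplus>\<^bsub>W\<^esub> g (v(i := x)) \<oplus>\<^bsub>W\<^esub> (f (v(i := y)) \<oplus>\<^bsub>W\<^esub> g (v(i := y)))"
    if "i < k" "x \<in> U" "y \<in> U" for i x y
    using alternatingD(2)[OF assms(2) v that] alternatingD(2)[OF assms(3) v that] that v
    by (simp add: tuples_upd W.M.a_ac)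
  show "f (v(i := a \<odot>\<^bsub>V\<^esub> x)) \<oplus>\<^bsub>W\<^esub> g (v(i := a \<odot>\<^bsub>V\<^esub> x)) = a \<odot>\<^bsub>W\<^esub> (f (v(i := x)) \<oplus>\<^bsub>W\<^esub> g (v(i := x)))"
    if "i < k" "a \<in> carrier K" "x \<in> U" for i a x
    using alternatingD(3)[OF assms(2) v that] alternatingD(3)[OF assms(3) v that] that v
    by (simp add: tuples_upd W.smult_r_distr)
  show "f v \<oplus>\<^bsub>W\<^esub> g v = \<zero>\<^bsub>W\<^esub>" if "i < k" "j < k" "i \<noteq> j" "v i = v j" for i j
    using alternatingD(4)[OF assms(2) v that] alternatingD(4)[OF assms(3) v that] by simp
qed

lemma alternating_smult:
  assumes "sub U" "alternating k U f" "b \<in> carrier K"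
  shows "alternating k U (\<lambda>v. b \<odot>\<^bsub>W\<^esub> f v)"
  unfolding alternating_def
proof (intro conjI ballI allI impI)
  note [simp] = alternatingD(1)[OF assms(2)] assms(3)
  fix v assume v: "v \<in> tuples k U"
  show "b \<odot>\<^bsub>W\<^esub> f v \<in> carrier W" using v by simp
  show "b \<odot>\<^bsub>W\<^esub> f (v(i := x \<oplus>\<^bsub>V\<^esub> y)) = b \<odot>\<^bsub>W\<^esub> f (v(i := x)) \<oplus>\<^bsub>W\<^esub> b \<odot>\<^bsub>W\<^esub> f (v(i := y))"
    if "i < k" "x \<in> U" "y \<in> U" for i x y
    using alternatingD(2)[OF assms(2) v that] that v by (simp add: tuples_upd W.smult_r_distr)
  show "b \<odot>\<^bsub>W\<^esub> f (v(i := a \<odot>\<^bsub>V\<^esub> x)) = a \<odot>\<^bsub>W\<^esub> (b \<odot>\<^bsub>W\<^esub> f (v(i := x)))"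
    if "i < k" "a \<in> carrier K" "x \<in> U" for i a x
    using alternatingD(3)[OF assms(2) v that] that v
    by (simp add: tuples_upd W.smult_assoc1[symmetric] R.m_comm)
  show "b \<odot>\<^bsub>W\<^esub> f v = \<zero>\<^bsub>W\<^esub>" if "i < k" "j < k" "i \<noteq> j" "v i = v j" for i j
    using alternatingD(4)[OF assms(2) v that] by simp
qed

text \<open>Members of F need not lie in U: while U is built up vector by vector, only their traces
  H \<inter> U impose conditions. Extensionality keeps the set finite.\<close>

definition forms :: "nat \<Rightarrow> 'c set \<Rightarrow> 'c set set \<Rightarrow> ((nat \<Rightarrow> 'c) \<Rightarrow> 'e) set" where
  "forms k U F = {f \<in> extensional (tuples k U). alternating k U f \<and>
     (\<forall>H\<in>F. \<forall>v\<in>tuples k (H \<inter> U). f v = \<zero>\<^bsub>W\<^esub>)}"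

lemma forms_subset_PiE: "forms k U F \<subseteq> tuples k U \<rightarrow>\<^sub>E carrier W"
  unfolding forms_def by (auto simp: PiE_def dest: alternatingD(1))

lemma finite_forms: "sub U \<Longrightarrow> finite (forms k U F)"
  by (rule finite_subset[OF forms_subset_PiE])
     (auto intro!: finite_PiE finite_tuples finite_sub finite_W)

lemma restrict_alternating:
  "sub U \<Longrightarrow> alternating k U (restrict f (tuples k U)) = alternating k U f"
  by (rule alternating_cong) auto

lemma restrict_in_forms:
  assumes "sub U" "alternating k U f" "\<And>H v. H \<in> F \<Longrightarrow> v \<in> tuples k (H \<inter> U) \<Longrightarrow> f v = \<zero>\<^bsub>W\<^esub>"
  shows "restrict f (tuples k U) \<in> forms k U F"
  using assms tuples_mono[of "_ \<inter> U" U k] unfolding forms_def by (auto simp: restrict_alternating)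

lemma alternating_zero: "alternating k U (\<lambda>_. \<zero>\<^bsub>W\<^esub>)"
  unfolding alternating_def by auto

lemma zero_in_forms: "sub U \<Longrightarrow> restrict (\<lambda>_. \<zero>\<^bsub>W\<^esub>) (tuples k U) \<in> forms k U F"
  by (rule restrict_in_forms[OF _ alternating_zero]) auto

lemma card_forms_pos: "sub U \<Longrightarrow> card (forms k U F) > 0"
  using zero_in_forms finite_forms card_gt_0_iff by blast

lemma alternating_diff:
  assumes "sub U" "alternating k U f" "alternating k U g"
  shows "alternating k U (\<lambda>v. f v \<oplus>\<^bsub>W\<^esub> (\<ominus>\<^bsub>K\<^esub> \<one>\<^bsub>K\<^esub>) \<odot>\<^bsub>W\<^esub> g v)"
  by (rule alternating_add[OF assms(1,2) alternating_smult[OF assms(1,3)]]) simp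

lemma W_diff_eq:
  assumes "a \<in> carrier W" "b \<in> carrier W"
  shows "a \<oplus>\<^bsub>W\<^esub> (\<ominus>\<^bsub>K\<^esub> \<one>\<^bsub>K\<^esub>) \<odot>\<^bsub>W\<^esub> b = \<zero>\<^bsub>W\<^esub> \<longleftrightarrow> a = b"
  using assms W.smult_l_minus[of "\<one>\<^bsub>K\<^esub>" b] W.M.minus_equality[of a "\<ominus>\<^bsub>W\<^esub> b"]
  by (auto simp: W.M.r_neg W.M.minus_minus)

text \<open>Write each argument as u + a x and expand: a term with two entries x vanishes by
  alternation, one with a single x is a contraction, and one without x lives on U. Hence a form on U
  + line x is determined by its restriction to U and its contraction by x.\<close>

lemma alternating_zero_if_zero:
  assumes U: "sub U" and x: "x \<in> carrier V" "x \<notin> U"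
    and f: "alternating (Suc k) (ssum U (line x)) f"
    and fU: "\<And>v. v \<in> tuples (Suc k) U \<Longrightarrow> f v = \<zero>\<^bsub>W\<^esub>"
    and fx: "\<And>w. w \<in> tuples k U \<Longrightarrow> f (case_nat x w) = \<zero>\<^bsub>W\<^esub>"
    and v: "v \<in> tuples (Suc k) (ssum U (line x))"
  shows "f v = \<zero>\<^bsub>W\<^esub>"
proof -
  let ?U = "ssum U (line x)"
  have sU: "sub ?U" by (rule sub_ssum[OF U sub_line[OF x(1)]])
  have UU: "U \<subseteq> ?U" by (rule ssum_upper1[OF U sub_line[OF x(1)]])
  have xU: "x \<in> ?U" using ssum_upper2[OF U sub_line[OF x(1)]] line_self[OF x(1)] by auto
  have split: "\<exists>u\<in>U. \<exists>a\<in>carrier K. z = u \<oplus>\<^bsub>V\<^esub> a \<odot>\<^bsub>V\<^esub> x" if "z \<in> ?U" for z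
    using that extend_mem_iff[OF U x(1)] by simp
  have inU: "v \<in> tuples (Suc k) U" if "v \<in> tuples (Suc k) ?U" "\<And>i. i < Suc k \<Longrightarrow> v i \<in> U" for v
    using that by (auto simp: tuples_def PiE_def)
  have exp: "f v = f (v(i := u)) \<oplus>\<^bsub>W\<^esub> a \<odot>\<^bsub>W\<^esub> f (v(i := x))"
    if "v \<in> tuples (Suc k) ?U" "i < Suc k" "u \<in> U" "a \<in> carrier K" "v i = u \<oplus>\<^bsub>V\<^esub> a \<odot>\<^bsub>V\<^esub> x" for v i u a
  proof -
    have "f v = f (v(i := u \<oplus>\<^bsub>V\<^esub> a \<odot>\<^bsub>V\<^esub> x))" using that(5)[symmetric] by simp
    also have "\<dots> = f (v(i := u)) \<oplus>\<^bsub>W\<^esub> f (v(i := a \<odot>\<^bsub>V\<^esub> x))"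
      using that UU sub_smult[OF sU _ xU] by (intro alternatingD(2)[OF f]) auto
    also have "f (v(i := a \<odot>\<^bsub>V\<^esub> x)) = a \<odot>\<^bsub>W\<^esub> f (v(i := x))"
      using that xU by (intro alternatingD(3)[OF f]) auto
    finally show ?thesis .
  qed
  \<comment> \<open>Tuples with x in place i, by induction on the number of other entries outside U.
    The general case then runs over the number of all entries outside U and falls back on this one
    whenever an entry is replaced by x.\<close>
  have one: "f v = \<zero>\<^bsub>W\<^esub>"
    if "v \<in> tuples (Suc k) ?U" "i < Suc k" "v i = x" "card {j. j < Suc k \<and> j \<noteq> i \<and> v j \<notin> U} = n" for v i n
    using that
  proof (induction n arbitrary: v)
    case 0
    then have oth: "v j \<in> U" if "j < Suc k" "j \<noteq> i" for j using that by (auto simp: card_eq_0_iff)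
    show ?case
    proof (cases "i = 0")
      case True
      have "(\<lambda>l. v (Suc l)) \<in> tuples k U"
        using tuples_SucD(2)[OF 0(1)] oth True by (auto simp: tuples_def PiE_def)
      then show ?thesis using fx[of "\<lambda>l. v (Suc l)"] case_nat_eta[of v] 0(3) True by simp
    next
      case False
      let ?v = "v(0 := v i, i := v 0)"
      have t: "?v \<in> tuples (Suc k) ?U" using 0 xU by (simp add: tuples_upd tuples_nth)
      have "(\<lambda>l. ?v (Suc l)) \<in> tuples k U"
        using tuples_SucD(2)[OF t] oth False by (auto simp: tuples_def PiE_def Pi_def split: if_splits)
      then have "f (case_nat x (\<lambda>l. ?v (Suc l))) = \<zero>\<^bsub>W\<^esub>" by (rule fx)
      moreover have "case_nat x (\<lambda>l. ?v (Suc l)) = ?v"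
        using 0(3) False by (auto simp: fun_eq_iff split: nat.splits)
      ultimately show ?thesis
        using alternating_swap[OF sU f 0(1), of 0 i] 0(2) False alternatingD(1)[OF f 0(1)] by simp
    qed
  next
    case (Suc n)
    then have "{j. j < Suc k \<and> j \<noteq> i \<and> v j \<notin> U} \<noteq> {}" by (metis card.empty nat.distinct(1))
    then obtain j where j: "j < Suc k" "j \<noteq> i" "v j \<notin> U" by auto
    obtain u a where ua: "u \<in> U" "a \<in> carrier K" "v j = u \<oplus>\<^bsub>V\<^esub> a \<odot>\<^bsub>V\<^esub> x"
      using split tuples_nth[OF Suc.prems(1) j(1)] by blast
    have "{l. l < Suc k \<and> l \<noteq> i \<and> (v(j := u)) l \<notin> U} = {l. l < Suc k \<and> l \<noteq> i \<and> v l \<notin> U} - {j}"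
      using ua by auto
    then have c: "card {l. l < Suc k \<and> l \<noteq> i \<and> (v(j := u)) l \<notin> U} = n"
      using Suc.prems(4) j by (simp add: card_Diff_singleton)
    have 1: "f (v(j := u)) = \<zero>\<^bsub>W\<^esub>"
      by (rule Suc.IH[OF tuples_upd[OF Suc.prems(1) j(1) subsetD[OF UU ua(1)]] Suc.prems(2) _ c])
        (use Suc.prems(3) j in simp)
    have 2: "f (v(j := x)) = \<zero>\<^bsub>W\<^esub>"
      using alternatingD(4)[OF f tuples_upd[OF Suc.prems(1) j(1) xU], of i j] Suc.prems j by simp
    show ?case using exp[OF Suc.prems(1) j(1) ua] 1 2 ua by simp
  qed
  have "f v = \<zero>\<^bsub>W\<^esub>" if "v \<in> tuples (Suc k) ?U" "card {j. j < Suc k \<and> v j \<notin> U} = n" for v n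
    using that
  proof (induction n arbitrary: v)
    case 0
    then show ?case using fU[OF inU] by (auto simp: card_eq_0_iff)
  next
    case (Suc n)
    then have "{j. j < Suc k \<and> v j \<notin> U} \<noteq> {}" by (metis card.empty nat.distinct(1))
    then obtain j where j: "j < Suc k" "v j \<notin> U" by auto
    obtain u a where ua: "u \<in> U" "a \<in> carrier K" "v j = u \<oplus>\<^bsub>V\<^esub> a \<odot>\<^bsub>V\<^esub> x"
      using split tuples_nth[OF Suc.prems(1) j(1)] by blast
    have "{l. l < Suc k \<and> (v(j := u)) l \<notin> U} = {l. l < Suc k \<and> v l \<notin> U} - {j}"
      using ua by auto
    then have c: "card {l. l < Suc k \<and> (v(j := u)) l \<notin> U} = n"
      using Suc.prems(2) j by (simp add: card_Diff_singleton)
    have 1: "f (v(j := u)) = \<zero>\<^bsub>W\<^esub>"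
      by (rule Suc.IH[OF tuples_upd[OF Suc.prems(1) j(1) subsetD[OF UU ua(1)]] c])
    have 2: "f (v(j := x)) = \<zero>\<^bsub>W\<^esub>"
      using one[OF tuples_upd[OF Suc.prems(1) j(1) xU] j(1)] by simp
    show ?case using exp[OF Suc.prems(1) j(1) ua] 1 2 ua by simp
  qed
  then show ?thesis using v by blast
qed

definition active :: "'c set \<Rightarrow> 'c \<Rightarrow> 'c set set \<Rightarrow> 'c set set" where
  "active U x F = {H \<in> F. \<not> H \<inter> ssum U (line x) \<subseteq> U}"

text \<open>Two extensions of the same form on U differ by a form that vanishes on U and is
  therefore determined by its contraction by x. If the trace of H grows, H contains some u + b x
  with b \<noteq> 0; with remaining arguments in H \<inter> U the difference vanishes at this vector
  and at u, hence so does the contraction by x.\<close>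

lemma card_forms_step:
  assumes U: "sub U" and x: "x \<in> carrier V" "x \<notin> U" and F: "\<And>H. H \<in> F \<Longrightarrow> sub H"
  shows "card (forms (Suc k) (ssum U (line x)) F) \<le>
    card (forms (Suc k) U F) * card (forms k U (active U x F))"
proof (rule card_le_card_times[where f = "\<lambda>f. restrict f (tuples (Suc k) U)"])
  let ?U = "ssum U (line x)"
  let ?m = "\<ominus>\<^bsub>K\<^esub> \<one>\<^bsub>K\<^esub>"
  have sU: "sub ?U" by (rule sub_ssum[OF U sub_line[OF x(1)]])
  have UU: "U \<subseteq> ?U" by (rule ssum_upper1[OF U sub_line[OF x(1)]])
  have xU: "x \<in> ?U" using ssum_upper2[OF U sub_line[OF x(1)]] line_self[OF x(1)] by auto
  show "finite (forms (Suc k) ?U F)" "finite (forms (Suc k) U F)" by (intro finite_forms sU U)+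
  show "(\<lambda>f. restrict f (tuples (Suc k) U)) ` forms (Suc k) ?U F \<subseteq> forms (Suc k) U F"
  proof (rule image_subsetI, rule restrict_in_forms[OF U])
    fix f assume f: "f \<in> forms (Suc k) ?U F"
    then show "alternating (Suc k) U f" using UU alternating_mono by (auto simp: forms_def)
    show "f v = \<zero>\<^bsub>W\<^esub>" if "H \<in> F" "v \<in> tuples (Suc k) (H \<inter> U)" for H v
      using f that tuples_mono[of "H \<inter> U" "H \<inter> ?U" "Suc k"] UU by (auto simp: forms_def)
  qed
  fix g assume g: "g \<in> forms (Suc k) U F"
  let ?S = "{f \<in> forms (Suc k) ?U F. restrict f (tuples (Suc k) U) = g}"
  show "card ?S \<le> card (forms k U (active U x F))"
  proof (cases "?S = {}")
    case False
    then obtain f0 where f0: "f0 \<in> forms (Suc k) ?U F" "restrict f0 (tuples (Suc k) U) = g" by auto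
    \<comment> \<open>The fibre has no distinguished point, so contractions are taken relative to
      some f0 in it.\<close>
    define \<Phi> where "\<Phi> f = (\<lambda>w\<in>tuples k U. f (case_nat x w) \<oplus>\<^bsub>W\<^esub> ?m \<odot>\<^bsub>W\<^esub> f0 (case_nat x w))" for f
    have agree: "f v = f0 v" if "f \<in> ?S" "v \<in> tuples (Suc k) U" for f v
    proof -
      have "restrict f (tuples (Suc k) U) v = restrict f0 (tuples (Suc k) U) v"
        using that(1) f0(2) by simp
      then show ?thesis using that(2) by simp
    qed
    have a0: "alternating (Suc k) ?U f0" using f0 by (auto simp: forms_def)
    show ?thesis
    proof (rule card_inj_on_le)
      show "finite (forms k U (active U x F))" by (rule finite_forms[OF U])
      show "inj_on \<Phi> ?S"
      proof (rule inj_onI)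
        fix f f' assume f: "f \<in> ?S" and f': "f' \<in> ?S" and eq: "\<Phi> f = \<Phi> f'"
        have a: "alternating (Suc k) ?U f" and a': "alternating (Suc k) ?U f'"
          using f f' by (auto simp: forms_def)
        have xw: "f (case_nat x w) = f' (case_nat x w)" if w: "w \<in> tuples k U" for w
        proof -
          have t: "case_nat x w \<in> tuples (Suc k) ?U"
            using tuples_SucI[OF xU] tuples_mono[OF UU, of k] w by auto
          have "\<Phi> f w = \<Phi> f' w" using eq by simp
          then show ?thesis using w t a a' a0 by (simp add: \<Phi>_def alternatingD(1))
        qed
        have z: "f v \<oplus>\<^bsub>W\<^esub> ?m \<odot>\<^bsub>W\<^esub> f' v = \<zero>\<^bsub>W\<^esub>" if v: "v \<in> tuples (Suc k) ?U" for v
        proof (rule alternating_zero_if_zero[OF U x alternating_diff[OF sU a a'] _ _ v])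
          fix v assume v: "v \<in> tuples (Suc k) U"
          then have v': "v \<in> tuples (Suc k) ?U" using tuples_mono[OF UU] by auto
          show "f v \<oplus>\<^bsub>W\<^esub> ?m \<odot>\<^bsub>W\<^esub> f' v = \<zero>\<^bsub>W\<^esub>"
            using agree[OF f v] agree[OF f' v] W_diff_eq alternatingD(1)[OF a v'] alternatingD(1)[OF a' v'] by simp
        next
          fix w assume w: "w \<in> tuples k U"
          then have t: "case_nat x w \<in> tuples (Suc k) ?U"
            using tuples_SucI[OF xU] tuples_mono[OF UU, of k] by auto
          show "f (case_nat x w) \<oplus>\<^bsub>W\<^esub> ?m \<odot>\<^bsub>W\<^esub> f' (case_nat x w) = \<zero>\<^bsub>W\<^esub>"
            using xw[OF w] W_diff_eq alternatingD(1)[OF a t] alternatingD(1)[OF a' t] by simp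
        qed
        show "f = f'"
        proof (rule extensionalityI[of _ "tuples (Suc k) ?U"])
          show "f \<in> extensional (tuples (Suc k) ?U)" "f' \<in> extensional (tuples (Suc k) ?U)"
            using f f' by (auto simp: forms_def)
          show "f v = f' v" if v: "v \<in> tuples (Suc k) ?U" for v
            using z[OF v] W_diff_eq[OF alternatingD(1)[OF a v] alternatingD(1)[OF a' v]] by simp
        qed
      qed
      show "\<Phi> ` ?S \<subseteq> forms k U (active U x F)"
      proof (rule image_subsetI)
        fix f assume f: "f \<in> ?S"
        then have a: "alternating (Suc k) ?U f" by (auto simp: forms_def)
        let ?d = "\<lambda>v. f v \<oplus>\<^bsub>W\<^esub> ?m \<odot>\<^bsub>W\<^esub> f0 v"
        have ad: "alternating (Suc k) ?U ?d" by (rule alternating_diff[OF sU a a0])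
        show "\<Phi> f \<in> forms k U (active U x F)"
          unfolding \<Phi>_def
        proof (rule restrict_in_forms[OF U])
          show "alternating k U (\<lambda>w. ?d (case_nat x w))"
            using alternating_mono[OF alternating_contract[OF ad xU] UU] .
          fix H w assume H: "H \<in> active U x F" and w: "w \<in> tuples k (H \<inter> U)"
          have HF: "H \<in> F" "sub H" using H F by (auto simp: active_def)
          obtain h where h: "h \<in> H" "h \<in> ?U" "h \<notin> U" using H by (auto simp: active_def)
          obtain u b where ub: "u \<in> U" "b \<in> carrier K" "h = u \<oplus>\<^bsub>V\<^esub> b \<odot>\<^bsub>V\<^esub> x"
            using h(2) extend_mem_iff[OF U x(1)] by auto
          have b0: "b \<noteq> \<zero>\<^bsub>K\<^esub>" using ub h(3) x(1) sub_carrier[OF U] by auto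
          have wU: "w \<in> tuples k U" "w \<in> tuples k ?U" "w \<in> tuples k (H \<inter> ?U)"
            using w tuples_mono[of "H \<inter> U" U k] tuples_mono[of "H \<inter> U" ?U k]
              tuples_mono[of "H \<inter> U" "H \<inter> ?U" k] UU by auto
          have t: "case_nat z w \<in> tuples (Suc k) ?U" if "z \<in> ?U" for z
            using tuples_SucI[OF that wU(2)] .
          have "f (case_nat h w) = \<zero>\<^bsub>W\<^esub>" "f0 (case_nat h w) = \<zero>\<^bsub>W\<^esub>"
            using f f0 HF tuples_SucI[OF _ wU(3), of h] h by (auto simp: forms_def)
          then have d1: "?d (case_nat h w) = \<zero>\<^bsub>W\<^esub>" by simp
          have uw: "case_nat u w \<in> tuples (Suc k) U" using tuples_SucI[OF ub(1) wU(1)] .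
          have d2: "?d (case_nat u w) = \<zero>\<^bsub>W\<^esub>"
            using agree[OF f uw] W_diff_eq alternatingD(1)[OF a0 t[of u]] ub UU by auto
          have "?d (case_nat h w) = ?d (case_nat u w) \<oplus>\<^bsub>W\<^esub> b \<odot>\<^bsub>W\<^esub> ?d (case_nat x w)"
          proof -
            have "?d ((case_nat x w)(0 := u \<oplus>\<^bsub>V\<^esub> b \<odot>\<^bsub>V\<^esub> x)) =
                ?d ((case_nat x w)(0 := u)) \<oplus>\<^bsub>W\<^esub> ?d ((case_nat x w)(0 := b \<odot>\<^bsub>V\<^esub> x))"
              using ub UU sub_smult[OF sU ub(2) xU] by (intro alternatingD(2)[OF ad t[OF xU]]) auto
            also have "?d ((case_nat x w)(0 := b \<odot>\<^bsub>V\<^esub> x)) = b \<odot>\<^bsub>W\<^esub> ?d ((case_nat x w)(0 := x))"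
              using ub xU by (intro alternatingD(3)[OF ad t[OF xU]]) auto
            finally show ?thesis by (simp only: case_nat_upd_0 ub(3))
          qed
          then have "b \<odot>\<^bsub>W\<^esub> ?d (case_nat x w) = \<zero>\<^bsub>W\<^esub>"
            using d1 d2 ub alternatingD(1)[OF ad t[OF xU]] by simp
          then have "inv\<^bsub>K\<^esub> b \<odot>\<^bsub>W\<^esub> (b \<odot>\<^bsub>W\<^esub> ?d (case_nat x w)) = \<zero>\<^bsub>W\<^esub>"
            using ub b0 by (simp add: field_Units)
          moreover have "inv\<^bsub>K\<^esub> b \<odot>\<^bsub>W\<^esub> (b \<odot>\<^bsub>W\<^esub> ?d (case_nat x w)) = ?d (case_nat x w)"
            using ub b0 alternatingD(1)[OF ad t[OF xU]]
            by (subst W.smult_assoc1[symmetric]) (auto simp: field_Units)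
          ultimately show "?d (case_nat x w) = \<zero>\<^bsub>W\<^esub>" by simp
        qed
      qed
    qed
  next
    case True
    then show ?thesis by (metis card.empty le0)
  qed
qed

end

section \<open>Counting conditions on forms\<close>

context finite_vectorspace
begin

text \<open>Induction along a chain from A to A + X that adds one vector of X at a time; that the
  new vector lies in X is what makes every space containing X active.\<close>

lemma sub_chain_induct:
  assumes A: "sub A" and X: "sub X" and base: "P A"
    and step: "\<And>U x. sub U \<Longrightarrow> A \<subseteq> U \<Longrightarrow> U \<subseteq> ssum A X \<Longrightarrow> x \<in> X \<Longrightarrow> x \<notin> U \<Longrightarrow> P U \<Longrightarrow> P (ssum U (line x))"
  shows "P (ssum A X)"
proof -
  let ?B = "ssum A X"
  have sB: "sub ?B" by (rule sub_ssum[OF A X])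
  define Q where "Q = {U. sub U \<and> A \<subseteq> U \<and> U \<subseteq> ?B \<and> P U}"
  have "finite Q" unfolding Q_def by (rule finite_subset[of _ "Pow ?B"]) (auto simp: finite_sub sB)
  moreover have "A \<in> Q" unfolding Q_def using A base ssum_upper1[OF A X] by auto
  ultimately obtain U where U: "U \<in> Q" "\<And>U'. U' \<in> Q \<Longrightarrow> U \<subseteq> U' \<Longrightarrow> U' = U"
    by (metis empty_iff finite_has_maximal)
  have sU: "sub U" "A \<subseteq> U" "U \<subseteq> ?B" "P U" using U(1) by (auto simp: Q_def)
  have "X \<subseteq> U"
  proof (rule ccontr)
    assume "\<not> X \<subseteq> U"
    then obtain x where x: "x \<in> X" "x \<notin> U" by auto
    have xc: "x \<in> carrier V" using x X sub_carrier by auto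
    let ?U = "ssum U (line x)"
    have UU: "U \<subseteq> ?U" by (rule ssum_upper1[OF sU(1) sub_line[OF xc]])
    have "line x \<subseteq> ?B" using ssum_upper2[OF A X] x by (intro line_least[OF sB]) auto
    then have "?U \<subseteq> ?B" using sU by (intro ssum_least[OF sB]) auto
    then have "?U \<in> Q"
      unfolding Q_def using step[OF sU(1,2,3) x sU(4)] sub_ssum[OF sU(1) sub_line[OF xc]] UU sU by auto
    then have "?U = U" using U(2) UU by blast
    then show False using x(2) ssum_upper2[OF sU(1) sub_line[OF xc]] line_self[OF xc] by blast
  qed
  then have "?B \<subseteq> U" using sU by (intro ssum_least[OF sU(1)]) auto
  then show ?thesis using sU by (metis subset_antisym)
qed

end

context alternating_forms
begin

definition lg :: "real \<Rightarrow> real" where "lg = log (real (card (carrier W)))"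

text \<open>The number of W-valued conditions that F imposes on forms on U: by
  \<open>card_forms_empty\<close> the first term is \<open>lg\<close> of the number of all
  forms.\<close>

definition codim :: "nat \<Rightarrow> 'c set \<Rightarrow> 'c set set \<Rightarrow> real" where
  "codim k U F = real (sdim U choose k) - lg (card (forms k U F))"

lemma lg_mult: "0 < x \<Longrightarrow> 0 < y \<Longrightarrow> lg (x * y) = lg x + lg y"
  and lg_mono: "0 < x \<Longrightarrow> x \<le> y \<Longrightarrow> lg x \<le> lg y"
  and lg_self: "lg (real (card (carrier W))) = 1"
  and lg_1: "lg 1 = 0"
  using card_W by (auto simp: lg_def log_mult)

text \<open>Take logarithms in \<open>card_forms_step\<close>; Pascal's rule for the dimension of
  \<open>ssum U (line x)\<close> matches the two factors.\<close>

lemma codim_step: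
  assumes U: "sub U" and x: "x \<in> carrier V" "x \<notin> U" and F: "\<And>H. H \<in> F \<Longrightarrow> sub H"
  shows "codim (Suc k) (ssum U (line x)) F \<ge> codim (Suc k) U F + codim k U (active U x F)"
proof -
  let ?U = "ssum U (line x)"
  have sU: "sub ?U" by (rule sub_ssum[OF U sub_line[OF x(1)]])
  have "lg (card (forms (Suc k) ?U F)) \<le> lg (real (card (forms (Suc k) U F)) * real (card (forms k U (active U x F))))"
    using card_forms_step[OF U x F, of F k] card_forms_pos[OF sU]
    by (intro lg_mono) (auto simp flip: of_nat_mult)
  also have "\<dots> = lg (card (forms (Suc k) U F)) + lg (card (forms k U (active U x F)))"
    using card_forms_pos[OF U] by (intro lg_mult) auto
  finally show ?thesis unfolding codim_def using sdim_extend[OF U x] by simp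
qed

lemma card_forms_0_le: "card (forms 0 U F) \<le> card (carrier W)"
proof -
  have "card (forms 0 U F) \<le> card (tuples 0 U \<rightarrow>\<^sub>E carrier W)"
    by (rule card_mono[OF _ forms_subset_PiE]) (auto simp: tuples_0 finite_W intro!: finite_PiE)
  then show ?thesis by (simp add: tuples_0 card_PiE)
qed

lemma codim_0_nonneg: "sub U \<Longrightarrow> codim 0 U F \<ge> 0"
  using lg_mono[of "card (forms 0 U F)" "card (carrier W)"] card_forms_0_le[of U F] card_forms_pos[of U 0 F]
  by (simp add: codim_def lg_self)

text \<open>A form of degree 0 is a single value at the empty tuple, which any member of F forces to
  be zero.\<close>

lemma codim_0_nonempty:
  assumes U: "sub U" and F: "F \<noteq> {}" shows "codim 0 U F = 1"
proof -
  have "forms 0 U F \<subseteq> {restrict (\<lambda>_. \<zero>\<^bsub>W\<^esub>) (tuples 0 U)}"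
  proof
    fix f assume f: "f \<in> forms 0 U F"
    obtain H where H: "H \<in> F" using F by auto
    have "f = restrict (\<lambda>_. \<zero>\<^bsub>W\<^esub>) (tuples 0 U)"
    proof (rule extensionalityI[of _ "tuples 0 U"])
      show "f v = restrict (\<lambda>_. \<zero>\<^bsub>W\<^esub>) (tuples 0 U) v" if "v \<in> tuples 0 U" for v
        using f H that by (auto simp: forms_def tuples_0)
    qed (use f in \<open>auto simp: forms_def\<close>)
    then show "f \<in> {restrict (\<lambda>_. \<zero>\<^bsub>W\<^esub>) (tuples 0 U)}" by simp
  qed
  then have "card (forms 0 U F) \<le> card {restrict (\<lambda>_. \<zero>\<^bsub>W\<^esub>) (tuples 0 U)}"
    by (intro card_mono) auto
  then have "card (forms 0 U F) = 1" using card_forms_pos[OF U, of 0 F] by simp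
  then show ?thesis by (simp add: codim_def lg_1)
qed

lemma alternating_zero_arg:
  assumes U: "sub U" and f: "alternating k U f" and v: "v \<in> tuples k U" "i < k" "v i = \<zero>\<^bsub>V\<^esub>"
  shows "f v = \<zero>\<^bsub>W\<^esub>"
proof -
  have "v = v(i := \<zero>\<^bsub>K\<^esub> \<odot>\<^bsub>V\<^esub> \<zero>\<^bsub>V\<^esub>)" using v(3) by auto
  then have "f v = \<zero>\<^bsub>K\<^esub> \<odot>\<^bsub>W\<^esub> f (v(i := \<zero>\<^bsub>V\<^esub>))"
    using alternatingD(3)[OF f v(1,2), of "\<zero>\<^bsub>K\<^esub>" "\<zero>\<^bsub>V\<^esub>"] sub_zero[OF U] by simp
  then show ?thesis using alternatingD(1)[OF f tuples_upd[OF v(1,2) sub_zero[OF U]]] by simp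
qed

lemma codim_Suc_triv: "codim (Suc k) {\<zero>\<^bsub>V\<^esub>} F = 0"
proof -
  have "forms (Suc k) {\<zero>\<^bsub>V\<^esub>} F \<subseteq> {restrict (\<lambda>_. \<zero>\<^bsub>W\<^esub>) (tuples (Suc k) {\<zero>\<^bsub>V\<^esub>})}"
  proof
    fix f assume f: "f \<in> forms (Suc k) {\<zero>\<^bsub>V\<^esub>} F"
    have "f = restrict (\<lambda>_. \<zero>\<^bsub>W\<^esub>) (tuples (Suc k) {\<zero>\<^bsub>V\<^esub>})"
    proof (rule extensionalityI[of _ "tuples (Suc k) {\<zero>\<^bsub>V\<^esub>}"])
      fix v assume v: "v \<in> tuples (Suc k) {\<zero>\<^bsub>V\<^esub>}"
      have "f v = \<zero>\<^bsub>W\<^esub>"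
        using f tuples_nth[OF v, of 0] by (intro alternating_zero_arg[OF sub_triv _ v, of _ 0]) (auto simp: forms_def)
      then show "f v = restrict (\<lambda>_. \<zero>\<^bsub>W\<^esub>) (tuples (Suc k) {\<zero>\<^bsub>V\<^esub>}) v" using v by simp
    qed (use f in \<open>auto simp: forms_def\<close>)
    then show "f \<in> {restrict (\<lambda>_. \<zero>\<^bsub>W\<^esub>) (tuples (Suc k) {\<zero>\<^bsub>V\<^esub>})}" by simp
  qed
  then have "card (forms (Suc k) {\<zero>\<^bsub>V\<^esub>} F) \<le> card {restrict (\<lambda>_. \<zero>\<^bsub>W\<^esub>) (tuples (Suc k) {\<zero>\<^bsub>V\<^esub>})}"
    by (intro card_mono) auto
  then have "card (forms (Suc k) {\<zero>\<^bsub>V\<^esub>} F) = 1" using card_forms_pos[OF sub_triv, of "Suc k" F] by simp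
  then show ?thesis by (simp add: codim_def lg_1 sdim_triv)
qed

lemma codim_nonneg:
  assumes U: "sub U" and F: "\<And>H. H \<in> F \<Longrightarrow> sub H" shows "codim k U F \<ge> 0"
  using assms
proof (induction k arbitrary: U F)
  case (Suc k)
  have "codim (Suc k) (ssum {\<zero>\<^bsub>V\<^esub>} U) F \<ge> 0"
  proof (rule sub_chain_induct[OF sub_triv Suc.prems(1)])
    fix U' x assume U': "sub U'" "x \<in> U" "x \<notin> U'" "0 \<le> codim (Suc k) U' F"
    have "codim k U' (active U' x F) \<ge> 0"
      using Suc.prems by (intro Suc.IH U') (auto simp: active_def)
    then show "0 \<le> codim (Suc k) (ssum U' (line x)) F"
      using codim_step[of U' x F k] U' Suc.prems sub_carrier[OF Suc.prems(1)] by fastforce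
  qed (simp add: codim_Suc_triv)
  then show ?case using ssum_triv_left[OF Suc.prems(1)] by simp
qed (simp add: codim_0_nonneg)

lemma codim_mono_space:
  assumes U: "sub U" "sub U'" "U \<subseteq> U'" and F: "\<And>H. H \<in> F \<Longrightarrow> sub H"
  shows "codim (Suc k) U F \<le> codim (Suc k) U' F"
proof -
  have "codim (Suc k) U F \<le> codim (Suc k) (ssum U U') F"
  proof (rule sub_chain_induct[OF U(1,2)])
    fix U'' x assume *: "sub U''" "x \<in> U'" "x \<notin> U''" "codim (Suc k) U F \<le> codim (Suc k) U'' F"
    have "codim k U'' (active U'' x F) \<ge> 0" using F by (intro codim_nonneg *) (auto simp: active_def)
    then show "codim (Suc k) U F \<le> codim (Suc k) (ssum U'' (line x)) F"
      using codim_step[of U'' x F k] * F sub_carrier[OF U(2)] by fastforce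
  qed simp
  then show ?thesis using ssum_absorb[OF U(2,1,3)] ssum_commute[OF U(1,2)] by simp
qed

text \<open>The bound for one member in degree k, stated as a predicate because
  \<open>codim_adjoin\<close> turns it into a bound in degree k + 1 and thereby drives the induction
  that proves it.\<close>

definition single_bound :: "nat \<Rightarrow> bool" where
  "single_bound k \<longleftrightarrow> (\<forall>U F B. sub U \<longrightarrow> (\<forall>H\<in>F. sub H) \<longrightarrow> B \<in> F \<longrightarrow>
     codim k U F \<ge> real (sdim (B \<inter> U) choose k))"

text \<open>Each vector of X outside the current space activates B and adds the degree k bound for
  B; along the chain these terms sum by Pascal's rule to a difference of binomial
  coefficients.\<close>

lemma codim_adjoin:
  assumes single: "single_bound k" and U: "sub U" and F: "\<And>H. H \<in> F \<Longrightarrow> sub H"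
    and B: "B \<in> F" and X: "sub X" "X \<subseteq> B"
  shows "codim (Suc k) (ssum U X) F \<ge>
    codim (Suc k) U F + real (sdim (B \<inter> ssum U X) choose Suc k) - real (sdim (B \<inter> U) choose Suc k)"
proof (rule sub_chain_induct[OF U X(1)])
  fix U' x assume U': "sub U'" "x \<in> X" "x \<notin> U'"
    and IH: "codim (Suc k) U' F \<ge>
      codim (Suc k) U F + real (sdim (B \<inter> U') choose Suc k) - real (sdim (B \<inter> U) choose Suc k)"
  let ?U = "ssum U' (line x)"
  have xc: "x \<in> carrier V" using U' X sub_carrier by auto
  have xU: "x \<in> ?U" using ssum_upper2[OF U'(1) sub_line[OF xc]] line_self[OF xc] by auto
  have "B \<in> active U' x F" using B U' X xU by (auto simp: active_def)
  then have "codim k U' (active U' x F) \<ge> real (sdim (B \<inter> U') choose k)"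
    using single U' F unfolding single_bound_def by (simp add: active_def)
  moreover have "sdim (B \<inter> ?U) = Suc (sdim (B \<inter> U'))"
    using U' xc F[OF B] X xU by (intro sdim_Int_extend_active) auto
  ultimately show "codim (Suc k) ?U F \<ge>
      codim (Suc k) U F + real (sdim (B \<inter> ?U) choose Suc k) - real (sdim (B \<inter> U) choose Suc k)"
    using IH codim_step[OF U'(1) xc U'(3) F, of F k] by simp
qed simp

lemma single_bound: "single_bound k"
proof (induction k)
  case 0
  have "codim 0 U F = 1" if "sub U" "B \<in> F" for U F B
    using codim_0_nonempty[OF that(1), of F] that(2) by blast
  then show ?case unfolding single_bound_def by (metis binomial_n_0 of_nat_1 order_refl)
next
  case (Suc k)
  show ?case unfolding single_bound_def
  proof (intro allI impI)
    fix U F B assume U: "sub U" and F: "\<forall>H\<in>F. sub H" and B: "B \<in> F"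
    have BU: "sub (B \<inter> U)" using U F B sub_Int by auto
    have "codim (Suc k) (ssum {\<zero>\<^bsub>V\<^esub>} (B \<inter> U)) F \<ge> codim (Suc k) {\<zero>\<^bsub>V\<^esub>} F
        + real (sdim (B \<inter> ssum {\<zero>\<^bsub>V\<^esub>} (B \<inter> U)) choose Suc k) - real (sdim (B \<inter> {\<zero>\<^bsub>V\<^esub>}) choose Suc k)"
      using F B by (intro codim_adjoin Suc sub_triv BU) auto
    moreover have "B \<inter> {\<zero>\<^bsub>V\<^esub>} = {\<zero>\<^bsub>V\<^esub>}" using sub_zero F B by auto
    moreover have "B \<inter> (B \<inter> U) = B \<inter> U" by auto
    ultimately have "codim (Suc k) (B \<inter> U) F \<ge> real (sdim (B \<inter> U) choose Suc k)"
      by (simp add: ssum_triv_left[OF BU] codim_Suc_triv sdim_triv)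
    also have "codim (Suc k) (B \<inter> U) F \<le> codim (Suc k) U F"
      using F by (intro codim_mono_space BU U) auto
    finally show "codim (Suc k) U F \<ge> real (sdim (B \<inter> U) choose Suc k)" .
  qed
qed

lemma codim_single:
  "sub U \<Longrightarrow> (\<And>H. H \<in> F \<Longrightarrow> sub H) \<Longrightarrow> B \<in> F \<Longrightarrow> codim k U F \<ge> real (sdim (B \<inter> U) choose k)"
  using single_bound[of k] unfolding single_bound_def by auto

text \<open>Inclusion-exclusion: build up B \<inter> U first and then adjoin B' \<inter> U, whose
  part inside B \<inter> U has already been paid for.\<close>

lemma codim_pair:
  assumes U: "sub U" and F: "\<And>H. H \<in> F \<Longrightarrow> sub H" and B: "B \<in> F" "B' \<in> F"
  shows "codim k U F \<ge> real (sdim (B \<inter> U) choose k) + real (sdim (B' \<inter> U) choose k)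
    - real (sdim (B \<inter> B' \<inter> U) choose k)"
proof (cases k)
  case 0
  have "codim 0 U F = 1" using codim_0_nonempty[OF U, of F] B by blast
  then show ?thesis using 0 by simp
next
  case (Suc l)
  have BU: "sub (B \<inter> U)" "sub (B' \<inter> U)" using U F B sub_Int by auto
  let ?S = "ssum (B \<inter> U) (B' \<inter> U)"
  have S: "sub ?S" by (rule sub_ssum[OF BU])
  have SU: "?S \<subseteq> U" by (rule ssum_least[OF U]) auto
  have "codim (Suc l) (B \<inter> U) F \<ge> real (sdim (B \<inter> (B \<inter> U)) choose Suc l)"
    by (rule codim_single[OF BU(1) F B(1)])
  moreover have "B \<inter> (B \<inter> U) = B \<inter> U" by auto
  moreover have "codim (Suc l) ?S F \<ge>
    codim (Suc l) (B \<inter> U) F + real (sdim (B' \<inter> ?S) choose Suc l) - real (sdim (B' \<inter> (B \<inter> U)) choose Suc l)"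
    by (rule codim_adjoin[OF single_bound BU(1) F B(2) BU(2)]) auto
  moreover have "B' \<inter> ?S = B' \<inter> U" using SU ssum_upper2[OF BU] by auto
  moreover have "B' \<inter> (B \<inter> U) = B \<inter> B' \<inter> U" by auto
  moreover have "codim (Suc l) ?S F \<le> codim (Suc l) U F" by (rule codim_mono_space[OF S U SU F])
  ultimately show ?thesis using Suc by simp
qed

text \<open>Adjoining a vector \<open>x \<in> X \<inter> (U + H)\<close> activates both \<open>X\<close> and \<open>H\<close>; the sum collects the
  contribution of \<open>H\<close> not already accounted for by \<open>X\<close>.\<close>

lemma codim_adjoin_pair:
  assumes U: "sub U" and F: "\<And>H. H \<in> F \<Longrightarrow> sub H" and XH: "X \<in> F" "H \<in> F"
    and Y: "sub Y" "Y \<subseteq> X" "Y \<subseteq> ssum U H"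
  defines "\<beta> \<equiv> sdim (H \<inter> U)" and "z \<equiv> sdim (X \<inter> H \<inter> U)" and "d \<equiv> sdim (X \<inter> H)"
  shows "codim (Suc k) (ssum U Y) F \<ge> codim (Suc k) U F
    + real (sdim (X \<inter> ssum U Y) choose Suc k) - real (sdim (X \<inter> U) choose Suc k)
    + (\<Sum>y\<in>{\<beta>..<sdim (H \<inter> ssum U Y)}. real (y choose k) - real (min d (z + y - \<beta>) choose k))"
proof -
  \<comment> \<open>The invariant records that the trace of X \<inter> H, starting from z, grows no
    faster than that of H; together with d this limits what inclusion-exclusion takes away at level
    y.\<close>
  define P where "P U' \<longleftrightarrow> \<beta> \<le> sdim (H \<inter> U') \<and> sdim (X \<inter> H \<inter> U') \<le> z + sdim (H \<inter> U') - \<beta> \<and>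
    codim (Suc k) U' F \<ge> codim (Suc k) U F
    + real (sdim (X \<inter> U') choose Suc k) - real (sdim (X \<inter> U) choose Suc k)
    + (\<Sum>y\<in>{\<beta>..<sdim (H \<inter> U')}. real (y choose k) - real (min d (z + y - \<beta>) choose k))" for U'
  have sXH: "sub X" "sub H" "sub (X \<inter> H)" using F XH sub_Int by auto
  have "P (ssum U Y)"
  proof (rule sub_chain_induct[OF U Y(1)])
    show "P U" unfolding P_def by (simp add: \<beta>_def z_def)
  next
    fix U' x assume U': "sub U'" "U \<subseteq> U'" "x \<in> Y" "x \<notin> U'" and IH: "P U'"
    let ?U = "ssum U' (line x)"
    have xc: "x \<in> carrier V" using U' Y sub_carrier by auto
    have xU: "x \<in> ?U" using ssum_upper2[OF U'(1) sub_line[OF xc]] line_self[OF xc] by auto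
    have sU: "sub ?U" by (rule sub_ssum[OF U'(1) sub_line[OF xc]])
    have UU: "U' \<subseteq> ?U" by (rule ssum_upper1[OF U'(1) sub_line[OF xc]])
    \<comment> \<open>The component h of x in H is new as well, so this one step enlarges the traces
      of both X and H.\<close>
    have "x \<in> ssum U H" using U' Y by auto
    then obtain u h where uh: "u \<in> U" "h \<in> H" "x = u \<oplus>\<^bsub>V\<^esub> h" by (rule ssumE)
    have uhc: "u \<in> carrier V" "h \<in> carrier V" using uh U sXH sub_carrier by auto
    have "h = \<ominus>\<^bsub>V\<^esub> u \<oplus>\<^bsub>V\<^esub> x" using uh uhc by (simp add: M.r_neg1)
    moreover have "u \<in> ?U" using uh U' UU by auto
    ultimately have h1: "h \<in> ?U" using sub_add[OF sU sub_neg[OF sU] xU] by simp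
    have h2: "h \<notin> U'"
      using uh U' sub_add[OF U'(1)] by auto
    have aX: "\<not> X \<inter> ?U \<subseteq> U'" and aH: "\<not> H \<inter> ?U \<subseteq> U'" using U' Y xU h1 h2 uh by auto
    have dX: "sdim (X \<inter> ?U) = Suc (sdim (X \<inter> U'))" by (rule sdim_Int_extend_active[OF U'(1) sXH(1) xc U'(4) aX])
    have dH: "sdim (H \<inter> ?U) = Suc (sdim (H \<inter> U'))" by (rule sdim_Int_extend_active[OF U'(1) sXH(2) xc U'(4) aH])
    have dXH: "sdim (X \<inter> H \<inter> ?U) \<le> Suc (sdim (X \<inter> H \<inter> U'))"
      by (rule sdim_Int_extend_le[OF U'(1) sXH(3) xc U'(4)])
    let ?y = "sdim (H \<inter> U')"
    have "codim k U' (active U' x F) \<ge> real (sdim (X \<inter> U') choose k) + real (?y choose k) - real (sdim (X \<inter> H \<inter> U') choose k)"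
      using F aX aH XH by (intro codim_pair[OF U'(1)]) (auto simp: active_def)
    moreover have "sdim (X \<inter> H \<inter> U') \<le> min d (z + ?y - \<beta>)"
      using IH sdim_mono[of "X \<inter> H \<inter> U'" "X \<inter> H"] sXH U' by (auto simp: P_def d_def sub_Int)
    then have "real (sdim (X \<inter> H \<inter> U') choose k) \<le> real (min d (z + ?y - \<beta>) choose k)"
      by (intro of_nat_mono binomial_right_mono)
    ultimately have "codim (Suc k) ?U F \<ge> codim (Suc k) U' F + real (sdim (X \<inter> U') choose k)
        + (real (?y choose k) - real (min d (z + ?y - \<beta>) choose k))"
      using codim_step[OF U'(1) xc U'(4) F, of F k] by simp
    moreover have "sdim (X \<inter> H \<inter> ?U) \<le> z + Suc ?y - \<beta>" "\<beta> \<le> Suc ?y"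
      using IH dXH unfolding P_def by linarith+
    ultimately show "P ?U" using IH unfolding P_def dX dH by (simp add: algebra_simps)
  qed
  then show ?thesis by (simp add: P_def)
qed

end

section \<open>Extension of forms\<close>

context finite_vectorspace
begin

text \<open>The choice is unique when x lies outside U, see \<open>split_vec_eq\<close>; this makes
  both components linear in z.\<close>

definition split_vec :: "'c set \<Rightarrow> 'c \<Rightarrow> 'c \<Rightarrow> 'c \<times> 'a" where
  "split_vec U x z = (SOME p. fst p \<in> U \<and> snd p \<in> carrier K \<and> z = fst p \<oplus>\<^bsub>V\<^esub> snd p \<odot>\<^bsub>V\<^esub> x)"

lemma split_vec_eq:
  assumes U: "sub U" and x: "x \<in> carrier V" "x \<notin> U" and ua: "u \<in> U" "a \<in> carrier K"
  shows "split_vec U x (u \<oplus>\<^bsub>V\<^esub> a \<odot>\<^bsub>V\<^esub> x) = (u, a)"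
  unfolding split_vec_def
proof (rule some_equality)
  fix p assume p: "fst p \<in> U \<and> snd p \<in> carrier K \<and> u \<oplus>\<^bsub>V\<^esub> a \<odot>\<^bsub>V\<^esub> x = fst p \<oplus>\<^bsub>V\<^esub> snd p \<odot>\<^bsub>V\<^esub> x"
  obtain u' b where ub: "p = (u', b)" by (cases p)
  have c: "u \<in> carrier V" "u' \<in> carrier V" "b \<in> carrier K" "u' \<in> U" using ua p ub sub_carrier[OF U] by auto
  have eq: "u \<oplus>\<^bsub>V\<^esub> a \<odot>\<^bsub>V\<^esub> x = u' \<oplus>\<^bsub>V\<^esub> b \<odot>\<^bsub>V\<^esub> x" using p ub by simp
  have "(a \<ominus>\<^bsub>K\<^esub> b) \<odot>\<^bsub>V\<^esub> x = a \<odot>\<^bsub>V\<^esub> x \<oplus>\<^bsub>V\<^esub> \<ominus>\<^bsub>V\<^esub> (b \<odot>\<^bsub>V\<^esub> x)"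
    using c ua x by (simp add: R.minus_eq smult_l_distr smult_l_minus)
  also have "\<dots> = \<ominus>\<^bsub>V\<^esub> u \<oplus>\<^bsub>V\<^esub> (u \<oplus>\<^bsub>V\<^esub> a \<odot>\<^bsub>V\<^esub> x) \<oplus>\<^bsub>V\<^esub> \<ominus>\<^bsub>V\<^esub> (b \<odot>\<^bsub>V\<^esub> x)"
    using c ua x by (simp add: M.r_neg1)
  also have "\<dots> = \<ominus>\<^bsub>V\<^esub> u \<oplus>\<^bsub>V\<^esub> (u' \<oplus>\<^bsub>V\<^esub> b \<odot>\<^bsub>V\<^esub> x) \<oplus>\<^bsub>V\<^esub> \<ominus>\<^bsub>V\<^esub> (b \<odot>\<^bsub>V\<^esub> x)" by (simp only: eq)
  also have "\<dots> = \<ominus>\<^bsub>V\<^esub> u \<oplus>\<^bsub>V\<^esub> u'"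
    using c ua x by (simp add: M.a_assoc M.r_neg)
  finally have e2: "(a \<ominus>\<^bsub>K\<^esub> b) \<odot>\<^bsub>V\<^esub> x = \<ominus>\<^bsub>V\<^esub> u \<oplus>\<^bsub>V\<^esub> u'" .
  then have "(a \<ominus>\<^bsub>K\<^esub> b) \<odot>\<^bsub>V\<^esub> x \<in> U" using ua c U sub_add sub_neg by simp
  then have ab: "a \<ominus>\<^bsub>K\<^esub> b = \<zero>\<^bsub>K\<^esub>"
    using smult_mem_iff[OF U x(1), of "a \<ominus>\<^bsub>K\<^esub> b"] x(2) ua c by auto
  then have "a = b" using ua c by simp
  moreover have "\<ominus>\<^bsub>V\<^esub> u \<oplus>\<^bsub>V\<^esub> u' = \<zero>\<^bsub>V\<^esub>" using e2 ab x by simp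
  then have "u = u'" using c M.minus_equality[of "\<ominus>\<^bsub>V\<^esub> u" u'] M.a_comm[of "\<ominus>\<^bsub>V\<^esub> u" u'] M.minus_minus by (metis M.a_inv_closed)
  ultimately show "p = (u, a)" using ub by simp
qed (use ua in simp)

end

context alternating_forms
begin

abbreviation "proj U x z \<equiv> fst (split_vec U x z)"
abbreviation "coef U x z \<equiv> snd (split_vec U x z)"

abbreviation wneg :: "'e \<Rightarrow> 'e" where "wneg w \<equiv> (\<ominus>\<^bsub>K\<^esub> \<one>\<^bsub>K\<^esub>) \<odot>\<^bsub>W\<^esub> w"

lemma wneg_eq: "w \<in> carrier W \<Longrightarrow> wneg w = \<ominus>\<^bsub>W\<^esub> w"
  by (simp add: W.smult_l_minus)

definition projs :: "'c set \<Rightarrow> 'c \<Rightarrow> nat \<Rightarrow> (nat \<Rightarrow> 'c) \<Rightarrow> nat \<Rightarrow> 'c" where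
  "projs U x k v = (\<lambda>i\<in>{..<k}. proj U x (v i))"

text \<open>\<open>extend k \<omega> \<eta>\<close> is the alternating form on \<open>U + \<langle>x\<rangle>\<close> that restricts to \<open>\<omega>\<close> on \<open>U\<close> and whose
  contraction by \<open>x\<close> restricts to \<open>\<eta>\<close>; expanding along the first argument avoids signed sums.\<close>

primrec extend :: "'c set \<Rightarrow> 'c \<Rightarrow> nat \<Rightarrow> ((nat \<Rightarrow> 'c) \<Rightarrow> 'e) \<Rightarrow> ((nat \<Rightarrow> 'c) \<Rightarrow> 'e) \<Rightarrow> (nat \<Rightarrow> 'c) \<Rightarrow> 'e" where
  "extend U x 0 = (\<lambda>\<omega> \<eta> v. \<omega> v)"
| "extend U x (Suc k) = (\<lambda>\<omega> \<eta> v.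
     coef U x (v 0) \<odot>\<^bsub>W\<^esub> \<eta> (projs U x k (\<lambda>i. v (Suc i))) \<oplus>\<^bsub>W\<^esub>
     extend U x k (\<lambda>w. \<omega> (case_nat (proj U x (v 0)) w)) (\<lambda>w. wneg (\<eta> (case_nat (proj U x (v 0)) w)))
       (\<lambda>i. v (Suc i)))"

context
  fixes U x
  assumes U: "sub U" and x: "x \<in> carrier V" "x \<notin> U"
begin

lemma sU: "sub (ssum U (line x))" by (rule sub_ssum[OF U sub_line[OF x(1)]])

lemma split_add:
  assumes "y \<in> ssum U (line x)" "z \<in> ssum U (line x)"
  shows "proj U x y \<in> U" "coef U x y \<in> carrier K"
    "proj U x (y \<oplus>\<^bsub>V\<^esub> z) = proj U x y \<oplus>\<^bsub>V\<^esub> proj U x z"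
    "coef U x (y \<oplus>\<^bsub>V\<^esub> z) = coef U x y \<oplus>\<^bsub>K\<^esub> coef U x z"
proof -
  obtain u a u' a' where *: "u \<in> U" "a \<in> carrier K" "y = u \<oplus>\<^bsub>V\<^esub> a \<odot>\<^bsub>V\<^esub> x"
    "u' \<in> U" "a' \<in> carrier K" "z = u' \<oplus>\<^bsub>V\<^esub> a' \<odot>\<^bsub>V\<^esub> x"
    using assms extend_mem_iff[OF U x(1)] by auto
  have c: "u \<in> carrier V" "u' \<in> carrier V" using * sub_carrier[OF U] by auto
  have "y \<oplus>\<^bsub>V\<^esub> z = (u \<oplus>\<^bsub>V\<^esub> u') \<oplus>\<^bsub>V\<^esub> (a \<oplus>\<^bsub>K\<^esub> a') \<odot>\<^bsub>V\<^esub> x"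
    using * c x by (simp add: smult_l_distr M.a_ac)
  then show "proj U x y \<in> U" "coef U x y \<in> carrier K"
    "proj U x (y \<oplus>\<^bsub>V\<^esub> z) = proj U x y \<oplus>\<^bsub>V\<^esub> proj U x z"
    "coef U x (y \<oplus>\<^bsub>V\<^esub> z) = coef U x y \<oplus>\<^bsub>K\<^esub> coef U x z"
    using * by (simp_all add: split_vec_eq[OF U x] sub_add[OF U])
qed

lemma split_mem:
  assumes "y \<in> ssum U (line x)" shows "proj U x y \<in> U" "coef U x y \<in> carrier K"
  using split_add(1,2)[OF assms assms] .

lemma split_smult:
  assumes "y \<in> ssum U (line x)" "b \<in> carrier K"
  shows "proj U x (b \<odot>\<^bsub>V\<^esub> y) = b \<odot>\<^bsub>V\<^esub> proj U x y"
    "coef U x (b \<odot>\<^bsub>V\<^esub> y) = b \<otimes>\<^bsub>K\<^esub> coef U x y"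
proof -
  obtain u a where *: "u \<in> U" "a \<in> carrier K" "y = u \<oplus>\<^bsub>V\<^esub> a \<odot>\<^bsub>V\<^esub> x"
    using assms extend_mem_iff[OF U x(1)] by auto
  have c: "u \<in> carrier V" using * sub_carrier[OF U] by auto
  have "b \<odot>\<^bsub>V\<^esub> y = b \<odot>\<^bsub>V\<^esub> u \<oplus>\<^bsub>V\<^esub> (b \<otimes>\<^bsub>K\<^esub> a) \<odot>\<^bsub>V\<^esub> x"
    using * c x assms by (simp add: smult_r_distr smult_assoc1)
  then show "proj U x (b \<odot>\<^bsub>V\<^esub> y) = b \<odot>\<^bsub>V\<^esub> proj U x y"
    "coef U x (b \<odot>\<^bsub>V\<^esub> y) = b \<otimes>\<^bsub>K\<^esub> coef U x y"
    using * assms by (simp_all add: split_vec_eq[OF U x] sub_smult[OF U])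
qed

lemma split_U:
  assumes "u \<in> U" shows "proj U x u = u" "coef U x u = \<zero>\<^bsub>K\<^esub>"
  using split_vec_eq[OF U x assms, of "\<zero>\<^bsub>K\<^esub>"] x sub_carrier[OF U assms] by simp_all

lemma split_x: "proj U x x = \<zero>\<^bsub>V\<^esub>" "coef U x x = \<one>\<^bsub>K\<^esub>"
  using split_vec_eq[OF U x sub_zero[OF U], of "\<one>\<^bsub>K\<^esub>"] x by simp_all

lemma proj_tuple:
  "v \<in> tuples k (ssum U (line x)) \<Longrightarrow> (projs U x k v) \<in> tuples k U"
  using tuples_nth[of v k] by (auto simp: projs_def tuples_def intro: split_mem)

lemma proj_tuple_id: "v \<in> tuples k U \<Longrightarrow> (projs U x k v) = v"
  using tuples_nth[of v k U] by (auto simp: projs_def tuples_def PiE_def extensional_def split_U fun_eq_iff)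

lemma alternating_pullback:
  assumes f: "alternating k U \<eta>"
  shows "alternating k (ssum U (line x)) (\<lambda>v. \<eta> (projs U x k v))"
  unfolding alternating_def
proof (intro conjI ballI allI impI)
  fix v assume v: "v \<in> tuples k (ssum U (line x))"
  note t = proj_tuple[OF v]
  have upd: "(projs U x k (v(i := y))) = (projs U x k v)(i := proj U x y)" if "i < k" for i y
    using that by (auto simp: projs_def)
  show "\<eta> (projs U x k v) \<in> carrier W" by (rule alternatingD(1)[OF f t])
  show "\<eta> (projs U x k (v(i := y \<oplus>\<^bsub>V\<^esub> z))) =
      \<eta> (projs U x k (v(i := y))) \<oplus>\<^bsub>W\<^esub> \<eta> (projs U x k (v(i := z)))"
    if "i < k" "y \<in> ssum U (line x)" "z \<in> ssum U (line x)" for i y z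
    unfolding upd[OF that(1)] split_add(3)[OF that(2,3)]
    by (rule alternatingD(2)[OF f t that(1)]) (use that split_mem in auto)
  show "\<eta> (projs U x k (v(i := b \<odot>\<^bsub>V\<^esub> y))) =
      b \<odot>\<^bsub>W\<^esub> \<eta> (projs U x k (v(i := y)))"
    if "i < k" "b \<in> carrier K" "y \<in> ssum U (line x)" for i b y
    unfolding upd[OF that(1)] split_smult(1)[OF that(3,2)]
    by (rule alternatingD(3)[OF f t that(1)]) (use that split_mem in auto)
  show "\<eta> (projs U x k v) = \<zero>\<^bsub>W\<^esub>" if "i < k" "j < k" "i \<noteq> j" "v i = v j" for i j
    using alternatingD(4)[OF f t that(1-3)] that by (simp add: projs_def)
qed

text \<open>Since \<eta> has degree one less than \<omega>, assumptions on it are stated for k = Suc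
  l; in degree 0 there is nothing to assume.\<close>

lemma extend_cong:
  assumes "v \<in> tuples k (ssum U (line x))" "\<And>w. w \<in> tuples k U \<Longrightarrow> \<omega> w = \<omega>' w"
    "\<And>l w. k = Suc l \<Longrightarrow> w \<in> tuples l U \<Longrightarrow> \<eta> w = \<eta>' w"
  shows "extend U x k \<omega> \<eta> v = extend U x k \<omega>' \<eta>' v"
  using assms
proof (induction k arbitrary: v \<omega> \<omega>' \<eta> \<eta>')
  case (Suc k)
  note v = tuples_SucD[OF Suc.prems(1)]
  note p = split_add(1)[OF v(1) v(1)]
  have "extend U x k (\<lambda>w. \<omega> (case_nat (proj U x (v 0)) w)) (\<lambda>w. wneg (\<eta> (case_nat (proj U x (v 0)) w))) (\<lambda>i. v (Suc i)) =
      extend U x k (\<lambda>w. \<omega>' (case_nat (proj U x (v 0)) w)) (\<lambda>w. wneg (\<eta>' (case_nat (proj U x (v 0)) w))) (\<lambda>i. v (Suc i))"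
    using Suc.prems(2,3) tuples_SucI[OF p] by (intro Suc.IH[OF v(2)]) auto
  then show ?case using Suc.prems(3)[OF refl proj_tuple[OF v(2)]] by simp
qed (simp add: tuples_0)

lemma extend_zero:
  assumes "v \<in> tuples k (ssum U (line x))" "\<And>w. w \<in> tuples k U \<Longrightarrow> \<omega> w = \<zero>\<^bsub>W\<^esub>"
    "\<And>l w. k = Suc l \<Longrightarrow> w \<in> tuples l U \<Longrightarrow> \<eta> w = \<zero>\<^bsub>W\<^esub>"
  shows "extend U x k \<omega> \<eta> v = \<zero>\<^bsub>W\<^esub>"
  using assms
proof (induction k arbitrary: v \<omega> \<eta>)
  case (Suc k)
  note v = tuples_SucD[OF Suc.prems(1)]
  note p = split_add(1)[OF v(1) v(1)]
  have "extend U x k (\<lambda>w. \<omega> (case_nat (proj U x (v 0)) w)) (\<lambda>w. wneg (\<eta> (case_nat (proj U x (v 0)) w))) (\<lambda>i. v (Suc i)) = \<zero>\<^bsub>W\<^esub>"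
    using Suc.prems(2,3) tuples_SucI[OF p] by (intro Suc.IH[OF v(2)]) auto
  then show ?case using Suc.prems(3)[OF refl proj_tuple[OF v(2)]] split_add(2)[OF v(1) v(1)] by simp
qed (simp add: tuples_0)

lemma extend_base:
  assumes "alternating k U \<omega>" "\<And>l. k = Suc l \<Longrightarrow> alternating l U \<eta>" "v \<in> tuples k U"
  shows "extend U x k \<omega> \<eta> v = \<omega> v"
  using assms
proof (induction k arbitrary: v \<omega> \<eta>)
  case (Suc k)
  note v = tuples_SucD[OF Suc.prems(3)]
  have "extend U x k (\<lambda>w. \<omega> (case_nat (v 0) w)) (\<lambda>w. wneg (\<eta> (case_nat (v 0) w))) (\<lambda>i. v (Suc i)) =
      \<omega> (case_nat (v 0) (\<lambda>i. v (Suc i)))"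
    using Suc.prems v
    by (intro Suc.IH alternating_contract alternating_smult U) auto
  then show ?case
    using alternatingD(1)[OF Suc.prems(2)[OF refl] v(2)] alternatingD(1)[OF Suc.prems(1,3)]
    by (simp add: split_U[OF v(1)] proj_tuple_id[OF v(2)] case_nat_eta)
qed simp

text \<open>The three facts go through one induction, because rearranging the sums in the step
  requires the values to lie in W.\<close>

lemma extend_add_closed:
  assumes "alternating k U \<omega>" "\<And>l. k = Suc l \<Longrightarrow> alternating l U \<eta>"
    "alternating k U \<omega>'" "\<And>l. k = Suc l \<Longrightarrow> alternating l U \<eta>'" "v \<in> tuples k (ssum U (line x))"
    and b: "b \<in> carrier K"
  shows "extend U x k \<omega> \<eta> v \<in> carrier W \<and>
    extend U x k (\<lambda>w. \<omega> w \<oplus>\<^bsub>W\<^esub> \<omega>' w) (\<lambda>w. \<eta> w \<oplus>\<^bsub>W\<^esub> \<eta>' w) v = extend U x k \<omega> \<eta> v \<oplus>\<^bsub>W\<^esub> extend U x k \<omega>' \<eta>' v \<and>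
    extend U x k (\<lambda>w. b \<odot>\<^bsub>W\<^esub> \<omega> w) (\<lambda>w. b \<odot>\<^bsub>W\<^esub> \<eta> w) v = b \<odot>\<^bsub>W\<^esub> extend U x k \<omega> \<eta> v"
  using assms(1-5)
proof (induction k arbitrary: v \<omega> \<eta> \<omega>' \<eta>')
  case 0
  have "\<omega> v \<in> carrier W" using alternatingD(1)[OF 0(1)] 0(5) by (simp add: tuples_0)
  then show ?case by simp
next
  case (Suc k)
  note v = tuples_SucD[OF Suc.prems(5)]
  let ?p = "proj U x (v 0)" and ?c = "coef U x (v 0)"
  let ?t = "projs U x k (\<lambda>i. v (Suc i))"
  note p = split_add(1)[OF v(1) v(1)] and c = split_add(2)[OF v(1) v(1)] and t = proj_tuple[OF v(2)]
  note \<eta> = Suc.prems(2)[OF refl] and \<eta>' = Suc.prems(4)[OF refl]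
  have w1: "\<eta> ?t \<in> carrier W" "\<eta>' ?t \<in> carrier W"
    using alternatingD(1)[OF \<eta> t] alternatingD(1)[OF \<eta>' t] by auto
  have mem: "\<eta> (case_nat ?p w) \<in> carrier W" "\<eta>' (case_nat ?p w) \<in> carrier W" if "k = Suc l" "w \<in> tuples l U" for l w
    using alternatingD(1)[OF \<eta>] alternatingD(1)[OF \<eta>'] tuples_SucI[OF p that(2)] that by auto
  have a\<eta>: "alternating l U (\<lambda>w. wneg (\<eta> (case_nat ?p w)))" "alternating l U (\<lambda>w. wneg (\<eta>' (case_nat ?p w)))" if "k = Suc l" for l
    using \<eta> \<eta>' that p by (auto intro!: alternating_smult U alternating_contract)
  note IH = Suc.IH[OF alternating_contract[OF Suc.prems(1) p] a\<eta>(1) alternating_contract[OF Suc.prems(3) p] a\<eta>(2) v(2)]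
  note IH' = Suc.IH[OF alternating_contract[OF Suc.prems(3) p] a\<eta>(2) alternating_contract[OF Suc.prems(3) p] a\<eta>(2) v(2)]
  have e1: "extend U x k (\<lambda>w. \<omega> (case_nat ?p w) \<oplus>\<^bsub>W\<^esub> \<omega>' (case_nat ?p w))
        (\<lambda>w. wneg (\<eta> (case_nat ?p w) \<oplus>\<^bsub>W\<^esub> \<eta>' (case_nat ?p w))) (\<lambda>i. v (Suc i)) =
      extend U x k (\<lambda>w. \<omega> (case_nat ?p w) \<oplus>\<^bsub>W\<^esub> \<omega>' (case_nat ?p w))
        (\<lambda>w. wneg (\<eta> (case_nat ?p w)) \<oplus>\<^bsub>W\<^esub> wneg (\<eta>' (case_nat ?p w))) (\<lambda>i. v (Suc i))"
    using mem by (intro extend_cong[OF v(2)]) (auto simp: W.smult_r_distr)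
  have e2: "extend U x k (\<lambda>w. b \<odot>\<^bsub>W\<^esub> \<omega> (case_nat ?p w)) (\<lambda>w. wneg (b \<odot>\<^bsub>W\<^esub> \<eta> (case_nat ?p w))) (\<lambda>i. v (Suc i)) =
      extend U x k (\<lambda>w. b \<odot>\<^bsub>W\<^esub> \<omega> (case_nat ?p w)) (\<lambda>w. b \<odot>\<^bsub>W\<^esub> wneg (\<eta> (case_nat ?p w))) (\<lambda>i. v (Suc i))"
    using mem b by (intro extend_cong[OF v(2)]) (auto simp: W.smult_assoc1[symmetric] R.m_comm)
  have e3: "?c \<odot>\<^bsub>W\<^esub> (b \<odot>\<^bsub>W\<^esub> \<eta> ?t) = b \<odot>\<^bsub>W\<^esub> (?c \<odot>\<^bsub>W\<^esub> \<eta> ?t)"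
    using c b w1 by (simp add: W.smult_assoc1[symmetric] R.m_comm)
  show ?case
    using IH IH' w1 c b by (simp add: e1 e2 e3 W.smult_r_distr W.M.a_ac)
qed

text \<open>By \<open>alternating_SucI\<close>. For equal first arguments u + a x the two mixed
  terms are a \<eta>(u, ...) with opposite signs: this is the purpose of \<open>wneg\<close> in
  \<open>extend\<close>, as contractions by u and x anticommute.\<close>

lemma extend_alternating:
  assumes "alternating k U \<omega>" "\<And>l. k = Suc l \<Longrightarrow> alternating l U \<eta>"
  shows "alternating k (ssum U (line x)) (extend U x k \<omega> \<eta>)"
  using assms
proof (induction k arbitrary: \<omega> \<eta>)
  case 0
  then show ?case by (auto simp: alternating_def tuples_0)
next
  case (Suc k)
  note \<omega> = Suc.prems(1) and \<eta> = Suc.prems(2)[OF refl]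
  have a\<eta>: "alternating l U (\<lambda>w. wneg (\<eta> (case_nat p w)))" if "k = Suc l" "p \<in> U" for l p
    using \<eta> that by (auto intro!: alternating_smult U alternating_contract)
  show ?case
  proof (rule alternating_SucI[OF sU])
    fix z assume z: "z \<in> ssum U (line x)"
    note p = split_add(1)[OF z z] and c = split_add(2)[OF z z]
    show "alternating k (ssum U (line x)) (\<lambda>w. extend U x (Suc k) \<omega> \<eta> (case_nat z w))"
      using alternating_add[OF sU alternating_smult[OF sU alternating_pullback[OF \<eta>] c]
        Suc.IH[OF alternating_contract[OF \<omega> p] a\<eta>[OF _ p]]] by simp
  next
    fix y z w assume y: "y \<in> ssum U (line x)" and z: "z \<in> ssum U (line x)" and w: "w \<in> tuples k (ssum U (line x))"
    note p = split_add(1)[OF y y] split_add(1)[OF z z] and c = split_add(2)[OF y y] split_add(2)[OF z z]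
    note t = proj_tuple[OF w]
    have eta: "\<eta> (case_nat (proj U x y \<oplus>\<^bsub>V\<^esub> proj U x z) u) = \<eta> (case_nat (proj U x y) u) \<oplus>\<^bsub>W\<^esub> \<eta> (case_nat (proj U x z) u)"
      "\<eta> (case_nat (proj U x y) u) \<in> carrier W" "\<eta> (case_nat (proj U x z) u) \<in> carrier W"
      if "k = Suc l" "u \<in> tuples l U" for l u
      using alternatingD(1,2)[OF \<eta>] tuples_SucI[OF p(1) that(2)] tuples_SucI[OF p(2) that(2)] that p
        alternatingD(2)[OF \<eta>, of "case_nat (proj U x y) u" 0 "proj U x y" "proj U x z"]
      by (auto simp: case_nat_upd_0)
    have om: "\<omega> (case_nat (proj U x y \<oplus>\<^bsub>V\<^esub> proj U x z) u) = \<omega> (case_nat (proj U x y) u) \<oplus>\<^bsub>W\<^esub> \<omega> (case_nat (proj U x z) u)"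
      if "u \<in> tuples k U" for u
      using tuples_SucI[OF p(1) that] p
        alternatingD(2)[OF \<omega>, of "case_nat (proj U x y) u" 0 "proj U x y" "proj U x z"]
      by (auto simp: case_nat_upd_0)
    have "extend U x k (\<lambda>u. \<omega> (case_nat (proj U x y \<oplus>\<^bsub>V\<^esub> proj U x z) u))
        (\<lambda>u. wneg (\<eta> (case_nat (proj U x y \<oplus>\<^bsub>V\<^esub> proj U x z) u))) w =
      extend U x k (\<lambda>u. \<omega> (case_nat (proj U x y) u) \<oplus>\<^bsub>W\<^esub> \<omega> (case_nat (proj U x z) u))
        (\<lambda>u. wneg (\<eta> (case_nat (proj U x y) u)) \<oplus>\<^bsub>W\<^esub> wneg (\<eta> (case_nat (proj U x z) u))) w"
      using om eta by (intro extend_cong[OF w]) (auto simp: W.smult_r_distr)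
    moreover note E1 = extend_add_closed[OF alternating_contract[OF \<omega> p(1)] a\<eta>[OF _ p(1)]
        alternating_contract[OF \<omega> p(2)] a\<eta>[OF _ p(2)] w R.one_closed]
      and E2 = extend_add_closed[OF alternating_contract[OF \<omega> p(2)] a\<eta>[OF _ p(2)]
        alternating_contract[OF \<omega> p(2)] a\<eta>[OF _ p(2)] w R.one_closed]
    moreover have "\<eta> (projs U x k w) \<in> carrier W" by (rule alternatingD(1)[OF \<eta> t])
    ultimately show "extend U x (Suc k) \<omega> \<eta> (case_nat (y \<oplus>\<^bsub>V\<^esub> z) w) =
        extend U x (Suc k) \<omega> \<eta> (case_nat y w) \<oplus>\<^bsub>W\<^esub> extend U x (Suc k) \<omega> \<eta> (case_nat z w)"
      using c by (simp add: split_add[OF y z] W.smult_l_distr W.M.a_ac)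
  next
    fix b z w assume b: "b \<in> carrier K" and z: "z \<in> ssum U (line x)" and w: "w \<in> tuples k (ssum U (line x))"
    note p = split_add(1)[OF z z] and c = split_add(2)[OF z z]
    note t = proj_tuple[OF w]
    have eta: "\<eta> (case_nat (b \<odot>\<^bsub>V\<^esub> proj U x z) u) = b \<odot>\<^bsub>W\<^esub> \<eta> (case_nat (proj U x z) u)"
      "\<eta> (case_nat (proj U x z) u) \<in> carrier W"
      if "k = Suc l" "u \<in> tuples l U" for l u
      using alternatingD(1)[OF \<eta>] tuples_SucI[OF p that(2)] that p b
        alternatingD(3)[OF \<eta>, of "case_nat (proj U x z) u" 0 b "proj U x z"]
      by (auto simp: case_nat_upd_0)
    have om: "\<omega> (case_nat (b \<odot>\<^bsub>V\<^esub> proj U x z) u) = b \<odot>\<^bsub>W\<^esub> \<omega> (case_nat (proj U x z) u)"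
      if "u \<in> tuples k U" for u
      using tuples_SucI[OF p that] p b
        alternatingD(3)[OF \<omega>, of "case_nat (proj U x z) u" 0 b "proj U x z"]
      by (auto simp: case_nat_upd_0)
    have "extend U x k (\<lambda>u. \<omega> (case_nat (b \<odot>\<^bsub>V\<^esub> proj U x z) u))
        (\<lambda>u. wneg (\<eta> (case_nat (b \<odot>\<^bsub>V\<^esub> proj U x z) u))) w =
      extend U x k (\<lambda>u. b \<odot>\<^bsub>W\<^esub> \<omega> (case_nat (proj U x z) u))
        (\<lambda>u. b \<odot>\<^bsub>W\<^esub> wneg (\<eta> (case_nat (proj U x z) u))) w"
      using om eta b by (intro extend_cong[OF w]) (auto simp: W.smult_assoc1[symmetric] R.m_comm)
    moreover note E = extend_add_closed[OF alternating_contract[OF \<omega> p] a\<eta>[OF _ p]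
        alternating_contract[OF \<omega> p] a\<eta>[OF _ p] w b]
    moreover have "\<eta> (projs U x k w) \<in> carrier W" by (rule alternatingD(1)[OF \<eta> t])
    ultimately show "extend U x (Suc k) \<omega> \<eta> (case_nat (b \<odot>\<^bsub>V\<^esub> z) w) =
        b \<odot>\<^bsub>W\<^esub> extend U x (Suc k) \<omega> \<eta> (case_nat z w)"
      using c b by (simp add: split_smult[OF z b] W.smult_r_distr W.smult_assoc1)
  next
    fix l z w assume k: "k = Suc l" and z: "z \<in> ssum U (line x)" and w: "w \<in> tuples l (ssum U (line x))"
    note p = split_add(1)[OF z z] and c = split_add(2)[OF z z]
    note t = proj_tuple[OF w]
    have tup: "projs U x (Suc l) (case_nat z w) = case_nat (proj U x z) (projs U x l w)"
      by (auto simp: projs_def fun_eq_iff split: nat.splits)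
    have "extend U x l (\<lambda>u. \<omega> (case_nat (proj U x z) (case_nat (proj U x z) u)))
        (\<lambda>u. wneg (wneg (\<eta> (case_nat (proj U x z) (case_nat (proj U x z) u))))) w = \<zero>\<^bsub>W\<^esub>"
    proof (rule extend_zero[OF w])
      fix u assume "u \<in> tuples l U"
      then show "\<omega> (case_nat (proj U x z) (case_nat (proj U x z) u)) = \<zero>\<^bsub>W\<^esub>"
        using alternatingD(4)[OF \<omega>[unfolded k] tuples_SucI[OF p tuples_SucI[OF p]], of u 0 1] by simp
    next
      fix l' u assume "l = Suc l'" "u \<in> tuples l' U"
      then show "wneg (wneg (\<eta> (case_nat (proj U x z) (case_nat (proj U x z) u)))) = \<zero>\<^bsub>W\<^esub>"
        using alternatingD(4)[OF \<eta>[unfolded k] , of "case_nat (proj U x z) (case_nat (proj U x z) u)" 0 1]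
          tuples_SucI[OF p tuples_SucI[OF p]] k by simp
    qed
    moreover have "\<eta> (case_nat (proj U x z) (projs U x l w)) \<in> carrier W"
      using alternatingD(1)[OF \<eta>[unfolded k] tuples_SucI[OF p t]] .
    ultimately show "extend U x (Suc k) \<omega> \<eta> (case_nat z (case_nat z w)) = \<zero>\<^bsub>W\<^esub>"
      using c unfolding k by (simp add: tup wneg_eq W.smult_r_minus W.M.r_neg)
  qed
qed

lemma extend_x:
  assumes "alternating (Suc k) U \<omega>" "alternating k U \<eta>" "w \<in> tuples k U"
  shows "extend U x (Suc k) \<omega> \<eta> (case_nat x w) = \<eta> w"
proof -
  have "extend U x k (\<lambda>u. \<omega> (case_nat \<zero>\<^bsub>V\<^esub> u)) (\<lambda>u. wneg (\<eta> (case_nat \<zero>\<^bsub>V\<^esub> u))) w = \<omega> (case_nat \<zero>\<^bsub>V\<^esub> w)"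
    using assms by (intro extend_base alternating_contract alternating_smult U sub_zero) auto
  also have "\<dots> = \<zero>\<^bsub>W\<^esub>"
    by (rule alternating_zero_arg[OF U assms(1) tuples_SucI[OF sub_zero[OF U] assms(3)], of 0]) auto
  finally show ?thesis
    using alternatingD(1)[OF assms(2,3)] by (simp add: split_x proj_tuple_id[OF assms(3)])
qed

text \<open>Extension is injective, as restriction to U recovers \<omega> and contraction by x
  recovers \<eta>. For F empty this is the inequality converse to
  \<open>card_forms_step\<close>.\<close>

lemma card_forms_extend:
  "card (forms (Suc k) U {}) * card (forms k U {}) \<le> card (forms (Suc k) (ssum U (line x)) {})"
proof -
  let ?e = "\<lambda>(\<omega>, \<eta>). restrict (extend U x (Suc k) \<omega> \<eta>) (tuples (Suc k) (ssum U (line x)))"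
  have UU: "U \<subseteq> ssum U (line x)" by (rule ssum_upper1[OF U sub_line[OF x(1)]])
  have xU: "x \<in> ssum U (line x)" using ssum_upper2[OF U sub_line[OF x(1)]] line_self[OF x(1)] by auto
  have "card (forms (Suc k) U {} \<times> forms k U {}) \<le> card (forms (Suc k) (ssum U (line x)) {})"
  proof (rule card_inj_on_le)
    show "finite (forms (Suc k) (ssum U (line x)) {})" by (rule finite_forms[OF sU])
    show "?e ` (forms (Suc k) U {} \<times> forms k U {}) \<subseteq> forms (Suc k) (ssum U (line x)) {}"
      by (auto intro!: restrict_in_forms[OF sU] extend_alternating simp: forms_def restrict_alternating sU simp del: extend.simps)
    show "inj_on ?e (forms (Suc k) U {} \<times> forms k U {})"
    proof (rule inj_onI, clarify)
      fix \<omega> \<eta> \<omega>' \<eta>' assume f: "\<omega> \<in> forms (Suc k) U {}" "\<eta> \<in> forms k U {}" "\<omega>' \<in> forms (Suc k) U {}" "\<eta>' \<in> forms k U {}"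
        and eq: "restrict (extend U x (Suc k) \<omega> \<eta>) (tuples (Suc k) (ssum U (line x))) =
          restrict (extend U x (Suc k) \<omega>' \<eta>') (tuples (Suc k) (ssum U (line x)))"
      have ev: "extend U x (Suc k) \<omega> \<eta> v = extend U x (Suc k) \<omega>' \<eta>' v" if "v \<in> tuples (Suc k) (ssum U (line x))" for v
        using fun_cong[OF eq, of v] that by (simp del: extend.simps)
      have a: "alternating (Suc k) U \<omega>" "alternating k U \<eta>" "alternating (Suc k) U \<omega>'" "alternating k U \<eta>'"
        using f by (auto simp: forms_def)
      have "\<omega> = \<omega>'"
      proof (rule extensionalityI[of _ "tuples (Suc k) U"])
        fix v assume v: "v \<in> tuples (Suc k) U"
        show "\<omega> v = \<omega>' v"
          using ev[of v] v tuples_mono[OF UU] extend_base[OF a(1) _ v, of \<eta>] extend_base[OF a(3) _ v, of \<eta>'] a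
          by (auto simp del: extend.simps)
      qed (use f in \<open>auto simp: forms_def\<close>)
      moreover have "\<eta> = \<eta>'"
      proof (rule extensionalityI[of _ "tuples k U"])
        fix w assume w: "w \<in> tuples k U"
        then have "case_nat x w \<in> tuples (Suc k) (ssum U (line x))"
          using tuples_SucI[OF xU] tuples_mono[OF UU] by auto
        then show "\<eta> w = \<eta>' w"
          using ev extend_x[OF a(1,2) w] extend_x[OF a(3,4) w] by (simp del: extend.simps)
      qed (use f in \<open>auto simp: forms_def\<close>)
      ultimately show "\<omega> = \<omega>' \<and> \<eta> = \<eta>'" by simp
    qed
  qed
  then show ?thesis by (simp add: card_cartesian_product)
qed

end

lemma card_forms_0: "card (forms 0 U {}) = card (carrier W)"
proof -
  have "forms 0 U {} = tuples 0 U \<rightarrow>\<^sub>E carrier W"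
    using forms_subset_PiE[of 0 U "{}"] by (auto simp: forms_def alternating_def tuples_0 PiE_def)
  then show ?thesis by (simp add: tuples_0 card_PiE)
qed

text \<open>For F empty the two inequalities agree, so the exponent satisfies Pascal's recursion
  exactly.\<close>

lemma card_forms_empty:
  assumes "sub U" shows "card (forms k U {}) = card (carrier W) ^ (sdim U choose k)"
  using assms
proof (induction k arbitrary: U)
  case 0
  then show ?case by (simp add: card_forms_0)
next
  case (Suc k)
  have "card (forms (Suc k) (ssum {\<zero>\<^bsub>V\<^esub>} U) {}) =
    card (carrier W) ^ (sdim (ssum {\<zero>\<^bsub>V\<^esub>} U) choose Suc k)"
  proof (rule sub_chain_induct[OF sub_triv Suc.prems])
    have "lg (card (forms (Suc k) {\<zero>\<^bsub>V\<^esub>} {})) = 0"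
      using codim_Suc_triv[of k "{}"] by (simp add: codim_def sdim_triv)
    then have "card (forms (Suc k) {\<zero>\<^bsub>V\<^esub>} {}) = 1"
      using card_forms_pos[OF sub_triv, of "Suc k" "{}"] card_W by (simp add: lg_def log_def)
    then show "card (forms (Suc k) {\<zero>\<^bsub>V\<^esub>} {}) = card (carrier W) ^ (sdim {\<zero>\<^bsub>V\<^esub>} choose Suc k)"
      by (simp add: sdim_triv)
  next
    fix U' x assume U': "sub U'" "x \<in> U" "x \<notin> U'"
      and IH: "card (forms (Suc k) U' {}) = card (carrier W) ^ (sdim U' choose Suc k)"
    have xc: "x \<in> carrier V" using U' Suc.prems sub_carrier by auto
    have "card (forms (Suc k) (ssum U' (line x)) {}) \<le> card (forms (Suc k) U' {}) * card (forms k U' {})"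
      using card_forms_step[OF U'(1) xc U'(3), of "{}" k] by (simp add: active_def)
    then have "card (forms (Suc k) (ssum U' (line x)) {}) = card (forms (Suc k) U' {}) * card (forms k U' {})"
      using card_forms_extend[OF U'(1) xc U'(3), of k] by simp
    then show "card (forms (Suc k) (ssum U' (line x)) {}) =
        card (carrier W) ^ (sdim (ssum U' (line x)) choose Suc k)"
      using IH Suc.IH[OF U'(1)] sdim_extend[OF U'(1) xc U'(3)] by (simp add: power_add[symmetric] add.commute)
  qed
  then show ?case using ssum_triv_left[OF Suc.prems] by simp
qed

text \<open>After subtraction of a base point, each fibre of restriction to H consists of forms that
  vanish on H as well, and there are \<open>card (carrier W) ^ (sdim H choose k)\<close> possible
  restrictions. Thus a further null space never costs more than an independent one.\<close>

lemma card_forms_insert_ge: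
  assumes U: "sub U" and H: "sub H" "H \<subseteq> U"
  shows "card (forms k U F) \<le> card (forms k U (insert H F)) * card (carrier W) ^ (sdim H choose k)"
proof -
  have HU: "H \<inter> U = H" using H by auto
  have "card (forms k U F) \<le> card (forms k H {}) * card (forms k U (insert H F))"
  proof (rule card_le_card_times[where f = "\<lambda>f. restrict f (tuples k H)"])
    show "finite (forms k U F)" "finite (forms k H {})" by (intro finite_forms U H)+
    show "(\<lambda>f. restrict f (tuples k H)) ` forms k U F \<subseteq> forms k H {}"
      using H alternating_mono by (auto simp: forms_def restrict_alternating)
    fix g assume "g \<in> forms k H {}"
    let ?S = "{f \<in> forms k U F. restrict f (tuples k H) = g}"
    show "card ?S \<le> card (forms k U (insert H F))"
    proof (cases "?S = {}")
      case False
      then obtain f0 where f0: "f0 \<in> forms k U F" "restrict f0 (tuples k H) = g" by auto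
      define \<Phi> where "\<Phi> f = (\<lambda>v\<in>tuples k U. f v \<oplus>\<^bsub>W\<^esub> wneg (f0 v))" for f
      have a0: "alternating k U f0" using f0 by (auto simp: forms_def)
      have z0: "f0 v = \<zero>\<^bsub>W\<^esub>" if "H' \<in> F" "v \<in> tuples k (H' \<inter> U)" for H' v using f0 that by (auto simp: forms_def)
      show ?thesis
      proof (rule card_inj_on_le)
        show "finite (forms k U (insert H F))" by (rule finite_forms[OF U])
        show "inj_on \<Phi> ?S"
        proof (rule inj_onI)
          fix f f' assume f: "f \<in> ?S" and f': "f' \<in> ?S" and eq: "\<Phi> f = \<Phi> f'"
          show "f = f'"
          proof (rule extensionalityI[of _ "tuples k U"])
            fix v assume v: "v \<in> tuples k U"
            have "f v \<in> carrier W" "f' v \<in> carrier W" "f0 v \<in> carrier W"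
              using f f' a0 v alternatingD(1) by (auto simp: forms_def)
            then show "f v = f' v" using fun_cong[OF eq, of v] v by (simp add: \<Phi>_def)
          qed (use f f' in \<open>auto simp: forms_def\<close>)
        qed
        show "\<Phi> ` ?S \<subseteq> forms k U (insert H F)"
        proof (rule image_subsetI)
          fix f assume f: "f \<in> ?S"
          then have a: "alternating k U f" by (auto simp: forms_def)
          show "\<Phi> f \<in> forms k U (insert H F)"
            unfolding \<Phi>_def
          proof (rule restrict_in_forms[OF U alternating_diff[OF U a a0]])
            fix H' v assume H': "H' \<in> insert H F" and v: "v \<in> tuples k (H' \<inter> U)"
            have vU: "v \<in> tuples k U" using v tuples_mono[of "H' \<inter> U" U k] by auto
            have "f v = f0 v"
            proof (cases "H' \<in> F")
              case True
              then show ?thesis using f z0 v by (auto simp: forms_def)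
            next
              case False
              then have vH: "v \<in> tuples k H" using H' v HU by auto
              have "restrict f (tuples k H) v = restrict f0 (tuples k H) v" using f f0(2) by simp
              then show ?thesis using vH by simp
            qed
            then show "f v \<oplus>\<^bsub>W\<^esub> wneg (f0 v) = \<zero>\<^bsub>W\<^esub>"
              using W_diff_eq alternatingD(1)[OF a vU] alternatingD(1)[OF a0 vU] by simp
          qed
        qed
      qed
    next
      case True
      then show ?thesis by (metis card.empty le0)
    qed
  qed
  then show ?thesis by (simp add: card_forms_empty[OF H(1)] mult.commute)
qed

end

section \<open>Forms and the exterior power\<close>

context module
begin

context
  fixes U assumes U: "submodule R U M"
begin

lemma subgroup_submodule: "subgroup U (add_monoid M)"
proof -
  interpret U: submodule R U M by (rule U)
  show ?thesis
  proof
    show "U \<subseteq> carrier (add_monoid M)" using U.subset by simp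
    show "inv\<^bsub>add_monoid M\<^esub> x \<in> U" if "x \<in> U" for x
    proof -
      have "x \<in> carrier M" using that U.subset by auto
      then have "(\<ominus> \<one>) \<odot>\<^bsub>M\<^esub> x = \<ominus>\<^bsub>M\<^esub> x" by (simp add: smult_l_minus)
      moreover have "(\<ominus> \<one>) \<odot>\<^bsub>M\<^esub> x \<in> U" using that by (intro U.smult_closed) auto
      ultimately show ?thesis by (simp add: a_inv_def)
    qed
  qed auto
qed

lemma quot_module_simps:
  "carrier (quot_module M U) = (\<lambda>x. U +>\<^bsub>M\<^esub> x) ` carrier M"
  "x \<in> carrier M \<Longrightarrow> y \<in> carrier M \<Longrightarrow>
    (U +>\<^bsub>M\<^esub> x) \<oplus>\<^bsub>quot_module M U\<^esub> (U +>\<^bsub>M\<^esub> y) = U +>\<^bsub>M\<^esub> (x \<oplus>\<^bsub>M\<^esub> y)"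
  "a \<in> carrier R \<Longrightarrow> x \<in> carrier M \<Longrightarrow>
    a \<odot>\<^bsub>quot_module M U\<^esub> (U +>\<^bsub>M\<^esub> x) = U +>\<^bsub>M\<^esub> (a \<odot>\<^bsub>M\<^esub> x)"
  "\<zero>\<^bsub>quot_module M U\<^esub> = U +>\<^bsub>M\<^esub> \<zero>\<^bsub>M\<^esub>"
proof -
  interpret U: submodule R U M by (rule U)
  interpret S: abelian_subgroup U M
    by (intro abelian_subgroupI3 additive_subgroupI subgroup_submodule) (rule M.abelian_group_axioms)
  show "carrier (quot_module M U) = (\<lambda>x. U +>\<^bsub>M\<^esub> x) ` carrier M"
    by (auto simp: quot_module_def A_RCOSETS_def')
  show "x \<in> carrier M \<Longrightarrow> y \<in> carrier M \<Longrightarrow>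
    (U +>\<^bsub>M\<^esub> x) \<oplus>\<^bsub>quot_module M U\<^esub> (U +>\<^bsub>M\<^esub> y) = U +>\<^bsub>M\<^esub> (x \<oplus>\<^bsub>M\<^esub> y)" for x y
    by (simp add: quot_module_def S.a_rcos_sum)
  show "a \<odot>\<^bsub>quot_module M U\<^esub> (U +>\<^bsub>M\<^esub> x) = U +>\<^bsub>M\<^esub> (a \<odot>\<^bsub>M\<^esub> x)"
    if a: "a \<in> carrier R" and x: "x \<in> carrier M"
  proof -
    \<comment> \<open>Every representative of the coset yields the same coset, so the union in
      \<open>quot_module\<close> is a single one.\<close>
    have "U +>\<^bsub>M\<^esub> (a \<odot>\<^bsub>M\<^esub> z) = U +>\<^bsub>M\<^esub> (a \<odot>\<^bsub>M\<^esub> x)" if z: "z \<in> U +>\<^bsub>M\<^esub> x" for z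
    proof -
      obtain u where u: "u \<in> U" "z = u \<oplus>\<^bsub>M\<^esub> x" using z by (auto simp: a_r_coset_def')
      then have "u \<in> carrier M" using U.subset by auto
      then have "a \<odot>\<^bsub>M\<^esub> z = a \<odot>\<^bsub>M\<^esub> u \<oplus>\<^bsub>M\<^esub> a \<odot>\<^bsub>M\<^esub> x" using u a x by (simp add: smult_r_distr)
      then have "a \<odot>\<^bsub>M\<^esub> z \<in> U +>\<^bsub>M\<^esub> (a \<odot>\<^bsub>M\<^esub> x)"
        using M.a_rcosI[OF U.smult_closed[OF a u(1)] U.subset, of "a \<odot>\<^bsub>M\<^esub> x"] a x by simp
      then show ?thesis using M.a_repr_independence[OF _ _ subgroup_submodule] a x by simp
    qed
    moreover have "U +>\<^bsub>M\<^esub> x \<noteq> {}" using M.a_rcosI[OF U.zero_closed U.subset x] by blast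
    ultimately show ?thesis by (auto simp: quot_module_def)
  qed
  show "\<zero>\<^bsub>quot_module M U\<^esub> = U +>\<^bsub>M\<^esub> \<zero>\<^bsub>M\<^esub>"
    using M.a_coset_add_zero[OF U.subset] by (simp add: quot_module_def)
qed

lemma quot_module_is_module: "module R (quot_module M U)"
proof (rule module_criteria)
  show "cring R" by (rule R.is_cring)
  let ?Q = "quot_module M U"
  note [simp] = quot_module_simps
  show "\<zero>\<^bsub>?Q\<^esub> \<in> carrier ?Q" by auto
  show "\<forall>v w. v \<in> carrier ?Q \<and> w \<in> carrier ?Q \<longrightarrow> v \<oplus>\<^bsub>?Q\<^esub> w \<in> carrier ?Q" by auto
  show "\<forall>v\<in>carrier ?Q. \<exists>neg_v\<in>carrier ?Q. v \<oplus>\<^bsub>?Q\<^esub> neg_v = \<zero>\<^bsub>?Q\<^esub>"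
  proof
    fix v assume "v \<in> carrier ?Q"
    then obtain x where x: "x \<in> carrier M" "v = U +>\<^bsub>M\<^esub> x" by auto
    then have "v \<oplus>\<^bsub>?Q\<^esub> (U +>\<^bsub>M\<^esub> (\<ominus>\<^bsub>M\<^esub> x)) = \<zero>\<^bsub>?Q\<^esub>" by (simp add: M.r_neg)
    then show "\<exists>neg_v\<in>carrier ?Q. v \<oplus>\<^bsub>?Q\<^esub> neg_v = \<zero>\<^bsub>?Q\<^esub>" using x by auto
  qed
  show "\<forall>c v. c \<in> carrier R \<and> v \<in> carrier ?Q \<longrightarrow> c \<odot>\<^bsub>?Q\<^esub> v \<in> carrier ?Q" by auto
  show "\<forall>v w. v \<in> carrier ?Q \<and> w \<in> carrier ?Q \<longrightarrow> v \<oplus>\<^bsub>?Q\<^esub> w = w \<oplus>\<^bsub>?Q\<^esub> v" by (auto simp: M.a_comm)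
  show "\<forall>v w x. v \<in> carrier ?Q \<and> w \<in> carrier ?Q \<and> x \<in> carrier ?Q \<longrightarrow>
      (v \<oplus>\<^bsub>?Q\<^esub> w) \<oplus>\<^bsub>?Q\<^esub> x = v \<oplus>\<^bsub>?Q\<^esub> (w \<oplus>\<^bsub>?Q\<^esub> x)" by (auto simp: M.a_assoc)
  show "\<forall>v\<in>carrier ?Q. v \<oplus>\<^bsub>?Q\<^esub> \<zero>\<^bsub>?Q\<^esub> = v" by auto
  show "\<forall>a b v. a \<in> carrier R \<and> b \<in> carrier R \<and> v \<in> carrier ?Q \<longrightarrow>
      (a \<otimes> b) \<odot>\<^bsub>?Q\<^esub> v = a \<odot>\<^bsub>?Q\<^esub> (b \<odot>\<^bsub>?Q\<^esub> v)" by (auto simp: smult_assoc1)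
  show "\<forall>v\<in>carrier ?Q. \<one> \<odot>\<^bsub>?Q\<^esub> v = v" by auto
  show "\<forall>a b v. a \<in> carrier R \<and> b \<in> carrier R \<and> v \<in> carrier ?Q \<longrightarrow>
      (a \<oplus> b) \<odot>\<^bsub>?Q\<^esub> v = a \<odot>\<^bsub>?Q\<^esub> v \<oplus>\<^bsub>?Q\<^esub> b \<odot>\<^bsub>?Q\<^esub> v" by (auto simp: smult_l_distr)
  show "\<forall>a v w. a \<in> carrier R \<and> v \<in> carrier ?Q \<and> w \<in> carrier ?Q \<longrightarrow>
      a \<odot>\<^bsub>?Q\<^esub> (v \<oplus>\<^bsub>?Q\<^esub> w) = a \<odot>\<^bsub>?Q\<^esub> v \<oplus>\<^bsub>?Q\<^esub> a \<odot>\<^bsub>?Q\<^esub> w" by (auto simp: smult_r_distr)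
qed

end

end

lemmas quotient_simps = module.quot_module_simps
lemmas quotient_module = module.quot_module_is_module
lemmas submodule_subgroup = module.subgroup_submodule
lemmas span_submodule = module.span_is_submodule
lemmas span_superset = module.in_own_span
lemmas span_least = module.span_is_subset

lemma (in cring) func_space_simps:
  "carrier (func_space S) = S \<rightarrow>\<^sub>E carrier R"
  "add (func_space S) = (\<lambda>f g. restrict (\<lambda>v. f v \<oplus> g v) S)"
  "zero (func_space S) = restrict (\<lambda>v. \<zero>) S"
  "smult (func_space S) = (\<lambda>c f. restrict (\<lambda>v. c \<otimes> f v) S)"
  by (auto simp: func_space_def)

section \<open>Universal property of the exterior power\<close>

context alternating_forms
begin

abbreviation "T k \<equiv> tuples k (carrier V)"
abbreviation "L k \<equiv> free_on_tuples K k V"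
abbreviation "g k \<equiv> gen K k V"
abbreviation "E k \<equiv> exterior_power K k V"

lemma finite_T: "finite (T k)" by (rule finite_tuples[OF finite_V])

lemma L_module: "module K (L k)"
  unfolding free_on_tuples_def by (rule func_space_is_module)

lemma gen_closed: "g k v \<in> carrier (L k)"
  by (auto simp: gen_def free_on_tuples_def R.func_space_simps)

lemma relations_subset: "alternating_relations K k V \<subseteq> carrier (L k)"
proof -
  interpret L: module K "L k" by (rule L_module)
  show ?thesis
    unfolding alternating_relations_def Let_def using gen_closed by (auto intro!: L.M.minus_closed)
qed

lemma relation_submodule: "submodule K (relation_space K k V) (L k)"
  unfolding relation_space_def by (rule span_submodule[OF L_module relations_subset])

lemma relation_superset: "alternating_relations K k V \<subseteq> relation_space K k V"
  unfolding relation_space_def by (rule span_superset[OF L_module relations_subset])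

abbreviation "cls k \<phi> \<equiv> relation_space K k V +>\<^bsub>L k\<^esub> \<phi>"

lemma E_module: "module K (E k)"
  unfolding exterior_power_def by (rule quotient_module[OF L_module relation_submodule])

lemmas E_simps = quotient_simps[OF L_module relation_submodule, folded exterior_power_def]

lemma wedge_closed: "wedge K k V v \<in> carrier (E k)"
  unfolding wedge_def E_simps using gen_closed by auto

text \<open>A function on the finite set of tuples is a combination of generators; the induction
  enlarges its support.\<close>

lemma L_induct:
  assumes N: "submodule K N (L k)" and gN: "\<And>v. v \<in> T k \<Longrightarrow> g k v \<in> N"
  shows "carrier (L k) \<subseteq> N"
proof
  interpret N: submodule K N "L k" by (rule N)
  note simps = free_on_tuples_def R.func_space_simps
  fix \<phi> assume \<phi>: "\<phi> \<in> carrier (L k)"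
  have *: "(\<lambda>w\<in>T k. if w \<in> A then \<phi> w else \<zero>\<^bsub>K\<^esub>) \<in> N" if "finite A" "A \<subseteq> T k" for A
    using that
  proof (induction A)
    case empty
    have "(\<lambda>w\<in>T k. if w \<in> {} then \<phi> w else \<zero>\<^bsub>K\<^esub>) = \<zero>\<^bsub>L k\<^esub>" by (auto simp: simps fun_eq_iff)
    then show ?case using N.zero_closed by (simp only:)
  next
    case (insert v A)
    then have v: "v \<in> T k" by simp
    have IH: "(\<lambda>w\<in>T k. if w \<in> A then \<phi> w else \<zero>\<^bsub>K\<^esub>) \<in> N"
      by (rule insert.IH) (use insert.prems in simp)
    have val: "\<phi> w \<in> carrier K" if "w \<in> T k" for w using \<phi> that by (auto simp: simps)
    have "(\<lambda>w\<in>T k. if w \<in> A then \<phi> w else \<zero>\<^bsub>K\<^esub>) \<oplus>\<^bsub>L k\<^esub> (\<phi> v \<odot>\<^bsub>L k\<^esub> g k v) \<in> N"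
      by (intro N.m_closed IH N.smult_closed val gN v)
    also have "(\<lambda>w\<in>T k. if w \<in> A then \<phi> w else \<zero>\<^bsub>K\<^esub>) \<oplus>\<^bsub>L k\<^esub> (\<phi> v \<odot>\<^bsub>L k\<^esub> g k v) =
        (\<lambda>w\<in>T k. if w \<in> insert v A then \<phi> w else \<zero>\<^bsub>K\<^esub>)"
      using insert.hyps v val by (intro ext) (auto simp: simps gen_def)
    finally show ?case .
  qed
  have "(\<lambda>w\<in>T k. if w \<in> T k then \<phi> w else \<zero>\<^bsub>K\<^esub>) = \<phi>"
    using \<phi> by (auto simp: simps fun_eq_iff PiE_def extensional_def)
  then show "\<phi> \<in> N" using *[OF finite_T order_refl] by simp
qed

definition eval_form :: "nat \<Rightarrow> ((nat \<Rightarrow> 'c) \<Rightarrow> 'e) \<Rightarrow> ((nat \<Rightarrow> 'c) \<Rightarrow> 'a) \<Rightarrow> 'e" where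
  "eval_form k f \<phi> = finsum W (\<lambda>v. \<phi> v \<odot>\<^bsub>W\<^esub> f v) (T k)"

lemma eval_form_hom:
  assumes f: "\<And>v. v \<in> T k \<Longrightarrow> f v \<in> carrier W"
  shows "eval_form k f \<in> module_hom K (L k) W"
proof -
  note simps = free_on_tuples_def R.func_space_simps
  have "eval_form k f (\<phi> \<oplus>\<^bsub>L k\<^esub> \<psi>) = eval_form k f \<phi> \<oplus>\<^bsub>W\<^esub> eval_form k f \<psi>"
    if "\<phi> \<in> carrier (L k)" "\<psi> \<in> carrier (L k)" for \<phi> \<psi>
  proof -
    have val: "\<phi> w \<in> carrier K" "\<psi> w \<in> carrier K" if "w \<in> T k" for w
      using that \<open>\<phi> \<in> _\<close> \<open>\<psi> \<in> _\<close> by (auto simp: simps)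
    have "eval_form k f (\<phi> \<oplus>\<^bsub>L k\<^esub> \<psi>) = finsum W (\<lambda>v. \<phi> v \<odot>\<^bsub>W\<^esub> f v \<oplus>\<^bsub>W\<^esub> \<psi> v \<odot>\<^bsub>W\<^esub> f v) (T k)"
      unfolding eval_form_def using val f
      by (intro W.M.finsum_cong') (auto simp: simps W.smult_l_distr)
    then show ?thesis unfolding eval_form_def using val f by (simp add: W.M.finsum_addf Pi_def)
  qed
  moreover have "eval_form k f (a \<odot>\<^bsub>L k\<^esub> \<phi>) = a \<odot>\<^bsub>W\<^esub> eval_form k f \<phi>"
    if "\<phi> \<in> carrier (L k)" and a: "a \<in> carrier K" for \<phi> a
  proof -
    have val: "\<phi> w \<in> carrier K" if "w \<in> T k" for w
      using that \<open>\<phi> \<in> _\<close> by (auto simp: simps)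
    have "eval_form k f (a \<odot>\<^bsub>L k\<^esub> \<phi>) = finsum W (\<lambda>v. a \<odot>\<^bsub>W\<^esub> (\<phi> v \<odot>\<^bsub>W\<^esub> f v)) (T k)"
      unfolding eval_form_def using val f a
      by (intro W.M.finsum_cong') (auto simp: simps W.smult_assoc1)
    also have "\<dots> = a \<odot>\<^bsub>W\<^esub> finsum W (\<lambda>v. \<phi> v \<odot>\<^bsub>W\<^esub> f v) (T k)"
      using val f a by (intro W.finsum_smult_ldistr[symmetric] finite_T) auto
    finally show ?thesis by (simp add: eval_form_def)
  qed
  moreover have "eval_form k f \<phi> \<in> carrier W" if "\<phi> \<in> carrier (L k)" for \<phi>
    unfolding eval_form_def using f that by (intro W.M.finsum_closed) (auto simp: simps)
  ultimately show ?thesis unfolding module_hom_def by auto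
qed

lemma eval_form_gen:
  assumes f: "\<And>v. v \<in> T k \<Longrightarrow> f v \<in> carrier W" and v: "v \<in> T k"
  shows "eval_form k f (g k v) = f v"
proof -
  have "eval_form k f (g k v) = finsum W (\<lambda>w. if v = w then f w else \<zero>\<^bsub>W\<^esub>) (T k)"
    unfolding eval_form_def using f by (intro W.M.finsum_cong') (auto simp: gen_def)
  also have "\<dots> = f v"
    using W.M.finsum_singleton[OF v finite_T, of f] f by (auto simp: Pi_def)
  finally show ?thesis .
qed

text \<open>Each relation expresses a defect of multilinearity or alternation and so evaluates to
  zero; the kernel, being a submodule, contains their span.\<close>

lemma eval_form_relation:
  assumes f: "alternating k (carrier V) f" and \<phi>: "\<phi> \<in> relation_space K k V"
  shows "eval_form k f \<phi> = \<zero>\<^bsub>W\<^esub>"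
proof -
  have fW: "f v \<in> carrier W" if "v \<in> T k" for v using alternatingD(1)[OF f that] .
  interpret h: mod_hom K "L k" W "eval_form k f"
    using eval_form_hom[OF fW] L_module W.module_axioms
    by (simp add: mod_hom_def mod_hom_axioms_def)
  have "alternating_relations K k V \<subseteq> h.ker"
  proof
    fix \<rho> assume \<rho>: "\<rho> \<in> alternating_relations K k V"
    have "eval_form k f \<rho> = \<zero>\<^bsub>W\<^esub>"
      using \<rho> unfolding alternating_relations_def Let_def
    proof (elim UnE CollectE exE conjE)
      fix v i x y assume *: "\<rho> = g k (v(i := x \<oplus>\<^bsub>V\<^esub> y)) \<ominus>\<^bsub>L k\<^esub> (g k (v(i := x)) \<oplus>\<^bsub>L k\<^esub> g k (v(i := y)))"
        "v \<in> T k" "i < k" "x \<in> carrier V" "y \<in> carrier V"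
      then have t: "v(i := x) \<in> T k" "v(i := y) \<in> T k" "v(i := x \<oplus>\<^bsub>V\<^esub> y) \<in> T k"
        by (auto intro: tuples_upd)
      show ?thesis unfolding *(1)
        using t gen_closed alternatingD(2)[OF f *(2-5)] fW
        by (simp add: h.f_minus h.f_add eval_form_gen W.M.r_neg a_minus_def)
    next
      fix v i a x assume *: "\<rho> = g k (v(i := a \<odot>\<^bsub>V\<^esub> x)) \<ominus>\<^bsub>L k\<^esub> (a \<odot>\<^bsub>L k\<^esub> g k (v(i := x)))"
        "v \<in> T k" "i < k" "a \<in> carrier K" "x \<in> carrier V"
      then have t: "v(i := x) \<in> T k" "v(i := a \<odot>\<^bsub>V\<^esub> x) \<in> T k"
        by (auto intro: tuples_upd)
      show ?thesis unfolding *(1)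
        using t gen_closed alternatingD(3)[OF f *(2-5)] fW *
        by (simp add: h.f_minus h.f_smult eval_form_gen W.M.r_neg a_minus_def)
    next
      fix v i j assume *: "\<rho> = g k v" "v \<in> T k" "i < k" "j < k" "i \<noteq> j" "v i = v j"
      show ?thesis unfolding *(1) using eval_form_gen[OF fW *(2)] alternatingD(4)[OF f *(2-6)] by simp
    qed
    then show "\<rho> \<in> h.ker" unfolding h.ker_def using \<rho> relations_subset by auto
  qed
  then have "relation_space K k V \<subseteq> h.ker"
    unfolding relation_space_def by (rule span_least[OF L_module _ h.ker_is_submodule])
  then show ?thesis using \<phi> by (auto simp: h.ker_def)
qed

definition form_of :: "nat \<Rightarrow> (((nat \<Rightarrow> 'c) \<Rightarrow> 'a) set \<Rightarrow> 'e) \<Rightarrow> (nat \<Rightarrow> 'c) \<Rightarrow> 'e" where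
  "form_of k \<theta> = (\<lambda>v\<in>T k. \<theta> (wedge K k V v))"

lemma wedge_hom_alternating:
  assumes \<theta>: "\<theta> \<in> module_hom K (E k) W"
  shows "alternating k (carrier V) (\<lambda>v. \<theta> (wedge K k V v))"
proof -
  interpret L: module K "L k" by (rule L_module)
  interpret R: submodule K "relation_space K k V" "L k" by (rule relation_submodule)
  have sg: "subgroup (relation_space K k V) (add_monoid (L k))"
    by (rule submodule_subgroup[OF L_module relation_submodule])
  \<comment> \<open>A relation becomes an equality of cosets in the quotient.\<close>
  have eq: "cls k \<phi> = cls k \<psi>" if "\<phi> \<ominus>\<^bsub>L k\<^esub> \<psi> \<in> alternating_relations K k V" "\<phi> \<in> carrier (L k)" "\<psi> \<in> carrier (L k)" for \<phi> \<psi>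
  proof -
    have "(\<phi> \<ominus>\<^bsub>L k\<^esub> \<psi>) \<oplus>\<^bsub>L k\<^esub> \<psi> \<in> cls k \<psi>"
      using that relation_superset by (intro L.M.a_rcosI R.subset) auto
    moreover have "(\<phi> \<ominus>\<^bsub>L k\<^esub> \<psi>) \<oplus>\<^bsub>L k\<^esub> \<psi> = \<phi>"
      using that by (simp add: a_minus_def L.M.a_assoc L.M.l_neg)
    ultimately show ?thesis using L.M.a_repr_independence[OF _ that(3) sg] by simp
  qed
  show ?thesis
    unfolding alternating_def
  proof (intro conjI ballI allI impI)
    fix v assume v: "v \<in> T k"
    show "\<theta> (wedge K k V v) \<in> carrier W"
      using module_hom_closed[OF \<theta>] wedge_closed by auto
    show "\<theta> (wedge K k V (v(i := x \<oplus>\<^bsub>V\<^esub> y))) = \<theta> (wedge K k V (v(i := x))) \<oplus>\<^bsub>W\<^esub> \<theta> (wedge K k V (v(i := y)))"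
      if i: "i < k" and xy: "x \<in> carrier V" "y \<in> carrier V" for i x y
    proof -
      have "g k (v(i := x \<oplus>\<^bsub>V\<^esub> y)) \<ominus>\<^bsub>L k\<^esub> (g k (v(i := x)) \<oplus>\<^bsub>L k\<^esub> g k (v(i := y))) \<in> alternating_relations K k V"
        unfolding alternating_relations_def Let_def using v i xy by blast
      from eq[OF this] have "wedge K k V (v(i := x \<oplus>\<^bsub>V\<^esub> y)) = wedge K k V (v(i := x)) \<oplus>\<^bsub>E k\<^esub> wedge K k V (v(i := y))"
        using gen_closed by (simp add: wedge_def E_simps)
      then show ?thesis using module_hom_add[OF \<theta> wedge_closed wedge_closed] by simp
    qed
    show "\<theta> (wedge K k V (v(i := a \<odot>\<^bsub>V\<^esub> x))) = a \<odot>\<^bsub>W\<^esub> \<theta> (wedge K k V (v(i := x)))"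
      if i: "i < k" and ax: "a \<in> carrier K" "x \<in> carrier V" for i a x
    proof -
      have "g k (v(i := a \<odot>\<^bsub>V\<^esub> x)) \<ominus>\<^bsub>L k\<^esub> (a \<odot>\<^bsub>L k\<^esub> g k (v(i := x))) \<in> alternating_relations K k V"
        unfolding alternating_relations_def Let_def using v i ax by blast
      from eq[OF this] have "wedge K k V (v(i := a \<odot>\<^bsub>V\<^esub> x)) = a \<odot>\<^bsub>E k\<^esub> wedge K k V (v(i := x))"
        using gen_closed ax by (simp add: wedge_def E_simps)
      then show ?thesis using module_hom_smult[OF \<theta> ax(1) wedge_closed] by simp
    qed
    show "\<theta> (wedge K k V v) = \<zero>\<^bsub>W\<^esub>" if ij: "i < k" "j < k" "i \<noteq> j" "v i = v j" for i j
    proof -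
      interpret h: mod_hom K "E k" W \<theta>
        using \<theta> E_module W.module_axioms by (simp add: mod_hom_def mod_hom_axioms_def)
      have "g k v \<in> alternating_relations K k V"
        unfolding alternating_relations_def Let_def using v ij by blast
      have m0: "\<ominus>\<^bsub>L k\<^esub> \<zero>\<^bsub>L k\<^esub> = \<zero>\<^bsub>L k\<^esub>" by (rule L.M.minus_equality) auto
      have "g k v \<ominus>\<^bsub>L k\<^esub> \<zero>\<^bsub>L k\<^esub> = g k v"
        unfolding a_minus_def m0 using gen_closed by (rule L.M.r_zero)
      with \<open>g k v \<in> alternating_relations K k V\<close>
      have "g k v \<ominus>\<^bsub>L k\<^esub> \<zero>\<^bsub>L k\<^esub> \<in> alternating_relations K k V" by simp
      from eq[OF this gen_closed] have "wedge K k V v = \<zero>\<^bsub>E k\<^esub>" by (simp add: wedge_def E_simps)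
      then show ?thesis using h.f0_is_0 by simp
    qed
  qed
qed

text \<open>The universal property: injectivity because the classes of generators generate,
  surjectivity because evaluation of an alternating form annihilates all relations and so factors
  through the quotient.\<close>

lemma bij_form_of: "bij_betw (form_of k) (Hom_space K (E k) W) (forms k (carrier V) {})"
  unfolding bij_betw_def
proof
  interpret L: module K "L k" by (rule L_module)
  interpret R: submodule K "relation_space K k V" "L k" by (rule relation_submodule)
  show "inj_on (form_of k) (Hom_space K (E k) W)"
  proof (rule inj_onI)
    fix \<theta> \<theta>' assume "\<theta> \<in> Hom_space K (E k) W" "\<theta>' \<in> Hom_space K (E k) W" and eq: "form_of k \<theta> = form_of k \<theta>'"
    then have \<theta>: "\<theta> \<in> module_hom K (E k) W" "\<theta>' \<in> module_hom K (E k) W"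
      "\<theta> \<in> extensional (carrier (E k))" "\<theta>' \<in> extensional (carrier (E k))" by (auto simp: Hom_space_def)
    define N where "N = {\<phi> \<in> carrier (L k). \<theta> (cls k \<phi>) = \<theta>' (cls k \<phi>)}"
    have cl: "cls k \<phi> \<in> carrier (E k)" if "\<phi> \<in> carrier (L k)" for \<phi> using that by (simp add: E_simps)
    interpret h: mod_hom K "E k" W \<theta>
      using \<theta> E_module W.module_axioms by (simp add: mod_hom_def mod_hom_axioms_def)
    interpret h': mod_hom K "E k" W \<theta>'
      using \<theta> E_module W.module_axioms by (simp add: mod_hom_def mod_hom_axioms_def)
    have "submodule K N (L k)"
    proof (rule submodule.intro[OF L_module])
      show "N \<subseteq> carrier (L k)" by (auto simp: N_def)
      show "v \<oplus>\<^bsub>L k\<^esub> w \<in> N" if "v \<in> N" "w \<in> N" for v w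
        using that module_hom_add[OF \<theta>(1), of "cls k v" "cls k w"] module_hom_add[OF \<theta>(2), of "cls k v" "cls k w"]
        by (simp add: N_def cl E_simps)
      show "\<zero>\<^bsub>L k\<^esub> \<in> N" using h.f0_is_0 h'.f0_is_0 by (simp add: N_def E_simps)
      show "c \<odot>\<^bsub>L k\<^esub> v \<in> N" if "c \<in> carrier K" "v \<in> N" for c v
        using that module_hom_smult[OF \<theta>(1), of c "cls k v"] module_hom_smult[OF \<theta>(2), of c "cls k v"]
        by (simp add: N_def cl E_simps)
    qed
    moreover have "g k v \<in> N" if "v \<in> T k" for v
      using fun_cong[OF eq, of v] that gen_closed by (simp add: N_def form_of_def wedge_def)
    ultimately have all: "carrier (L k) \<subseteq> N" by (rule L_induct)
    show "\<theta> = \<theta>'"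
    proof (rule extensionalityI[OF \<theta>(3,4)])
      fix X assume "X \<in> carrier (E k)"
      then obtain \<phi> where "\<phi> \<in> carrier (L k)" "X = cls k \<phi>" by (auto simp: E_simps)
      then show "\<theta> X = \<theta>' X" using all by (auto simp: N_def)
    qed
  qed
  show "form_of k ` Hom_space K (E k) W = forms k (carrier V) {}"
  proof
    show "form_of k ` Hom_space K (E k) W \<subseteq> forms k (carrier V) {}"
      using wedge_hom_alternating unfolding form_of_def
      by (auto intro!: restrict_in_forms sub_carrier_V simp: Hom_space_def)
    show "forms k (carrier V) {} \<subseteq> form_of k ` Hom_space K (E k) W"
    proof
      fix f assume f: "f \<in> forms k (carrier V) {}"
      then have alt: "alternating k (carrier V) f" and ext: "f \<in> extensional (T k)" by (auto simp: forms_def)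
      have fW: "f v \<in> carrier W" if "v \<in> T k" for v using alternatingD(1)[OF alt that] .
      interpret e: mod_hom K "L k" W "eval_form k f"
        using eval_form_hom[OF fW] L_module W.module_axioms by (simp add: mod_hom_def mod_hom_axioms_def)
      \<comment> \<open>Evaluation at a chosen representative; \<open>eval_form_relation\<close>
        makes the choice irrelevant.\<close>
      define \<theta> where "\<theta> = (\<lambda>X\<in>carrier (E k). eval_form k f (SOME \<phi>. \<phi> \<in> X))"
      have \<theta>_cls: "\<theta> (cls k \<phi>) = eval_form k f \<phi>" if \<phi>: "\<phi> \<in> carrier (L k)" for \<phi>
      proof -
        have "\<zero>\<^bsub>L k\<^esub> \<oplus>\<^bsub>L k\<^esub> \<phi> \<in> cls k \<phi>" by (intro L.M.a_rcosI R.subset R.zero_closed \<phi>)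
        then have "(SOME \<psi>. \<psi> \<in> cls k \<phi>) \<in> cls k \<phi>" by (rule someI[of "\<lambda>\<psi>. \<psi> \<in> cls k \<phi>"])
        then obtain u where u: "u \<in> relation_space K k V" "(SOME \<psi>. \<psi> \<in> cls k \<phi>) = u \<oplus>\<^bsub>L k\<^esub> \<phi>"
          by (auto simp: a_r_coset_def')
        have "u \<in> carrier (L k)" using u R.subset by auto
        then have "eval_form k f (u \<oplus>\<^bsub>L k\<^esub> \<phi>) = eval_form k f \<phi>"
          using e.f_add[of u \<phi>] \<phi> eval_form_relation[OF alt u(1)] by simp
        then show ?thesis using u \<phi> by (simp add: \<theta>_def E_simps)
      qed
      have "\<theta> \<in> module_hom K (E k) W"
        unfolding module_hom_def using e.f_im by (auto simp: E_simps \<theta>_cls e.f_add e.f_smult)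
      then have "\<theta> \<in> Hom_space K (E k) W" by (simp add: Hom_space_def \<theta>_def)
      moreover have "form_of k \<theta> = f"
        by (rule extensionalityI[of _ "T k"])
          (auto simp: form_of_def wedge_def \<theta>_cls gen_closed eval_form_gen fW ext)
      ultimately show "f \<in> form_of k ` Hom_space K (E k) W" by blast
    qed
  qed
qed

text \<open>The kernel of \<theta> is a submodule and the wedges of vectors of H generate the
  exterior power of H, so vanishing on these wedges suffices.\<close>

lemma null_iff:
  assumes \<theta>: "\<theta> \<in> Hom_space K (E k) W" and H: "H \<subseteq> carrier V"
  shows "\<theta> ` exterior_subspace K k V H = {\<zero>\<^bsub>W\<^esub>} \<longleftrightarrow> (\<forall>v\<in>tuples k H. form_of k \<theta> v = \<zero>\<^bsub>W\<^esub>)"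
proof -
  interpret h: mod_hom K "E k" W \<theta>
    using \<theta> E_module W.module_axioms by (simp add: Hom_space_def mod_hom_def mod_hom_axioms_def)
  have wE: "wedge K k V ` tuples k H \<subseteq> carrier (E k)" using wedge_closed by auto
  have HT: "tuples k H \<subseteq> T k" by (rule tuples_mono[OF H])
  interpret S: submodule K "exterior_subspace K k V H" "E k"
    unfolding exterior_subspace_def by (rule span_submodule[OF E_module wE])
  show ?thesis
  proof
    assume "\<theta> ` exterior_subspace K k V H = {\<zero>\<^bsub>W\<^esub>}"
    moreover have "wedge K k V ` tuples k H \<subseteq> exterior_subspace K k V H"
      unfolding exterior_subspace_def by (rule span_superset[OF E_module wE])
    ultimately show "\<forall>v\<in>tuples k H. form_of k \<theta> v = \<zero>\<^bsub>W\<^esub>"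
      using HT by (auto simp: form_of_def)
  next
    assume *: "\<forall>v\<in>tuples k H. form_of k \<theta> v = \<zero>\<^bsub>W\<^esub>"
    have "wedge K k V ` tuples k H \<subseteq> h.ker"
    proof (rule image_subsetI)
      fix v assume v: "v \<in> tuples k H"
      have "form_of k \<theta> v = \<zero>\<^bsub>W\<^esub>" using * v by blast
      then show "wedge K k V v \<in> h.ker"
        using subsetD[OF HT v] wedge_closed by (simp add: h.ker_def form_of_def)
    qed
    then have "exterior_subspace K k V H \<subseteq> h.ker"
      unfolding exterior_subspace_def by (rule span_least[OF E_module _ h.ker_is_submodule])
    then show "\<theta> ` exterior_subspace K k V H = {\<zero>\<^bsub>W\<^esub>}"
      using imageI[OF S.zero_closed, of \<theta>] unfolding h.f0_is_0 by (auto simp: h.ker_def)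
  qed
qed

lemma card_null:
  assumes S: "\<And>H. H \<in> S \<Longrightarrow> sub H"
  shows "card {\<theta> \<in> Hom_space K (E k) W. \<forall>H\<in>S. \<theta> ` exterior_subspace K k V H = {\<zero>\<^bsub>W\<^esub>}} =
    card (forms k (carrier V) S)"
proof -
  let ?A = "{\<theta> \<in> Hom_space K (E k) W. \<forall>H\<in>S. \<theta> ` exterior_subspace K k V H = {\<zero>\<^bsub>W\<^esub>}}"
  have HV: "H \<inter> carrier V = H" if "H \<in> S" for H using sub_subset[OF S[OF that]] by auto
  have "form_of k ` ?A = forms k (carrier V) S"
  proof (intro equalityI subsetI)
    fix f assume "f \<in> form_of k ` ?A"
    then obtain \<theta> where \<theta>: "\<theta> \<in> ?A" "f = form_of k \<theta>" by auto
    then have "f \<in> forms k (carrier V) {}" using bij_form_of[of k] by (auto simp: bij_betw_def)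
    moreover have "f v = \<zero>\<^bsub>W\<^esub>" if "H \<in> S" "v \<in> tuples k H" for H v
      using \<theta> that null_iff[of \<theta> k H] sub_subset[OF S] by auto
    ultimately show "f \<in> forms k (carrier V) S" using HV by (auto simp: forms_def)
  next
    fix f assume f: "f \<in> forms k (carrier V) S"
    then have "f \<in> forms k (carrier V) {}" by (auto simp: forms_def)
    then obtain \<theta> where \<theta>: "\<theta> \<in> Hom_space K (E k) W" "f = form_of k \<theta>"
      using bij_form_of[of k] unfolding bij_betw_def by blast
    have "\<theta> ` exterior_subspace K k V H = {\<zero>\<^bsub>W\<^esub>}" if "H \<in> S" for H
      using f \<theta> HV[OF that] that null_iff[OF \<theta>(1) sub_subset[OF S[OF that]]] by (auto simp: forms_def)
    then show "f \<in> form_of k ` ?A" using \<theta> by blast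
  qed
  moreover have "inj_on (form_of k) ?A"
    using bij_form_of[of k] unfolding bij_betw_def by (auto intro: inj_on_subset)
  then have "card (form_of k ` ?A) = card ?A" by (rule card_image)
  ultimately show ?thesis by simp
qed

end

section \<open>Gain at resonance\<close>

text \<open>By absorption, k binom(n, k) = n binom(n-1, k-1), so binom(n, k) / n is nondecreasing in
  n.\<close>

lemma choose_ratio_linear:
  assumes "j \<le> r" "k \<ge> 1"
  shows "real (j choose k) * real r \<le> real (r choose k) * real j"
proof -
  obtain l where k: "k = Suc l" using assms by (cases k) auto
  have *: "k * (n choose k) = n * (n - 1 choose l)" for n
    using k binomial_absorption[of l n] by simp
  have "k * (j choose k) * r = j * (j - 1 choose l) * r" using * by simp
  also have "\<dots> \<le> j * (r - 1 choose l) * r"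
    using assms by (intro mult_right_mono mult_left_mono binomial_right_mono) auto
  also have "\<dots> = j * (k * (r choose k))" using * by simp
  finally have "k * ((j choose k) * r) \<le> k * ((r choose k) * j)" by (simp add: algebra_simps)
  then have "(j choose k) * r \<le> (r choose k) * j" using assms(2) by simp
  then show ?thesis by (metis of_nat_le_iff of_nat_mult)
qed

text \<open>One factor comes off by absorption and the linear case applies to the rest. The
  quadratic rate is what leaves c j (r - j) / r in \<open>base_gain\<close>; the linear rate would
  leave nothing.\<close>

lemma choose_ratio_square:
  assumes "j \<le> r" "k \<ge> 2" "r \<ge> 1"
  shows "real (j choose k) * (real r)\<^sup>2 \<le> real (r choose k) * (real j)\<^sup>2"
proof (cases "j = 0")
  case False
  obtain l where k: "k = Suc l" "l \<ge> 1" using assms by (cases k) auto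
  have *: "real k * real (n choose k) = real n * real (n - 1 choose l)" for n
    using k binomial_absorption[of l n] by (metis diff_Suc_1 of_nat_mult)
  have "real (j - 1 choose l) * real r \<le> real (r - 1 choose l) * real j"
  proof -
    have a: "real (j - 1 choose l) * real (r - 1) \<le> real (r - 1 choose l) * real (j - 1)"
      using assms k by (intro choose_ratio_linear) auto
    have b: "real (j - 1 choose l) \<le> real (r - 1 choose l)"
      using assms by (intro of_nat_mono binomial_right_mono) auto
    \<comment> \<open>The linear case concerns j - 1 and r - 1; adding b restores j and r.\<close>
    have r1: "real r = real (r - 1) + 1" and j1: "real j = real (j - 1) + 1" using assms False by auto
    show ?thesis unfolding r1 j1 using add_mono[OF a b] by (simp only: distrib_left mult_1_right)
  qed
  then have "(real j * real r) * (real (j - 1 choose l) * real r) \<le> (real j * real r) * (real (r - 1 choose l) * real j)"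
    by (intro mult_left_mono) auto
  then have "real k * real (j choose k) * (real r)\<^sup>2 \<le> real k * real (r choose k) * (real j)\<^sup>2"
    unfolding * by (simp add: power2_eq_square algebra_simps)
  then show ?thesis using k by simp
next
  case True
  then show ?thesis using assms by (cases k) auto
qed

lemma Suc_times_choose: "Suc t * (n choose Suc t) = (n - t) * (n choose t)"
  by (simp only: binomial_absorption binomial_absorb_comp)

text \<open>Factor by factor: r - i \<le> 2 (y - i) for i < t.\<close>

lemma choose_le_two_power:
  assumes "r + t \<le> 2 * y" shows "(r choose t) \<le> 2 ^ t * (y choose t)"
  using assms
proof (induction t)
  case (Suc t)
  have "Suc t * (r choose Suc t) = (r - t) * (r choose t)" by (rule Suc_times_choose)
  also have "\<dots> \<le> (2 * (y - t)) * (2 ^ t * (y choose t))"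
    using Suc by (intro mult_mono) auto
  also have "\<dots> = 2 ^ Suc t * ((y - t) * (y choose t))" by simp
  also have "\<dots> = 2 ^ Suc t * (Suc t * (y choose Suc t))" by (simp only: Suc_times_choose)
  also have "\<dots> = Suc t * (2 ^ Suc t * (y choose Suc t))" by (rule mult.left_commute)
  finally show ?case by (subst (asm) mult_le_cancel1) simp
qed simp

section \<open>Gain along a chain of subspaces\<close>

locale resonance = alternating_forms K V W
  for K :: "('a, 'b) ring_scheme" and V :: "('a, 'c, 'd) module_scheme"
    and W :: "('a, 'e, 'f) module_scheme" +
  fixes k r m c :: nat
  assumes k: "k \<ge> 3" and r: "r \<ge> 4 * k + 14"
    and res: "real m * real (r choose k) = real r * real c"
    and W_card: "card (carrier W) = card (carrier K) ^ m"
begin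

text \<open>By resonance \<open>gain\<close> vanishes on a direct sum of \<open>r\<close>-dimensional members of \<open>F\<close>.\<close>

definition gain :: "'c set \<Rightarrow> 'c set set \<Rightarrow> real" where
  "gain U F = real m * codim k U F - real c * real (sdim U)"

text \<open>In \<open>level_gain\<close> a factor 8 is lost between levels v and y, and a factor
  2^(k-1) between levels y and r.\<close>

definition kap :: real where "kap = 1 / 2 ^ (k + 2)"

lemma kap_bounds: "0 < kap" "kap \<le> 1 / 8"
proof -
  have "(2::real) ^ 3 \<le> 2 ^ (k + 2)" using k by (intro power_increasing) auto
  then show "kap \<le> 1 / 8" by (simp add: kap_def divide_simps)
qed (simp add: kap_def)

lemma r_pos: "r > 0" using r by simp

text \<open>Adjoining an r-space that meets U in dimension j adds at least binom(r, k) - binom(j, k)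
  conditions and exactly r - j dimensions. By resonance m binom(j, k) \<le> c j^2 / r, which leaves
  the surplus c j (r - j) / r; it vanishes at both ends j = 0 and j = r.\<close>

lemma base_gain:
  assumes "j \<le> r"
  shows "real m * (real (r choose k) - real (j choose k)) - real c * (real r - real j) \<ge>
    real c * real j * (real r - real j) / real r"
proof -
  have "real m * real (j choose k) * (real r)\<^sup>2 \<le> real m * (real (r choose k) * (real j)\<^sup>2)"
    using choose_ratio_square[OF assms, of k] k r by (simp add: mult_left_mono mult.assoc)
  also have "\<dots> = real r * (real c * (real j)\<^sup>2)" using res by (simp add: algebra_simps)
  finally have "real m * real (j choose k) * real r \<le> real c * (real j)\<^sup>2"
    using r_pos by (simp add: power2_eq_square algebra_simps)
  then have "real m * real (j choose k) \<le> real c * (real j)\<^sup>2 / real r"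
    using r_pos by (simp add: field_simps)
  then have "real m * (real (r choose k) - real (j choose k)) - real c * (real r - real j) \<ge>
      real c * real j - real c * (real j)\<^sup>2 / real r"
    using res by (simp add: algebra_simps)
  also have "real c * real j - real c * (real j)\<^sup>2 / real r = real c * real j * (real r - real j) / real r"
    using r_pos by (simp add: field_simps power2_eq_square)
  finally show ?thesis by linarith
qed

text \<open>Pays for one dimension of H at level y while X \<inter> H has trace at most v. As v
  \<le> 7 y / 8, at least an eighth of binom(y, k-1) remains; for y \<ge> 5 r / 8 this is comparable
  to binom(r, k-1), and resonance gives m binom(r, k-1) \<ge> k c.\<close>

lemma level_gain:
  assumes y: "5 * r \<le> 8 * y" "y < r" and v: "8 * v + r \<le> 8 * y"
  shows "real m * (real (y choose (k - 1)) - real (v choose (k - 1))) \<ge> kap * real c"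
proof -
  have y0: "real y > 0" using y r by auto
  have "real (v choose (k - 1)) * real y \<le> real (y choose (k - 1)) * real v"
    using v k by (intro choose_ratio_linear) auto
  also have "\<dots> \<le> real (y choose (k - 1)) * (7 / 8 * real y)"
    using v y by (intro mult_left_mono) auto
  finally have "real (v choose (k - 1)) \<le> 7 / 8 * real (y choose (k - 1))" using y0 by simp
  then have 1: "real (y choose (k - 1)) - real (v choose (k - 1)) \<ge> real (y choose (k - 1)) / 8" by simp
  have "r choose (k - 1) \<le> 2 ^ (k - 1) * (y choose (k - 1))"
    using y r by (intro choose_le_two_power) auto
  then have 2: "real (r choose (k - 1)) \<le> 2 ^ (k - 1) * real (y choose (k - 1))"
    by (metis (mono_tags, lifting) of_nat_le_iff of_nat_mult of_nat_numeral of_nat_power)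
  have abs: "k * (r choose k) = (r - (k - 1)) * (r choose (k - 1))"
    using Suc_times_choose[of "k - 1" r] k by simp
  have "k * (r choose k) \<le> r * (r choose (k - 1))" unfolding abs by (intro mult_right_mono) auto
  then have "real k * real (r choose k) \<le> real r * real (r choose (k - 1))" by (metis of_nat_le_iff of_nat_mult)
  then have "real m * (real k * real (r choose k)) \<le> real m * (real r * real (r choose (k - 1)))"
    by (intro mult_left_mono) auto
  then have "real r * (real k * real c) \<le> real r * (real m * real (r choose (k - 1)))"
    using res by (simp add: algebra_simps)
  then have "real k * real c \<le> real m * real (r choose (k - 1))" using r_pos by simp
  also have "\<dots> \<le> real m * (2 ^ (k - 1) * real (y choose (k - 1)))" using 2 by (intro mult_left_mono) auto
  finally have 3: "real k * real c \<le> 2 ^ (k - 1) * (real m * real (y choose (k - 1)))" by (simp add: algebra_simps)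
  have p: "(2::real) ^ (k + 2) = 8 * 2 ^ (k - 1)" using k by (cases k) auto
  have "real c \<le> real k * real c" using k by (simp add: mult_le_cancel_right1)
  then have "kap * real c \<le> real m * real (y choose (k - 1)) / 8"
    using 3 unfolding kap_def p by (simp add: field_simps)
  also have "\<dots> \<le> real m * (real (y choose (k - 1)) - real (v choose (k - 1)))"
    using mult_left_mono[OF 1, of "real m"] by simp
  finally show ?thesis .
qed

lemma sub_foldl: "sub U \<Longrightarrow> (\<And>X. X \<in> set xs \<Longrightarrow> sub X) \<Longrightarrow> sub (foldl ssum U xs)"
  by (induction xs arbitrary: U) (auto intro: sub_ssum)

lemma foldl_upper:
  "sub U \<Longrightarrow> (\<And>X. X \<in> set xs \<Longrightarrow> sub X) \<Longrightarrow> U \<subseteq> foldl ssum U xs \<and> (\<forall>X\<in>set xs. X \<subseteq> foldl ssum U xs)"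
proof (induction xs rule: rev_induct)
  case (snoc X xs)
  have s: "sub (foldl ssum U xs)" using snoc by (intro sub_foldl) auto
  have "sub X" using snoc by auto
  then show ?case using snoc ssum_upper1[OF s] ssum_upper2[OF s] by (auto; blast)
qed simp

lemma foldl_least:
  "sub C \<Longrightarrow> U \<subseteq> C \<Longrightarrow> (\<And>X. X \<in> set xs \<Longrightarrow> X \<subseteq> C) \<Longrightarrow> foldl ssum U xs \<subseteq> C"
proof (induction xs arbitrary: U)
  case (Cons X xs)
  have "foldl ssum (ssum U X) xs \<subseteq> C"
    by (rule Cons.IH) (use Cons.prems ssum_least in auto)
  then show ?case by simp
qed simp

context
  fixes F assumes F: "\<And>H. H \<in> F \<Longrightarrow> sub H"
begin

lemma sdim_ssum_r:
  assumes "sub U" "X \<in> F" "sdim X = r"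
  shows "real (sdim (ssum U X)) = real (sdim U) + real r - real (sdim (X \<inter> U))"
  using sdim_ssum[OF assms(1) F[OF assms(2)]] assms(3) by (simp add: Int_commute)

lemma gain_adjoin:
  assumes U: "sub U" and X: "X \<in> F" "sdim X = r"
  defines "j \<equiv> real (sdim (X \<inter> U))"
  shows "gain (ssum U X) F \<ge> gain U F + real c * j * (real r - j) / real r"
    "gain (ssum U X) F \<ge> gain U F"
proof -
  obtain l where l: "k = Suc l" using k by (cases k) auto
  have sX: "sub X" using F X by auto
  have jr: "sdim (X \<inter> U) \<le> r" using sdim_mono[of "X \<inter> U" X] sX U X by (auto simp: sub_Int)
  have XX: "X \<inter> ssum U X = X" using ssum_upper2[OF U sX] by auto
  have "codim k (ssum U X) F \<ge> codim k U F + real (r choose k) - real (sdim (X \<inter> U) choose k)"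
    using codim_adjoin[OF single_bound U F X(1) sX order_refl, of l] X unfolding l XX by simp
  then have "real m * codim k (ssum U X) F \<ge> real m * (codim k U F + real (r choose k) - real (sdim (X \<inter> U) choose k))"
    by (intro mult_left_mono) auto
  then show 1: "gain (ssum U X) F \<ge> gain U F + real c * j * (real r - j) / real r"
    using base_gain[OF jr] unfolding gain_def sdim_ssum_r[OF U X] j_def by (simp add: algebra_simps)
  have "real c * j * (real r - j) / real r \<ge> 0" using jr by (auto simp: j_def)
  then show "gain (ssum U X) F \<ge> gain U F" using 1 by linarith
qed

text \<open>H watches while X is adjoined: every dimension by which the trace of H rises above y0
  yields kap c. Either X \<inter> H \<inter> U has dimension at least r / 8, and the base gain of X
  suffices; or the trace of X \<inter> H stays r / 8 below that of H and \<open>level_gain\<close>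
  applies. The assumption on d provides this distance: a dimension of at most r / 2 is r / 8 below 5
  r / 8, and otherwise the trace of H starts above r / 2, that of X \<inter> H below r / 8, and the
  latter grows no faster.\<close>

lemma gain_adjoin_observer:
  assumes U: "sub U" and X: "X \<in> F" "sdim X = r" and H: "H \<in> F" "sdim H = r"
    and d: "sdim (X \<inter> H) \<le> d" "2 * d \<le> r \<or> d \<le> sdim (H \<inter> U)" and y0: "d \<le> y0" "5 * r \<le> 8 * y0"
  shows "gain (ssum U X) F \<ge> gain U F +
    kap * real c * (real (max (sdim (H \<inter> ssum U X)) y0) - real (max (sdim (H \<inter> U)) y0))"
proof -
  obtain l where l: "k = Suc l" using k by (cases k) auto
  have sX: "sub X" and sH: "sub H" using F X H by auto
  define \<beta> \<beta>' z j where "\<beta> = sdim (H \<inter> U)" and "\<beta>' = sdim (H \<inter> ssum U X)"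
    and "z = sdim (X \<inter> H \<inter> U)" and "j = sdim (X \<inter> U)"
  have sUX: "sub (ssum U X)" by (rule sub_ssum[OF U sX])
  have jr: "j \<le> r" unfolding j_def using sdim_mono[of "X \<inter> U" X] sX U X by (auto simp: sub_Int)
  have zj: "z \<le> j" unfolding z_def j_def using sX sH U by (intro sdim_mono sub_Int) auto
  have z\<beta>: "z \<le> \<beta>" unfolding z_def \<beta>_def using sX sH U by (intro sdim_mono sub_Int) auto
  have \<beta>r: "\<beta>' \<le> r" unfolding \<beta>'_def using sdim_mono[of "H \<inter> ssum U X" H] sH sUX H by (auto simp: sub_Int)
  have \<beta>\<beta>: "\<beta> \<le> \<beta>'" unfolding \<beta>_def \<beta>'_def
    using sH U sUX ssum_upper1[OF U sX] by (intro sdim_mono sub_Int) auto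
  have g: "\<beta>' + j \<le> \<beta> + r"
  proof -
    have "sdim (ssum (H \<inter> ssum U X) U) + sdim (H \<inter> ssum U X \<inter> U) = \<beta>' + sdim U"
      unfolding \<beta>'_def by (intro sdim_ssum sub_Int sH sUX U)
    moreover have "H \<inter> ssum U X \<inter> U = H \<inter> U" using ssum_upper1[OF U sX] by auto
    moreover have "sdim (ssum (H \<inter> ssum U X) U) \<le> sdim (ssum U X)"
      using ssum_upper1[OF U sX] by (intro sdim_mono sub_ssum sub_Int sH sUX U ssum_least) auto
    ultimately show ?thesis
      using sdim_ssum[OF U sX] X(2) by (simp add: \<beta>_def j_def Int_commute)
  qed
  \<comment> \<open>Vectors of X in U + H are the ones that enlarge the trace of H; they are
    adjoined first, the rest of X afterwards.\<close>
  let ?Y = "X \<inter> ssum U H"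
  have sY: "sub ?Y" by (intro sub_Int sX sub_ssum U sH)
  let ?U1 = "ssum U ?Y"
  have sU1: "sub ?U1" by (rule sub_ssum[OF U sY])
  have U1X: "ssum ?U1 X = ssum U X"
  proof -
    have "ssum ?Y X = X" using ssum_absorb[OF sX sY] ssum_commute[OF sX sY] by auto
    then show ?thesis using ssum_assoc[OF U sY sX] by simp
  qed
  have HU1: "H \<inter> ?U1 = H \<inter> ssum U X"
  proof (intro equalityI subsetI)
    fix h assume "h \<in> H \<inter> ?U1"
    then show "h \<in> H \<inter> ssum U X" using ssum_mono[of U U ?Y X] by auto
  next
    fix h assume h: "h \<in> H \<inter> ssum U X"
    then obtain u x where ux: "u \<in> U" "x \<in> X" "h = u \<oplus>\<^bsub>V\<^esub> x" by (auto elim: ssumE)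
    have "u \<in> carrier V" "x \<in> carrier V" using ux U sX sub_carrier by auto
    then have "x = \<ominus>\<^bsub>V\<^esub> u \<oplus>\<^bsub>V\<^esub> h" using ux by (simp add: M.r_neg1)
    then have "x \<in> ssum U H" using ssumI[OF sub_neg[OF U ux(1)], of h H] h by simp
    then show "h \<in> H \<inter> ?U1" using h ux by (auto intro: ssumI)
  qed
  define S where "S = (\<Sum>y\<in>{\<beta>..<\<beta>'}. real (y choose l) - real (min (sdim (X \<inter> H)) (z + y - \<beta>) choose l))"
  have c1: "codim k ?U1 F \<ge> codim k U F + real (sdim (X \<inter> ?U1) choose k) - real (j choose k) + S"
    using codim_adjoin_pair[OF U F X(1) H(1) sY, of l] unfolding S_def \<beta>_def \<beta>'_def z_def j_def l HU1 by simp
  have XX: "X \<inter> ssum U X = X" using ssum_upper2[OF U sX] by auto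
  have "codim k (ssum U X) F \<ge> codim k ?U1 F + real (r choose k) - real (sdim (X \<inter> ?U1) choose k)"
    using codim_adjoin[OF single_bound sU1 F X(1) sX order_refl, of l] X(2) unfolding l U1X XX by simp
  then have "codim k (ssum U X) F \<ge> codim k U F + real (r choose k) - real (j choose k) + S" using c1 by linarith
  then have "real m * codim k (ssum U X) F \<ge> real m * (codim k U F + real (r choose k) - real (j choose k) + S)"
    by (intro mult_left_mono) auto
  then have main: "gain (ssum U X) F \<ge> gain U F + real c * real j * (real r - real j) / real r + real m * S"
    using base_gain[OF jr] unfolding gain_def sdim_ssum_r[OF U X] j_def by (simp add: algebra_simps)
  have term0: "real (y choose l) - real (min (sdim (X \<inter> H)) (z + y - \<beta>) choose l) \<ge> 0" if "\<beta> \<le> y" for y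
  proof -
    have "min (sdim (X \<inter> H)) (z + y - \<beta>) \<le> y" using that z\<beta> by linarith
    then show ?thesis using binomial_right_mono[of "min (sdim (X \<inter> H)) (z + y - \<beta>)" y l] by simp
  qed
  have S0: "S \<ge> 0" unfolding S_def by (intro sum_nonneg term0) auto
  let ?\<Delta> = "real (max \<beta>' y0) - real (max \<beta> y0)"
  have \<Delta>: "?\<Delta> \<le> real \<beta>' - real \<beta>" "0 \<le> ?\<Delta>" using \<beta>\<beta> by auto
  have "kap * real c * ?\<Delta> \<le> real c * real j * (real r - real j) / real r + real m * S"
  proof (cases "r \<le> 8 * z")
    \<comment> \<open>By \<open>g\<close> the trace of H grows by at most r - j, and here j / r
      \<ge> 1/8.\<close>
    case True
    then have j8: "real j / real r \<ge> 1 / 8" using zj r_pos by (simp add: field_simps)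
    have "kap * real c * ?\<Delta> \<le> (1 / 8) * real c * (real r - real j)"
      using kap_bounds \<Delta> g jr by (intro mult_mono) auto
    also have "\<dots> \<le> (real j / real r) * (real c * (real r - real j))"
      using mult_right_mono[OF j8, of "real c * (real r - real j)"] jr by simp
    also have "\<dots> = real c * real j * (real r - real j) / real r" by simp
    also have "\<dots> \<le> real c * real j * (real r - real j) / real r + real m * S" using S0 by simp
    finally show ?thesis .
  next
    case False
    have low: "real m * (real (y choose l) - real (min (sdim (X \<inter> H)) (z + y - \<beta>) choose l)) \<ge> kap * real c"
      if y: "max \<beta> y0 \<le> y" "y < \<beta>'" for y
    proof -
      have "8 * min (sdim (X \<inter> H)) (z + y - \<beta>) + r \<le> 8 * y"
        using d y y0 False \<beta>_def by (auto simp: min_def)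
      then show ?thesis using level_gain[of y "min (sdim (X \<inter> H)) (z + y - \<beta>)"] y y0 \<beta>r l by simp
    qed
    have "kap * real c * ?\<Delta> \<le> (\<Sum>y\<in>{max \<beta> y0..<\<beta>'}. kap * real c)"
    proof -
      have "?\<Delta> \<le> real (\<beta>' - max \<beta> y0)" by (auto simp: max_def)
      then have "kap * real c * ?\<Delta> \<le> kap * real c * real (\<beta>' - max \<beta> y0)"
        using kap_bounds by (intro mult_left_mono) auto
      then show ?thesis by (simp add: mult.commute)
    qed
    also have "\<dots> \<le> (\<Sum>y\<in>{max \<beta> y0..<\<beta>'}. real m * (real (y choose l) - real (min (sdim (X \<inter> H)) (z + y - \<beta>) choose l)))"
      by (intro sum_mono low) auto
    also have "\<dots> \<le> (\<Sum>y\<in>{\<beta>..<\<beta>'}. real m * (real (y choose l) - real (min (sdim (X \<inter> H)) (z + y - \<beta>) choose l)))"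
      by (intro sum_mono2) (auto intro!: mult_nonneg_nonneg term0)
    also have "\<dots> = real m * S" by (simp add: S_def sum_distrib_left)
    also have "\<dots> \<le> real c * real j * (real r - real j) / real r + real m * S" using jr by simp
    finally show ?thesis .
  qed
  then show ?thesis using main unfolding \<beta>_def \<beta>'_def by linarith
qed

lemma gain_foldl:
  assumes "sub U" "\<And>X. X \<in> set xs \<Longrightarrow> X \<in> F \<and> sdim X = r"
  shows "gain (foldl ssum U xs) F \<ge> gain U F"
  using assms
proof (induction xs rule: rev_induct)
  case (snoc X xs)
  have "sub (foldl ssum U xs)" using snoc F by (intro sub_foldl) auto
  then show ?case using snoc gain_adjoin(2)[of "foldl ssum U xs" X] by fastforce
qed simp

text \<open>Taking maxima with y0 makes the bounds for single steps telescope.\<close>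

lemma gain_foldl_observer:
  assumes U: "sub U" and xs: "\<And>X. X \<in> set xs \<Longrightarrow> X \<in> F \<and> sdim X = r" and H: "H \<in> F" "sdim H = r"
    and d: "\<And>X. X \<in> set xs \<Longrightarrow> sdim (X \<inter> H) \<le> d" "2 * d \<le> r \<or> d \<le> sdim (H \<inter> U)"
    and y0: "d \<le> y0" "5 * r \<le> 8 * y0"
  shows "gain (foldl ssum U xs) F \<ge> gain U F +
    kap * real c * (real (max (sdim (H \<inter> foldl ssum U xs)) y0) - real (max (sdim (H \<inter> U)) y0))"
  using xs d(1)
proof (induction xs rule: rev_induct)
  case (snoc X xs)
  have s: "sub (foldl ssum U xs)" using snoc F U by (intro sub_foldl) auto
  have IH: "gain (foldl ssum U xs) F \<ge> gain U F +
    kap * real c * (real (max (sdim (H \<inter> foldl ssum U xs)) y0) - real (max (sdim (H \<inter> U)) y0))"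
    by (rule snoc.IH) (use snoc.prems in auto)
  have "U \<subseteq> foldl ssum U xs" using foldl_upper[OF U, of xs] snoc.prems F by auto
  then have "sdim (H \<inter> U) \<le> sdim (H \<inter> foldl ssum U xs)"
    using H F U s by (intro sdim_mono sub_Int) auto
  then have "2 * d \<le> r \<or> d \<le> sdim (H \<inter> foldl ssum U xs)" using d(2) by auto
  then have "gain (ssum (foldl ssum U xs) X) F \<ge> gain (foldl ssum U xs) F +
    kap * real c * (real (max (sdim (H \<inter> ssum (foldl ssum U xs) X)) y0) - real (max (sdim (H \<inter> foldl ssum U xs)) y0))"
    using snoc.prems H y0 by (intro gain_adjoin_observer[OF s]) auto
  then show ?case using IH by (simp add: algebra_simps)
qed simp

end

abbreviation "spanl xs \<equiv> foldl ssum {\<zero>\<^bsub>V\<^esub>} xs"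

lemma gain_triv: "gain {\<zero>\<^bsub>V\<^esub>} F = 0"
  using k codim_Suc_triv[of "k - 1" F] by (simp add: gain_def sdim_triv)

text \<open>The sixteenth is lost in the last case of \<open>gain_spanl\<close>, where only the
  dimensions of H between y0 and j count, and these number at least a / 16.\<close>

definition kap' :: real where "kap' = kap / 16"

text \<open>If \<open>H = Hs ! i\<close> nearly lies in the span of its predecessors but is far from each single one,
  put its closest predecessor first: then most of \<open>H\<close> is swept out by other members, and every
  dimension swept out imposes new conditions through \<open>H\<close>.\<close>

lemma gain_spanl:
  assumes Hs: "\<And>X. X \<in> set Hs \<Longrightarrow> sub X \<and> sdim X = r" and i: "i < length Hs"
    and a: "\<And>l. l < i \<Longrightarrow> sdim (Hs ! i \<inter> Hs ! l) + a \<le> r" "a \<le> r"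
  defines "j \<equiv> sdim (Hs ! i \<inter> spanl (take i Hs))"
  shows "gain (spanl Hs) (set Hs) \<ge> kap' * real c * real (min a j)"
proof -
  let ?F = "set Hs" and ?H = "Hs ! i"
  have F: "\<And>H. H \<in> ?F \<Longrightarrow> sub H" using Hs by auto
  have H: "?H \<in> ?F" "sub ?H" "sdim ?H = r" using Hs i by auto
  let ?P = "spanl (take i Hs)"
  have tk: "X \<in> ?F \<and> sdim X = r" if "X \<in> set (take i Hs)" for X
    using that Hs set_take_subset[of i Hs] by auto
  have dr: "X \<in> ?F \<and> sdim X = r" if "X \<in> set (drop i Hs)" for X
    using that Hs set_drop_subset[of i Hs] by auto
  have sP: "sub ?P" using tk F by (intro sub_foldl sub_triv) auto
  have jr: "j \<le> r" unfolding j_def using sdim_mono[of "?H \<inter> ?P" ?H] H sP by (auto simp: sub_Int)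
  have split: "Hs = take i Hs @ ?H # drop (Suc i) Hs" using i by (simp add: id_take_nth_drop[symmetric])
  have dr': "X \<in> ?F \<and> sdim X = r" if "X \<in> set (drop (Suc i) Hs)" for X
    using that Hs set_drop_subset[of "Suc i" Hs] by auto
  have "spanl Hs = foldl ssum (ssum ?P ?H) (drop (Suc i) Hs)"
    by (subst split) simp
  then have tot1: "gain (spanl Hs) ?F \<ge> gain (ssum ?P ?H) ?F"
    using gain_foldl[OF F sub_ssum[OF sP H(2)] dr'] by simp
  have step: "gain (ssum ?P ?H) ?F \<ge> gain ?P ?F + real c * real j * (real r - real j) / real r"
    using gain_adjoin(1)[OF F sP H(1,3)] unfolding j_def by simp
  have P0: "gain ?P ?F \<ge> 0" using gain_foldl[OF F sub_triv tk] by (simp add: gain_triv)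
  have kp: "0 < kap'" "kap' \<le> 1 / 8" using kap_bounds by (auto simp: kap'_def)
  \<comment> \<open>In cases a and b adjoining H itself suffices: its base gain is at least c j / 4
    when j \<le> 3 r / 4, and at least c (r - j) / 2 \<ge> c a / 8 when r - j \<ge> a / 4 and j > 3
    r / 4. Case c is the space nearly inside the span.\<close>
  consider (a) "4 * j \<le> 3 * r" | (b) "4 * j > 3 * r" "a \<le> 4 * (r - j)" | (c) "4 * j > 3 * r" "a > 4 * (r - j)"
    by linarith
  then show ?thesis
  proof cases
    case a
    have "kap' * real c * real (min a j) \<le> (1 / 4) * real c * real j"
      using kp by (intro mult_mono) auto
    also have "\<dots> = real c * real j * (1 / 4)" by simp
    also have "\<dots> \<le> real c * real j * ((real r - real j) / real r)"
      using a r_pos by (intro mult_left_mono) (auto simp: field_simps)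
    finally show ?thesis using tot1 step P0 by simp
  next
    case b
    have "kap' * real c * real (min a j) \<le> (1 / 8) * real c * (4 * real (r - j))"
      using kp b by (intro mult_mono) auto
    also have "\<dots> = real c * (real r - real j) * (1 / 2)" using jr by simp
    also have "\<dots> \<le> real c * (real r - real j) * (real j / real r)"
      using b r_pos jr by (intro mult_left_mono mult_nonneg_nonneg) (auto simp: field_simps)
    also have "\<dots> = real c * real j * (real r - real j) / real r" by simp
    finally show ?thesis using tot1 step P0 by linarith
  next
    case c
    have "i \<noteq> 0"
    proof
      assume "i = 0"
      then have "j \<le> 0" unfolding j_def using sdim_mono[of "?H \<inter> {\<zero>\<^bsub>V\<^esub>}" "{\<zero>\<^bsub>V\<^esub>}"] H sub_triv
        by (simp add: sub_Int sdim_triv)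
      then show False using c r_pos by simp
    qed
    define d where "d = Max ((\<lambda>l. sdim (?H \<inter> Hs ! l)) ` {..<i})"
    have "d \<in> (\<lambda>l. sdim (?H \<inter> Hs ! l)) ` {..<i}" unfolding d_def using \<open>i \<noteq> 0\<close> by (intro Max_in) auto
    then obtain l where l: "l < i" "d = sdim (?H \<inter> Hs ! l)" by auto
    have dmax: "sdim (?H \<inter> Hs ! l') \<le> d" if "l' < i" for l' unfolding d_def using that by (intro Max_ge) auto
    have X: "Hs ! l \<in> ?F" "sub (Hs ! l)" "sdim (Hs ! l) = r" using Hs i l by auto
    have "take i Hs ! l \<in> set (take i Hs)" using l i by (intro nth_mem) auto
    then have "Hs ! l \<in> set (take i Hs)" using l by simp
    then have inP: "Hs ! l \<subseteq> ?P"
      using foldl_upper[OF sub_triv, of "take i Hs"] tk F by blast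
    \<comment> \<open>The closest predecessor occurs a second time in \<open>take i Hs\<close>,
      where adjoining it again changes nothing.\<close>
    have eqP: "foldl ssum (Hs ! l) (take i Hs) = ?P"
    proof
      have tkP: "X \<subseteq> ?P" if "X \<in> set (take i Hs)" for X
        using foldl_upper[OF sub_triv, of "take i Hs"] tk F that by auto
      show "foldl ssum (Hs ! l) (take i Hs) \<subseteq> ?P" by (rule foldl_least[OF sP inP tkP])
      have s: "sub (foldl ssum (Hs ! l) (take i Hs))" using tk F by (intro sub_foldl X) auto
      show "?P \<subseteq> foldl ssum (Hs ! l) (take i Hs)"
        using foldl_upper[OF X(2), of "take i Hs"] tk F sub_zero[OF s] by (intro foldl_least[OF s]) auto
    qed
    \<comment> \<open>\<open>(5 * r + 7) div 8\<close> is 5 r / 8 rounded up, the level from which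
      \<open>level_gain\<close> works; d is the part of H already in the first space.\<close>
    define y0 where "y0 = max d ((5 * r + 7) div 8)"
    have "gain (Hs ! l) ?F \<ge> 0"
      using gain_adjoin(2)[OF F sub_triv X(1,3)] by (simp add: gain_triv ssum_triv_left X)
    moreover have "gain (foldl ssum (Hs ! l) (take i Hs)) ?F \<ge> gain (Hs ! l) ?F +
      kap * real c * (real (max (sdim (?H \<inter> foldl ssum (Hs ! l) (take i Hs))) y0) - real (max (sdim (?H \<inter> Hs ! l)) y0))"
    proof (rule gain_foldl_observer[OF F X(2) tk H(1,3)])
      show "sdim (X \<inter> ?H) \<le> d" if "X \<in> set (take i Hs)" for X
        using that dmax i by (auto simp: in_set_conv_nth Int_commute)
    qed (auto simp: y0_def l)
    ultimately have g: "gain ?P ?F \<ge> kap * real c * (real (max j y0) - real y0)"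
      unfolding eqP using l by (simp add: j_def y0_def)
    have "real a / 16 \<le> real j - real y0"
    proof -
      have "d + a \<le> r" using a(1)[OF l(1)] l by simp
      moreover have "8 * ((5 * r + 7) div 8) \<le> 5 * r + 7" by simp
      \<comment> \<open>If y0 = d, then j - d > 3 a / 4 because d \<le> r - a and r - j < a / 4.
        Otherwise 16 j > 12 r and 16 y0 \<le> 10 r + 14, which leaves at least a since a \<le> r and
        r \<ge> 14.\<close>
      ultimately have "a + 16 * y0 \<le> 16 * j" using c a(2) r k unfolding y0_def by (auto simp: max_def)
      then show ?thesis by (simp add: field_simps)
    qed
    then have "kap * real c * (real (min a j) / 16) \<le> kap * real c * (real (max j y0) - real y0)"
      using kap_bounds by (intro mult_left_mono) auto
    moreover have "gain (ssum ?P ?H) ?F \<ge> gain ?P ?F" using gain_adjoin(2)[OF F sP H(1,3)] .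
    ultimately show ?thesis using g tot1 by (simp add: kap'_def)
  qed
qed

end

section \<open>Joint moments at resonance\<close>

lemma card_UN_le_mult:
  assumes "finite I" "real (card I) \<le> x" "\<And>i. i \<in> I \<Longrightarrow> real (card (S i)) \<le> y" "0 \<le> y"
  shows "real (card (\<Union>i\<in>I. S i)) \<le> x * y"
proof -
  have "real (card (\<Union>i\<in>I. S i)) \<le> real (\<Sum>i\<in>I. card (S i))"
    using card_UN_le[OF assms(1), of S] by (rule of_nat_mono)
  also have "\<dots> = (\<Sum>i\<in>I. real (card (S i)))" by simp
  also have "\<dots> \<le> (\<Sum>i\<in>I. y)" by (intro sum_mono assms)
  also have "\<dots> = real (card I) * y" by simp
  also have "\<dots> \<le> x * y" using assms by (intro mult_right_mono) auto
  finally show ?thesis .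
qed

locale resonant_space = resonance K V W k r m c
  for K :: "('a, 'b) ring_scheme" and V :: "('a, 'c, 'd) module_scheme"
    and W :: "('a, 'e, 'f) module_scheme" and k r m c :: nat +
  assumes dimV: "sdim (carrier V) = r + c"
begin

abbreviation "q \<equiv> real (card (carrier K))"

definition G :: "'c set set" where "G = {H. sub H \<and> sdim H = r}"

lemma G_D: "H \<in> G \<Longrightarrow> sub H" "H \<in> G \<Longrightarrow> sdim H = r"
  by (auto simp: G_def)

lemma finite_G: "finite G"
  by (rule finite_subset[of _ "Pow (carrier V)"]) (auto simp: G_def finite_V dest: sub_carrier)

lemma q2: "q \<ge> 2" using q_ge2 by simp

section \<open>Counting spaces and lists by their intersections\<close>

lemma between_top:
  assumes "sub A" "sdim A = j" "j \<le> r"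
  shows "real (card (between A (carrier V) (r - j))) \<le> 4 * q ^ ((r - j) * c)"
proof -
  have "sdim (carrier V) - sdim A - (r - j) = c" using assms dimV by simp
  then show ?thesis using card_between_le[OF assms(1) sub_carrier_V sub_subset[OF assms(1)], of "r - j"] by (simp only:)
qed

text \<open>Choose the intersection with P, then a space above it. The part (r - j) c of the
  exponent cancels against the weight in \<open>sum_lists_adm\<close>; the excess is t dim
  P.\<close>

lemma count_meet:
  assumes P: "sub P" and j: "j \<le> r" "j \<le> t"
  shows "real (card {H \<in> G. sdim (H \<inter> P) = j}) \<le> 16 * q ^ ((r - j) * c + t * sdim P)"
proof -
  have "{H \<in> G. sdim (H \<inter> P) = j} \<subseteq> (\<Union>A\<in>between {\<zero>\<^bsub>V\<^esub>} P j. between A (carrier V) (r - j))"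
  proof
    fix H assume H: "H \<in> {H \<in> G. sdim (H \<inter> P) = j}"
    then have "H \<inter> P \<in> between {\<zero>\<^bsub>V\<^esub>} P j" "H \<in> between (H \<inter> P) (carrier V) (r - j)"
      using P j by (auto simp: between_def G_def sub_Int sub_zero sdim_triv sub_carrier)
    then show "H \<in> (\<Union>A\<in>between {\<zero>\<^bsub>V\<^esub>} P j. between A (carrier V) (r - j))" by blast
  qed
  then have "real (card {H \<in> G. sdim (H \<inter> P) = j}) \<le> real (card (\<Union>A\<in>between {\<zero>\<^bsub>V\<^esub>} P j. between A (carrier V) (r - j)))"
    by (intro of_nat_mono card_mono) (auto simp: finite_between)
  also have "\<dots> \<le> (4 * q ^ (t * sdim P)) * (4 * q ^ ((r - j) * c))"
  proof (rule card_UN_le_mult[OF finite_between])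
    have "real (card (between {\<zero>\<^bsub>V\<^esub>} P j)) \<le> 4 * q ^ (j * (sdim P - sdim {\<zero>\<^bsub>V\<^esub>} - j))"
      by (rule card_between_le[OF sub_triv P]) (use sub_zero[OF P] in auto)
    also have "\<dots> \<le> 4 * q ^ (t * sdim P)"
      using q2 j by (intro mult_left_mono power_increasing mult_mono) auto
    finally show "real (card (between {\<zero>\<^bsub>V\<^esub>} P j)) \<le> 4 * q ^ (t * sdim P)" .
    show "real (card (between A (carrier V) (r - j))) \<le> 4 * q ^ ((r - j) * c)" if "A \<in> between {\<zero>\<^bsub>V\<^esub>} P j" for A
      using that j by (intro between_top) (auto simp: between_def sdim_triv)
  qed (use q2 in auto)
  also have "\<dots> = 16 * q ^ ((r - j) * c + t * sdim P)" by (simp add: power_add)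
  finally show ?thesis .
qed

text \<open>Choose H \<inter> X, then H \<inter> P, then H. The first two choices are cheap: H
  \<inter> X has codimension a in X, and H \<inter> P has dimension at most a over it, with a \<le>
  t.\<close>

lemma count_close:
  assumes P: "sub P" and X: "X \<in> G" "X \<subseteq> P" and j: "j \<le> r" and a: "a \<le> r" "a \<le> t"
  shows "real (card {H \<in> G. sdim (H \<inter> P) = j \<and> sdim (H \<inter> X) = r - a}) \<le>
    64 * q ^ ((r - j) * c + t * (sdim P + r))"
proof (cases "r - a \<le> j")
  case True
  note XG = G_D[OF X(1)]
  let ?S = "\<Union>A\<in>between {\<zero>\<^bsub>V\<^esub>} X (r - a). \<Union>B\<in>between A P (j - (r - a)). between B (carrier V) (r - j)"
  have "{H \<in> G. sdim (H \<inter> P) = j \<and> sdim (H \<inter> X) = r - a} \<subseteq> ?S"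
  proof
    fix H assume H: "H \<in> {H \<in> G. sdim (H \<inter> P) = j \<and> sdim (H \<inter> X) = r - a}"
    have "H \<inter> X \<in> between {\<zero>\<^bsub>V\<^esub>} X (r - a)"
      using H XG by (auto simp: between_def G_def sub_Int sub_zero sdim_triv)
    moreover have "H \<inter> P \<in> between (H \<inter> X) P (j - (r - a))"
      using H X P True by (auto simp: between_def G_def sub_Int)
    moreover have "H \<in> between (H \<inter> P) (carrier V) (r - j)"
      using H P j by (auto simp: between_def G_def sub_Int sub_carrier)
    ultimately show "H \<in> ?S" by blast
  qed
  then have "real (card {H \<in> G. sdim (H \<inter> P) = j \<and> sdim (H \<inter> X) = r - a}) \<le> real (card ?S)"
    by (intro of_nat_mono card_mono) (auto simp: finite_between)
  also have "\<dots> \<le> (4 * q ^ (t * r)) * ((4 * q ^ (t * sdim P)) * (4 * q ^ ((r - j) * c)))"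
  proof (rule card_UN_le_mult[OF finite_between])
    have "real (card (between {\<zero>\<^bsub>V\<^esub>} X (r - a))) \<le> 4 * q ^ ((r - a) * (sdim X - sdim {\<zero>\<^bsub>V\<^esub>} - (r - a)))"
      by (rule card_between_le[OF sub_triv XG(1)]) (use sub_zero[OF XG(1)] in auto)
    also have "(r - a) * (sdim X - sdim {\<zero>\<^bsub>V\<^esub>} - (r - a)) = a * (r - a)"
      using XG a by (simp add: sdim_triv mult.commute)
    also have "4 * q ^ (a * (r - a)) \<le> 4 * q ^ (t * r)"
      using q2 a by (intro mult_left_mono power_increasing mult_mono) auto
    finally show "real (card (between {\<zero>\<^bsub>V\<^esub>} X (r - a))) \<le> 4 * q ^ (t * r)" .
    show "real (card (\<Union>B\<in>between A P (j - (r - a)). between B (carrier V) (r - j))) \<le>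
        (4 * q ^ (t * sdim P)) * (4 * q ^ ((r - j) * c))" if A: "A \<in> between {\<zero>\<^bsub>V\<^esub>} X (r - a)" for A
    proof (rule card_UN_le_mult[OF finite_between])
      have A': "sub A" "A \<subseteq> P" "sdim A = r - a" using A X by (auto simp: between_def sdim_triv)
      have "real (card (between A P (j - (r - a)))) \<le> 4 * q ^ ((j - (r - a)) * (sdim P - sdim A - (j - (r - a))))"
        by (rule card_between_le[OF A'(1) P A'(2)])
      also have "\<dots> \<le> 4 * q ^ (t * sdim P)"
        using q2 a j by (intro mult_left_mono power_increasing mult_mono) auto
      finally show "real (card (between A P (j - (r - a)))) \<le> 4 * q ^ (t * sdim P)" .
      show "real (card (between B (carrier V) (r - j))) \<le> 4 * q ^ ((r - j) * c)" if "B \<in> between A P (j - (r - a))" for B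
        using that j A' True by (intro between_top) (auto simp: between_def)
    qed (use q2 in auto)
  qed (use q2 in auto)
  also have "\<dots> = 64 * q ^ ((r - j) * c + t * (sdim P + r))" by (simp add: power_add add_mult_distrib2)
  finally show ?thesis .
next
  case False
  have empty: "{H \<in> G. sdim (H \<inter> P) = j \<and> sdim (H \<inter> X) = r - a} = {}"
  proof -
    have "sdim (H \<inter> X) \<le> sdim (H \<inter> P)" if "H \<in> G" for H
      using G_D(1)[OF that] G_D(1)[OF X(1)] P X(2) by (intro sdim_mono sub_Int) auto
    then show ?thesis using False by fastforce
  qed
  show ?thesis unfolding empty using q2 by simp
qed

text \<open>\<open>lists_adm t\<close> interpolates between direct sums (\<open>t = 0\<close>) and all lists of distinct spaces
  (\<open>t = r\<close>).\<close>

definition admissible :: "nat \<Rightarrow> 'c set list \<Rightarrow> 'c set \<Rightarrow> bool" where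
  "admissible t xs H \<longleftrightarrow> sdim (H \<inter> spanl xs) \<le> t \<or> (\<exists>X\<in>set xs. r \<le> sdim (H \<inter> X) + t)"

lemma spanl_sub: "set xs \<subseteq> G \<Longrightarrow> sub (spanl xs)"
  using G_D by (intro sub_foldl sub_triv) auto

lemma spanl_upper: "set xs \<subseteq> G \<Longrightarrow> X \<in> set xs \<Longrightarrow> X \<subseteq> spanl xs"
  using foldl_upper[OF sub_triv, of xs] G_D by auto

lemma sdim_spanl_le: "set xs \<subseteq> G \<Longrightarrow> sdim (spanl xs) \<le> length xs * r"
proof (induction xs rule: rev_induct)
  case (snoc X xs)
  have "sdim (ssum (spanl xs) X) \<le> sdim (spanl xs) + sdim X"
    using sdim_ssum[of "spanl xs" X] spanl_sub[of xs] snoc.prems G_D by auto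
  then show ?case using snoc G_D by auto
qed (simp add: sdim_triv)

text \<open>Either the intersection with the span is small, or some member X of the list and some
  codimension a \<le> t witness closeness; the factors before the power of q count these
  witnesses.\<close>

lemma count_admissible:
  assumes xs: "set xs \<subseteq> G" and j: "j \<le> r" and t: "t \<le> r"
  shows "real (card {H \<in> G. sdim (H \<inter> spanl xs) = j \<and> admissible t xs H}) \<le>
    64 * (real (length xs) + 1) * (real r + 1) * q ^ ((r - j) * c + t * (sdim (spanl xs) + r))"
proof -
  let ?P = "spanl xs"
  let ?E = "q ^ ((r - j) * c + t * (sdim ?P + r))"
  have sP: "sub ?P" by (rule spanl_sub[OF xs])
  let ?A = "{H \<in> G. sdim (H \<inter> ?P) = j \<and> j \<le> t}"
  let ?B = "\<Union>X\<in>set xs. \<Union>a\<in>{..t}. {H \<in> G. sdim (H \<inter> ?P) = j \<and> sdim (H \<inter> X) = r - a}"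
  have "{H \<in> G. sdim (H \<inter> ?P) = j \<and> admissible t xs H} \<subseteq> ?A \<union> ?B"
  proof
    fix H assume H: "H \<in> {H \<in> G. sdim (H \<inter> ?P) = j \<and> admissible t xs H}"
    show "H \<in> ?A \<union> ?B"
    proof (cases "j \<le> t")
      case False
      then obtain X where X: "X \<in> set xs" "r \<le> sdim (H \<inter> X) + t" using H by (auto simp: admissible_def)
      have "sdim (H \<inter> X) \<le> sdim H" using H X xs G_D by (intro sdim_mono sub_Int) auto
      then have "sdim (H \<inter> X) \<le> r" using H G_D by auto
      then have "sdim (H \<inter> X) = r - (r - sdim (H \<inter> X))" "r - sdim (H \<inter> X) \<le> t" using X by auto
      then show ?thesis using H X by blast
    qed (use H in auto)
  qed
  then have "real (card {H \<in> G. sdim (H \<inter> ?P) = j \<and> admissible t xs H}) \<le> real (card (?A \<union> ?B))"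
    by (intro of_nat_mono card_mono) (auto simp: finite_G)
  also have "\<dots> \<le> real (card ?A) + real (card ?B)" using card_Un_le[of ?A ?B] by linarith
  also have "real (card ?A) \<le> 16 * ?E"
  proof (cases "j \<le> t")
    case True
    have "real (card ?A) \<le> 16 * q ^ ((r - j) * c + t * sdim ?P)" using count_meet[OF sP j True] True by simp
    also have "\<dots> \<le> 16 * ?E" using q2 by (intro mult_left_mono power_increasing) auto
    finally show ?thesis .
  qed (use q2 in simp)
  also have "real (card ?B) \<le> real (length xs) * ((real r + 1) * (64 * ?E))"
  proof (rule card_UN_le_mult)
    show "real (card (set xs)) \<le> real (length xs)" by (simp add: card_length)
    show "real (card (\<Union>a\<in>{..t}. {H \<in> G. sdim (H \<inter> ?P) = j \<and> sdim (H \<inter> X) = r - a})) \<le> (real r + 1) * (64 * ?E)"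
      if X: "X \<in> set xs" for X
      using X xs spanl_upper[OF xs X] t q2
      by (intro card_UN_le_mult count_close[OF sP _ _ j]) auto
  qed (use q2 in auto)
  also have "16 * ?E + real (length xs) * ((real r + 1) * (64 * ?E)) \<le>
      64 * (real (length xs) + 1) * (real r + 1) * ?E"
  proof -
    have "16 * ?E \<le> (64 * (real r + 1)) * ?E" using q2 by (intro mult_right_mono) auto
    then show ?thesis by (simp add: algebra_simps)
  qed
  finally show ?thesis by simp
qed

primrec lists_adm :: "nat \<Rightarrow> nat \<Rightarrow> 'c set list set" where
  "lists_adm t 0 = {[]}"
| "lists_adm t (Suc s) = (\<lambda>(xs, H). xs @ [H]) ` (SIGMA xs:lists_adm t s. {H \<in> G. H \<notin> set xs \<and> admissible t xs H})"

lemma lists_adm_D: "Hs \<in> lists_adm t s \<Longrightarrow> set Hs \<subseteq> G \<and> length Hs = s \<and> distinct Hs"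
proof (induction s arbitrary: Hs)
  case (Suc s)
  then obtain xs H where "xs \<in> lists_adm t s" "Hs = xs @ [H]" "H \<in> G" "H \<notin> set xs" by auto
  then show ?case using Suc.IH[of xs] by auto
qed simp

lemma finite_lists_adm: "finite (lists_adm t s)"
  by (induction s) (auto intro!: finite_imageI finite_SigmaI simp: finite_G)

text \<open>Appending H raises the dimension of the span by r - j, so the weight drops by q^((r - j)
  c), exactly the leading part of the number of such H. One factor per member is left, with a second
  r + 1 for the choice of j.\<close>

lemma sum_lists_adm:
  assumes "t \<le> r" "s \<le> n"
  shows "(\<Sum>Hs\<in>lists_adm t s. 1 / q ^ (c * sdim (spanl Hs))) \<le>
    (64 * (real n + 1) * (real r + 1)\<^sup>2 * q ^ (t * (n + 1) * r)) ^ s"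
  using assms(2)
proof (induction s)
  case 0
  then show ?case by (simp add: sdim_triv)
next
  case (Suc s)
  let ?M = "64 * (real n + 1) * (real r + 1)\<^sup>2 * q ^ (t * (n + 1) * r)"
  have M0: "?M \<ge> 0" using q2 by simp
  have step: "(\<Sum>H\<in>{H \<in> G. H \<notin> set xs \<and> admissible t xs H}. 1 / q ^ (c * sdim (spanl (xs @ [H])))) \<le>
      ?M * (1 / q ^ (c * sdim (spanl xs)))" if xs: "xs \<in> lists_adm t s" for xs
  proof -
    have x: "set xs \<subseteq> G" "length xs = s" using lists_adm_D[OF xs] by auto
    let ?P = "spanl xs"
    have sP: "sub ?P" by (rule spanl_sub[OF x(1)])
    let ?T = "{H \<in> G. H \<notin> set xs \<and> admissible t xs H}"
    have jr: "sdim (H \<inter> ?P) \<le> r" if "H \<in> G" for H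
      using sdim_mono[of "H \<inter> ?P" H] that G_D sP by (auto simp: sub_Int)
    have val: "1 / q ^ (c * sdim (spanl (xs @ [H]))) = (1 / q ^ (c * sdim ?P)) * (1 / q ^ ((r - sdim (H \<inter> ?P)) * c))"
      if H: "H \<in> G" for H
    proof -
      have "sdim (ssum ?P H) = sdim ?P + (r - sdim (H \<inter> ?P))"
        using sdim_ssum[OF sP G_D(1)[OF H]] G_D(2)[OF H] jr[OF H] by (simp add: Int_commute)
      then show ?thesis by (simp add: power_add[symmetric] algebra_simps)
    qed
    have "(\<Sum>H\<in>?T. 1 / q ^ ((r - sdim (H \<inter> ?P)) * c)) =
        (\<Sum>j\<in>{..r}. \<Sum>H\<in>{H \<in> ?T. sdim (H \<inter> ?P) = j}. 1 / q ^ ((r - sdim (H \<inter> ?P)) * c))"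
      using jr finite_G by (intro sum.group[symmetric]) auto
    also have "\<dots> \<le> (\<Sum>j\<in>{..r}. 64 * (real n + 1) * (real r + 1) * q ^ (t * (n + 1) * r))"
    proof (intro sum_mono)
      fix j assume j: "j \<in> {..r}"
      have "(\<Sum>H\<in>{H \<in> ?T. sdim (H \<inter> ?P) = j}. 1 / q ^ ((r - sdim (H \<inter> ?P)) * c)) =
          real (card {H \<in> ?T. sdim (H \<inter> ?P) = j}) * (1 / q ^ ((r - j) * c))" by simp
      also have "\<dots> \<le> (64 * (real (length xs) + 1) * (real r + 1) * q ^ ((r - j) * c + t * (sdim ?P + r))) * (1 / q ^ ((r - j) * c))"
      proof (rule mult_right_mono)
        have "real (card {H \<in> ?T. sdim (H \<inter> ?P) = j}) \<le> real (card {H \<in> G. sdim (H \<inter> ?P) = j \<and> admissible t xs H})"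
          using finite_G by (intro of_nat_mono card_mono) auto
        also have "\<dots> \<le> 64 * (real (length xs) + 1) * (real r + 1) * q ^ ((r - j) * c + t * (sdim ?P + r))"
          using j by (intro count_admissible x assms) auto
        finally show "real (card {H \<in> ?T. sdim (H \<inter> ?P) = j}) \<le> 64 * (real (length xs) + 1) * (real r + 1) * q ^ ((r - j) * c + t * (sdim ?P + r))" .
      qed (use q2 in simp)
      also have "\<dots> = 64 * (real s + 1) * (real r + 1) * q ^ (t * (sdim ?P + r))"
        using q2 x by (simp add: power_add)
      also have "\<dots> \<le> 64 * (real n + 1) * (real r + 1) * q ^ (t * (n + 1) * r)"
      proof -
        have "sdim ?P + r \<le> s * r + r" using sdim_spanl_le[OF x(1)] x by simp
        also have "\<dots> \<le> n * r + r" using Suc.prems by (intro add_mono mult_right_mono) auto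
        also have "\<dots> = (n + 1) * r" by simp
        finally have "t * (sdim ?P + r) \<le> t * (n + 1) * r" by (metis mult.assoc mult_le_mono2)
        then have e: "q ^ (t * (sdim ?P + r)) \<le> q ^ (t * (n + 1) * r)"
          using q2 by (intro power_increasing) auto
        have f: "64 * (real s + 1) * (real r + 1) \<le> 64 * (real n + 1) * (real r + 1)"
          using Suc.prems by (intro mult_mono) auto
        show ?thesis using q2 by (intro mult_mono[OF f e]) auto
      qed
      finally show "(\<Sum>H\<in>{H \<in> ?T. sdim (H \<inter> ?P) = j}. 1 / q ^ ((r - sdim (H \<inter> ?P)) * c)) \<le>
          64 * (real n + 1) * (real r + 1) * q ^ (t * (n + 1) * r)" .
    qed
    also have "\<dots> = ?M" by (simp add: power2_eq_square)
    finally have "(\<Sum>H\<in>?T. 1 / q ^ ((r - sdim (H \<inter> ?P)) * c)) \<le> ?M" .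
    then have "(1 / q ^ (c * sdim ?P)) * (\<Sum>H\<in>?T. 1 / q ^ ((r - sdim (H \<inter> ?P)) * c)) \<le> (1 / q ^ (c * sdim ?P)) * ?M"
      using q2 by (intro mult_left_mono) auto
    moreover have "(\<Sum>H\<in>?T. 1 / q ^ (c * sdim (spanl (xs @ [H])))) =
        (1 / q ^ (c * sdim ?P)) * (\<Sum>H\<in>?T. 1 / q ^ ((r - sdim (H \<inter> ?P)) * c))"
      unfolding sum_distrib_left by (intro sum.cong refl val) auto
    ultimately show ?thesis by (simp only: mult.commute)
  qed
  have inj: "inj_on (\<lambda>(xs, H). xs @ [H]) (SIGMA xs:lists_adm t s. {H \<in> G. H \<notin> set xs \<and> admissible t xs H})"
    by (auto simp: inj_on_def)
  have "(\<Sum>Hs\<in>lists_adm t (Suc s). 1 / q ^ (c * sdim (spanl Hs))) =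
      (\<Sum>xs\<in>lists_adm t s. \<Sum>H\<in>{H \<in> G. H \<notin> set xs \<and> admissible t xs H}. 1 / q ^ (c * sdim (spanl (xs @ [H]))))"
    unfolding lists_adm.simps sum.reindex[OF inj]
    using finite_lists_adm finite_G by (subst sum.Sigma) (auto simp: case_prod_unfold)
  also have "\<dots> \<le> (\<Sum>xs\<in>lists_adm t s. ?M * (1 / q ^ (c * sdim (spanl xs))))" by (intro sum_mono step)
  also have "\<dots> = ?M * (\<Sum>xs\<in>lists_adm t s. 1 / q ^ (c * sdim (spanl xs)))" by (simp only: sum_distrib_left)
  also have "\<dots> \<le> ?M * ?M ^ s" using Suc M0 by (intro mult_left_mono) auto
  finally show ?case by simp
qed

section \<open>Probabilities of joint nullity\<close>

definition null_prob :: "'c set set \<Rightarrow> real" where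
  "null_prob S = real (card (forms k (carrier V) S)) / real (card (forms k (carrier V) {}))"

definition p :: real where "p = 1 / q ^ (r * c)"

lemma m_choose: "m * (r choose k) = r * c"
  using res by (metis of_nat_eq_iff of_nat_mult)

lemma W_power_choose: "card (carrier W) ^ (r choose k) = card (carrier K) ^ (r * c)"
  unfolding W_card by (simp add: power_mult[symmetric] m_choose)

lemma null_prob_empty: "null_prob {} = 1"
  using card_forms_pos[OF sub_carrier_V, of k "{}"] by (simp add: null_prob_def)

lemma null_prob_insert: "H \<in> G \<Longrightarrow> null_prob S * p \<le> null_prob (insert H S)"
proof -
  assume H: "H \<in> G"
  have "card (forms k (carrier V) S) \<le> card (forms k (carrier V) (insert H S)) * card (carrier K) ^ (r * c)"
    using card_forms_insert_ge[OF sub_carrier_V G_D(1)[OF H] sub_subset[OF G_D(1)[OF H]], of k S] G_D(2)[OF H]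
    by (simp add: W_power_choose)
  then have "real (card (forms k (carrier V) S)) \<le> real (card (forms k (carrier V) (insert H S))) * q ^ (r * c)"
    by (metis of_nat_le_iff of_nat_mult of_nat_power)
  then have "real (card (forms k (carrier V) S)) * p \<le> real (card (forms k (carrier V) (insert H S)))"
    using q2 by (simp add: p_def field_simps)
  then show ?thesis
    using card_forms_pos[OF sub_carrier_V, of k "{}"] by (simp add: null_prob_def divide_right_mono)
qed

lemma p_nonneg: "0 \<le> p" "p \<le> 1" using q2 by (auto simp: p_def)

text \<open>Each further null space costs at most a factor p. Hence only upper bounds remain to be
  shown, and a dependent family has error at most its own probability.\<close>

lemma null_prob_ge: "finite S \<Longrightarrow> S \<subseteq> G \<Longrightarrow> p ^ card S \<le> null_prob S"
proof (induction S rule: finite_induct)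
  case (insert H S)
  have "p ^ card (insert H S) = p ^ card S * p" using insert by simp
  also have "\<dots> \<le> null_prob S * p" using insert p_nonneg by (intro mult_right_mono) auto
  also have "\<dots> \<le> null_prob (insert H S)" using insert by (intro null_prob_insert) auto
  finally show ?case .
qed (simp add: null_prob_empty)

text \<open>Restricting to the span can only lose conditions, and |W| = q^m turns them into the
  exponent m codim = c dim + gain.\<close>

lemma null_prob_gain:
  assumes Hs: "set Hs \<subseteq> G"
  shows "null_prob (set Hs) \<le> 1 / q ^ (c * sdim (spanl Hs)) * q powr (- gain (spanl Hs) (set Hs))"
proof -
  let ?F = "set Hs" and ?U = "spanl Hs"
  let ?Q = "real (card (carrier W))"
  obtain l where l: "k = Suc l" using k by (cases k) auto
  have F: "\<And>H. H \<in> ?F \<Longrightarrow> sub H" using Hs G_D by auto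
  have sU: "sub ?U" by (rule spanl_sub[OF Hs])
  have mono: "codim k ?U ?F \<le> codim k (carrier V) ?F"
    unfolding l by (rule codim_mono_space[OF sU sub_carrier_V sub_subset[OF sU] F])
  have Q: "?Q > 1" "?Q = q ^ m" using card_W by simp (simp add: W_card)
  have Q0: "?Q > 0" using Q(1) by linarith
  have pos: "real (card (forms k (carrier V) ?F)) > 0" using card_forms_pos[OF sub_carrier_V, of k ?F] by simp
  have "real (card (forms k (carrier V) ?F)) = ?Q powr lg (card (forms k (carrier V) ?F))"
    using Q(1) pos unfolding lg_def by (subst powr_log_cancel) auto
  also have "\<dots> = ?Q powr (real (sdim (carrier V) choose k) - codim k (carrier V) ?F)" by (simp add: codim_def)
  also have "\<dots> = ?Q ^ (sdim (carrier V) choose k) * ?Q powr (- codim k (carrier V) ?F)"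
    by (simp only: diff_conv_add_uminus powr_add powr_realpow[OF Q0])
  also have "?Q ^ (sdim (carrier V) choose k) = real (card (forms k (carrier V) {}))"
    using card_forms_empty[OF sub_carrier_V, of k] by simp
  finally have "null_prob ?F = ?Q powr (- codim k (carrier V) ?F)"
    using card_forms_pos[OF sub_carrier_V, of k "{}"] by (simp add: null_prob_def)
  also have "\<dots> \<le> ?Q powr (- codim k ?U ?F)" using mono Q by (intro powr_mono) auto
  also have "\<dots> = q powr (- (real m * codim k ?U ?F))"
    unfolding Q(2) using q2 by (simp add: powr_realpow[symmetric] powr_powr)
  also have "- (real m * codim k ?U ?F) = - real (c * sdim ?U) + - gain ?U ?F" by (simp add: gain_def)
  also have "q powr (- real (c * sdim ?U) + - gain ?U ?F) = 1 / q ^ (c * sdim ?U) * q powr (- gain ?U ?F)"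
    unfolding powr_add using q2 by (simp only: powr_minus powr_realpow) (simp add: divide_inverse powr_realpow)
  finally show ?thesis .
qed

lemma lists_adm_top: "set Hs \<subseteq> G \<Longrightarrow> distinct Hs \<Longrightarrow> Hs \<in> lists_adm r (length Hs)"
proof (induction Hs rule: rev_induct)
  case (snoc H xs)
  have "sdim (H \<inter> spanl xs) \<le> r"
    using sdim_mono[of "H \<inter> spanl xs" H] spanl_sub[of xs] snoc.prems G_D by (auto simp: sub_Int)
  then have "admissible r xs H" by (simp add: admissible_def)
  then show ?case using snoc by (auto intro!: image_eqI[of _ _ "(xs, H)"])
qed simp

lemma lists_adm_if_prefixes:
  assumes "set Hs \<subseteq> G" "distinct Hs" "\<And>i. i < length Hs \<Longrightarrow> admissible t (take i Hs) (Hs ! i)"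
  shows "Hs \<in> lists_adm t (length Hs)"
  using assms
proof (induction Hs rule: rev_induct)
  case (snoc H xs)
  have "xs \<in> lists_adm t (length xs)"
  proof (rule snoc.IH)
    fix i assume "i < length xs"
    then show "admissible t (take i xs) (xs ! i)" using snoc.prems(3)[of i] by (simp add: nth_append)
  qed (use snoc.prems in auto)
  moreover have "admissible t xs H" using snoc.prems(3)[of "length xs"] by simp
  ultimately show ?case using snoc.prems by (auto intro!: image_eqI[of _ _ "(xs, H)"])
qed simp

text \<open>At t = 0 the sum is direct, and nonnegativity of the gain gives an upper bound that
  matches \<open>null_prob_ge\<close>.\<close>

lemma null_prob_independent:
  assumes "Hs \<in> lists_adm 0 s" shows "null_prob (set Hs) = p ^ s"
proof -
  have Hs: "set Hs \<subseteq> G" "length Hs = s" "distinct Hs" using lists_adm_D[OF assms] by auto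
  have dim: "sdim (spanl Hs) = s * r" using assms
  proof (induction s arbitrary: Hs)
    case (Suc s)
    then obtain xs H where xs: "xs \<in> lists_adm 0 s" "Hs = xs @ [H]" "H \<in> G" "H \<notin> set xs" "admissible 0 xs H" by auto
    have x: "set xs \<subseteq> G" using lists_adm_D[OF xs(1)] by auto
    have sP: "sub (spanl xs)" by (rule spanl_sub[OF x])
    have "sdim (H \<inter> spanl xs) = 0"
    \<comment> \<open>With t = 0 the other alternative of \<open>admissible\<close> means H = X,
      which distinctness excludes.\<close>
    proof (rule ccontr)
      assume "sdim (H \<inter> spanl xs) \<noteq> 0"
      then obtain X where X: "X \<in> set xs" "r \<le> sdim (H \<inter> X)" using xs by (auto simp: admissible_def)
      have XG: "X \<in> G" using X x by auto
      have sHX: "sub (H \<inter> X)" using xs XG G_D sub_Int by auto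
      have "H \<inter> X = H" using sdim_eq_imp_eq[OF sHX G_D(1)[OF xs(3)]] X G_D(2)[OF xs(3)] by simp
      moreover have "H \<inter> X = X" using sdim_eq_imp_eq[OF sHX G_D(1)[OF XG]] X G_D(2)[OF XG] by simp
      ultimately show False using X xs by simp
    qed
    then show ?case
      using sdim_ssum[OF sP G_D(1)[OF xs(3)]] G_D(2)[OF xs(3)] Suc.IH[OF xs(1)] xs(2) by (simp add: Int_commute)
  qed (simp add: sdim_triv)
  have "gain (spanl Hs) (set Hs) \<ge> gain {\<zero>\<^bsub>V\<^esub>} (set Hs)"
    using Hs G_D by (intro gain_foldl sub_triv) auto
  then have "q powr (- gain (spanl Hs) (set Hs)) \<le> q powr 0"
    using q2 by (intro powr_mono) (auto simp: gain_triv)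
  then have "q powr (- gain (spanl Hs) (set Hs)) \<le> 1" using q2 by simp
  then have "1 / q ^ (c * sdim (spanl Hs)) * q powr (- gain (spanl Hs) (set Hs)) \<le> 1 / q ^ (c * sdim (spanl Hs)) * 1"
    using q2 by (intro mult_left_mono) auto
  then have "null_prob (set Hs) \<le> 1 / q ^ (c * sdim (spanl Hs))" using null_prob_gain[OF Hs(1)] by linarith
  also have "\<dots> = p ^ s" unfolding dim p_def by (simp add: power_divide power_mult[symmetric] mult.commute mult.left_commute)
  finally have "null_prob (set Hs) \<le> p ^ s" .
  moreover have "p ^ s \<le> null_prob (set Hs)"
    using null_prob_ge[of "set Hs"] Hs distinct_card[of Hs] by simp
  ultimately show ?thesis by simp
qed

text \<open>Take t least. At level t - 1 some member fails both alternatives, so it meets the span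
  of its predecessors in dimension at least t and each of them in codimension at least t;
  \<open>gain_spanl\<close> then yields kap' c t.\<close>

lemma null_prob_dependent:
  assumes Hs: "set Hs \<subseteq> G" "distinct Hs" "length Hs = s" and dep: "Hs \<notin> lists_adm 0 s"
  shows "\<exists>t\<in>{1..r}. Hs \<in> lists_adm t s \<and>
    null_prob (set Hs) \<le> 1 / q ^ (c * sdim (spanl Hs)) * q powr (- (kap' * real c * real t))"
proof -
  define t where "t = (LEAST t. Hs \<in> lists_adm t s)"
  have top: "Hs \<in> lists_adm r s" using lists_adm_top Hs by auto
  have in_t: "Hs \<in> lists_adm t s" unfolding t_def by (rule LeastI[of "\<lambda>x. Hs \<in> lists_adm x s", OF top])
  have le: "t \<le> r" unfolding t_def by (rule Least_le[of "\<lambda>x. Hs \<in> lists_adm x s", OF top])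
  have pos: "t \<ge> 1" using in_t dep by (cases t) auto
  have "Hs \<notin> lists_adm (t - 1) s"
    using not_less_Least[of "t - 1" "\<lambda>x. Hs \<in> lists_adm x s"] pos unfolding t_def[symmetric] by auto
  then obtain i where i: "i < length Hs" "\<not> admissible (t - 1) (take i Hs) (Hs ! i)"
    using lists_adm_if_prefixes[OF Hs(1,2), of "t - 1"] Hs(3) by auto
  then have j: "sdim (Hs ! i \<inter> spanl (take i Hs)) \<ge> t"
    and far: "\<And>X. X \<in> set (take i Hs) \<Longrightarrow> sdim (Hs ! i \<inter> X) + t \<le> r"
    using pos by (auto simp: admissible_def not_le)
  have "sdim (Hs ! i \<inter> Hs ! l) + t \<le> r" if "l < i" for l
  proof -
    have "take i Hs ! l \<in> set (take i Hs)" using that i by (intro nth_mem) auto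
    then show ?thesis using far[of "Hs ! l"] that by simp
  qed
  then have "gain (spanl Hs) (set Hs) \<ge> kap' * real c * real (min t (sdim (Hs ! i \<inter> spanl (take i Hs))))"
    using Hs G_D i le by (intro gain_spanl) auto
  then have "gain (spanl Hs) (set Hs) \<ge> kap' * real c * real t" using j by (simp add: min_def split: if_splits)
  then have "q powr (- gain (spanl Hs) (set Hs)) \<le> q powr (- (kap' * real c * real t))"
    using q2 by (intro powr_mono) auto
  then have "1 / q ^ (c * sdim (spanl Hs)) * q powr (- gain (spanl Hs) (set Hs)) \<le>
      1 / q ^ (c * sdim (spanl Hs)) * q powr (- (kap' * real c * real t))"
    using q2 by (intro mult_left_mono) auto
  then have "null_prob (set Hs) \<le> 1 / q ^ (c * sdim (spanl Hs)) * q powr (- (kap' * real c * real t))"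
    using null_prob_gain[OF Hs(1)] by linarith
  then show ?thesis using in_t le pos by auto
qed

text \<open>Every dependent list is charged to a level t. Apart from the base factor, the total mass
  there is at most q^(t n (n + 1) r), which by \<open>small\<close> uses up at most half of the
  exponent kap' c t; the other half is at least kap' c / 2.\<close>

lemma moment_error:
  assumes sL: "s \<le> n" and small: "2 * real (n * (n + 1) * r) \<le> kap' * real c"
  shows "(\<Sum>S\<in>{S. S \<subseteq> G \<and> card S = s}. \<bar>null_prob S - p ^ s\<bar>) \<le>
    real r * (64 * (real n + 1) * (real r + 1)\<^sup>2) ^ s * q powr (- (kap' * real c / 2))"
proof -
  define D where "D = {Hs. set Hs \<subseteq> G \<and> distinct Hs \<and> length Hs = s}"
  have finD: "finite D"
    by (rule finite_subset[OF _ finite_lists_length_eq[OF finite_G, of s]]) (auto simp: D_def)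
  let ?A = "64 * (real n + 1) * (real r + 1)\<^sup>2"
  let ?w = "\<lambda>Hs. 1 / q ^ (c * sdim (spanl Hs))"
  have sets: "{S. S \<subseteq> G \<and> card S = s} = set ` D"
  proof (intro equalityI subsetI)
    fix S assume S: "S \<in> {S. S \<subseteq> G \<and> card S = s}"
    then have "finite S" using finite_G finite_subset by auto
    then obtain xs where "set xs = S" "distinct xs" using finite_distinct_list by auto
    then show "S \<in> set ` D" using S distinct_card[of xs] by (auto simp: D_def intro!: image_eqI[of _ _ xs])
  qed (auto simp: D_def distinct_card)
  \<comment> \<open>Each set is counted once for every ordering, which only enlarges the
    sum.\<close>
  have "(\<Sum>S\<in>{S. S \<subseteq> G \<and> card S = s}. \<bar>null_prob S - p ^ s\<bar>) \<le> (\<Sum>Hs\<in>D. \<bar>null_prob (set Hs) - p ^ s\<bar>)"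
    unfolding sets using sum_image_le[OF finD, of "\<lambda>S. \<bar>null_prob S - p ^ s\<bar>" set] by simp
  also have "\<dots> \<le> (\<Sum>Hs\<in>D. \<Sum>t\<in>{1..r}. if Hs \<in> lists_adm t s then ?w Hs * q powr (- (kap' * real c * real t)) else 0)"
  proof (rule sum_mono)
    fix Hs assume Hs: "Hs \<in> D"
    have nn: "0 \<le> (if Hs \<in> lists_adm t s then ?w Hs * q powr (- (kap' * real c * real t)) else 0)" for t
      using q2 by auto
    show "\<bar>null_prob (set Hs) - p ^ s\<bar> \<le> (\<Sum>t\<in>{1..r}. if Hs \<in> lists_adm t s then ?w Hs * q powr (- (kap' * real c * real t)) else 0)"
    proof (cases "Hs \<in> lists_adm 0 s")
      case True
      then show ?thesis using null_prob_independent[OF True] by (simp add: sum_nonneg)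
    next
      case False
      then obtain t where t: "t \<in> {1..r}" "Hs \<in> lists_adm t s"
        "null_prob (set Hs) \<le> ?w Hs * q powr (- (kap' * real c * real t))"
        using null_prob_dependent[of Hs s] Hs by (auto simp: D_def)
      have "p ^ s \<le> null_prob (set Hs)"
        using null_prob_ge[of "set Hs"] Hs distinct_card[of Hs] by (auto simp: D_def)
      then have "\<bar>null_prob (set Hs) - p ^ s\<bar> \<le> null_prob (set Hs)" using p_nonneg by simp
      also have "\<dots> \<le> (if Hs \<in> lists_adm t s then ?w Hs * q powr (- (kap' * real c * real t)) else 0)" using t by simp
      also have "\<dots> \<le> (\<Sum>t\<in>{1..r}. if Hs \<in> lists_adm t s then ?w Hs * q powr (- (kap' * real c * real t)) else 0)"
        using t(1) nn by (intro member_le_sum) auto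
      finally show ?thesis .
    qed
  qed
  also have "\<dots> = (\<Sum>t\<in>{1..r}. \<Sum>Hs\<in>D. if Hs \<in> lists_adm t s then ?w Hs * q powr (- (kap' * real c * real t)) else 0)"
    by (rule sum.swap)
  also have "\<dots> \<le> (\<Sum>t\<in>{1..r}. ?A ^ s * q powr (- (kap' * real c / 2)))"
  proof (rule sum_mono)
    fix t assume t: "t \<in> {1..r}"
    have "(\<Sum>Hs\<in>D. if Hs \<in> lists_adm t s then ?w Hs * q powr (- (kap' * real c * real t)) else 0) =
        (\<Sum>Hs\<in>D \<inter> lists_adm t s. ?w Hs * q powr (- (kap' * real c * real t)))"
      by (simp only: sum.inter_restrict[OF finD])
    also have "D \<inter> lists_adm t s = lists_adm t s" using lists_adm_D by (auto simp: D_def)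
    also have "(\<Sum>Hs\<in>lists_adm t s. ?w Hs * q powr (- (kap' * real c * real t))) =
        (\<Sum>Hs\<in>lists_adm t s. ?w Hs) * q powr (- (kap' * real c * real t))" by (simp only: sum_distrib_right)
    also have "\<dots> \<le> (?A * q ^ (t * (n + 1) * r)) ^ s * q powr (- (kap' * real c * real t))"
      using t sL by (intro mult_right_mono sum_lists_adm) auto
    also have "\<dots> = ?A ^ s * (q powr (real (t * (n + 1) * r * s)) * q powr (- (kap' * real c * real t)))"
    proof -
      have e: "q powr (real (t * (n + 1) * r * s)) = q ^ (t * (n + 1) * r * s)"
        using q2 by (intro powr_realpow) auto
      show ?thesis unfolding e power_mult_distrib power_mult[symmetric] by (rule mult.assoc)
    qed
    also have "\<dots> = ?A ^ s * q powr (real (t * (n + 1) * r * s) - kap' * real c * real t)"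
      by (simp add: powr_add[symmetric])
    also have "\<dots> \<le> ?A ^ s * q powr (- (kap' * real c / 2))"
    proof (intro mult_left_mono powr_mono)
      have "real (t * (n + 1) * r * s) \<le> real (t * (n + 1) * r * n)"
        using sL by (intro of_nat_mono mult_left_mono) auto
      also have "\<dots> = real t * real (n * (n + 1) * r)" by (simp add: algebra_simps)
      also have "\<dots> \<le> real t * (kap' * real c / 2)" using small by (intro mult_left_mono) auto
      finally have 1: "real (t * (n + 1) * r * s) \<le> real t * (kap' * real c / 2)" .
      have "kap' * real c / 2 * 1 \<le> kap' * real c / 2 * real t"
        using t kap_bounds by (intro mult_left_mono) (auto simp: kap'_def)
      then show "real (t * (n + 1) * r * s) - kap' * real c * real t \<le> - (kap' * real c / 2)"
        using 1 by (simp add: algebra_simps)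
    qed (use q2 in auto)
    finally show "(\<Sum>Hs\<in>D. if Hs \<in> lists_adm t s then ?w Hs * q powr (- (kap' * real c * real t)) else 0) \<le>
        ?A ^ s * q powr (- (kap' * real c / 2))" .
  qed
  also have "\<dots> = real r * ?A ^ s * q powr (- (kap' * real c / 2))" by simp
  finally show ?thesis .
qed

end

section \<open>The Poisson approximation\<close>

text \<open>Both laws are images of the field of indicators of Z, and neither map increases the
  distance. For the Bernoulli subset this field is independent, and is compared with Poisson
  variables coordinate by coordinate.\<close>

lemma poisson_approximations:
  assumes G: "finite G" "G \<noteq> {}" and P: "set_pmf P \<subseteq> Pow G" and p: "0 < p" "p \<le> 1"
    and d: "d_TV P (bernoulli_subset G p) \<le> d" and e: "real (card G) * p\<^sup>2 \<le> e"
  shows "d_TV (map_pmf (\<lambda>Z. atomic_measure G (\<lambda>H. of_bool (H \<in> Z))) P) (poisson_process G p) \<le> d + e"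
    and "d_TV (map_pmf card P) (poisson_pmf (real (card G) * p)) \<le> d + e"
proof -
  let ?f = "\<lambda>Z x. of_bool (x \<in> Z) :: nat" and ?R = "Pi_pmf G 0 (\<lambda>_. poisson_pmf p)"
  have "d_TV (map_pmf ?f P) ?R \<le>
      d_TV (map_pmf ?f P) (map_pmf ?f (bernoulli_subset G p)) + d_TV (map_pmf ?f (bernoulli_subset G p)) ?R"
    by (rule d_TV_triangle)
  also have "\<dots> \<le> d + e"
    using d_TV_map[of ?f P "bernoulli_subset G p"] d e d_TV_bernoulli_subset_poisson[OF G(1) p] by linarith
  finally have *: "d_TV (map_pmf ?f P) ?R \<le> d + e" .
  have "map_pmf (\<lambda>Z. atomic_measure G (\<lambda>H. of_bool (H \<in> Z))) P = map_pmf (atomic_measure G) (map_pmf ?f P)"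
    by (simp add: pmf.map_comp comp_def)
  then show "d_TV (map_pmf (\<lambda>Z. atomic_measure G (\<lambda>H. of_bool (H \<in> Z))) P) (poisson_process G p) \<le> d + e"
    using d_TV_map[of "atomic_measure G" "map_pmf ?f P" ?R] * unfolding poisson_process_def by simp
  have "map_pmf card P = map_pmf (\<lambda>g. \<Sum>x\<in>G. g x) (map_pmf ?f P)"
    unfolding pmf.map_comp comp_def
  proof (rule map_pmf_cong[OF refl])
    fix Z assume "Z \<in> set_pmf P"
    then have "Z \<subseteq> G" using P by blast
    then show "card Z = (\<Sum>x\<in>G. of_bool (x \<in> Z))" using G(1) by (simp add: Int_absorb1 of_bool_def sum.If_cases)
  qed
  then show "d_TV (map_pmf card P) (poisson_pmf (real (card G) * p)) \<le> d + e"
    using d_TV_map[of "\<lambda>g. \<Sum>x\<in>G. g x" "map_pmf ?f P" ?R] * map_sum_Pi_pmf_poisson[OF G p(1)] by simp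
qed

lemma expectation_card:
  assumes G: "finite G" and P: "set_pmf P \<subseteq> Pow G"
  shows "measure_pmf.expectation P (\<lambda>Z. real (card Z)) = (\<Sum>x\<in>G. measure_pmf.prob P {Z. x \<in> Z})"
proof -
  have "measure_pmf.expectation P (\<lambda>Z. real (card Z)) = measure_pmf.expectation P (\<lambda>Z. \<Sum>x\<in>G. indicator {Z. x \<in> Z} Z)"
  proof (rule integral_cong_AE)
    show "AE Z in measure_pmf P. real (card Z) = (\<Sum>x\<in>G. indicator {Z. x \<in> Z} Z)"
    proof (rule AE_pmfI)
      fix Z assume "Z \<in> set_pmf P"
      then have "Z \<subseteq> G" using P by blast
      then show "real (card Z) = (\<Sum>x\<in>G. indicator {Z. x \<in> Z} Z)"
        using G by (simp add: Int_absorb1 indicator_def sum.If_cases)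
    qed
  qed simp_all
  also have "\<dots> = (\<Sum>x\<in>G. measure_pmf.expectation P (indicator {Z. x \<in> Z}))"
    by (rule Bochner_Integration.integral_sum) (simp add: measure_pmf.integrable_const_bound[where B = 1])
  finally show ?thesis by simp
qed

context resonant_space
begin

definition null_law :: "'c set set pmf" where
  "null_law = map_pmf (\<lambda>\<theta>. {H \<in> G. \<theta> ` exterior_subspace K k V H = {\<zero>\<^bsub>W\<^esub>}})
     (pmf_of_set (Hom_space K (E k) W))"

lemma set_null_law: "set_pmf null_law \<subseteq> Pow G"
  by (auto simp: null_law_def)

lemma prob_null_law:
  assumes S: "S \<subseteq> G" shows "measure_pmf.prob null_law {Z. S \<subseteq> Z} = null_prob S"
proof -
  let ?H = "Hom_space K (E k) W"
  have fin: "finite ?H" using bij_betw_finite[OF bij_form_of] finite_forms[OF sub_carrier_V] by blast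
  have c: "card ?H = card (forms k (carrier V) {})" by (rule bij_betw_same_card[OF bij_form_of])
  then have ne: "?H \<noteq> {}" using card_forms_pos[OF sub_carrier_V, of k "{}"] by auto
  have "measure_pmf.prob null_law {Z. S \<subseteq> Z} =
      real (card (?H \<inter> {\<theta>. S \<subseteq> {H \<in> G. \<theta> ` exterior_subspace K k V H = {\<zero>\<^bsub>W\<^esub>}}})) / real (card ?H)"
    unfolding null_law_def using measure_pmf_of_set[OF ne fin] by (simp add: vimage_def)
  also have "?H \<inter> {\<theta>. S \<subseteq> {H \<in> G. \<theta> ` exterior_subspace K k V H = {\<zero>\<^bsub>W\<^esub>}}} =
      {\<theta> \<in> ?H. \<forall>H\<in>S. \<theta> ` exterior_subspace K k V H = {\<zero>\<^bsub>W\<^esub>}}"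
    using S by auto
  also have "card \<dots> = card (forms k (carrier V) S)" using S G_D by (intro card_null) blast
  finally show ?thesis by (simp add: null_prob_def c)
qed

lemma null_prob_single: "H \<in> G \<Longrightarrow> null_prob {H} = p"
proof -
  assume H: "H \<in> G"
  have "H \<inter> spanl [] = {\<zero>\<^bsub>V\<^esub>}" using sub_zero[OF G_D(1)[OF H]] by auto
  then have "admissible 0 [] H" by (simp add: admissible_def sdim_triv)
  then have "([], H) \<in> (SIGMA xs:lists_adm 0 0. {H \<in> G. H \<notin> set xs \<and> admissible 0 xs H})" using H by simp
  then have "[H] \<in> lists_adm 0 (Suc 0)" unfolding lists_adm.simps(2) by force
  then show ?thesis using null_prob_independent[of "[H]" 1] by simp
qed

text \<open>The Gaussian binomial coefficient of r + c over r, with the leading powers of q taken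
  out of all factors; numerator and denominator then differ by q^(r c) = 1 / p.\<close>

lemma mean_eq:
  "real (card G) * p = (\<Prod>j<r. 1 - (1 / q) ^ Suc (c + j)) / (\<Prod>j<r. 1 - (1 / q) ^ Suc j)"
proof -
  define x where "x = 1 / q"
  have q0: "q > 0" using q2 by simp
  have "between {\<zero>\<^bsub>V\<^esub>} (carrier V) r = G"
    using sub_subset sub_zero by (auto simp: between_def G_def sdim_triv)
  then have "card G * (\<Prod>i<r. card (carrier K) ^ r - card (carrier K) ^ i) =
      (\<Prod>i<r. card (carrier K) ^ (r + c) - card (carrier K) ^ i)"
    using card_between[OF sub_triv sub_carrier_V, of r] by (simp add: sdim_triv dimV)
  then have "real (card G) * real (\<Prod>i<r. card (carrier K) ^ r - card (carrier K) ^ i) =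
      real (\<Prod>i<r. card (carrier K) ^ (r + c) - card (carrier K) ^ i)"
    by (metis of_nat_mult)
  moreover have prod: "real (\<Prod>i<r. card (carrier K) ^ (r + d) - card (carrier K) ^ i) =
      q ^ ((r + d) * r) * (\<Prod>j<r. 1 - x ^ Suc (d + j))" for d
  proof -
    have "real (\<Prod>i<r. card (carrier K) ^ (r + d) - card (carrier K) ^ i) = (\<Prod>i<r. q ^ (r + d) - q ^ i)"
      unfolding of_nat_prod
    proof (rule prod.cong[OF refl])
      fix i assume "i \<in> {..<r}"
      then have "card (carrier K) ^ i \<le> card (carrier K) ^ (r + d)" using q_ge2 by (intro power_increasing) auto
      then show "real (card (carrier K) ^ (r + d) - card (carrier K) ^ i) = q ^ (r + d) - q ^ i" by (simp add: of_nat_diff)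
    qed
    also have "\<dots> = (\<Prod>j<r. q ^ (r + d) - q ^ (r - Suc j))" by (rule prod.nat_diff_reindex[symmetric])
    also have "\<dots> = (\<Prod>j<r. q ^ (r + d) * (1 - x ^ Suc (d + j)))"
    proof (rule prod.cong[OF refl])
      fix j assume "j \<in> {..<r}"
      then have "r + d = (r - Suc j) + Suc (d + j)" by simp
      then have "q ^ (r + d) = q ^ (r - Suc j) * q ^ Suc (d + j)" by (metis power_add)
      then have "q ^ (r + d) * x ^ Suc (d + j) = q ^ (r - Suc j)"
        using q0 by (simp add: x_def power_one_over field_simps del: power_Suc)
      then show "q ^ (r + d) - q ^ (r - Suc j) = q ^ (r + d) * (1 - x ^ Suc (d + j))"
        by (simp add: right_diff_distrib del: power_Suc)
    qed
    also have "\<dots> = q ^ ((r + d) * r) * (\<Prod>j<r. 1 - x ^ Suc (d + j))"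
      by (simp add: prod.distrib power_mult)
    finally show ?thesis .
  qed
  ultimately have eq: "real (card G) * (q ^ (r * r) * (\<Prod>j<r. 1 - x ^ Suc j)) =
      q ^ ((r + c) * r) * (\<Prod>j<r. 1 - x ^ Suc (c + j))"
    using prod[of 0] prod[of c] by simp
  have "(\<Prod>j<r. 1 - x ^ Suc j) \<ge> 1 / 4"
    using q2 by (intro prod_one_minus_powers_ge) (auto simp: x_def field_simps)
  then have A: "(\<Prod>j<r. 1 - x ^ Suc j) > 0" by linarith
  have "q ^ ((r + c) * r) = q ^ (r * r) * q ^ (r * c)" by (simp add: power_add[symmetric] algebra_simps)
  then have "q ^ (r * r) * (real (card G) * (\<Prod>j<r. 1 - x ^ Suc j)) =
      q ^ (r * r) * (q ^ (r * c) * (\<Prod>j<r. 1 - x ^ Suc (c + j)))"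
    using eq by (simp only: mult_ac)
  then have "real (card G) * (\<Prod>j<r. 1 - x ^ Suc j) = q ^ (r * c) * (\<Prod>j<r. 1 - x ^ Suc (c + j))"
    using q0 by (simp only: mult_left_cancel power_not_zero less_imp_neq[symmetric] not_False_eq_True mult_cancel_left) auto
  then have "real (card G) * p * (\<Prod>j<r. 1 - x ^ Suc j) = (p * q ^ (r * c)) * (\<Prod>j<r. 1 - x ^ Suc (c + j))"
    by (simp only: mult_ac)
  also have "p * q ^ (r * c) = 1" using q0 by (simp add: p_def)
  finally have "real (card G) * p * (\<Prod>j<r. 1 - x ^ Suc j) = (\<Prod>j<r. 1 - x ^ Suc (c + j))" by (simp only: mult_1)
  moreover have "(\<Prod>j<r. 1 - x ^ Suc j) \<noteq> 0" using A by linarith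
  ultimately show ?thesis unfolding x_def[symmetric] by (rule nonzero_eq_divide_eq[THEN iffD2, rotated])
qed

lemma null_law_bernoulli:
  assumes small: "2 * real (n * (n + 1) * r) \<le> kap' * real c"
  shows "d_TV null_law (bernoulli_subset G p) \<le> 2 ^ n * (real (n + 1) *
    (real r * (64 * (real n + 1) * (real r + 1)\<^sup>2) ^ n * q powr (- (kap' * real c / 2))) +
    2 * (real (card G) * p) ^ n / fact n)"
proof (rule d_TV_bernoulli_subset[OF finite_G set_null_law p_nonneg])
  fix s assume s: "s \<le> n"
  let ?b = "64 * (real n + 1) * (real r + 1)\<^sup>2"
  have "(\<Sum>S | S \<subseteq> G \<and> card S = s. \<bar>measure_pmf.prob null_law {Z. S \<subseteq> Z} - p ^ s\<bar>) =
      (\<Sum>S | S \<subseteq> G \<and> card S = s. \<bar>null_prob S - p ^ s\<bar>)"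
    by (intro sum.cong) (auto simp: prob_null_law)
  also have "\<dots> \<le> real r * ?b ^ s * q powr (- (kap' * real c / 2))" by (rule moment_error[OF s small])
  also have "\<dots> \<le> real r * ?b ^ n * q powr (- (kap' * real c / 2))"
  proof -
    have "1 * 1 \<le> (64 * (real n + 1)) * (real r + 1)\<^sup>2" by (intro mult_mono) (auto simp: one_le_power)
    then show ?thesis using s by (intro mult_right_mono mult_left_mono power_increasing) auto
  qed
  finally show "(\<Sum>S | S \<subseteq> G \<and> card S = s. \<bar>measure_pmf.prob null_law {Z. S \<subseteq> Z} - p ^ s\<bar>) \<le>
    real r * ?b ^ n * q powr (- (kap' * real c / 2))" .
qed

lemma expectation_null_law: "measure_pmf.expectation null_law (\<lambda>Z. real (card Z)) = real (card G) * p"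
proof -
  have "measure_pmf.prob null_law {Z. H \<in> Z} = p" if "H \<in> G" for H
    using prob_null_law[of "{H}"] null_prob_single[OF that] that by simp
  then show ?thesis unfolding expectation_card[OF finite_G set_null_law] by simp
qed

end

section \<open>Coordinate spaces and the final estimates\<close>

lemma resonant_space_coord:
  fixes F :: "nat ring"
  assumes F: "is_GF q F" and k: "k \<ge> 3" and r: "r \<ge> 4 * k + 14" and m: "m \<ge> 1" and res: "resonant k r m c"
  shows "resonant_space F (coord_space F (r + c)) (coord_space F m) k r m c"
proof -
  interpret F: Ring.field F using F by (simp add: is_GF_def)
  have fin: "finite (carrier F)" and q: "card (carrier F) = q" using F by (auto simp: is_GF_def)
  interpret V: module F "coord_space F (r + c)" by (rule F.func_space_is_module)
  interpret W: module F "coord_space F m" by (rule F.func_space_is_module)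
  have fins: "finite (carrier (coord_space F n))" for n
    unfolding F.func_space_simps using fin by (intro finite_PiE) auto
  have card: "card (carrier (coord_space F n)) = card (carrier F) ^ n" for n
    unfolding F.func_space_simps by (simp add: card_PiE)
  interpret V: finite_vectorspace F "coord_space F (r + c)"
    by unfold_locales (use fin fins in auto)
  have "card (carrier F) ^ 1 \<le> card (carrier F) ^ m" using m V.q_ge2 by (intro power_increasing) auto
  then have W2: "card (carrier (coord_space F m)) \<ge> 2" using V.q_ge2 by (simp add: card)
  show ?thesis
  proof unfold_locales
    show "finite (carrier (coord_space F m))" by (rule fins)
    show "2 \<le> card (carrier (coord_space F m))" by (rule W2)
    show "3 \<le> k" "4 * k + 14 \<le> r" by (rule k, rule r)
    show "real m * real (r choose k) = real r * real c" using res by (simp add: resonant_def)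
    show "card (carrier (coord_space F m)) = card (carrier F) ^ m" by (rule card)
    show "V.sdim (carrier (coord_space F (r + c))) = r + c" by (rule V.sdim_eqI) (rule card)
  qed
qed

text \<open>The target error e is shared, one half for the distance to the Bernoulli subset and one
  half for the passage to Poisson variables. The 20 is the constant of
  \<open>mean_approx\<close>.\<close>

lemma total_variation_bounds:
  assumes k: "k \<ge> 3"
  shows "\<exists>a::real. a > 0 \<and> (\<exists>r0::nat. \<forall>r\<ge>r0. \<forall>q m c N. \<forall>F :: nat ring.
        primepow q \<and> is_GF q F \<and> m \<ge> 1 \<and> resonant k r m c \<and> N = r + c \<longrightarrow>
          d_TV (Z_law F k m N r)
               (bernoulli_subset (Gr F r (coord_space F N)) (p_res k q m r))
            \<le> exp (- a * Psi m k r) \<and>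
          d_TV (Xi_law F k m N r)
               (poisson_process (Gr F r (coord_space F N)) (p_res k q m r))
            \<le> exp (- a * Psi m k r) \<and>
          d_TV (X_law F k m N r) (poisson_pmf (mean_X F k m N r))
            \<le> exp (- a * Psi m k r) \<and>
          d_TV (X_law F k m N r) (poisson_pmf (C_const q))
            \<le> 20 * (1 / real q) ^ r + exp (- a * Psi m k r))"
proof -
  obtain \<alpha> a :: real and r0 :: nat where a: "0 < a" "0 < \<alpha>" "4 * k + 14 \<le> r0"
    and asy: "\<And>r m c q L. r \<ge> r0 \<Longrightarrow> m \<ge> 1 \<Longrightarrow> real m * real (r choose k) = real r * real c \<Longrightarrow> q \<ge> (2::real) \<Longrightarrow>
      L = nat \<lceil>\<alpha> * rho m k r\<rceil> \<Longrightarrow>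
      r \<le> c \<and> 2 * real (L * (L + 1) * r) \<le> 1 / 2 ^ (k + 2) / 16 * real c \<and>
      (\<forall>\<mu>. 0 \<le> \<mu> \<longrightarrow> \<mu> \<le> 4 \<longrightarrow>
        2 ^ L * (real (L + 1) * (real r * (64 * (real L + 1) * (real r + 1)\<^sup>2) ^ L * q powr (- (1 / 2 ^ (k + 2) / 16 * real c / 2)))
          + 2 * \<mu> ^ L / fact L) \<le> exp (- a * Psi m k r) / 2) \<and>
      4 / q ^ (r * c) \<le> exp (- a * Psi m k r) / 4"
    by (rule asymptotic_constants[OF k]) (rule that; assumption)
  show ?thesis
  proof (intro exI[of _ a] conjI exI[of _ r0] allI impI; (elim conjE)?)
    show "a > 0" by (rule a)
  next
    fix r q m c N and F :: "nat ring"
    assume r: "r0 \<le> r" and F: "is_GF q F" and m: "1 \<le> m" and res: "resonant k r m c" and N: "N = r + c"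
    interpret R: resonant_space F "coord_space F (r + c)" "coord_space F m" k r m c
      using a(3) r by (intro resonant_space_coord[OF F k _ m res]) auto
    have q: "card (carrier F) = q" using F by (simp add: is_GF_def)
    have q2: "real q \<ge> 2" "q \<ge> 2" using R.q_ge2 q by auto
    have GG: "Gr F r (coord_space F N) = R.G" unfolding N R.G_def using R.Gr_iff by blast
    have p: "p_res k q m r = R.p" unfolding p_res_def R.m_choose q by (simp add: power_one_over R.p_def q)
    have Z: "Z_law F k m N r = R.null_law"
      unfolding Z_law_def Theta_law_def R.null_law_def null_spaces_def[abs_def] GG unfolding N ..
    define e where "e = exp (- a * Psi m k r)"
    define L where "L = nat \<lceil>\<alpha> * rho m k r\<rceil>"
    note A = asy[OF r m R.res q2(1) L_def]
    note rc = conjunct1[OF A] and A2 = conjunct1[OF conjunct2[OF A]]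
      and A3 = conjunct1[OF conjunct2[OF conjunct2[OF A]]] and A4 = conjunct2[OF conjunct2[OF conjunct2[OF A]]]
    let ?\<mu> = "real (card R.G) * R.p"
    have \<mu>: "0 < ?\<mu>" "?\<mu> \<le> 4" "\<bar>?\<mu> - C_const q\<bar> \<le> 20 * (1 / real q) ^ r"
      unfolding R.mean_eq q by (rule mean_approx[OF q2(2) rc])+
    have "d_TV R.null_law (bernoulli_subset R.G R.p) \<le> 2 ^ L * (real (L + 1) *
        (real r * (64 * (real L + 1) * (real r + 1)\<^sup>2) ^ L * real q powr (- (R.kap' * real c / 2))) +
        2 * ?\<mu> ^ L / fact L)"
      using R.null_law_bernoulli[of L] A2 by (simp only: q R.kap'_def R.kap_def)
    also have "\<dots> \<le> e / 2" using A3[rule_format, OF less_imp_le[OF \<mu>(1)] \<mu>(2)] by (simp only: e_def R.kap'_def R.kap_def)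
    finally have B: "d_TV R.null_law (bernoulli_subset R.G R.p) \<le> e / 2" .
    have ne: "R.G \<noteq> {}" using \<mu>(1) by auto
    have p01: "0 < R.p" "R.p \<le> 1" using R.q2 R.p_nonneg by (auto simp: R.p_def)
    have "real (card R.G) * R.p\<^sup>2 = ?\<mu> * R.p" by (simp add: power2_eq_square)
    also have "\<dots> \<le> 4 * R.p" using \<mu> p01 by (intro mult_right_mono) auto
    also have "\<dots> \<le> e / 4" using A4 by (simp add: e_def q R.p_def)
    also have "\<dots> \<le> e / 2" by (simp add: e_def)
    finally have e: "real (card R.G) * R.p\<^sup>2 \<le> e / 2" .
    note PA = poisson_approximations[OF R.finite_G ne R.set_null_law p01 B e, simplified]
    have mean: "mean_X F k m N r = ?\<mu>"
      unfolding mean_X_def X_law_def Z by (simp add: R.expectation_null_law)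
    show "d_TV (Z_law F k m N r) (bernoulli_subset (Gr F r (coord_space F N)) (p_res k q m r))
        \<le> exp (- a * Psi m k r)"
      using B d_TV_nonneg[of R.null_law "bernoulli_subset R.G R.p"] unfolding Z GG p e_def by linarith
    show "d_TV (Xi_law F k m N r) (poisson_process (Gr F r (coord_space F N)) (p_res k q m r))
        \<le> exp (- a * Psi m k r)"
      using PA(1) unfolding Xi_law_def Z GG p e_def by simp
    show X: "d_TV (X_law F k m N r) (poisson_pmf (mean_X F k m N r)) \<le> exp (- a * Psi m k r)"
      using PA(2) unfolding mean X_law_def Z e_def by simp
    have "d_TV (poisson_pmf ?\<mu>) (poisson_pmf (C_const q)) \<le> 20 * (1 / real q) ^ r"
      using d_TV_poisson[OF \<mu>(1), of "C_const q"] C_const_bounds(1)[OF q2(2)] \<mu>(3) by linarith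
    then show "d_TV (X_law F k m N r) (poisson_pmf (C_const q))
        \<le> 20 * (1 / real q) ^ r + exp (- a * Psi m k r)"
      using X d_TV_triangle[of "X_law F k m N r" "poisson_pmf (C_const q)" "poisson_pmf ?\<mu>"] unfolding mean by linarith
  qed
qed

text \<open>By \<open>rho_ge\<close> the growth is at least that of sqrt r, whatever m is.\<close>

lemma Psi_at_top:
  assumes k: "k \<ge> 3" and r: "filterlim r at_top sequentially" and m: "\<And>n. m n \<ge> 1"
  shows "filterlim (\<lambda>n. Psi (m n) k (r n)) at_top sequentially"
proof (rule filterlim_at_top_mono)
  have r': "filterlim (\<lambda>n. real (r n)) at_top sequentially" by (rule filterlim_compose[OF filterlim_real_sequentially r])
  have s: "filterlim (\<lambda>n. sqrt (real (r n))) at_top sequentially" by (rule filterlim_compose[OF sqrt_at_top r'])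
  show "filterlim (\<lambda>n. ln 2 * sqrt (real (r n))) at_top sequentially"
    by (rule filterlim_tendsto_pos_mult_at_top[OF tendsto_const _ s]) simp
  have "eventually (\<lambda>n. r n \<ge> 1) sequentially" using r by (auto simp: filterlim_at_top)
  then show "eventually (\<lambda>n. ln 2 * sqrt (real (r n)) \<le> Psi (m n) k (r n)) sequentially"
  proof eventually_elim
    case (elim n)
    have x: "sqrt (real (r n)) \<le> rho (m n) k (r n)" by (rule rho_ge[OF elim k m])
    have x0: "0 \<le> rho (m n) k (r n)" using x real_sqrt_ge_zero[of "real (r n)"] by linarith
    have "sqrt (real (r n)) * ln 2 \<le> rho (m n) k (r n) * ln (2 + rho (m n) k (r n))"
      using x x0 by (intro mult_mono) auto
    then show ?case by (simp add: Psi_def mult.commute)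
  qed
qed

lemma C_const_tendsto_1:
  assumes "filterlim q at_top sequentially" "\<And>n. q n \<ge> 2"
  shows "(\<lambda>n. C_const (q n)) \<longlonglongrightarrow> 1"
proof (rule tendsto_sandwich[where f = "\<lambda>_. 1" and h = "\<lambda>n. 1 + 32 / real (q n)"])
  have "filterlim (\<lambda>n. real (q n)) at_top sequentially" by (rule filterlim_compose[OF filterlim_real_sequentially assms(1)])
  then have "(\<lambda>n. 32 / real (q n)) \<longlonglongrightarrow> 0"
    by (intro tendsto_divide_0[OF tendsto_const] filterlim_at_top_imp_at_infinity)
  then show "(\<lambda>n. 1 + 32 / real (q n)) \<longlonglongrightarrow> 1" using tendsto_add[OF tendsto_const[of 1]] by fastforce
  show "(\<lambda>_. 1) \<longlonglongrightarrow> (1::real)" by simp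
qed (use C_const_bounds assms(2) in auto)

theorem theorem1p1:
  "(\<exists>B::real. B > 0 \<and>
     (\<forall>k\<ge>3. \<exists>a::real. a > 0 \<and> (\<exists>r0::nat. \<forall>r\<ge>r0. \<forall>q m c N. \<forall>F :: nat ring.
        primepow q \<and> is_GF q F \<and> m \<ge> 1 \<and> resonant k r m c \<and> N = r + c \<longrightarrow>
          d_TV (Z_law F k m N r)
               (bernoulli_subset (Gr F r (coord_space F N)) (p_res k q m r))
            \<le> exp (- a * Psi m k r) \<and>
          d_TV (Xi_law F k m N r)
               (poisson_process (Gr F r (coord_space F N)) (p_res k q m r))
            \<le> exp (- a * Psi m k r) \<and>
          d_TV (X_law F k m N r) (poisson_pmf (mean_X F k m N r))
            \<le> exp (- a * Psi m k r) \<and>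
          d_TV (X_law F k m N r) (poisson_pmf (C_const q))
            \<le> B * (1 / real q) ^ r + exp (- a * Psi m k r)))) \<and>
   (\<forall>k\<ge>3. \<forall>r q m c N :: nat \<Rightarrow> nat. \<forall>F :: nat \<Rightarrow> nat ring.
      filterlim r at_top sequentially \<and>
      (\<forall>n. primepow (q n) \<and> is_GF (q n) (F n) \<and> m n \<ge> 1 \<and>
           resonant k (r n) (m n) (c n) \<and> N n = r n + c n) \<longrightarrow>
        (\<lambda>n. d_TV (X_law (F n) k (m n) (N n) (r n)) (poisson_pmf (C_const (q n)))) \<longlonglongrightarrow> 0 \<and>
        (filterlim q at_top sequentially \<longrightarrow>
          (\<lambda>n. C_const (q n)) \<longlonglongrightarrow> 1 \<and>
          weak_conv_m (\<lambda>n. distr (measure_pmf (X_law (F n) k (m n) (N n) (r n))) borel real)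
                      (distr (measure_pmf (poisson_pmf 1)) borel real)))"
proof (rule conjI)
  show "\<exists>B::real. B > 0 \<and>
     (\<forall>k\<ge>3. \<exists>a::real. a > 0 \<and> (\<exists>r0::nat. \<forall>r\<ge>r0. \<forall>q m c N. \<forall>F :: nat ring.
        primepow q \<and> is_GF q F \<and> m \<ge> 1 \<and> resonant k r m c \<and> N = r + c \<longrightarrow>
          d_TV (Z_law F k m N r)
               (bernoulli_subset (Gr F r (coord_space F N)) (p_res k q m r))
            \<le> exp (- a * Psi m k r) \<and>
          d_TV (Xi_law F k m N r)
               (poisson_process (Gr F r (coord_space F N)) (p_res k q m r))
            \<le> exp (- a * Psi m k r) \<and>
          d_TV (X_law F k m N r) (poisson_pmf (mean_X F k m N r))
            \<le> exp (- a * Psi m k r) \<and>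
          d_TV (X_law F k m N r) (poisson_pmf (C_const q))
            \<le> B * (1 / real q) ^ r + exp (- a * Psi m k r)))"
    \<comment> \<open>The constant 20 is the same for all k, so B can be chosen before k.\<close>
    by (rule exI[of _ 20], rule conjI[OF _ allI[OF impI[OF total_variation_bounds]]]) simp_all
next
  show "\<forall>k\<ge>3. \<forall>r q m c N :: nat \<Rightarrow> nat. \<forall>F :: nat \<Rightarrow> nat ring.
      filterlim r at_top sequentially \<and>
      (\<forall>n. primepow (q n) \<and> is_GF (q n) (F n) \<and> m n \<ge> 1 \<and>
           resonant k (r n) (m n) (c n) \<and> N n = r n + c n) \<longrightarrow>
        (\<lambda>n. d_TV (X_law (F n) k (m n) (N n) (r n)) (poisson_pmf (C_const (q n)))) \<longlonglongrightarrow> 0 \<and>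
        (filterlim q at_top sequentially \<longrightarrow>
          (\<lambda>n. C_const (q n)) \<longlonglongrightarrow> 1 \<and>
          weak_conv_m (\<lambda>n. distr (measure_pmf (X_law (F n) k (m n) (N n) (r n))) borel real)
                      (distr (measure_pmf (poisson_pmf 1)) borel real))"
  proof (intro allI impI, elim conjE)
    fix k and r q m c N :: "nat \<Rightarrow> nat" and F :: "nat \<Rightarrow> nat ring"
    assume k: "3 \<le> k" and r: "filterlim r at_top sequentially"
      and H: "\<forall>n. primepow (q n) \<and> is_GF (q n) (F n) \<and> m n \<ge> 1 \<and>
           resonant k (r n) (m n) (c n) \<and> N n = r n + c n"
    let ?X = "\<lambda>n. X_law (F n) k (m n) (N n) (r n)"
    obtain a r0 where a: "a > 0" and bd: "\<And>r q m c N (F :: nat ring). r \<ge> r0 \<Longrightarrow>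
        primepow q \<and> is_GF q F \<and> m \<ge> 1 \<and> resonant k r m c \<and> N = r + c \<Longrightarrow>
        d_TV (X_law F k m N r) (poisson_pmf (C_const q)) \<le> 20 * (1 / real q) ^ r + exp (- a * Psi m k r)"
      using total_variation_bounds[OF k] by blast
    have q2: "q n \<ge> 2" for n using H primepow_gt_Suc_0[of "q n"] by fastforce
    \<comment> \<open>Since q n \<ge> 2, powers of 1 / q n are bounded by powers of 1 / 2, however q
      varies.\<close>
    have lim1: "(\<lambda>n. 20 * (1 / 2 :: real) ^ r n) \<longlonglongrightarrow> 0"
    proof -
      have "(\<lambda>i. (1 / 2 :: real) ^ i) \<longlonglongrightarrow> 0" by (rule LIMSEQ_power_zero) simp
      then show ?thesis by (intro tendsto_mult_right_zero filterlim_compose[OF _ r])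
    qed
    have lim2: "(\<lambda>n. exp (- a * Psi (m n) k (r n))) \<longlonglongrightarrow> 0"
    proof (rule filterlim_compose[OF exp_at_bot])
      have "filterlim (\<lambda>n. a * Psi (m n) k (r n)) at_top sequentially"
        using H by (intro filterlim_tendsto_pos_mult_at_top[OF tendsto_const a] Psi_at_top[OF k r]) blast
      then show "filterlim (\<lambda>n. - a * Psi (m n) k (r n)) at_bot sequentially"
        by (simp add: filterlim_uminus_at_bot)
    qed
    have conv: "(\<lambda>n. d_TV (?X n) (poisson_pmf (C_const (q n)))) \<longlonglongrightarrow> 0"
    proof (rule Lim_null_comparison)
      show "(\<lambda>n. 20 * (1 / 2 :: real) ^ r n + exp (- a * Psi (m n) k (r n))) \<longlonglongrightarrow> 0"
        using tendsto_add[OF lim1 lim2] by simp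
      have "eventually (\<lambda>n. r n \<ge> r0) sequentially" using r by (auto simp: filterlim_at_top)
      then show "eventually (\<lambda>n. norm (d_TV (?X n) (poisson_pmf (C_const (q n)))) \<le>
          20 * (1 / 2 :: real) ^ r n + exp (- a * Psi (m n) k (r n))) sequentially"
      proof eventually_elim
        case (elim n)
        have "1 / real (q n) \<le> 1 / 2" using q2[of n] by (intro divide_left_mono) auto
        then have "(1 / real (q n)) ^ r n \<le> (1 / 2) ^ r n" by (intro power_mono) auto
        then show ?case
          using bd[OF elim, of "q n" "F n" "m n" "c n" "N n"] H d_TV_nonneg[of "?X n"] by fastforce
      qed
    qed
    \<comment> \<open>Triangle inequality through the Poisson law of rate C_q: the rates converge to
      1, and Poisson laws are Lipschitz in the rate.\<close>
    moreover have "weak_conv_m (\<lambda>n. distr (measure_pmf (?X n)) borel real) (distr (measure_pmf (poisson_pmf 1)) borel real)"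
      if C: "(\<lambda>n. C_const (q n)) \<longlonglongrightarrow> 1"
    proof (rule weak_conv_if_d_TV, rule Lim_null_comparison)
      show "(\<lambda>n. d_TV (?X n) (poisson_pmf (C_const (q n))) + \<bar>C_const (q n) - 1\<bar>) \<longlonglongrightarrow> 0"
        using tendsto_add[OF conv tendsto_rabs_zero[OF LIM_zero[OF C]]] by simp
      show "eventually (\<lambda>n. norm (d_TV (?X n) (poisson_pmf 1)) \<le>
          d_TV (?X n) (poisson_pmf (C_const (q n))) + \<bar>C_const (q n) - 1\<bar>) sequentially"
      proof (intro always_eventually allI)
        fix n
        have "d_TV (poisson_pmf (C_const (q n))) (poisson_pmf 1) \<le> \<bar>C_const (q n) - 1\<bar>"
          using C_const_bounds(1)[OF q2[of n]] by (intro d_TV_poisson) auto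
        then show "norm (d_TV (?X n) (poisson_pmf 1)) \<le>
            d_TV (?X n) (poisson_pmf (C_const (q n))) + \<bar>C_const (q n) - 1\<bar>"
          using d_TV_triangle[of "?X n" "poisson_pmf 1" "poisson_pmf (C_const (q n))"]
            d_TV_nonneg[of "?X n" "poisson_pmf 1"] unfolding real_norm_def by linarith
      qed
    qed
    ultimately show "(\<lambda>n. d_TV (?X n) (poisson_pmf (C_const (q n)))) \<longlonglongrightarrow> 0 \<and>
        (filterlim q at_top sequentially \<longrightarrow>
          (\<lambda>n. C_const (q n)) \<longlonglongrightarrow> 1 \<and>
          weak_conv_m (\<lambda>n. distr (measure_pmf (?X n)) borel real) (distr (measure_pmf (poisson_pmf 1)) borel real))"
      using C_const_tendsto_1[of q] q2 by blast
  qed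
qed

end
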